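(* Let $(G,H,\tau,\alpha)$ be a Lie crossed module, $\mathbb{G}=[H\rtimes_\alpha G\rightrightarrows G]$ the associated Lie 2-group, and let $\pi:\mathbb{E}\to\mathbb{X}$ be a principal $\mathbb{G}$-bundle over a Lie groupoid $\mathbb{X}$. Then the extended gauge 2-group $\mathcal{G}^{\mathrm{ext}}=\mathcal{G}(\mathbb{E})\times\widehat{\Omega}^{\mathbb{G}}(E_0,L(H))$ has a left action on the category $\Omega^{\mathrm{semi}}_{\mathbb{E}}$ of semi-strict connection 1-forms, given by $$\big((F,\lambda),\omega\big)\mapsto\omega\circ F_*^{-1}+\overline{\lambda}:T\mathbb{E}\to L(\mathbb{G}),$$ $$\big((\Psi,\theta),\zeta\big)\mapsto\zeta\circ_H\Psi_*^{-1}+\theta,$$ where $\circ_H$ denotes horizontal composition of natural transformations.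
   Context: **Basics.** A Lie groupoid has submersive source/target and smooth structure maps. A Lie 2-group is a Lie groupoid $\mathbb{G}=[G_1\rightrightarrows G_0]$ with a morphism of Lie groupoids $\mathbb{G}\times\mathbb{G}\to\mathbb{G}$ inducing Lie group structures on $G_1,G_0$. Lie crossed module $(G,H,\tau,\alpha)$: Lie groups $G,H$, homomorphism $\tau:H\to G$, smooth action $\alpha_g(h)=\alpha(g,h)$ of $G$ on $H$ by Lie group homomorphisms, with $\tau(\alpha(g,h))=g\tau(h)g^{-1}$ and $\alpha(\tau(h),h')=hh'h^{-1}$; $\tau,\alpha_g$ also denote the induced Lie algebra maps. Its Lie 2-group $[H\rtimes_\alpha G\rightrightarrows G]$: $s(h,g)=g$, $t(h,g)=\tau(h)g$, $(h_2,g_2)\circ(h_1,g_1)=(h_2h_1,g_1)$, product $(h_2,g_2)(h_1,g_1)=(h_2\alpha(g_2,h_1),g_2g_1)$. $L(\mathbb{G})=[L(H)\oplus L(G)\rightrightarrows L(G)]$ has $s(A,B)=B$, $t(A,B)=\tau(A)+B$, $(A_2,B_2)\circ(A_1,B_1)=(A_2+A_1,B_1)$. A principal $\mathbb{G}$-bundle over $\mathbb{X}=[X_1\rightrightarrows X_0]$ is a morphism of Lie groupoids $\pi:\mathbb{E}=[E_1\rightrightarrows E_0]\to\mathbb{X}$ with a right action of $\mathbb{G}$ on $\mathbb{E}$ (a morphism of Lie groupoids $\mathbb{E}\times\mathbb{G}\to\mathbb{E}$ that is a Lie group action on objects and on morphisms) such that $\pi_i:E_i\to X_i$ is a principal $G_i$-bundle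 for $i=0,1$. $T\mathbb{E}=[TE_1\rightrightarrows TE_0]$ is the tangent Lie groupoid, and $1_g$, $1_p$ denote identity arrows. **Gauge 2-group.** $\mathcal{G}(\mathbb{E})$ is the strict 2-group whose objects are the $\mathbb{G}$-equivariant isomorphisms of Lie groupoids $F:\mathbb{E}\to\mathbb{E}$ with $\pi\circ F=\pi$, and whose morphisms $\Psi:F\Rightarrow F'$ are smooth natural isomorphisms with $\Psi(pg)=\Psi(p)1_g$ and $\pi(\Psi(p))=1_{\pi(p)}$ for $p\in E_0$, $g\in G_0$. Its group products on objects and morphisms are $(F,F')\mapsto F'\circ F$ and $(\Psi:F_1\Rightarrow F_2,\ \Psi':F_1'\Rightarrow F_2')\mapsto\Psi'\circ_H\Psi:F_1'\circ F_1\Rightarrow F_2'\circ F_2$, where $(\Psi'\circ_H\Psi)_p=\Psi'_{F_2(p)}\circ F_1'(\Psi_p)$. $F_*:T\mathbb{E}\to T\mathbb{E}$ is given by the differentials of $F$ on objects and morphisms, and $\Psi_*:F_*\Rightarrow F'_*$ is the natural isomorphism given by the differential of $\Psi$. **Extended gauge 2-group.** Let $\Omega^G(E_0,L(H))$ be the set of smooth $L(H)$-valued 1-forms $\lambda:TE_0\to L(H)$ with $\lambda_{pg}(v\cdot g)=\alpha_{g^{-1}}(\lambda_p(v))$. Each such $\lambda$ induces a $\mathbb{G}$-equivariant $L(\mathbb{G})$-valued 1-form $\overline\lambda:T\mathbb{E}\to L(\mathbb{G})$ with $\overline\lambda_0=\tau(\lambda)$ and $\overline\lambda_1=(t^*\lambda-s^*\lambda)+\tau(s^*\lambda)$,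 valued in $L(H)\oplus\tau(L(H))$. $\widehat{\Omega}^{\mathbb{G}}(E_0,L(H))$ is the category whose objects are these $\overline\lambda$ and whose morphisms $\theta$ are fibrewise linear natural transformations. The objects of $\mathcal{G}^{\mathrm{ext}}$ are identified with pairs $(F,\lambda)$, $F$ an object of $\mathcal{G}(\mathbb{E})$ and $\lambda\in\Omega^G(E_0,L(H))$. The group products of the strict 2-group $\mathcal{G}^{\mathrm{ext}}$ are $(F,\lambda)(F',\lambda')=(FF',\lambda+(\lambda'\circ F_*^{-1}))$ and $(\Psi,\theta)(\Psi',\theta')=(\Psi\Psi',\theta+(\theta'\circ_H\Psi_*^{-1}))$, where $FF'$ and $\Psi\Psi'$ denote the products in $\mathcal{G}(\mathbb{E})$. **Semi-strict connection 1-forms.** $\delta:\mathbb{E}\times L(\mathbb{G})\to T\mathbb{E}$ is the fundamental (vertical) vector field functor $(x,A)\mapsto\delta_x(A)$. A semi-strict connection 1-form is a morphism of Lie groupoids $\omega=(\omega_1,\omega_0):T\mathbb{E}\to L(\mathbb{G})$, with $\omega_i$ an $L(G_i)$-valued differential 1-form on $E_i$, which is $\mathbb{G}$-equivariant ($\omega_i(v\cdot g)=\mathrm{ad}_{g^{-1}}\omega_i(v)$) and for which there is a smooth fibrewise linear natural isomorphism $\kappa:\omega\circ\delta\Rightarrow\mathrm{pr}_2$ that is $\mathbb{G}$-equivariant, i.e. $\kappa(pg,\mathrm{ad}_{g^{-1}}B)=\mathrm{ad}_{1_g^{-1}}\kappa(p,B)$. $\Omega^{\mathrm{semi}}_{\mathbb{E}}$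 is the groupoid whose objects are the semi-strict connection 1-forms and whose morphisms $\eta:\omega\Rightarrow\omega'$ are smooth natural isomorphisms with $\eta((p,v)\cdot g)=\eta(p,v)\cdot 1_g$ for all $(p,v)\in TE_0$, $g\in G_0$, where $\eta(p,v)\cdot 1_g=\mathrm{ad}_{1_g^{-1}}\eta(p,v)$.
   Formalization: The products in the gauge 2-group are taken as FF' = F∘F' and ΨΨ' = Ψ∘_HΨ' (with the opposite order the extended product is not associative), and the morphisms θ of the category of forms are required to be smooth and equivariant (otherwise the sum with θ need not be a morphism). *)

theory Defs
  imports
    "HOL-Analysis.Analysis"
    "HOL-Algebra.Group"
    "HOL-Library.Function_Algebras"
begin

section \<open>Smooth manifolds\<close>

text \<open>Function types carry the pointwise vector space structure; it is used for tangent vectors,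
  which are encoded below as functions on charts.\<close>

instantiation "fun" :: (type, real_vector) real_vector
begin

definition scaleR_fun :: "real \<Rightarrow> ('a \<Rightarrow> 'b) \<Rightarrow> 'a \<Rightarrow> 'b"
  where "scaleR_fun r f = (\<lambda>x. r *\<^sub>R f x)"

instance
  by standard (simp_all add: scaleR_fun_def fun_eq_iff scaleR_add_right scaleR_add_left)

end

primrec Ck_on :: "nat \<Rightarrow> ('a::real_normed_vector \<Rightarrow> 'b::real_normed_vector) \<Rightarrow> 'a set \<Rightarrow> bool" where
  "Ck_on 0 f S \<longleftrightarrow> continuous_on S f"
| "Ck_on (Suc k) f S \<longleftrightarrow> (\<forall>x\<in>S. f differentiable (at x)) \<and>
     (\<forall>v. Ck_on k (\<lambda>x. frechet_derivative f (at x) v) S)"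

text \<open>Only meant for open sets in finite-dimensional spaces.\<close>

definition smooth_on :: "'a::real_normed_vector set \<Rightarrow> ('a \<Rightarrow> 'b::real_normed_vector) \<Rightarrow> bool"
  where "smooth_on S f \<longleftrightarrow> (\<forall>k. Ck_on k f S)"

text \<open>A manifold is given by a (not necessarily maximal) atlas, which determines its underlying set
  and its topology. The model space \<open>'e\<close> is a finite-dimensional inner product space; the class
  \<open>euclidean_space\<close> would exclude manifolds of dimension 0 (for instance discrete groups).
  In a chart \<open>(U, \<phi>)\<close> only the values of \<open>\<phi>\<close> on \<open>U\<close> matter.\<close>

type_synonym ('a, 'e) chart = "'a set \<times> ('a \<Rightarrow> 'e)"
type_synonym ('a, 'e) atlas = "('a, 'e) chart set"

definition pts :: "('a, 'e) atlas \<Rightarrow> 'a set"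
  where "pts M = (\<Union>c\<in>M. fst c)"

definition chart_inv :: "('a, 'e) chart \<Rightarrow> 'e \<Rightarrow> 'a"
  where "chart_inv c = inv_into (fst c) (snd c)"

definition mtop :: "('a, 'e::real_inner) atlas \<Rightarrow> 'a topology"
  where "mtop M = topology (\<lambda>W. W \<subseteq> pts M \<and> (\<forall>c\<in>M. open (snd c ` (W \<inter> fst c))))"

definition manifold :: "('a, 'e::real_inner) atlas \<Rightarrow> bool" where
  "manifold M \<longleftrightarrow>
     (\<exists>B::'e set. finite B \<and> span B = UNIV) \<and>
     (\<forall>c\<in>M. inj_on (snd c) (fst c)) \<and>
     (\<forall>c\<in>M. \<forall>d\<in>M. open (snd c ` (fst c \<inter> fst d)) \<and>
        smooth_on (snd c ` (fst c \<inter> fst d)) (snd d \<circ> chart_inv c)) \<and>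
     Hausdorff_space (mtop M) \<and> second_countable (mtop M)"

text \<open>Openness of the coordinate domains for all pairs of charts amounts to continuity.\<close>

definition smooth_map ::
  "('a, 'e::real_inner) atlas \<Rightarrow> ('b, 'f::real_inner) atlas \<Rightarrow> ('a \<Rightarrow> 'b) \<Rightarrow> bool" where
  "smooth_map M N f \<longleftrightarrow> f \<in> pts M \<rightarrow> pts N \<and>
     (\<forall>c\<in>M. \<forall>d\<in>N. open (snd c ` {p \<in> fst c. f p \<in> fst d}) \<and>
        smooth_on (snd c ` {p \<in> fst c. f p \<in> fst d}) (snd d \<circ> f \<circ> chart_inv c))"

definition open_sub :: "('a, 'e) atlas \<Rightarrow> 'a set \<Rightarrow> ('a, 'e) atlas"
  where "open_sub M W = (\<lambda>c. (fst c \<inter> W, snd c)) ` M"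

text \<open>Smoothness on a subset (in the applications, an embedded submanifold): local smooth
  extensions exist.\<close>

definition smooth_map_on ::
  "('a, 'e::real_inner) atlas \<Rightarrow> 'a set \<Rightarrow> ('b, 'f::real_inner) atlas \<Rightarrow> ('a \<Rightarrow> 'b) \<Rightarrow> bool" where
  "smooth_map_on M S N f \<longleftrightarrow> S \<subseteq> pts M \<and> f \<in> S \<rightarrow> pts N \<and>
     (\<forall>p\<in>S. \<exists>W h. openin (mtop M) W \<and> p \<in> W \<and> smooth_map (open_sub M W) N h \<and>
        (\<forall>q\<in>S \<inter> W. h q = f q))"

definition prod_atlas :: "('a, 'e) atlas \<Rightarrow> ('b, 'f) atlas \<Rightarrow> ('a \<times> 'b, 'e \<times> 'f) atlas"
  where "prod_atlas M N = {(fst c \<times> fst d, map_prod (snd c) (snd d)) | c d. c \<in> M \<and> d \<in> N}"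

section \<open>Tangent vectors and differentials\<close>

text \<open>A tangent vector at \<open>p\<close> is the family of its coordinate vectors in all charts around \<open>p\<close>,
  related by the derivatives of the coordinate changes (and 0 on all other arguments).\<close>

definition tangent_space :: "('a, 'e::real_inner) atlas \<Rightarrow> 'a \<Rightarrow> (('a, 'e) chart \<Rightarrow> 'e) set" where
  "tangent_space M p = {\<xi>.
     (\<forall>c. \<not> (c \<in> M \<and> p \<in> fst c) \<longrightarrow> \<xi> c = 0) \<and>
     (\<forall>c\<in>M. \<forall>d\<in>M. p \<in> fst c \<and> p \<in> fst d \<longrightarrow>
        \<xi> d = frechet_derivative (snd d \<circ> chart_inv c) (at (snd c p)) (\<xi> c))}"

type_synonym ('a, 'e) tangent = "'a \<times> (('a, 'e) chart \<Rightarrow> 'e)"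

definition tangent_bundle ::
  "('a, 'e::real_inner) atlas \<Rightarrow> (('a, 'e) tangent, 'e \<times> 'e) atlas" where
  "tangent_bundle M =
     (\<lambda>c. ({(p, \<xi>). p \<in> fst c \<and> \<xi> \<in> tangent_space M p}, \<lambda>(p, \<xi>). (snd c p, \<xi> c))) ` M"

definition Tmap :: "('a, 'e::real_inner) atlas \<Rightarrow> ('b, 'f::real_inner) atlas \<Rightarrow> ('a \<Rightarrow> 'b) \<Rightarrow>
    ('a, 'e) tangent \<Rightarrow> ('b, 'f) tangent" where
  "Tmap M N f = (\<lambda>(p, \<xi>). (f p, \<lambda>d. if d \<in> N \<and> f p \<in> fst d
     then let c = (SOME c. c \<in> M \<and> p \<in> fst c)
          in frechet_derivative (snd d \<circ> f \<circ> chart_inv c) (at (snd c p)) (\<xi> c)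
     else 0))"

definition submersion ::
  "('a, 'e::real_inner) atlas \<Rightarrow> ('b, 'f::real_inner) atlas \<Rightarrow> ('a \<Rightarrow> 'b) \<Rightarrow> bool" where
  "submersion M N f \<longleftrightarrow> smooth_map M N f \<and>
     (\<forall>p\<in>pts M. (\<lambda>\<xi>. snd (Tmap M N f (p, \<xi>))) ` tangent_space M p = tangent_space N (f p))"

text \<open>The curve \<open>\<gamma>\<close> is differentiable at time 0 with velocity \<open>v\<close>.\<close>

definition has_velocity ::
  "('a, 'e::real_inner) atlas \<Rightarrow> (real \<Rightarrow> 'a) \<Rightarrow> ('a, 'e) tangent \<Rightarrow> bool" where
  "has_velocity M \<gamma> v \<longleftrightarrow> v \<in> pts (tangent_bundle M) \<and> \<gamma> 0 = fst v \<and>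
     (\<forall>c\<in>M. fst v \<in> fst c \<longrightarrow> (\<forall>\<^sub>F t in nhds 0. \<gamma> t \<in> fst c) \<and>
        ((\<lambda>t. snd c (\<gamma> t)) has_vector_derivative snd v c) (at 0))"

definition fibre_linear ::
  "('a, 'e::real_inner) atlas \<Rightarrow> (('a, 'e) tangent \<Rightarrow> 'v::real_vector) \<Rightarrow> bool" where
  "fibre_linear M f \<longleftrightarrow> (\<forall>p\<in>pts M. \<forall>\<xi>\<in>tangent_space M p.
     (\<forall>\<xi>'\<in>tangent_space M p. f (p, \<xi> + \<xi>') = f (p, \<xi>) + f (p, \<xi>')) \<and>
     (\<forall>a. f (p, a *\<^sub>R \<xi>) = a *\<^sub>R f (p, \<xi>)))"

section \<open>Lie groups\<close>

record ('a, 'e) lie_grp = "'a monoid" +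
  charts :: "('a, 'e) atlas"

definition lie_group :: "('a, 'e::real_inner) lie_grp \<Rightarrow> bool" where
  "lie_group G \<longleftrightarrow> group G \<and> manifold (charts G) \<and> pts (charts G) = carrier G \<and>
     smooth_map (prod_atlas (charts G) (charts G)) (charts G) (\<lambda>(x, y). x \<otimes>\<^bsub>G\<^esub> y) \<and>
     smooth_map (charts G) (charts G) (\<lambda>x. inv\<^bsub>G\<^esub> x)"

definition lie_alg :: "('a, 'e::real_inner) lie_grp \<Rightarrow> (('a, 'e) chart \<Rightarrow> 'e) set"
  where "lie_alg G = tangent_space (charts G) \<one>\<^bsub>G\<^esub>"

definition lie_alg_atlas ::
  "('a, 'e::real_inner) lie_grp \<Rightarrow> (('a, 'e) chart \<Rightarrow> 'e, 'e) atlas" where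
  "lie_alg_atlas G = {(lie_alg G, \<lambda>A. A c) | c. c \<in> charts G \<and> \<one>\<^bsub>G\<^esub> \<in> fst c}"

text \<open>The linear map of Lie algebras induced by a map preserving the unit.\<close>

definition Lmap :: "('a, 'e::real_inner) lie_grp \<Rightarrow> ('b, 'f::real_inner) lie_grp \<Rightarrow> ('a \<Rightarrow> 'b) \<Rightarrow>
    (('a, 'e) chart \<Rightarrow> 'e) \<Rightarrow> (('b, 'f) chart \<Rightarrow> 'f)" where
  "Lmap G G' f A = snd (Tmap (charts G) (charts G') f (\<one>\<^bsub>G\<^esub>, A))"

definition Ad :: "('a, 'e::real_inner) lie_grp \<Rightarrow> 'a \<Rightarrow> (('a, 'e) chart \<Rightarrow> 'e) \<Rightarrow> (('a, 'e) chart \<Rightarrow> 'e)"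
  where "Ad G g = Lmap G G (\<lambda>x. g \<otimes>\<^bsub>G\<^esub> x \<otimes>\<^bsub>G\<^esub> inv\<^bsub>G\<^esub> g)"

definition lie_group_right_action ::
  "('g, 'e::real_inner) lie_grp \<Rightarrow> ('p, 'm::real_inner) atlas \<Rightarrow> ('p \<times> 'g \<Rightarrow> 'p) \<Rightarrow> bool" where
  "lie_group_right_action G M r \<longleftrightarrow> smooth_map (prod_atlas M (charts G)) M r \<and>
     (\<forall>p\<in>pts M. r (p, \<one>\<^bsub>G\<^esub>) = p) \<and>
     (\<forall>p\<in>pts M. \<forall>g\<in>carrier G. \<forall>g'\<in>carrier G. r (r (p, g), g') = r (p, g \<otimes>\<^bsub>G\<^esub> g'))"

definition principal_bundle :: "('g, 'e::real_inner) lie_grp \<Rightarrow> ('p, 'm::real_inner) atlas \<Rightarrow>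
    ('x, 'n::real_inner) atlas \<Rightarrow> ('p \<Rightarrow> 'x) \<Rightarrow> ('p \<times> 'g \<Rightarrow> 'p) \<Rightarrow> bool" where
  "principal_bundle G M N \<pi> r \<longleftrightarrow>
     lie_group G \<and> manifold M \<and> manifold N \<and> smooth_map M N \<pi> \<and> lie_group_right_action G M r \<and>
     (\<forall>p\<in>pts M. \<forall>g\<in>carrier G. \<pi> (r (p, g)) = \<pi> p) \<and>
     (\<forall>x\<in>pts N. \<exists>U \<phi> \<psi>. openin (mtop N) U \<and> x \<in> U \<and>
        (let V = {p \<in> pts M. \<pi> p \<in> U} in
         smooth_map (open_sub M V) (prod_atlas (open_sub N U) (charts G)) \<phi> \<and>
         smooth_map (prod_atlas (open_sub N U) (charts G)) (open_sub M V) \<psi> \<and>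
         (\<forall>p\<in>V. \<psi> (\<phi> p) = p) \<and> (\<forall>y\<in>U \<times> carrier G. \<phi> (\<psi> y) = y) \<and>
         (\<forall>p\<in>V. fst (\<phi> p) = \<pi> p \<and>
            (\<forall>g\<in>carrier G. \<phi> (r (p, g)) = (\<pi> p, snd (\<phi> p) \<otimes>\<^bsub>G\<^esub> g)))))"

section \<open>Categories, functors and natural transformations\<close>

record ('o, 'a) cat =
  Ob :: "'o set"
  Mor :: "'a set"
  Src :: "'a \<Rightarrow> 'o"
  Tgt :: "'a \<Rightarrow> 'o"
  Idn :: "'o \<Rightarrow> 'a"
  Cmp :: "'a \<Rightarrow> 'a \<Rightarrow> 'a"  \<comment> \<open>\<open>Cmp C y x\<close> is \<open>y \<circ> x\<close>, defined for \<open>Src C y = Tgt C x\<close>\<close>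

definition category :: "('o, 'a, 'z) cat_scheme \<Rightarrow> bool" where
  "category C \<longleftrightarrow>
     Src C \<in> Mor C \<rightarrow> Ob C \<and> Tgt C \<in> Mor C \<rightarrow> Ob C \<and>
     (\<forall>u\<in>Ob C. Idn C u \<in> Mor C \<and> Src C (Idn C u) = u \<and> Tgt C (Idn C u) = u) \<and>
     (\<forall>x\<in>Mor C. \<forall>y\<in>Mor C. Src C y = Tgt C x \<longrightarrow>
        Cmp C y x \<in> Mor C \<and> Src C (Cmp C y x) = Src C x \<and> Tgt C (Cmp C y x) = Tgt C y) \<and>
     (\<forall>x\<in>Mor C. Cmp C x (Idn C (Src C x)) = x \<and> Cmp C (Idn C (Tgt C x)) x = x) \<and>
     (\<forall>x\<in>Mor C. \<forall>y\<in>Mor C. \<forall>z\<in>Mor C. Src C y = Tgt C x \<and> Src C z = Tgt C y \<longrightarrow>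
        Cmp C z (Cmp C y x) = Cmp C (Cmp C z y) x)"

definition inverse_arrows :: "('o, 'a, 'z) cat_scheme \<Rightarrow> 'a \<Rightarrow> 'a \<Rightarrow> bool" where
  "inverse_arrows C x y \<longleftrightarrow> x \<in> Mor C \<and> y \<in> Mor C \<and> Src C y = Tgt C x \<and> Tgt C y = Src C x \<and>
     Cmp C y x = Idn C (Src C x) \<and> Cmp C x y = Idn C (Tgt C x)"

definition arrow_inv :: "('o, 'a, 'z) cat_scheme \<Rightarrow> 'a \<Rightarrow> 'a"
  where "arrow_inv C x = (THE y. inverse_arrows C x y)"

definition is_functor :: "('o, 'a, 'z) cat_scheme \<Rightarrow> ('o2, 'a2, 'z2) cat_scheme \<Rightarrow>
    ('o \<Rightarrow> 'o2) \<times> ('a \<Rightarrow> 'a2) \<Rightarrow> bool" where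
  "is_functor C D F \<longleftrightarrow>
     fst F \<in> Ob C \<rightarrow> Ob D \<and> snd F \<in> Mor C \<rightarrow> Mor D \<and>
     (\<forall>x\<in>Mor C. Src D (snd F x) = fst F (Src C x) \<and> Tgt D (snd F x) = fst F (Tgt C x)) \<and>
     (\<forall>u\<in>Ob C. snd F (Idn C u) = Idn D (fst F u)) \<and>
     (\<forall>x\<in>Mor C. \<forall>y\<in>Mor C. Src C y = Tgt C x \<longrightarrow>
        snd F (Cmp C y x) = Cmp D (snd F y) (snd F x))"

definition nat_trans :: "('o, 'a, 'z) cat_scheme \<Rightarrow> ('o2, 'a2, 'z2) cat_scheme \<Rightarrow>
    ('o \<Rightarrow> 'o2) \<times> ('a \<Rightarrow> 'a2) \<Rightarrow> ('o \<Rightarrow> 'o2) \<times> ('a \<Rightarrow> 'a2) \<Rightarrow> ('o \<Rightarrow> 'a2) \<Rightarrow> bool" where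
  "nat_trans C D F F' \<eta> \<longleftrightarrow>
     (\<forall>u\<in>Ob C. \<eta> u \<in> Mor D \<and> Src D (\<eta> u) = fst F u \<and> Tgt D (\<eta> u) = fst F' u) \<and>
     (\<forall>x\<in>Mor C. Cmp D (\<eta> (Tgt C x)) (snd F x) = Cmp D (snd F' x) (\<eta> (Src C x)))"

definition nat_iso :: "('o, 'a, 'z) cat_scheme \<Rightarrow> ('o2, 'a2, 'z2) cat_scheme \<Rightarrow>
    ('o \<Rightarrow> 'o2) \<times> ('a \<Rightarrow> 'a2) \<Rightarrow> ('o \<Rightarrow> 'o2) \<times> ('a \<Rightarrow> 'a2) \<Rightarrow> ('o \<Rightarrow> 'a2) \<Rightarrow> bool" where
  "nat_iso C D F F' \<eta> \<longleftrightarrow>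
     nat_trans C D F F' \<eta> \<and> (\<forall>u\<in>Ob C. \<exists>y. inverse_arrows D (\<eta> u) y)"

text \<open>Functors and transformations are kept extensional (\<open>undefined\<close> off their domain), so that
  equality of such data is equality in the logic.\<close>

definition extensional_functor ::
  "('o, 'a, 'z) cat_scheme \<Rightarrow> ('o \<Rightarrow> 'o2) \<times> ('a \<Rightarrow> 'a2) \<Rightarrow> bool" where
  "extensional_functor C F \<longleftrightarrow> fst F \<in> extensional (Ob C) \<and> snd F \<in> extensional (Mor C)"

definition id_functor :: "('o, 'a, 'z) cat_scheme \<Rightarrow> ('o \<Rightarrow> 'o) \<times> ('a \<Rightarrow> 'a)"
  where "id_functor C = (\<lambda>u\<in>Ob C. u, \<lambda>x\<in>Mor C. x)"

definition comp_functor :: "('o, 'a, 'z) cat_scheme \<Rightarrow> ('o2 \<Rightarrow> 'o3) \<times> ('a2 \<Rightarrow> 'a3) \<Rightarrow>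
    ('o \<Rightarrow> 'o2) \<times> ('a \<Rightarrow> 'a2) \<Rightarrow> ('o \<Rightarrow> 'o3) \<times> ('a \<Rightarrow> 'a3)" where
  "comp_functor C K F = (\<lambda>u\<in>Ob C. fst K (fst F u), \<lambda>x\<in>Mor C. snd K (snd F x))"

definition inv_functor ::
  "('o, 'a, 'z) cat_scheme \<Rightarrow> ('o \<Rightarrow> 'o) \<times> ('a \<Rightarrow> 'a) \<Rightarrow> ('o \<Rightarrow> 'o) \<times> ('a \<Rightarrow> 'a)" where
  "inv_functor C F =
     (\<lambda>u\<in>Ob C. inv_into (Ob C) (fst F) u, \<lambda>x\<in>Mor C. inv_into (Mor C) (snd F) x)"

text \<open>A transformation with its source and target is a triple \<open>(F, \<eta>, F')\<close>.\<close>

type_synonym ('f, 't) trans = "'f \<times> 't \<times> 'f"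

definition id_trans :: "('o, 'a, 'z) cat_scheme \<Rightarrow> ('o2, 'a2, 'z2) cat_scheme \<Rightarrow>
    ('o \<Rightarrow> 'o2) \<Rightarrow> 'o \<Rightarrow> 'a2" where
  "id_trans C D F0 = (\<lambda>u\<in>Ob C. Idn D (F0 u))"

definition vcomp :: "('o, 'a, 'z) cat_scheme \<Rightarrow> ('o2, 'a2, 'z2) cat_scheme \<Rightarrow>
    ('f, 'o \<Rightarrow> 'a2) trans \<Rightarrow> ('f, 'o \<Rightarrow> 'a2) trans \<Rightarrow> ('f, 'o \<Rightarrow> 'a2) trans" where
  "vcomp C D = (\<lambda>(F', \<eta>', F'') (F, \<eta>, _). (F, \<lambda>u\<in>Ob C. Cmp D (\<eta>' u) (\<eta> u), F''))"

text \<open>\<open>hcomp C D \<eta>' \<eta>\<close> is \<open>\<eta>' \<circ>\<^sub>H \<eta> : K \<circ> F \<Rightarrow> K' \<circ> F'\<close> for \<open>\<eta> : F \<Rightarrow> F'\<close>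
  with domain \<open>C\<close> and \<open>\<eta>' : K \<Rightarrow> K'\<close> with codomain \<open>D\<close>.\<close>

definition hcomp :: "('o, 'a, 'z) cat_scheme \<Rightarrow> ('o3, 'a3, 'z3) cat_scheme \<Rightarrow>
    (('o2 \<Rightarrow> 'o3) \<times> ('a2 \<Rightarrow> 'a3), 'o2 \<Rightarrow> 'a3) trans \<Rightarrow>
    (('o \<Rightarrow> 'o2) \<times> ('a \<Rightarrow> 'a2), 'o \<Rightarrow> 'a2) trans \<Rightarrow>
    (('o \<Rightarrow> 'o3) \<times> ('a \<Rightarrow> 'a3), 'o \<Rightarrow> 'a3) trans" where
  "hcomp C D = (\<lambda>(K, \<eta>', K') (F, \<eta>, F').
     (comp_functor C K F,
      \<lambda>u\<in>Ob C. Cmp D (\<eta>' (fst F' u)) (snd K (\<eta> u)),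
      comp_functor C K' F'))"

text \<open>The inverse with respect to horizontal composition, for \<open>\<eta>\<close> between automorphisms of a
  groupoid; the source is \<open>F\<^sup>-\<^sup>1\<close> and the target \<open>F'\<^sup>-\<^sup>1\<close>.\<close>

definition hinv :: "('o, 'a, 'z) cat_scheme \<Rightarrow>
    (('o \<Rightarrow> 'o) \<times> ('a \<Rightarrow> 'a), 'o \<Rightarrow> 'a) trans \<Rightarrow> (('o \<Rightarrow> 'o) \<times> ('a \<Rightarrow> 'a), 'o \<Rightarrow> 'a) trans" where
  "hinv C = (\<lambda>(F, \<eta>, F').
     (inv_functor C F,
      \<lambda>u\<in>Ob C. snd (inv_functor C F) (arrow_inv C (\<eta> (fst (inv_functor C F') u))),
      inv_functor C F'))"

definition prod_cat ::
  "('o, 'a, 'z) cat_scheme \<Rightarrow> ('o2, 'a2, 'z2) cat_scheme \<Rightarrow> ('o \<times> 'o2, 'a \<times> 'a2) cat" where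
  "prod_cat C D = \<lparr>
     Ob = Ob C \<times> Ob D,
     Mor = Mor C \<times> Mor D,
     Src = map_prod (Src C) (Src D),
     Tgt = map_prod (Tgt C) (Tgt D),
     Idn = map_prod (Idn C) (Idn D),
     Cmp = (\<lambda>(y, y') (x, x'). (Cmp C y x, Cmp D y' x'))\<rparr>"

section \<open>Strict 2-groups and their actions on categories\<close>

record ('o, 'a) two_grp = "('o, 'a) cat" +
  ob_grp :: "'o monoid"
  mor_grp :: "'a monoid"

definition strict_2group :: "('o, 'a) two_grp \<Rightarrow> bool" where
  "strict_2group \<G> \<longleftrightarrow> category \<G> \<and>
     group (ob_grp \<G>) \<and> carrier (ob_grp \<G>) = Ob \<G> \<and>
     group (mor_grp \<G>) \<and> carrier (mor_grp \<G>) = Mor \<G> \<and>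
     is_functor (prod_cat \<G> \<G>) \<G>
       (\<lambda>(g, g'). g \<otimes>\<^bsub>ob_grp \<G>\<^esub> g', \<lambda>(x, x'). x \<otimes>\<^bsub>mor_grp \<G>\<^esub> x')"

definition left_2group_action :: "('o, 'a) two_grp \<Rightarrow> ('p, 'b, 'z) cat_scheme \<Rightarrow>
    ('o \<times> 'p \<Rightarrow> 'p) \<times> ('a \<times> 'b \<Rightarrow> 'b) \<Rightarrow> bool" where
  "left_2group_action \<G> C \<rho> \<longleftrightarrow>
     strict_2group \<G> \<and> category C \<and> is_functor (prod_cat \<G> C) C \<rho> \<and>
     (\<forall>w\<in>Ob C. fst \<rho> (\<one>\<^bsub>ob_grp \<G>\<^esub>, w) = w) \<and>
     (\<forall>g\<in>Ob \<G>. \<forall>g'\<in>Ob \<G>. \<forall>w\<in>Ob C.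
        fst \<rho> (g \<otimes>\<^bsub>ob_grp \<G>\<^esub> g', w) = fst \<rho> (g, fst \<rho> (g', w))) \<and>
     (\<forall>z\<in>Mor C. snd \<rho> (\<one>\<^bsub>mor_grp \<G>\<^esub>, z) = z) \<and>
     (\<forall>x\<in>Mor \<G>. \<forall>x'\<in>Mor \<G>. \<forall>z\<in>Mor C.
        snd \<rho> (x \<otimes>\<^bsub>mor_grp \<G>\<^esub> x', z) = snd \<rho> (x, snd \<rho> (x', z)))"

section \<open>Lie groupoids\<close>

record ('o, 'a, 'm, 'n) lie_gpd = "('o, 'a) cat" +
  ob_charts :: "('o, 'm) atlas"
  mor_charts :: "('a, 'n) atlas"

definition lie_groupoid :: "('o, 'a, 'm::real_inner, 'n::real_inner) lie_gpd \<Rightarrow> bool" where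
  "lie_groupoid E \<longleftrightarrow> category E \<and> (\<forall>x\<in>Mor E. \<exists>y. inverse_arrows E x y) \<and>
     manifold (ob_charts E) \<and> pts (ob_charts E) = Ob E \<and>
     manifold (mor_charts E) \<and> pts (mor_charts E) = Mor E \<and>
     submersion (mor_charts E) (ob_charts E) (Src E) \<and>
     submersion (mor_charts E) (ob_charts E) (Tgt E) \<and>
     smooth_map (ob_charts E) (mor_charts E) (Idn E) \<and>
     smooth_map (mor_charts E) (mor_charts E) (arrow_inv E) \<and>
     smooth_map_on (prod_atlas (mor_charts E) (mor_charts E))
       {(y, x). y \<in> Mor E \<and> x \<in> Mor E \<and> Src E y = Tgt E x} (mor_charts E)
       (\<lambda>(y, x). Cmp E y x)"

definition lie_functor ::
  "('o, 'a, 'm::real_inner, 'n::real_inner) lie_gpd \<Rightarrow>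
   ('o2, 'a2, 'm2::real_inner, 'n2::real_inner) lie_gpd \<Rightarrow>
   ('o \<Rightarrow> 'o2) \<times> ('a \<Rightarrow> 'a2) \<Rightarrow> bool" where
  "lie_functor E D F \<longleftrightarrow> is_functor E D F \<and>
     smooth_map (ob_charts E) (ob_charts D) (fst F) \<and>
     smooth_map (mor_charts E) (mor_charts D) (snd F)"

definition lie_automorphism ::
  "('o, 'a, 'm::real_inner, 'n::real_inner) lie_gpd \<Rightarrow> ('o \<Rightarrow> 'o) \<times> ('a \<Rightarrow> 'a) \<Rightarrow> bool" where
  "lie_automorphism E F \<longleftrightarrow> lie_functor E E F \<and>
     (\<exists>K. lie_functor E E K \<and>
        comp_functor E K F = id_functor E \<and> comp_functor E F K = id_functor E)"

definition prod_lie_gpd ::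
  "('o, 'a, 'm, 'n) lie_gpd \<Rightarrow> ('o2, 'a2, 'm2, 'n2) lie_gpd \<Rightarrow>
   ('o \<times> 'o2, 'a \<times> 'a2, 'm \<times> 'm2, 'n \<times> 'n2) lie_gpd" where
  "prod_lie_gpd E D = cat.extend (prod_cat E D)
     (lie_gpd.fields (prod_atlas (ob_charts E) (ob_charts D))
                     (prod_atlas (mor_charts E) (mor_charts D)))"

text \<open>Composition in the tangent groupoid is the differential of the composition
  \<open>E\<^sub>1 \<times>\<^bsub>E\<^sub>0\<^esub> E\<^sub>1 \<rightarrow> E\<^sub>1\<close>, described on velocities of curves of composable arrows
  (the fibre product carries no atlas here).\<close>

definition tangent_Cmp :: "('o, 'a, 'm::real_inner, 'n::real_inner) lie_gpd \<Rightarrow>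
    ('a, 'n) tangent \<Rightarrow> ('a, 'n) tangent \<Rightarrow> ('a, 'n) tangent" where
  "tangent_Cmp E u v = (THE w. \<exists>\<gamma> \<mu>.
     has_velocity (mor_charts E) \<gamma> u \<and> has_velocity (mor_charts E) \<mu> v \<and>
     (\<forall>\<^sub>F t in nhds 0. Src E (\<gamma> t) = Tgt E (\<mu> t)) \<and>
     has_velocity (mor_charts E) (\<lambda>t. Cmp E (\<gamma> t) (\<mu> t)) w)"

definition tangent_gpd :: "('o, 'a, 'm::real_inner, 'n::real_inner) lie_gpd \<Rightarrow>
    (('o, 'm) tangent, ('a, 'n) tangent, 'm \<times> 'm, 'n \<times> 'n) lie_gpd" where
  "tangent_gpd E = \<lparr>
     Ob = pts (tangent_bundle (ob_charts E)),
     Mor = pts (tangent_bundle (mor_charts E)),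
     Src = Tmap (mor_charts E) (ob_charts E) (Src E),
     Tgt = Tmap (mor_charts E) (ob_charts E) (Tgt E),
     Idn = Tmap (ob_charts E) (mor_charts E) (Idn E),
     Cmp = tangent_Cmp E,
     ob_charts = tangent_bundle (ob_charts E),
     mor_charts = tangent_bundle (mor_charts E)\<rparr>"

definition push_functor :: "('o, 'a, 'm::real_inner, 'n::real_inner) lie_gpd \<Rightarrow>
    ('o \<Rightarrow> 'o) \<times> ('a \<Rightarrow> 'a) \<Rightarrow>
    (('o, 'm) tangent \<Rightarrow> ('o, 'm) tangent) \<times> (('a, 'n) tangent \<Rightarrow> ('a, 'n) tangent)" where
  "push_functor E F =
     (\<lambda>v\<in>Ob (tangent_gpd E). Tmap (ob_charts E) (ob_charts E) (fst F) v,
      \<lambda>v\<in>Mor (tangent_gpd E). Tmap (mor_charts E) (mor_charts E) (snd F) v)"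

definition push_trans :: "('o, 'a, 'm::real_inner, 'n::real_inner) lie_gpd \<Rightarrow>
    (('o \<Rightarrow> 'o) \<times> ('a \<Rightarrow> 'a), 'o \<Rightarrow> 'a) trans \<Rightarrow>
    ((('o, 'm) tangent \<Rightarrow> ('o, 'm) tangent) \<times> (('a, 'n) tangent \<Rightarrow> ('a, 'n) tangent),
     ('o, 'm) tangent \<Rightarrow> ('a, 'n) tangent) trans" where
  "push_trans E = (\<lambda>(F, \<Psi>, F').
     (push_functor E F,
      \<lambda>v\<in>Ob (tangent_gpd E). Tmap (ob_charts E) (mor_charts E) \<Psi> v,
      push_functor E F'))"

section \<open>Lie crossed modules and their Lie 2-groups\<close>

record ('g, 'm, 'h, 'n) xmod =
  GG :: "('g, 'm) lie_grp"
  HH :: "('h, 'n) lie_grp"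
  tau :: "'h \<Rightarrow> 'g"
  alpha :: "'g \<Rightarrow> 'h \<Rightarrow> 'h"

definition lie_crossed_module :: "('g, 'm::real_inner, 'h, 'n::real_inner) xmod \<Rightarrow> bool" where
  "lie_crossed_module K \<longleftrightarrow>
     lie_group (GG K) \<and> lie_group (HH K) \<and>
     tau K \<in> hom (HH K) (GG K) \<and> smooth_map (charts (HH K)) (charts (GG K)) (tau K) \<and>
     smooth_map (prod_atlas (charts (GG K)) (charts (HH K))) (charts (HH K))
       (\<lambda>(g, h). alpha K g h) \<and>
     (\<forall>g\<in>carrier (GG K). alpha K g \<in> hom (HH K) (HH K)) \<and>
     (\<forall>h\<in>carrier (HH K). alpha K \<one>\<^bsub>GG K\<^esub> h = h) \<and>
     (\<forall>g\<in>carrier (GG K). \<forall>g'\<in>carrier (GG K). \<forall>h\<in>carrier (HH K).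
        alpha K (g \<otimes>\<^bsub>GG K\<^esub> g') h = alpha K g (alpha K g' h)) \<and>
     (\<forall>g\<in>carrier (GG K). \<forall>h\<in>carrier (HH K).
        tau K (alpha K g h) = g \<otimes>\<^bsub>GG K\<^esub> tau K h \<otimes>\<^bsub>GG K\<^esub> inv\<^bsub>GG K\<^esub> g) \<and>
     (\<forall>h\<in>carrier (HH K). \<forall>h'\<in>carrier (HH K).
        alpha K (tau K h) h' = h \<otimes>\<^bsub>HH K\<^esub> h' \<otimes>\<^bsub>HH K\<^esub> inv\<^bsub>HH K\<^esub> h)"

definition semidirect :: "('g, 'm, 'h, 'n) xmod \<Rightarrow> ('h \<times> 'g, 'n \<times> 'm) lie_grp" where
  "semidirect K = \<lparr>
     carrier = carrier (HH K) \<times> carrier (GG K),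
     monoid.mult = (\<lambda>(h2, g2) (h1, g1). (h2 \<otimes>\<^bsub>HH K\<^esub> alpha K g2 h1, g2 \<otimes>\<^bsub>GG K\<^esub> g1)),
     one = (\<one>\<^bsub>HH K\<^esub>, \<one>\<^bsub>GG K\<^esub>),
     charts = prod_atlas (charts (HH K)) (charts (GG K))\<rparr>"

definition lie_2group :: "('g, 'm, 'h, 'n) xmod \<Rightarrow> ('g, 'h \<times> 'g, 'm, 'n \<times> 'm) lie_gpd" where
  "lie_2group K = \<lparr>
     Ob = carrier (GG K),
     Mor = carrier (HH K) \<times> carrier (GG K),
     Src = snd,
     Tgt = (\<lambda>(h, g). tau K h \<otimes>\<^bsub>GG K\<^esub> g),
     Idn = (\<lambda>g. (\<one>\<^bsub>HH K\<^esub>, g)),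
     Cmp = (\<lambda>(h2, g2) (h1, g1). (h2 \<otimes>\<^bsub>HH K\<^esub> h1, g1)),
     ob_charts = charts (GG K),
     mor_charts = charts (semidirect K)\<rparr>"

definition Ltau :: "('g, 'm::real_inner, 'h, 'n::real_inner) xmod \<Rightarrow>
    (('h, 'n) chart \<Rightarrow> 'n) \<Rightarrow> (('g, 'm) chart \<Rightarrow> 'm)"
  where "Ltau K = Lmap (HH K) (GG K) (tau K)"

definition Lalpha :: "('g, 'm::real_inner, 'h, 'n::real_inner) xmod \<Rightarrow> 'g \<Rightarrow>
    (('h, 'n) chart \<Rightarrow> 'n) \<Rightarrow> (('h, 'n) chart \<Rightarrow> 'n)"
  where "Lalpha K g = Lmap (HH K) (HH K) (alpha K g)"

text \<open>The groupoid \<open>L(H) \<oplus> L(G) \<rightrightarrows> L(G)\<close>.\<close>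

definition lie_2alg :: "('g, 'm::real_inner, 'h, 'n::real_inner) xmod \<Rightarrow>
    (('g, 'm) chart \<Rightarrow> 'm, (('h, 'n) chart \<Rightarrow> 'n) \<times> (('g, 'm) chart \<Rightarrow> 'm), 'm, 'n \<times> 'm) lie_gpd" where
  "lie_2alg K = \<lparr>
     Ob = lie_alg (GG K),
     Mor = lie_alg (HH K) \<times> lie_alg (GG K),
     Src = snd,
     Tgt = (\<lambda>(A, B). Ltau K A + B),
     Idn = (\<lambda>B. (0, B)),
     Cmp = (\<lambda>(A2, B2) (A1, B1). (A2 + A1, B1)),
     ob_charts = lie_alg_atlas (GG K),
     mor_charts = prod_atlas (lie_alg_atlas (HH K)) (lie_alg_atlas (GG K))\<rparr>"

text \<open>The identification of \<open>L(H) \<oplus> L(G)\<close> with the Lie algebra of \<open>H \<rtimes> G\<close>, and its inverse.\<close>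

definition join_alg :: "('g, 'm::real_inner, 'h, 'n::real_inner) xmod \<Rightarrow>
    (('h, 'n) chart \<Rightarrow> 'n) \<times> (('g, 'm) chart \<Rightarrow> 'm) \<Rightarrow> (('h \<times> 'g, 'n \<times> 'm) chart \<Rightarrow> 'n \<times> 'm)" where
  "join_alg K = (\<lambda>(A, B). Lmap (HH K) (semidirect K) (\<lambda>h. (h, \<one>\<^bsub>GG K\<^esub>)) A +
                          Lmap (GG K) (semidirect K) (\<lambda>g. (\<one>\<^bsub>HH K\<^esub>, g)) B)"

definition split_alg :: "('g, 'm::real_inner, 'h, 'n::real_inner) xmod \<Rightarrow>
    (('h \<times> 'g, 'n \<times> 'm) chart \<Rightarrow> 'n \<times> 'm) \<Rightarrow> (('h, 'n) chart \<Rightarrow> 'n) \<times> (('g, 'm) chart \<Rightarrow> 'm)" where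
  "split_alg K C = (Lmap (semidirect K) (HH K) fst C, Lmap (semidirect K) (GG K) snd C)"

definition Ad1 :: "('g, 'm::real_inner, 'h, 'n::real_inner) xmod \<Rightarrow> 'h \<times> 'g \<Rightarrow>
    (('h, 'n) chart \<Rightarrow> 'n) \<times> (('g, 'm) chart \<Rightarrow> 'm) \<Rightarrow>
    (('h, 'n) chart \<Rightarrow> 'n) \<times> (('g, 'm) chart \<Rightarrow> 'm)" where
  "Ad1 K a C = split_alg K (Ad (semidirect K) a (join_alg K C))"

text \<open>\<open>A \<cdot> 1\<^sub>g\<close>, that is, the adjoint action of the inverse of the arrow \<open>1\<^sub>g\<close>.\<close>

definition Ad_unit_inv :: "('g, 'm::real_inner, 'h, 'n::real_inner) xmod \<Rightarrow> 'g \<Rightarrow>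
    (('h, 'n) chart \<Rightarrow> 'n) \<times> (('g, 'm) chart \<Rightarrow> 'm) \<Rightarrow>
    (('h, 'n) chart \<Rightarrow> 'n) \<times> (('g, 'm) chart \<Rightarrow> 'm)" where
  "Ad_unit_inv K g = Ad1 K (inv\<^bsub>semidirect K\<^esub> (Idn (lie_2group K) g))"

section \<open>Principal bundles over Lie groupoids\<close>

record ('g, 'h, 'p, 'q, 'k, 'l, 'x, 'y, 'i, 'j) bundle_data =
  total :: "('p, 'q, 'k, 'l) lie_gpd"
  base :: "('x, 'y, 'i, 'j) lie_gpd"
  proj :: "('p \<Rightarrow> 'x) \<times> ('q \<Rightarrow> 'y)"
  act :: "('p \<times> 'g \<Rightarrow> 'p) \<times> ('q \<times> ('h \<times> 'g) \<Rightarrow> 'q)"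

definition principal_2bundle ::
  "('g, 'm::real_inner, 'h, 'n::real_inner) xmod \<Rightarrow>
   ('g, 'h, 'p, 'q, 'k::real_inner, 'l::real_inner, 'x, 'y, 'i::real_inner, 'j::real_inner) bundle_data \<Rightarrow>
   bool" where
  "principal_2bundle K P \<longleftrightarrow>
     lie_groupoid (total P) \<and> lie_groupoid (base P) \<and>
     lie_functor (total P) (base P) (proj P) \<and>
     lie_functor (prod_lie_gpd (total P) (lie_2group K)) (total P) (act P) \<and>
     principal_bundle (GG K) (ob_charts (total P)) (ob_charts (base P))
       (fst (proj P)) (fst (act P)) \<and>
     principal_bundle (semidirect K) (mor_charts (total P)) (mor_charts (base P))
       (snd (proj P)) (snd (act P))"

text \<open>The induced right actions of \<open>G\<close> on \<open>TE\<^sub>0\<close> and of \<open>H \<rtimes> G\<close> on \<open>TE\<^sub>1\<close>.\<close>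

definition tact0 where
  "tact0 P v g = Tmap (ob_charts (total P)) (ob_charts (total P)) (\<lambda>p. fst (act P) (p, g)) v"

definition tact1 where
  "tact1 P v a = Tmap (mor_charts (total P)) (mor_charts (total P)) (\<lambda>x. snd (act P) (x, a)) v"

abbreviation TE where "TE P \<equiv> tangent_gpd (total P)"

section \<open>The gauge 2-group\<close>

definition gauge_ob where
  "gauge_ob K P = {F. lie_automorphism (total P) F \<and> extensional_functor (total P) F \<and>
     (\<forall>p\<in>Ob (total P). \<forall>g\<in>carrier (GG K). fst F (fst (act P) (p, g)) = fst (act P) (fst F p, g)) \<and>
     (\<forall>x\<in>Mor (total P). \<forall>a\<in>carrier (semidirect K).
        snd F (snd (act P) (x, a)) = snd (act P) (snd F x, a)) \<and>
     (\<forall>p\<in>Ob (total P). fst (proj P) (fst F p) = fst (proj P) p) \<and>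
     (\<forall>x\<in>Mor (total P). snd (proj P) (snd F x) = snd (proj P) x)}"

definition gauge_mor where
  "gauge_mor K P = {(F, \<Psi>, F'). F \<in> gauge_ob K P \<and> F' \<in> gauge_ob K P \<and>
     \<Psi> \<in> extensional (Ob (total P)) \<and> nat_iso (total P) (total P) F F' \<Psi> \<and>
     smooth_map (ob_charts (total P)) (mor_charts (total P)) \<Psi> \<and>
     (\<forall>p\<in>Ob (total P). \<forall>g\<in>carrier (GG K).
        \<Psi> (fst (act P) (p, g)) = snd (act P) (\<Psi> p, Idn (lie_2group K) g)) \<and>
     (\<forall>p\<in>Ob (total P). snd (proj P) (\<Psi> p) = Idn (base P) (fst (proj P) p))}"

text \<open>The group product is \<open>F F' = F \<circ> F'\<close> and \<open>\<Psi> \<Psi>' = \<Psi> \<circ>\<^sub>H \<Psi>'\<close>. With the opposite order,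
  the products of the extended gauge 2-group below would not be associative.\<close>

definition gauge where
  "gauge K P = \<lparr>
     Ob = gauge_ob K P,
     Mor = gauge_mor K P,
     Src = (\<lambda>(F, \<Psi>, F'). F),
     Tgt = (\<lambda>(F, \<Psi>, F'). F'),
     Idn = (\<lambda>F. (F, id_trans (total P) (total P) (fst F), F)),
     Cmp = vcomp (total P) (total P),
     ob_grp = \<lparr>carrier = gauge_ob K P,
       monoid.mult = comp_functor (total P),
       one = id_functor (total P)\<rparr>,
     mor_grp = \<lparr>carrier = gauge_mor K P,
       monoid.mult = hcomp (total P) (total P),
       one = (id_functor (total P), id_trans (total P) (total P) (\<lambda>p. p), id_functor (total P))\<rparr>\<rparr>"

section \<open>The extended gauge 2-group\<close>

definition add_on :: "'s set \<Rightarrow> ('s \<Rightarrow> 'v::plus) \<Rightarrow> ('s \<Rightarrow> 'v) \<Rightarrow> 's \<Rightarrow> 'v"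
  where "add_on S f f' = (\<lambda>v\<in>S. f v + f' v)"

definition add_functor where
  "add_functor C F F' = (add_on (Ob C) (fst F) (fst F'), add_on (Mor C) (snd F) (snd F'))"

definition add_trans where
  "add_trans C = (\<lambda>(F1, \<eta>, F2) (F1', \<eta>', F2').
     (add_functor C F1 F1', add_on (Ob C) \<eta> \<eta>', add_functor C F2 F2'))"

text \<open>The set of \<open>G\<close>-equivariant \<open>L(H)\<close>-valued 1-forms on \<open>E\<^sub>0\<close>.\<close>

definition Omega_H where
  "Omega_H K P = {l. l \<in> extensional (Ob (TE P)) \<and>
     smooth_map (ob_charts (TE P)) (lie_alg_atlas (HH K)) l \<and>
     fibre_linear (ob_charts (total P)) l \<and>
     (\<forall>v\<in>Ob (TE P). \<forall>g\<in>carrier (GG K). l (tact0 P v g) = Lalpha K (inv\<^bsub>GG K\<^esub> g) (l v))}"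

text \<open>The functor \<open>\<lambda>-bar : TE \<rightarrow> L(H) \<oplus> L(G)\<close> induced by \<open>\<lambda>\<close>.\<close>

definition form_bar where
  "form_bar K P l =
     (\<lambda>v\<in>Ob (TE P). Ltau K (l v),
      \<lambda>v\<in>Mor (TE P). (l (Tgt (TE P) v) - l (Src (TE P) v), Ltau K (l (Src (TE P) v))))"

definition bar_trans where
  "bar_trans K P = (\<lambda>(l, \<theta>, l'). (form_bar K P l, \<theta>, form_bar K P l'))"

text \<open>Objects are represented by \<open>\<lambda>\<close>. Morphisms are smooth and equivariant like all other data;
  equivariance does not follow from naturality when \<open>\<tau>\<close> is not surjective.\<close>

definition Omega_hat_mor where
  "Omega_hat_mor K P = {(l, \<theta>, l'). l \<in> Omega_H K P \<and> l' \<in> Omega_H K P \<and>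
     \<theta> \<in> extensional (Ob (TE P)) \<and>
     nat_trans (TE P) (lie_2alg K) (form_bar K P l) (form_bar K P l') \<theta> \<and>
     smooth_map (ob_charts (TE P)) (mor_charts (lie_2alg K)) \<theta> \<and>
     fibre_linear (ob_charts (total P)) \<theta> \<and>
     (\<forall>v\<in>Ob (TE P). \<forall>g\<in>carrier (GG K). \<theta> (tact0 P v g) = Ad_unit_inv K g (\<theta> v))}"

definition Omega_hat where
  "Omega_hat K P = \<lparr>
     Ob = Omega_H K P,
     Mor = Omega_hat_mor K P,
     Src = (\<lambda>(l, \<theta>, l'). l),
     Tgt = (\<lambda>(l, \<theta>, l'). l'),
     Idn = (\<lambda>l. (l, id_trans (TE P) (lie_2alg K) (fst (form_bar K P l)), l)),
     Cmp = vcomp (TE P) (lie_2alg K)\<rparr>"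

text \<open>\<open>\<lambda> \<circ> F\<^sub>*\<^sup>-\<^sup>1\<close> and \<open>\<zeta> \<circ>\<^sub>H \<Psi>\<^sub>*\<^sup>-\<^sup>1\<close>; here
  \<open>F\<^sub>*\<^sup>-\<^sup>1\<close> and \<open>\<Psi>\<^sub>*\<^sup>-\<^sup>1\<close> are the differentials of the inverses in the gauge 2-group.\<close>

definition transport_form where
  "transport_form P F l =
     (\<lambda>v\<in>Ob (TE P). l (fst (push_functor (total P) (inv_functor (total P) F)) v))"

definition transport_trans where
  "transport_trans K P \<Psi> \<zeta> =
     hcomp (TE P) (lie_2alg K) \<zeta> (push_trans (total P) (hinv (total P) \<Psi>))"

definition ext_ob_mult where
  "ext_ob_mult K P = (\<lambda>(F, l) (F', l').
     (F \<otimes>\<^bsub>ob_grp (gauge K P)\<^esub> F', add_on (Ob (TE P)) l (transport_form P F l')))"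

definition ext_mor_mult where
  "ext_mor_mult K P = (\<lambda>(\<Psi>, (l1, \<theta>, l2)) (\<Psi>', (l1', \<theta>', l2')).
     (\<Psi> \<otimes>\<^bsub>mor_grp (gauge K P)\<^esub> \<Psi>',
      (add_on (Ob (TE P)) l1 (transport_form P (Src (gauge K P) \<Psi>) l1'),
       add_on (Ob (TE P)) \<theta>
         (fst (snd (transport_trans K P \<Psi> (bar_trans K P (l1', \<theta>', l2'))))),
       add_on (Ob (TE P)) l2 (transport_form P (Tgt (gauge K P) \<Psi>) l2'))))"

definition zero_form where
  "zero_form P = (\<lambda>v\<in>Ob (TE P). 0)"

definition ext_gauge where
  "ext_gauge K P = cat.extend (prod_cat (gauge K P) (Omega_hat K P))
     (two_grp.fields
       \<lparr>carrier = Ob (prod_cat (gauge K P) (Omega_hat K P)),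
        monoid.mult = ext_ob_mult K P,
        one = (\<one>\<^bsub>ob_grp (gauge K P)\<^esub>, zero_form P)\<rparr>
       \<lparr>carrier = Mor (prod_cat (gauge K P) (Omega_hat K P)),
        monoid.mult = ext_mor_mult K P,
        one = (\<one>\<^bsub>mor_grp (gauge K P)\<^esub>, (zero_form P, zero_form P, zero_form P))\<rparr>)"

section \<open>Semi-strict connection 1-forms\<close>

text \<open>The fundamental vector field functor \<open>E \<times> L(H \<rtimes> G \<rightrightarrows> G) \<rightarrow> TE\<close>.\<close>

definition fundamental where
  "fundamental K P =
     (\<lambda>(p, B). Tmap (charts (GG K)) (ob_charts (total P)) (\<lambda>g. fst (act P) (p, g))
        (\<one>\<^bsub>GG K\<^esub>, B),
      \<lambda>(x, C). Tmap (charts (semidirect K)) (mor_charts (total P)) (\<lambda>a. snd (act P) (x, a))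
        (\<one>\<^bsub>semidirect K\<^esub>, join_alg K C))"

definition semi_strict where
  "semi_strict K P \<omega> \<longleftrightarrow> (\<exists>\<kappa>.
     nat_iso (prod_lie_gpd (total P) (lie_2alg K)) (lie_2alg K)
       (comp_functor (prod_lie_gpd (total P) (lie_2alg K)) \<omega> (fundamental K P)) (snd, snd) \<kappa> \<and>
     smooth_map (ob_charts (prod_lie_gpd (total P) (lie_2alg K))) (mor_charts (lie_2alg K)) \<kappa> \<and>
     (\<forall>p\<in>Ob (total P). \<forall>B\<in>lie_alg (GG K).
        (\<forall>B'\<in>lie_alg (GG K). \<kappa> (p, B + B') = \<kappa> (p, B) + \<kappa> (p, B')) \<and>
        (\<forall>a. \<kappa> (p, a *\<^sub>R B) = a *\<^sub>R \<kappa> (p, B))) \<and>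
     (\<forall>p\<in>Ob (total P). \<forall>B\<in>lie_alg (GG K). \<forall>g\<in>carrier (GG K).
        \<kappa> (fst (act P) (p, g), Ad (GG K) (inv\<^bsub>GG K\<^esub> g) B) = Ad_unit_inv K g (\<kappa> (p, B))))"

definition Omega_semi_ob where
  "Omega_semi_ob K P = {\<omega>. lie_functor (TE P) (lie_2alg K) \<omega> \<and> extensional_functor (TE P) \<omega> \<and>
     fibre_linear (ob_charts (total P)) (fst \<omega>) \<and>
     fibre_linear (mor_charts (total P)) (snd \<omega>) \<and>
     (\<forall>v\<in>Ob (TE P). \<forall>g\<in>carrier (GG K).
        fst \<omega> (tact0 P v g) = Ad (GG K) (inv\<^bsub>GG K\<^esub> g) (fst \<omega> v)) \<and>
     (\<forall>v\<in>Mor (TE P). \<forall>a\<in>carrier (semidirect K).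
        snd \<omega> (tact1 P v a) = Ad1 K (inv\<^bsub>semidirect K\<^esub> a) (snd \<omega> v)) \<and>
     semi_strict K P \<omega>}"

definition Omega_semi_mor where
  "Omega_semi_mor K P = {(\<omega>, \<eta>, \<omega>'). \<omega> \<in> Omega_semi_ob K P \<and> \<omega>' \<in> Omega_semi_ob K P \<and>
     \<eta> \<in> extensional (Ob (TE P)) \<and> nat_iso (TE P) (lie_2alg K) \<omega> \<omega>' \<eta> \<and>
     smooth_map (ob_charts (TE P)) (mor_charts (lie_2alg K)) \<eta> \<and>
     (\<forall>v\<in>Ob (TE P). \<forall>g\<in>carrier (GG K). \<eta> (tact0 P v g) = Ad_unit_inv K g (\<eta> v))}"

definition Omega_semi where
  "Omega_semi K P = \<lparr>
     Ob = Omega_semi_ob K P,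
     Mor = Omega_semi_mor K P,
     Src = (\<lambda>(\<omega>, \<eta>, \<omega>'). \<omega>),
     Tgt = (\<lambda>(\<omega>, \<eta>, \<omega>'). \<omega>'),
     Idn = (\<lambda>\<omega>. (\<omega>, id_trans (TE P) (lie_2alg K) (fst \<omega>), \<omega>)),
     Cmp = vcomp (TE P) (lie_2alg K)\<rparr>"

end

theory Submission
  imports Defs
begin

text \<open>The extended gauge 2-group is a semidirect product, and its action is an affine one: gauge
  transformations act linearly on equivariant forms and transformations with values in
  \<open>L(H) \<oplus> L(G)\<close>, by \<open>\<zeta> \<mapsto> \<zeta> \<circ>\<^sub>H \<Psi>\<^sub>*\<^sup>-\<^sup>1\<close>, and the forms
  \<open>\<lambda>-bar\<close> act by translation. Both actions are compatible, since the bar of the transported form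
  \<open>\<lambda> \<circ> F\<^sub>*\<^sup>-\<^sup>1\<close> is the transport of \<open>\<lambda>-bar\<close> (lemmas \<open>form_bar_transport\<close> and
  \<open>bar_hat_transport\<close>). Once this is known, the axioms of a strict 2-group and of an action follow from
  the rules for the linear part, which are collected in the lemmas \<open>transport_mult\<close>,
  \<open>transport_one\<close>, \<open>transport_vcomp\<close> and \<open>transport_add\<close>. These in turn express
  that taking differentials is a strict 2-functor on Lie groupoids, that horizontal composition satisfies
  associativity and interchange, and that composition in \<open>L(H) \<oplus> L(G)\<close> is addition of first
  components.

  It remains to see that the operations preserve the conditions imposed on the data. Smoothness, linearity,
  functoriality and equivariance are preserved by sums and by precomposition with differentials of gauge
  transformations. That \<open>\<lambda>-bar\<close> itself is equivariant on arrows is an infinitesimal form of the Peiffer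
  identity (lemma \<open>Ad1_bar\<close>). The new form is again semi-strict, because gauge transformations
  preserve fundamental vectors and because \<open>\<lambda>\<close>, evaluated on fundamental vectors, is an isomorphism
  between \<open>\<lambda>-bar\<close> and zero there; adding this isomorphism to the given trivialization yields a
  trivialization of the new form (lemma \<open>semi_strict_act\<close>).

  Differentials are handled through curves. A tangent vector is the velocity of some curve, velocities are
  unique, and differentials map velocities to velocities; so an equation between differentials is proved by
  writing down the corresponding equation between points of curves. For the composition of tangent arrows this
  requires that composable tangent arrows are velocities of composable curves. Such curves are found by
  lifting a curve through a submersion (lemma \<open>lift_curve\<close>), which is the main analytic ingredient.\<close>

section \<open>Smooth calculus on finite-dimensional inner product spaces\<close>

definition fin_dim :: "'e::real_inner itself \<Rightarrow> bool"
  where "fin_dim _ \<longleftrightarrow> (\<exists>B::'e set. finite B \<and> span B = UNIV)"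

text \<open>The type class of Euclidean spaces excludes dimension 0, so coordinates are taken with respect
  to an orthogonal family. Zero vectors in the family are harmless because division by 0 gives 0.\<close>

lemma fin_dim_expand:
  assumes "fin_dim TYPE('e::real_inner)"
  obtains B :: "'e::real_inner set" and d where "finite B" "\<And>v. v = (\<Sum>b\<in>B. (v \<bullet> d b) *\<^sub>R b)"
proof -
  obtain C :: "'e set" where C: "finite C" "span C = UNIV" "pairwise orthogonal C"
    using assms basis_orthogonal unfolding fin_dim_def by metis
  define d where "d b = b /\<^sub>R (b \<bullet> b)" for b :: 'e
  let ?S = "{v. v = (\<Sum>b\<in>C. (v \<bullet> d b) *\<^sub>R b)}"
  have "subspace ?S"
    unfolding subspace_def
    by (auto simp: inner_add_left scaleR_add_left sum.distrib simp flip: scaleR_scaleR scaleR_sum_right)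
  moreover have "c \<in> ?S" if "c \<in> C" for c
  proof -
    have "(\<Sum>b\<in>C. (c \<bullet> d b) *\<^sub>R b) = (\<Sum>b\<in>C. if b = c then c else 0)"
    proof (rule sum.cong[OF refl])
      fix b assume "b \<in> C"
      then have "b \<noteq> c \<Longrightarrow> c \<bullet> b = 0" using C(3) that by (auto simp: pairwise_def orthogonal_def)
      then show "(c \<bullet> d b) *\<^sub>R b = (if b = c then c else 0)"
        by (cases "c = 0") (auto simp: d_def)
    qed
    then show ?thesis using that C(1) by simp
  qed
  ultimately have "span C \<subseteq> ?S" by (intro span_minimal) auto
  then have "\<And>v. v = (\<Sum>b\<in>C. (v \<bullet> d b) *\<^sub>R b)" using C(2) by blast
  then show ?thesis using C(1) that by blast
qed

lemma fin_dim_linear_bounded: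
  fixes f :: "'e::real_inner \<Rightarrow> 'f::real_normed_vector"
  assumes "fin_dim TYPE('e)" "linear f"
  shows "bounded_linear f"
proof -
  obtain B :: "'e set" and d where B: "finite B" "\<And>v. v = (\<Sum>b\<in>B. (v \<bullet> d b) *\<^sub>R b)"
    using fin_dim_expand[OF assms(1)] by blast
  have e: "f v = (\<Sum>b\<in>B. (v \<bullet> d b) *\<^sub>R f b)" for v
    by (subst B(2)[of v]) (simp add: linear_sum[OF assms(2)] linear_scale[OF assms(2)])
  have "bounded_linear (\<lambda>v. \<Sum>b\<in>B. (v \<bullet> d b) *\<^sub>R f b)"
    by (intro bounded_linear_sum bounded_linear_scaleR_const bounded_linear_inner_left)
  then show ?thesis using e by (metis (no_types, lifting) ext)
qed

lemma fin_dim_prod: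
  assumes "fin_dim TYPE('e::real_inner)" "fin_dim TYPE('f::real_inner)"
  shows "fin_dim TYPE('e::real_inner \<times> 'f::real_inner)"
proof -
  obtain B :: "'e set" where B: "finite B" "span B = UNIV" using assms(1) unfolding fin_dim_def by blast
  obtain C :: "'f set" where C: "finite C" "span C = UNIV" using assms(2) unfolding fin_dim_def by blast
  let ?D = "(\<lambda>b. (b, 0)) ` B \<union> (\<lambda>c. (0, c)) ` C"
  have l: "linear (\<lambda>b::'e. (b, 0::'f))" "linear (\<lambda>c::'f. (0::'e, c))"
    by (auto intro!: linearI)
  have "(x, 0) \<in> span ?D" for x
    using span_mono[of "(\<lambda>b. (b, 0)) ` B" ?D] linear_span_image[OF l(1), of B] B(2) by auto
  moreover have "(0, y) \<in> span ?D" for y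
    using span_mono[of "(\<lambda>c. (0, c)) ` C" ?D] linear_span_image[OF l(2), of C] C(2) by auto
  ultimately have "(x, y) \<in> span ?D" for x y
    using span_add[of "(x, 0)" ?D "(0, y)"] by simp
  then have "span ?D = UNIV" by auto
  then show ?thesis using B C unfolding fin_dim_def by (meson finite_Un finite_imageI)
qed

lemma fin_dim_complete:
  assumes "fin_dim TYPE('e::real_inner)"
  shows "complete (UNIV :: 'e::real_inner set)"
proof (rule completeI)
  fix f :: "nat \<Rightarrow> 'e" assume f: "Cauchy f"
  obtain B :: "'e set" and d where B: "finite B" "\<And>v. v = (\<Sum>b\<in>B. (v \<bullet> d b) *\<^sub>R b)"
    using fin_dim_expand[OF assms(1)] by blast
  have "convergent (\<lambda>n. f n \<bullet> d b)" for b
    using bounded_linear.Cauchy[OF bounded_linear_inner_left f] by (rule real_Cauchy_convergent)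
  then obtain l where "(\<lambda>n. f n \<bullet> d b) \<longlonglongrightarrow> l b" for b
    unfolding convergent_def by metis
  then have "(\<lambda>n. \<Sum>b\<in>B. (f n \<bullet> d b) *\<^sub>R b) \<longlonglongrightarrow> (\<Sum>b\<in>B. l b *\<^sub>R b)"
    by (intro tendsto_intros)
  then show "\<exists>l\<in>UNIV. f \<longlonglongrightarrow> l" using B(2) by auto
qed

lemma Ck_on_subset: "Ck_on k f S \<Longrightarrow> T \<subseteq> S \<Longrightarrow> Ck_on k f T"
  by (induction k arbitrary: f) (auto intro: continuous_on_subset)

lemma frechet_cong:
  assumes "open S" "x \<in> S" "\<And>y. y \<in> S \<Longrightarrow> f y = g y" "f differentiable (at x)"
  shows "g differentiable (at x)" "frechet_derivative g (at x) = frechet_derivative f (at x)"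
proof -
  have "(g has_derivative frechet_derivative f (at x)) (at x)"
    using assms has_derivative_transform_within_open[of f _ x UNIV S g]
    by (simp add: frechet_derivative_works)
  then show "g differentiable (at x)" "frechet_derivative g (at x) = frechet_derivative f (at x)"
    by (auto simp: differentiable_def frechet_derivative_at[symmetric])
qed

lemma Ck_on_cong:
  assumes "open S" "\<And>x. x \<in> S \<Longrightarrow> f x = g x" "Ck_on k f S"
  shows "Ck_on k g S"
  using assms(2,3)
proof (induction k arbitrary: f g)
  case 0 then show ?case using continuous_on_cong[of S S f g] by simp
next
  case (Suc k)
  have "g differentiable (at x)" "frechet_derivative g (at x) = frechet_derivative f (at x)"
    if "x \<in> S" for x
    using frechet_cong[OF assms(1) that, of f g] Suc.prems that by auto
  moreover have "Ck_on k (\<lambda>x. frechet_derivative g (at x) v) S" for v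
    by (rule Suc.IH[of "\<lambda>x. frechet_derivative f (at x) v"]) (use Suc.prems calculation in auto)
  ultimately show ?case by simp
qed

lemma Ck_on_local:
  assumes "\<And>x. x \<in> S \<Longrightarrow> \<exists>T. open T \<and> x \<in> T \<and> Ck_on k f T"
  shows "Ck_on k f S"
  using assms
proof (induction k arbitrary: f)
  case 0 then show ?case
    by (fastforce simp: continuous_on_eq_continuous_at intro!: continuous_at_imp_continuous_on)
next
  case (Suc k)
  have "Ck_on k (\<lambda>x. frechet_derivative f (at x) v) S" for v
    by (rule Suc.IH) (use Suc.prems in fastforce)
  then show ?case using Suc.prems by fastforce
qed

lemma Ck_on_Suc_D: "Ck_on (Suc k) f S \<Longrightarrow> Ck_on k f S"
proof (induction k arbitrary: f)
  case 0 then show ?case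
    by (auto intro!: continuous_at_imp_continuous_on differentiable_imp_continuous_within)
next
  case (Suc k)
  have "\<forall>x\<in>S. f differentiable (at x)" "\<forall>v. Ck_on (Suc k) (\<lambda>x. frechet_derivative f (at x) v) S"
    using Suc.prems by auto
  then show ?case using Suc.IH by simp
qed

text \<open>By uniqueness of derivatives any exhibited derivative may replace \<^const>\<open>frechet_derivative\<close> in the
  recursion.\<close>

lemma Ck_on_SucI:
  assumes "\<And>x. x \<in> S \<Longrightarrow> (f has_derivative f' x) (at x)" "\<And>v. Ck_on k (\<lambda>x. f' x v) S" "open S"
  shows "Ck_on (Suc k) f S"
proof -
  have "frechet_derivative f (at x) = f' x" if "x \<in> S" for x
    using frechet_derivative_at[OF assms(1)[OF that]] by simp
  then have "Ck_on k (\<lambda>x. frechet_derivative f (at x) v) S" for v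
    using Ck_on_cong[OF assms(3) _ assms(2)] by simp
  then show ?thesis using assms(1) by (auto simp: differentiable_def)
qed

lemma Ck_on_SucD:
  assumes "Ck_on (Suc k) f S" "x \<in> S"
  shows "(f has_derivative frechet_derivative f (at x)) (at x)"
  using assms by (auto simp: frechet_derivative_works)

lemma Ck_on_const: "open S \<Longrightarrow> Ck_on k (\<lambda>x. c) S"
proof (induction k arbitrary: c)
  case (Suc k) show ?case
    by (rule Ck_on_SucI[where f' = "\<lambda>x v. 0"]) (use Suc in auto)
qed simp

lemma Ck_on_bounded_linear: "open S \<Longrightarrow> bounded_linear f \<Longrightarrow> Ck_on k f S"
proof (cases k)
  case (Suc k')
  assume "open S" "bounded_linear f"
  then show ?thesis unfolding Suc
    by (intro Ck_on_SucI[where f' = "\<lambda>x. f"]) (auto intro: bounded_linear_imp_has_derivative Ck_on_const)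
qed (auto intro: linear_continuous_on)

lemma Ck_on_linear_comp:
  assumes "open S" "bounded_linear L" "Ck_on k f S"
  shows "Ck_on k (\<lambda>x. L (f x)) S"
  using assms(3)
proof (induction k arbitrary: f)
  case 0 then show ?case
    using linear_continuous_on_compose bounded_linear.continuous_on[OF assms(2)] by simp
next
  case (Suc k)
  show ?case
    by (rule Ck_on_SucI[where f' = "\<lambda>x v. L (frechet_derivative f (at x) v)"])
      (use Suc assms in \<open>auto intro!: bounded_linear.has_derivative[OF assms(2)] simp: frechet_derivative_works[symmetric]\<close>)
qed

lemma Ck_on_add:
  assumes "open S" "Ck_on k f S" "Ck_on k g S"
  shows "Ck_on k (\<lambda>x. f x + g x) S"
  using assms(2,3)
proof (induction k arbitrary: f g)
  case 0 then show ?case by (auto intro: continuous_intros)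
next
  case (Suc k)
  show ?case
    by (rule Ck_on_SucI[where f' = "\<lambda>x v. frechet_derivative f (at x) v + frechet_derivative g (at x) v"])
      (use Suc assms(1) in \<open>auto intro!: has_derivative_add simp: frechet_derivative_works[symmetric]\<close>)
qed

lemma Ck_on_sum:
  assumes "open S" "\<And>i. i \<in> I \<Longrightarrow> Ck_on k (f i) S"
  shows "Ck_on k (\<lambda>x. \<Sum>i\<in>I. f i x) S"
  using assms(2)
proof (induction I rule: infinite_finite_induct)
  case (insert i I) then show ?case using Ck_on_add[OF assms(1), of k "f i" "\<lambda>x. \<Sum>i\<in>I. f i x"] by simp
qed (auto intro: Ck_on_const assms(1))

lemma Ck_on_scaleR:
  fixes f :: "'a::real_normed_vector \<Rightarrow> real"
  assumes "open S" "Ck_on k f S" "Ck_on k g S"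
  shows "Ck_on k (\<lambda>x. f x *\<^sub>R g x) S"
  using assms(2,3)
proof (induction k arbitrary: f g)
  case 0 then show ?case by (auto intro: continuous_intros)
next
  case (Suc k)
  have "Ck_on k f S" "Ck_on k g S" using Suc.prems Ck_on_Suc_D by blast+
  then show ?case
    by (intro Ck_on_SucI[where f' = "\<lambda>x v. f x *\<^sub>R frechet_derivative g (at x) v + frechet_derivative f (at x) v *\<^sub>R g x"]
      Ck_on_add has_derivative_scaleR Suc.IH Ck_on_SucD[OF Suc.prems(1)] Ck_on_SucD[OF Suc.prems(2)] assms(1))
     (use Suc.prems in auto)
qed

lemma Ck_on_Pair:
  assumes "open S" "Ck_on k f S" "Ck_on k g S"
  shows "Ck_on k (\<lambda>x. (f x, g x)) S"
proof -
  have "Ck_on k (\<lambda>x. (f x, 0) + (0, g x)) S"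
    by (rule Ck_on_add[OF assms(1)
        Ck_on_linear_comp[OF assms(1) bounded_linear_Pair[OF bounded_linear_ident bounded_linear_zero] assms(2)]
        Ck_on_linear_comp[OF assms(1) bounded_linear_Pair[OF bounded_linear_zero bounded_linear_ident] assms(3)]])
  then show ?thesis by simp
qed

text \<open>The chain rule expands the inner derivative in coordinates, so that the outer derivative is only
  evaluated on constant vectors.\<close>

lemma Ck_on_compose:
  fixes f :: "'a::real_normed_vector \<Rightarrow> 'b::real_inner" and g :: "'b \<Rightarrow> 'c::real_normed_vector"
  assumes fd: "fin_dim TYPE('b)" and S: "open S" "f ` S \<subseteq> T" and "Ck_on k f S" "Ck_on k g T"
  shows "Ck_on k (\<lambda>x. g (f x)) S"
  using assms(4,5)
proof (induction k arbitrary: g)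
  case 0 then show ?case using S(2) continuous_on_compose2 by auto
next
  case (Suc k)
  obtain B :: "'b set" and d where B: "finite B" "\<And>v. v = (\<Sum>b\<in>B. (v \<bullet> d b) *\<^sub>R b)"
    using fin_dim_expand[OF fd] by blast
  let ?Df = "\<lambda>x. frechet_derivative f (at x)" and ?Dg = "\<lambda>y. frechet_derivative g (at y)"
  have e: "?Dg (f x) w = (\<Sum>b\<in>B. (w \<bullet> d b) *\<^sub>R ?Dg (f x) b)" if "x \<in> S" for x w
  proof -
    have l: "linear (?Dg (f x))"
      using Suc.prems(2) S(2) that by (intro linear_frechet_derivative) auto
    show ?thesis by (subst B(2)[of w]) (simp add: linear_sum[OF l] linear_scale[OF l])
  qed
  show ?case
  proof (rule Ck_on_SucI[where f' = "\<lambda>x v. ?Dg (f x) (?Df x v)"])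
    fix x assume "x \<in> S"
    then show "((\<lambda>x. g (f x)) has_derivative (\<lambda>v. ?Dg (f x) (?Df x v))) (at x)"
      using Ck_on_SucD[OF Suc.prems(1)] Ck_on_SucD[OF Suc.prems(2)] S(2)
        diff_chain_at[of f "?Df x" x g "?Dg (f x)"] by (auto simp: o_def)
  next
    fix v
    have "Ck_on k (\<lambda>x. ?Dg (f x) b) S" for b
      using Suc.IH[of "\<lambda>y. ?Dg y b"] Ck_on_Suc_D[OF Suc.prems(1)] Suc.prems(2) by simp
    then have "Ck_on k (\<lambda>x. \<Sum>b\<in>B. (?Df x v \<bullet> d b) *\<^sub>R ?Dg (f x) b) S"
      using Suc.prems(1) S(1)
      by (intro Ck_on_sum Ck_on_scaleR Ck_on_linear_comp[OF _ bounded_linear_inner_left]) auto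
    then show "Ck_on k (\<lambda>x. ?Dg (f x) (?Df x v)) S"
      by (rule Ck_on_cong[OF S(1), rotated]) (use e in simp)
  qed (use S in auto)
qed

lemma smooth_on_subset: "smooth_on S f \<Longrightarrow> T \<subseteq> S \<Longrightarrow> smooth_on T f"
  unfolding smooth_on_def using Ck_on_subset by blast

lemma smooth_on_cong: "open S \<Longrightarrow> (\<And>x. x \<in> S \<Longrightarrow> f x = g x) \<Longrightarrow> smooth_on S f \<Longrightarrow> smooth_on S g"
  unfolding smooth_on_def using Ck_on_cong by blast

lemma smooth_on_local: "(\<And>x. x \<in> S \<Longrightarrow> \<exists>T. open T \<and> x \<in> T \<and> smooth_on T f) \<Longrightarrow> smooth_on S f"
  unfolding smooth_on_def by (intro allI Ck_on_local) blast

lemma smooth_on_continuous: "smooth_on S f \<Longrightarrow> continuous_on S f"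
  unfolding smooth_on_def by (drule spec[of _ 0]) simp

lemma smooth_on_differentiable: "smooth_on S f \<Longrightarrow> x \<in> S \<Longrightarrow> f differentiable (at x)"
  unfolding smooth_on_def by (drule spec[of _ 1]) simp

lemma smooth_on_has_derivative:
  "smooth_on S f \<Longrightarrow> x \<in> S \<Longrightarrow> (f has_derivative frechet_derivative f (at x)) (at x)"
  using smooth_on_differentiable frechet_derivative_works by blast

lemma smooth_on_derivative: "smooth_on S f \<Longrightarrow> smooth_on S (\<lambda>x. frechet_derivative f (at x) v)"
  unfolding smooth_on_def by (intro allI, drule_tac x = "Suc k" in spec) simp

lemma smooth_on_const: "open S \<Longrightarrow> smooth_on S (\<lambda>x. c)"
  unfolding smooth_on_def by (simp add: Ck_on_const)

lemma smooth_on_bounded_linear: "open S \<Longrightarrow> bounded_linear f \<Longrightarrow> smooth_on S f"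
  unfolding smooth_on_def by (simp add: Ck_on_bounded_linear)

lemma smooth_on_linear_comp:
  "open S \<Longrightarrow> bounded_linear L \<Longrightarrow> smooth_on S f \<Longrightarrow> smooth_on S (\<lambda>x. L (f x))"
  unfolding smooth_on_def by (simp add: Ck_on_linear_comp)

lemma smooth_on_add: "open S \<Longrightarrow> smooth_on S f \<Longrightarrow> smooth_on S g \<Longrightarrow> smooth_on S (\<lambda>x. f x + g x)"
  unfolding smooth_on_def by (simp add: Ck_on_add)

lemma smooth_on_Pair: "open S \<Longrightarrow> smooth_on S f \<Longrightarrow> smooth_on S g \<Longrightarrow> smooth_on S (\<lambda>x. (f x, g x))"
  unfolding smooth_on_def by (simp add: Ck_on_Pair)

lemma smooth_on_compose:
  fixes f :: "'a::real_normed_vector \<Rightarrow> 'b::real_inner"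
  shows "fin_dim TYPE('b) \<Longrightarrow> open S \<Longrightarrow> f ` S \<subseteq> T \<Longrightarrow> smooth_on S f \<Longrightarrow> smooth_on T g \<Longrightarrow>
    smooth_on S (\<lambda>x. g (f x))"
  unfolding smooth_on_def using Ck_on_compose by blast

text \<open>Smoothness gives the partial derivatives along fixed vectors only. Being linear in \<^term>\<open>v\<close>, the
  derivative is a sum of these, taken over a spanning family, with the coordinates of \<^term>\<open>v\<close> as
  coefficients.\<close>

lemma smooth_on_total_derivative:
  fixes f :: "'a::real_inner \<Rightarrow> 'b::real_normed_vector"
  assumes fd: "fin_dim TYPE('a)" and "open S" "smooth_on S f"
  shows "smooth_on (S \<times> UNIV) (\<lambda>(x, v). frechet_derivative f (at x) v)"
proof -
  obtain B :: "'a set" and d where B: "finite B" "\<And>v. v = (\<Sum>b\<in>B. (v \<bullet> d b) *\<^sub>R b)"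
    using fin_dim_expand[OF fd] by blast
  have o: "open (S \<times> (UNIV::'a set))" by (simp add: assms(2) open_Times)
  have "smooth_on (S \<times> (UNIV :: 'a set)) (\<lambda>z. frechet_derivative f (at (fst z)) b)" for b
    by (rule smooth_on_compose[where f = fst and g = "\<lambda>x. frechet_derivative f (at x) b",
          OF fd o _ smooth_on_bounded_linear[OF o bounded_linear_fst] smooth_on_derivative[OF assms(3)]]) auto
  moreover have "smooth_on (S \<times> UNIV) (\<lambda>z. snd z \<bullet> d b)" for b
    by (rule smooth_on_linear_comp[OF o bounded_linear_inner_left
          smooth_on_bounded_linear[OF o bounded_linear_snd]])
  ultimately have "smooth_on (S \<times> UNIV) (\<lambda>z. \<Sum>b\<in>B. (snd z \<bullet> d b) *\<^sub>R frechet_derivative f (at (fst z)) b)"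
    unfolding smooth_on_def by (simp add: Ck_on_sum Ck_on_scaleR o)
  then show ?thesis
  proof (rule smooth_on_cong[OF o, rotated])
    fix z :: "'a \<times> 'a" assume "z \<in> S \<times> UNIV"
    then have l: "linear (frechet_derivative f (at (fst z)))"
      using smooth_on_differentiable[OF assms(3)] by (intro linear_frechet_derivative) auto
    have "frechet_derivative f (at (fst z)) (snd z) = (\<Sum>b\<in>B. (snd z \<bullet> d b) *\<^sub>R frechet_derivative f (at (fst z)) b)"
      by (subst B(2)[of "snd z"]) (simp add: linear_sum[OF l] linear_scale[OF l])
    then show "(\<Sum>b\<in>B. (snd z \<bullet> d b) *\<^sub>R frechet_derivative f (at (fst z)) b) =
      (case z of (x, v) \<Rightarrow> frechet_derivative f (at x) v)" by (simp add: split_beta)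
  qed
qed

text \<open>Differentiable lifting of a curve through a map with surjective derivative. Along a linear right
  inverse \<open>R\<close> of the derivative, the equation for the correction \<open>y\<close> of the straight line is solved
  by a contraction on a ball whose radius is twice the defect of the straight line; as the defect is
  \<open>o(t)\<close>, so is the correction, and the lift has the prescribed velocity at 0.\<close>

lemma lift_curve:
  fixes f :: "'a::real_inner \<Rightarrow> 'b::real_inner" and \<beta> :: "real \<Rightarrow> 'b"
  assumes fa: "fin_dim TYPE('a)" and fb: "fin_dim TYPE('b)"
    and U: "open U" "x0 \<in> U" "smooth_on U f"
    and surj: "surj (frechet_derivative f (at x0))"
    and \<beta>: "\<beta> 0 = f x0" "(\<beta> has_vector_derivative frechet_derivative f (at x0) u) (at 0)"
  shows "\<exists>\<gamma>. \<gamma> 0 = x0 \<and> (\<gamma> has_vector_derivative u) (at 0) \<and> (\<forall>\<^sub>F t in nhds 0. \<gamma> t \<in> U \<and> f (\<gamma> t) = \<beta> t)"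
proof -
  let ?D = "\<lambda>x. frechet_derivative f (at x)"
  obtain A :: "'a set" and da where A: "finite A" "\<And>v. v = (\<Sum>b\<in>A. (v \<bullet> da b) *\<^sub>R b)"
    using fin_dim_expand[OF fa] by blast
  have lD: "linear (?D x)" if "x \<in> U" for x
    using smooth_on_differentiable[OF U(3) that] by (rule linear_frechet_derivative)
  obtain R where R: "linear R" "\<And>w. ?D x0 (R w) = w"
    using linear_surj_right_inverse[OF lD[OF U(2)], of UNIV UNIV] surj by auto
  have bR: "bounded_linear R" using fin_dim_linear_bounded[OF fb R(1)] .
  obtain r0 where r0: "r0 > 0" "\<And>y. norm (R y) \<le> norm y * r0"
    using bounded_linear.pos_bounded[OF bR] by (auto simp: mult.commute)
  \<comment> \<open>\<^term>\<open>r0\<close> bounds the norm of \<^term>\<open>R\<close>, so the contraction below has factor 1/2\<close>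
  define \<epsilon> where "\<epsilon> = 1 / (2 * r0)"
  have \<epsilon>: "\<epsilon> > 0" using r0 by (simp add: \<epsilon>_def)
  \<comment> \<open>strict differentiability at \<open>x0\<close>\<close>
  obtain r where r: "r > 0" "ball x0 r \<subseteq> U"
    "\<And>z z'. z \<in> ball x0 r \<Longrightarrow> z' \<in> ball x0 r \<Longrightarrow> norm (f z - f z' - ?D x0 (z - z')) \<le> \<epsilon> * norm (z - z')"
  proof -
    have cont: "continuous_on U (\<lambda>x. \<Sum>b\<in>A. norm (da b) * norm (?D x b - ?D x0 b))"
      by (intro continuous_intros smooth_on_continuous smooth_on_derivative U)
    have "\<forall>\<^sub>F x in at x0. (\<Sum>b\<in>A. norm (da b) * norm (?D x b - ?D x0 b)) < \<epsilon>"
      using cont U(1,2) \<epsilon>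
      by (intro order_tendstoD(2)[where y = "\<Sum>b\<in>A. norm (da b) * norm (?D x0 b - ?D x0 b)"])
        (auto simp: continuous_on_eq_continuous_at continuous_within)
    then obtain s where s: "s > 0"
      "\<And>x. x \<noteq> x0 \<Longrightarrow> dist x x0 < s \<Longrightarrow> (\<Sum>b\<in>A. norm (da b) * norm (?D x b - ?D x0 b)) < \<epsilon>"
      unfolding eventually_at by auto
    obtain s' where s': "s' > 0" "ball x0 s' \<subseteq> U" using U openE by blast
    define r where "r = min s s'"
    have rU: "ball x0 r \<subseteq> U" using s' by (auto simp: r_def)
    have "norm (f z - f z' - ?D x0 (z - z')) \<le> \<epsilon> * norm (z - z')"
      if "z \<in> ball x0 r" "z' \<in> ball x0 r" for z z'
    proof -
      have b0: "bounded_linear (?D x0)" by (rule fin_dim_linear_bounded[OF fa lD[OF U(2)]])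
      have "norm ((f z - ?D x0 z) - (f z' - ?D x0 z')) \<le> \<epsilon> * norm (z - z')"
      proof (rule differentiable_bound[OF convex_ball _ _ that, where f' = "\<lambda>x v. ?D x v - ?D x0 v"])
        fix x assume x: "x \<in> ball x0 r"
        then have xU: "x \<in> U" using rU by blast
        show "((\<lambda>x. f x - ?D x0 x) has_derivative (\<lambda>v. ?D x v - ?D x0 v)) (at x within ball x0 r)"
          by (intro has_derivative_diff has_derivative_at_withinI[OF smooth_on_has_derivative[OF U(3) xU]]
              bounded_linear_imp_has_derivative b0)
        show "onorm (\<lambda>v. ?D x v - ?D x0 v) \<le> \<epsilon>"
        proof (rule onorm_bound)
          show "0 \<le> \<epsilon>" using \<epsilon> by simp
        next
          fix v
          have l: "linear (\<lambda>v. ?D x v - ?D x0 v)"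
            by (intro linear_compose_sub lD xU U)
          have "?D x v - ?D x0 v = (\<Sum>b\<in>A. (v \<bullet> da b) *\<^sub>R (?D x b - ?D x0 b))"
            using linear_sum[OF l, of "\<lambda>b. (v \<bullet> da b) *\<^sub>R b" A] linear_scale[OF l] A(2)[of v] by simp
          also have "norm \<dots> \<le> (\<Sum>b\<in>A. norm v * (norm (da b) * norm (?D x b - ?D x0 b)))"
            by (intro norm_sum[THEN order_trans] sum_mono)
              (auto simp: mult.assoc[symmetric] intro!: mult_right_mono Cauchy_Schwarz_ineq2)
          also have "\<dots> = (\<Sum>b\<in>A. norm (da b) * norm (?D x b - ?D x0 b)) * norm v"
            by (simp add: sum_distrib_left mult.commute)
          also have "\<dots> \<le> \<epsilon> * norm v"
          proof (cases "x = x0")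
            case False
            then show ?thesis using s(2)[of x] x by (intro mult_right_mono) (auto simp: r_def dist_commute)
          qed (use \<epsilon> in simp)
          finally show "norm (?D x v - ?D x0 v) \<le> \<epsilon> * norm v" .
        qed
      qed
      then show ?thesis by (simp add: linear_diff[OF lD[OF U(2)]] algebra_simps)
    qed
    then show ?thesis using that[of r] s s' rU by (auto simp: r_def)
  qed
  define e where "e t = norm (f (x0 + t *\<^sub>R u) - \<beta> t)" for t
  have e0: "e 0 = 0" using \<beta>(1) by (simp add: e_def)
  have fl: "((\<lambda>t. f (x0 + t *\<^sub>R u) - \<beta> t) has_vector_derivative 0) (at 0)"
  proof -
    have "((\<lambda>t. x0 + t *\<^sub>R u) has_derivative (\<lambda>t. t *\<^sub>R u)) (at 0)"
      by (auto intro!: derivative_eq_intros)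
    moreover have "(f has_derivative ?D x0) (at (x0 + 0 *\<^sub>R u))"
      using smooth_on_has_derivative[OF U(3,2)] by simp
    ultimately have "((\<lambda>t. f (x0 + t *\<^sub>R u)) has_derivative (\<lambda>t. ?D x0 (t *\<^sub>R u))) (at 0)"
      using has_derivative_compose by blast
    then have "((\<lambda>t. f (x0 + t *\<^sub>R u)) has_vector_derivative ?D x0 u) (at 0)"
      unfolding has_vector_derivative_def by (simp add: linear_scale[OF lD[OF U(2)]])
    then show ?thesis using has_vector_derivative_diff[OF _ \<beta>(2)] by fastforce
  qed
  have elim: "(\<lambda>t. e t / \<bar>t\<bar>) \<midarrow>0\<rightarrow> 0"
    using tendsto_norm_zero[where f = "\<lambda>y. (f (x0 + y *\<^sub>R u) - \<beta> y) /\<^sub>R \<bar>y\<bar>" and F = "at 0"] fl e0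
    unfolding has_vector_derivative_def has_derivative_at_within
    by (simp add: e_def \<beta>(1) divide_inverse mult.commute)
  have "((\<lambda>t. 2 * r0 * e t + \<bar>t\<bar> * norm u) \<longlongrightarrow> 0) (nhds 0)"
  proof -
    have "continuous (at 0) (\<lambda>t. f (x0 + t *\<^sub>R u) - \<beta> t)"
      using fl has_vector_derivative_continuous by blast
    then have "((\<lambda>t. f (x0 + t *\<^sub>R u) - \<beta> t) \<longlongrightarrow> 0) (nhds 0)"
      using \<beta>(1) tendsto_at_iff_tendsto_nhds[of "\<lambda>t. f (x0 + t *\<^sub>R u) - \<beta> t" 0] by (simp add: continuous_at)
    then have "(e \<longlongrightarrow> 0) (nhds 0)" unfolding e_def by (rule tendsto_norm_zero)
    then show ?thesis by (auto intro!: tendsto_eq_intros filterlim_ident)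
  qed
  then have small: "\<forall>\<^sub>F t in nhds 0. 2 * r0 * e t + \<bar>t\<bar> * norm u < r"
    using r(1) order_tendstoD(2) by fastforce
  let ?z = "\<lambda>t y. x0 + t *\<^sub>R u + R y"
  have sol: "\<exists>y. norm y \<le> 2 * e t \<and> ?z t y \<in> ball x0 r \<and> f (?z t y) = \<beta> t"
    if t: "2 * r0 * e t + \<bar>t\<bar> * norm u < r" for t
  proof -
    let ?s = "cball 0 (2 * e t) :: 'b set" and ?\<Phi> = "\<lambda>y. y - (f (?z t y) - \<beta> t)"
    have zb: "?z t y \<in> ball x0 r" if "y \<in> ?s" for y
    proof -
      have "norm (R y) \<le> 2 * e t * r0"
        using order_trans[OF r0(2) mult_right_mono[of "norm y" "2 * e t" r0]] that r0(1) by simp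
      then have "norm (t *\<^sub>R u + R y) < r"
        using t norm_triangle_ineq[of "t *\<^sub>R u" "R y"] by (simp add: mult_ac)
      moreover have "dist x0 (?z t y) = norm (t *\<^sub>R u + R y)"
        by (metis add.assoc add_diff_cancel_left' dist_commute dist_norm)
      ultimately show ?thesis by simp
    qed
    have con: "norm (?\<Phi> y - ?\<Phi> y') \<le> 1 / 2 * norm (y - y')" if "y \<in> ?s" "y' \<in> ?s" for y y'
    proof -
      have "?D x0 (R (y - y')) = y - y'" using R(2) .
      moreover have "?z t y - ?z t y' = R (y - y')" by (simp add: linear_diff[OF R(1)])
      moreover have "?\<Phi> y - ?\<Phi> y' = - (f (?z t y) - f (?z t y') - (y - y'))" by simp
      ultimately have "norm (?\<Phi> y - ?\<Phi> y') = norm (f (?z t y) - f (?z t y') - ?D x0 (?z t y - ?z t y'))"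
        by (metis norm_minus_cancel)
      also have "\<dots> \<le> \<epsilon> * norm (R (y - y'))"
        using r(3)[OF zb[OF that(1)] zb[OF that(2)]] \<open>?z t y - ?z t y' = R (y - y')\<close> by simp
      also have "\<dots> \<le> \<epsilon> * (norm (y - y') * r0)" using r0(2) \<epsilon> by simp
      also have "\<dots> = 1 / 2 * norm (y - y')" using r0(1) by (simp add: \<epsilon>_def)
      finally show ?thesis .
    qed
    have self: "?\<Phi> ` ?s \<subseteq> ?s"
    proof
      fix w assume "w \<in> ?\<Phi> ` ?s"
      then obtain y where y: "y \<in> ?s" "w = ?\<Phi> y" by blast
      have z: "0 \<in> ?s" by (simp add: e_def)
      have "norm (?\<Phi> 0) = e t" by (simp add: e_def linear_0[OF R(1)] norm_minus_commute)
      moreover have "norm (?\<Phi> y) \<le> norm (?\<Phi> y - ?\<Phi> 0) + norm (?\<Phi> 0)"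
        by (metis diff_add_cancel norm_triangle_ineq)
      ultimately show "w \<in> ?s" using con[OF y(1) z] y by simp
    qed
    have "complete ?s" using complete_closed_subset[OF closed_cball subset_UNIV fin_dim_complete[OF fb]] .
    moreover have "?s \<noteq> {}" by (auto simp: e_def)
    ultimately have "\<exists>!y\<in>?s. ?\<Phi> y = y"
      using self con by (intro Banach_fix[of ?s "1/2"]) (auto simp: dist_norm)
    then obtain y where "y \<in> ?s" "?\<Phi> y = y" by blast
    then show ?thesis using zb[of y] by (intro exI[of _ y]) auto
  qed
  define y where "y t = (SOME y. norm y \<le> 2 * e t \<and> ?z t y \<in> ball x0 r \<and> f (?z t y) = \<beta> t)" for t
  have y: "norm (y t) \<le> 2 * e t" "?z t (y t) \<in> ball x0 r" "f (?z t (y t)) = \<beta> t"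
    if "2 * r0 * e t + \<bar>t\<bar> * norm u < r" for t
    using someI_ex[OF sol[OF that]] unfolding y_def by auto
  let ?\<gamma> = "\<lambda>t. ?z t (y t)"
  have y0: "y 0 = 0" using y(1)[of 0] e0 r(1) by simp
  have yd: "(y has_vector_derivative 0) (at 0)"
  proof -
    have "\<forall>\<^sub>F t in at 0. norm (norm (y t) / \<bar>t\<bar>) \<le> 2 * (e t / \<bar>t\<bar>)"
      using eventually_nhds_x_imp_x small
      by (rule_tac eventually_mono[OF eventually_at_filter[THEN iffD2, OF eventually_mono[OF small]]])
        (auto simp: divide_right_mono dest: y(1))
    then have "((\<lambda>t. norm (y t) / \<bar>t\<bar>) \<longlongrightarrow> 0) (at 0)"
      by (rule Lim_null_comparison) (use tendsto_mult_right_zero[OF elim] in auto)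
    then have "((\<lambda>t. norm (y t /\<^sub>R \<bar>t\<bar>)) \<longlongrightarrow> 0) (at 0)" by (simp add: divide_inverse mult.commute)
    then have "((\<lambda>t. y t /\<^sub>R \<bar>t\<bar>) \<longlongrightarrow> 0) (at 0)" by (rule tendsto_norm_zero_cancel)
    then show ?thesis
      unfolding has_vector_derivative_def has_derivative_at_within by (simp add: y0)
  qed
  have "(?\<gamma> has_vector_derivative u) (at 0)"
    using bounded_linear.has_vector_derivative[OF bR yd]
    by (auto intro!: derivative_eq_intros simp: linear_0[OF R(1)])
  moreover have "\<forall>\<^sub>F t in nhds 0. ?\<gamma> t \<in> U \<and> f (?\<gamma> t) = \<beta> t"
    using small by eventually_elim (use y r(2) in auto)
  ultimately show ?thesis using y0 by (intro exI[of _ ?\<gamma>]) (auto simp: linear_0[OF R(1)])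
qed

section \<open>Smooth maps between atlases\<close>

text \<open>The part of \<^const>\<open>manifold\<close> that is not about the topology. It is inherited by all the
  atlases built from manifolds below (products, tangent bundles, Lie algebras), and it is all that
  composition of smooth maps needs.\<close>

definition smooth_atlas :: "('a, 'e::real_inner) atlas \<Rightarrow> bool" where
  "smooth_atlas M \<longleftrightarrow> fin_dim TYPE('e) \<and> (\<forall>c\<in>M. inj_on (snd c) (fst c)) \<and>
     (\<forall>c\<in>M. \<forall>d\<in>M. open (snd c ` (fst c \<inter> fst d)) \<and>
        smooth_on (snd c ` (fst c \<inter> fst d)) (snd d \<circ> chart_inv c))"

lemma manifold_smooth_atlas: "manifold M \<Longrightarrow> smooth_atlas M"
  by (simp add: manifold_def smooth_atlas_def fin_dim_def)

lemma smooth_atlasD: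
  assumes "smooth_atlas (M :: ('a, 'e::real_inner) atlas)"
  shows "fin_dim TYPE('e)" "c \<in> M \<Longrightarrow> inj_on (snd c) (fst c)"
    "c \<in> M \<Longrightarrow> d \<in> M \<Longrightarrow> open (snd c ` (fst c \<inter> fst d))"
    "c \<in> M \<Longrightarrow> d \<in> M \<Longrightarrow> smooth_on (snd c ` (fst c \<inter> fst d)) (\<lambda>x. snd d (chart_inv c x))"
    "c \<in> M \<Longrightarrow> open (snd c ` fst c)"
    "c \<in> M \<Longrightarrow> p \<in> fst c \<Longrightarrow> chart_inv c (snd c p) = p"
  using assms unfolding smooth_atlas_def chart_inv_def o_def
  by (blast, blast, blast, blast, metis Int_absorb, simp)

lemma ptsE: assumes "p \<in> pts M" obtains c where "c \<in> M" "p \<in> fst c"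
  using assms unfolding pts_def by blast

lemma ptsI: "c \<in> M \<Longrightarrow> p \<in> fst c \<Longrightarrow> p \<in> pts M"
  unfolding pts_def by blast

lemma smooth_mapD:
  assumes "smooth_map M N f"
  shows "p \<in> pts M \<Longrightarrow> f p \<in> pts N"
    "c \<in> M \<Longrightarrow> d \<in> N \<Longrightarrow> open (snd c ` {p \<in> fst c. f p \<in> fst d})"
    "c \<in> M \<Longrightarrow> d \<in> N \<Longrightarrow> smooth_on (snd c ` {p \<in> fst c. f p \<in> fst d}) (\<lambda>x. snd d (f (chart_inv c x)))"
  using assms unfolding smooth_map_def o_def by auto

text \<open>One pair of charts near every point is enough because the coordinate expressions in all other pairs
  differ from it by coordinate changes.\<close>

lemma smooth_map_localI:
  assumes M: "smooth_atlas (M :: ('a, 'e::real_inner) atlas)"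
    and N: "smooth_atlas (N :: ('b, 'f::real_inner) atlas)"
    and loc: "\<And>p. p \<in> pts M \<Longrightarrow> \<exists>c\<in>M. \<exists>d\<in>N. \<exists>U. open U \<and> p \<in> fst c \<and> snd c p \<in> U \<and> U \<subseteq> snd c ` fst c \<and>
      (\<forall>x\<in>U. f (chart_inv c x) \<in> fst d) \<and> smooth_on U (\<lambda>x. snd d (f (chart_inv c x)))"
  shows "smooth_map M N f"
proof -
  have "f p \<in> pts N" if p: "p \<in> pts M" for p
  proof -
    obtain c d U where "c \<in> M" "d \<in> N" "p \<in> fst c" "snd c p \<in> U" "\<forall>x\<in>U. f (chart_inv c x) \<in> fst d"
      using loc[OF p] by blast
    then show ?thesis using smooth_atlasD(6)[OF M, of c p] by (metis ptsI)
  qed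
  moreover
  have key: "\<exists>V. open V \<and> snd c' p \<in> V \<and> V \<subseteq> snd c' ` {p \<in> fst c'. f p \<in> fst d'} \<and>
      smooth_on V (\<lambda>x. snd d' (f (chart_inv c' x)))"
    if c': "c' \<in> M" "p \<in> fst c'" and d': "d' \<in> N" "f p \<in> fst d'" for c' d' p
  proof -
    obtain c d U where c: "c \<in> M" "d \<in> N" "open U" "p \<in> fst c" "snd c p \<in> U" "U \<subseteq> snd c ` fst c"
      "\<And>x. x \<in> U \<Longrightarrow> f (chart_inv c x) \<in> fst d" "smooth_on U (\<lambda>x. snd d (f (chart_inv c x)))"
      using loc[OF ptsI[OF c']] by blast
    let ?W = "snd c' ` (fst c' \<inter> fst c)" and ?T = "snd d ` (fst d \<inter> fst d')"
    let ?\<tau> = "\<lambda>x. snd c (chart_inv c' x)" and ?g = "\<lambda>x. snd d (f (chart_inv c x))"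
      and ?\<sigma> = "\<lambda>y. snd d' (chart_inv d y)"
    have o: "open ?W" "open ?T" 
    by (rule smooth_atlasD(3)[OF M c'(1) c(1)], rule smooth_atlasD(3)[OF N c(2) d'(1)])
    have \<tau>: "smooth_on ?W ?\<tau>" and \<sigma>: "smooth_on ?T ?\<sigma>"
      using smooth_atlasD(4)[OF M c'(1) c(1)] smooth_atlasD(4)[OF N c(2) d'(1)] by auto
    define U' where "U' = {y \<in> U. ?g y \<in> ?T}"
    have U': "open U'" unfolding U'_def
      using continuous_open_preimage[OF smooth_on_continuous[OF c(8)] c(3) o(2)]
      by (simp add: vimage_def Int_def)
    define V where "V = {x \<in> ?W. ?\<tau> x \<in> U'}"
    have V: "open V" unfolding V_def
      using continuous_open_preimage[OF smooth_on_continuous[OF \<tau>] o(1) U']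
      by (simp add: vimage_def Int_def)
    have fp: "f p \<in> fst d" using c(4,5,7) smooth_atlasD(6)[OF M c(1)] by metis
    have pV: "snd c' p \<in> V"
      using c c' d' fp by (auto simp: V_def U'_def smooth_atlasD(6)[OF M])
    have inV: "\<exists>q. q \<in> fst c' \<and> q \<in> fst c \<and> x = snd c' q \<and> f q \<in> fst d \<and> f q \<in> fst d'" if x: "x \<in> V" for x
    proof -
      obtain q where q: "q \<in> fst c'" "q \<in> fst c" "x = snd c' q" "snd c q \<in> U" "snd d (f q) \<in> ?T"
        using x c c' by (auto simp: V_def U'_def smooth_atlasD(6)[OF M])
      then have "f q \<in> fst d" using c(7)[of "snd c q"] smooth_atlasD(6)[OF M c(1)] by metis
      moreover then have "f q \<in> fst d'" using q(5) smooth_atlasD(2)[OF N c(2)] by (auto dest: inj_onD)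
      ultimately show ?thesis using q by blast
    qed
    have "smooth_on V (\<lambda>x. ?\<sigma> (?g (?\<tau> x)))"
    proof (rule smooth_on_compose[where f = "\<lambda>x. ?g (?\<tau> x)" and g = ?\<sigma>, OF smooth_atlasD(1)[OF N] V _ _ \<sigma>])
      show "(\<lambda>x. ?g (?\<tau> x)) ` V \<subseteq> ?T" by (auto simp: V_def U'_def)
      have "smooth_on V ?\<tau>" by (rule smooth_on_subset[OF \<tau>]) (auto simp: V_def)
      then show "smooth_on V (\<lambda>x. ?g (?\<tau> x))"
        by (intro smooth_on_compose[where f = ?\<tau> and g = ?g, OF smooth_atlasD(1)[OF M] V _ _ c(8)])
          (auto simp: V_def U'_def)
    qed
    then have "smooth_on V (\<lambda>x. snd d' (f (chart_inv c' x)))"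
      by (rule smooth_on_cong[OF V, rotated])
        (use inV c c' in \<open>force simp: smooth_atlasD(6)[OF M] smooth_atlasD(6)[OF N]\<close>)
    moreover have "V \<subseteq> snd c' ` {p \<in> fst c'. f p \<in> fst d'}" using inV by blast
    ultimately show ?thesis using V pV by blast
  qed
  have "open (snd c ` {p \<in> fst c. f p \<in> fst d})" if "c \<in> M" "d \<in> N" for c d
  proof (subst open_subopen, intro ballI)
    fix x assume "x \<in> snd c ` {p \<in> fst c. f p \<in> fst d}"
    then obtain p where "p \<in> fst c" "f p \<in> fst d" "x = snd c p" by blast
    then show "\<exists>T. open T \<and> x \<in> T \<and> T \<subseteq> snd c ` {p \<in> fst c. f p \<in> fst d}"
      using key[of c p d] that by blast
  qed
  moreover have "smooth_on (snd c ` {p \<in> fst c. f p \<in> fst d}) (\<lambda>x. snd d (f (chart_inv c x)))"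
    if "c \<in> M" "d \<in> N" for c d
    by (rule smooth_on_local) (use key[of c _ d] that in blast)
  ultimately show ?thesis unfolding smooth_map_def o_def by auto
qed

lemma smooth_map_cong: "smooth_map M N f \<Longrightarrow> smooth_atlas M \<Longrightarrow> (\<And>p. p \<in> pts M \<Longrightarrow> f p = g p) \<Longrightarrow> smooth_map M N g"
proof -
  assume f: "smooth_map M N f" and M: "smooth_atlas M" and e: "\<And>p. p \<in> pts M \<Longrightarrow> f p = g p"
  have "{p \<in> fst c. g p \<in> fst d} = {p \<in> fst c. f p \<in> fst d}" if "c \<in> M" for c and d :: "('c, 'd) chart"
    using e that by (auto dest: ptsI)
  moreover have "smooth_on (snd c ` {p \<in> fst c. f p \<in> fst d}) (\<lambda>x. snd d (g (chart_inv c x)))"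
    if "c \<in> M" "d \<in> N" for c d
    by (rule smooth_on_cong[OF smooth_mapD(2)[OF f that] _ smooth_mapD(3)[OF f that]])
      (use e ptsI[OF that(1)] in \<open>auto simp: smooth_atlasD(6)[OF M that(1)]\<close>)
  moreover have "g \<in> pts M \<rightarrow> pts N" using e smooth_mapD(1)[OF f] by fastforce
  ultimately show ?thesis using smooth_mapD(2)[OF f] unfolding smooth_map_def o_def by simp
qed

text \<open>The local extensions in \<^const>\<open>smooth_map_on\<close> are maps on open submanifolds. In charts they become
  smooth functions between the model spaces, to which the calculus above applies.\<close>

lemma smooth_map_on_extension:
  assumes M: "smooth_atlas M" and f: "smooth_map_on M S N f"
    and c: "c \<in> M" "p \<in> fst c" "p \<in> S" and d: "d \<in> N" "f p \<in> fst d"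
  shows "\<exists>V G. open V \<and> snd c p \<in> V \<and> V \<subseteq> snd c ` fst c \<and> smooth_on V G \<and>
    (\<forall>q\<in>S. q \<in> fst c \<longrightarrow> snd c q \<in> V \<longrightarrow> f q \<in> fst d \<and> snd d (f q) = G (snd c q))"
proof -
  obtain W h where h: "p \<in> W" "smooth_map (open_sub M W) N h" "\<And>q. q \<in> S \<inter> W \<Longrightarrow> h q = f q"
    using f c(3) unfolding smooth_map_on_def by metis
  let ?c = "(fst c \<inter> W, snd c)"
  have c': "?c \<in> open_sub M W" using c(1) unfolding open_sub_def by auto
  let ?V = "snd c ` {q \<in> fst c \<inter> W. h q \<in> fst d}" and ?G = "\<lambda>x. snd d (h (chart_inv ?c x))"
  have inj: "inj_on (snd c) (fst c)" using smooth_atlasD(2)[OF M c(1)] .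
  have "open ?V" "smooth_on ?V ?G" using smooth_mapD(2,3)[OF h(2) c' d(1)] by auto
  moreover have "snd c p \<in> ?V" using c d h by auto
  moreover have "f q \<in> fst d \<and> snd d (f q) = ?G (snd c q)" if q: "q \<in> S" "q \<in> fst c" "snd c q \<in> ?V" for q
  proof -
    have qW: "q \<in> W" "h q \<in> fst d" using q inj by (auto dest: inj_onD)
    moreover have "chart_inv ?c (snd c q) = q"
      unfolding chart_inv_def using q(2) qW(1) inj by (simp add: inv_into_f_f inj_on_Int)
    ultimately show ?thesis using h(3)[of q] q(1) by simp
  qed
  ultimately show ?thesis by (intro exI[of _ ?V] exI[of _ ?G]) auto
qed

lemma smooth_map_comp:
  assumes M: "smooth_atlas M" and N: "smooth_atlas N" and L: "smooth_atlas L"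
    and f: "smooth_map M N f" and g: "smooth_map N L g"
  shows "smooth_map M L (\<lambda>p. g (f p))"
proof (rule smooth_map_localI[OF M L])
  fix p assume p: "p \<in> pts M"
  obtain c where c: "c \<in> M" "p \<in> fst c" using ptsE[OF p] .
  obtain d where d: "d \<in> N" "f p \<in> fst d" using ptsE[OF smooth_mapD(1)[OF f p]] .
  obtain e where e: "e \<in> L" "g (f p) \<in> fst e" using ptsE[OF smooth_mapD(1)[OF g smooth_mapD(1)[OF f p]]] .
  let ?U1 = "snd c ` {p \<in> fst c. f p \<in> fst d}" and ?T = "snd d ` {q \<in> fst d. g q \<in> fst e}"
    and ?f = "\<lambda>x. snd d (f (chart_inv c x))" and ?g = "\<lambda>x. snd e (g (chart_inv d x))"
  have fs: "open ?U1" "smooth_on ?U1 ?f" using smooth_mapD[OF f] c d by auto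
  have gs: "open ?T" "smooth_on ?T ?g" using smooth_mapD[OF g] d e by auto
  define U where "U = {x \<in> ?U1. ?f x \<in> ?T}"
  have U: "open U" unfolding U_def
    using continuous_open_preimage[OF smooth_on_continuous[OF fs(2)] fs(1) gs(1)]
    by (simp add: vimage_def Int_def)
  have inU: "\<exists>q. q \<in> fst c \<and> x = snd c q \<and> f q \<in> fst d \<and> g (f q) \<in> fst e" if x: "x \<in> U" for x
  proof -
    obtain q where q: "q \<in> fst c" "x = snd c q" "f q \<in> fst d" "snd d (f q) \<in> ?T"
      using x c(1) by (auto simp: U_def smooth_atlasD(6)[OF M])
    then have "g (f q) \<in> fst e" using smooth_atlasD(2)[OF N d(1)] by (auto dest: inj_onD)
    then show ?thesis using q by blast
  qed
  have "smooth_on U (\<lambda>x. ?g (?f x))"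
    by (rule smooth_on_compose[where f = ?f and g = ?g, OF smooth_atlasD(1)[OF N] U _ smooth_on_subset[OF fs(2)] gs(2)])
      (auto simp: U_def)
  then have "smooth_on U (\<lambda>x. snd e (g (f (chart_inv c x))))"
    by (rule smooth_on_cong[OF U, rotated])
      (use inU c d in \<open>force simp: smooth_atlasD(6)[OF M] smooth_atlasD(6)[OF N]\<close>)
  moreover have "snd c p \<in> U" using c d e by (auto simp: U_def smooth_atlasD(6)[OF M])
  moreover have "U \<subseteq> snd c ` fst c" "\<forall>x\<in>U. g (f (chart_inv c x)) \<in> fst e"
    using inU c by (auto simp: smooth_atlasD(6)[OF M] dest!: inU)
  ultimately show "\<exists>c\<in>M. \<exists>d\<in>L. \<exists>U. open U \<and> p \<in> fst c \<and> snd c p \<in> U \<and> U \<subseteq> snd c ` fst c \<and>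
      (\<forall>x\<in>U. g (f (chart_inv c x)) \<in> fst d) \<and> smooth_on U (\<lambda>x. snd d (g (f (chart_inv c x))))"
    using c e U by (intro bexI[of _ c] bexI[of _ e] exI[of _ U]) auto
qed

lemma smooth_map_on_comp:
  assumes M: "smooth_atlas M" and N: "smooth_atlas N" and L: "smooth_atlas L"
    and f: "smooth_map M N f" "\<And>p. p \<in> pts M \<Longrightarrow> f p \<in> S" and g: "smooth_map_on N S L g"
  shows "smooth_map M L (\<lambda>p. g (f p))"
proof (rule smooth_map_localI[OF M L])
  fix p assume p: "p \<in> pts M"
  obtain c where c: "c \<in> M" "p \<in> fst c" using ptsE[OF p] .
  obtain d where d: "d \<in> N" "f p \<in> fst d" using ptsE[OF smooth_mapD(1)[OF f(1) p]] .
  have "g (f p) \<in> pts L" using g f(2)[OF p] unfolding smooth_map_on_def by auto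
  then obtain e where e: "e \<in> L" "g (f p) \<in> fst e" by (rule ptsE)
  obtain V G where V: "open V" "snd d (f p) \<in> V" "V \<subseteq> snd d ` fst d" "smooth_on V G"
    "\<And>q. q\<in>S \<Longrightarrow> q \<in> fst d \<Longrightarrow> snd d q \<in> V \<Longrightarrow> g q \<in> fst e \<and> snd e (g q) = G (snd d q)"
    using smooth_map_on_extension[OF N g d f(2)[OF p] e] by blast
  let ?U1 = "snd c ` {p \<in> fst c. f p \<in> fst d}" and ?f = "\<lambda>x. snd d (f (chart_inv c x))"
  have fs: "open ?U1" "smooth_on ?U1 ?f" using smooth_mapD[OF f(1)] c d by auto
  define U where "U = {x \<in> ?U1. ?f x \<in> V}"
  have U: "open U" unfolding U_def
    using continuous_open_preimage[OF smooth_on_continuous[OF fs(2)] fs(1) V(1)]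
    by (simp add: vimage_def Int_def)
  have inU: "\<exists>q. q \<in> fst c \<and> x = snd c q \<and> f q \<in> fst d \<and> g (f q) \<in> fst e \<and> snd e (g (f q)) = G (snd d (f q))"
    if x: "x \<in> U" for x
  proof -
    obtain q where q: "q \<in> fst c" "x = snd c q" "f q \<in> fst d" "snd d (f q) \<in> V"
      using x c(1) by (auto simp: U_def smooth_atlasD(6)[OF M])
    then show ?thesis using V(5)[OF f(2)[OF ptsI[OF c(1) q(1)]]] by blast
  qed
  have "smooth_on U (\<lambda>x. G (?f x))"
    by (rule smooth_on_compose[where f = ?f and g = G, OF smooth_atlasD(1)[OF N] U _ smooth_on_subset[OF fs(2)] V(4)])
      (auto simp: U_def)
  then have "smooth_on U (\<lambda>x. snd e (g (f (chart_inv c x))))"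
    by (rule smooth_on_cong[OF U, rotated])
      (use inU c d in \<open>force simp: smooth_atlasD(6)[OF M] smooth_atlasD(6)[OF N]\<close>)
  moreover have "snd c p \<in> U" using c d V(2) by (auto simp: U_def smooth_atlasD(6)[OF M])
  moreover have "U \<subseteq> snd c ` fst c" "\<forall>x\<in>U. g (f (chart_inv c x)) \<in> fst e"
    using inU c by (auto simp: smooth_atlasD(6)[OF M] dest!: inU)
  ultimately show "\<exists>c\<in>M. \<exists>d\<in>L. \<exists>U. open U \<and> p \<in> fst c \<and> snd c p \<in> U \<and> U \<subseteq> snd c ` fst c \<and>
      (\<forall>x\<in>U. g (f (chart_inv c x)) \<in> fst d) \<and> smooth_on U (\<lambda>x. snd d (g (f (chart_inv c x))))"
    using c e U by (intro bexI[of _ c] bexI[of _ e] exI[of _ U]) auto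
qed

text \<open>For maps such as projections and partial derivatives, which have one coordinate expression on a whole
  chart domain.\<close>

lemma smooth_map_chartsI:
  assumes M: "smooth_atlas M" and N: "smooth_atlas N"
    and loc: "\<And>p. p \<in> pts M \<Longrightarrow> \<exists>c\<in>M. \<exists>d\<in>N. \<exists>G. p \<in> fst c \<and>
      (\<forall>q\<in>fst c. f q \<in> fst d \<and> snd d (f q) = G (snd c q)) \<and> smooth_on (snd c ` fst c) G"
  shows "smooth_map M N f"
proof (rule smooth_map_localI[OF M N])
  fix p assume "p \<in> pts M"
  then obtain c d G where c: "c \<in> M" "d \<in> N" "p \<in> fst c"
      "\<And>q. q\<in>fst c \<Longrightarrow> f q \<in> fst d \<and> snd d (f q) = G (snd c q)" "smooth_on (snd c ` fst c) G"
    using loc by blast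
  have o: "open (snd c ` fst c)" using smooth_atlasD(5)[OF M c(1)] .
  have "smooth_on (snd c ` fst c) (\<lambda>x. snd d (f (chart_inv c x)))"
    by (rule smooth_on_cong[OF o _ c(5)]) (use c in \<open>auto simp: smooth_atlasD(6)[OF M]\<close>)
  then show "\<exists>c\<in>M. \<exists>d\<in>N. \<exists>U. open U \<and> p \<in> fst c \<and> snd c p \<in> U \<and> U \<subseteq> snd c ` fst c \<and>
      (\<forall>x\<in>U. f (chart_inv c x) \<in> fst d) \<and> smooth_on U (\<lambda>x. snd d (f (chart_inv c x)))"
    using c o by (intro bexI[of _ c] bexI[of _ d] exI[of _ "snd c ` fst c"])
      (auto simp: smooth_atlasD(6)[OF M])
qed

lemma smooth_map_ident: "smooth_atlas M \<Longrightarrow> smooth_map M M (\<lambda>p. p)"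
  by (rule smooth_map_chartsI)
    (auto elim!: ptsE intro!: bexI smooth_on_bounded_linear smooth_atlasD(5) exI[of _ "\<lambda>x. x"])

lemma smooth_map_const: "smooth_atlas M \<Longrightarrow> smooth_atlas N \<Longrightarrow> q \<in> pts N \<Longrightarrow> smooth_map M N (\<lambda>p. q)"
proof (rule smooth_map_chartsI)
  fix p assume a: "smooth_atlas M" "smooth_atlas N" "q \<in> pts N" "p \<in> pts M"
  obtain c where c: "c \<in> M" "p \<in> fst c" using ptsE[OF a(4)] .
  obtain d where d: "d \<in> N" "q \<in> fst d" using ptsE[OF a(3)] .
  show "\<exists>c\<in>M. \<exists>d\<in>N. \<exists>G. p \<in> fst c \<and> (\<forall>q'\<in>fst c. q \<in> fst d \<and> snd d q = G (snd c q')) \<and>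
      smooth_on (snd c ` fst c) G"
    using c d smooth_on_const[OF smooth_atlasD(5)[OF a(1) c(1)]]
    by (intro bexI[of _ c] bexI[of _ d] exI[of _ "\<lambda>x. snd d q"]) auto
qed

subsection \<open>Products\<close>

lemma prod_atlasE:
  assumes "e \<in> prod_atlas M N"
  obtains c d where "c \<in> M" "d \<in> N" "fst e = fst c \<times> fst d" "snd e = map_prod (snd c) (snd d)"
  using assms unfolding prod_atlas_def by auto

lemma prod_atlasI: "c \<in> M \<Longrightarrow> d \<in> N \<Longrightarrow> (fst c \<times> fst d, map_prod (snd c) (snd d)) \<in> prod_atlas M N"
  unfolding prod_atlas_def by blast

lemma pts_prod_atlas [simp]: "pts (prod_atlas M N) = pts M \<times> pts N"
proof (rule equalityI; rule subsetI)
  fix z assume "z \<in> pts (prod_atlas M N)"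
  then obtain e where "e \<in> prod_atlas M N" "z \<in> fst e" by (rule ptsE)
  then show "z \<in> pts M \<times> pts N" by (elim prod_atlasE) (auto intro: ptsI)
next
  fix z assume "z \<in> pts M \<times> pts N"
  then obtain c d where "c \<in> M" "fst z \<in> fst c" "d \<in> N" "snd z \<in> fst d" by (auto elim!: ptsE)
  then show "z \<in> pts (prod_atlas M N)" using ptsI[OF prod_atlasI, of c M d N z] by (simp add: mem_Times_iff)
qed

lemma smooth_atlas_prod:
  fixes M :: "('a, 'e::real_inner) atlas" and N :: "('b, 'f::real_inner) atlas"
  assumes M: "smooth_atlas M" and N: "smooth_atlas N"
  shows "smooth_atlas (prod_atlas M N)"
  unfolding smooth_atlas_def
proof (intro conjI ballI)
  show "fin_dim TYPE('e \<times> 'f)" by (rule fin_dim_prod[OF smooth_atlasD(1)[OF M] smooth_atlasD(1)[OF N]])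
  show "inj_on (snd e) (fst e)" if e: "e \<in> prod_atlas M N" for e
  proof -
    obtain c d where "c \<in> M" "d \<in> N" "fst e = fst c \<times> fst d" "snd e = map_prod (snd c) (snd d)"
      using prod_atlasE[OF e] .
    then show ?thesis using smooth_atlasD(2)[OF M] smooth_atlasD(2)[OF N] by (simp add: map_prod_inj_on)
  qed
  fix e e' assume "e \<in> prod_atlas M N" "e' \<in> prod_atlas M N"
  then obtain c d c' d' where c: "c \<in> M" "d \<in> N" "c' \<in> M" "d' \<in> N"
    and e: "fst e = fst c \<times> fst d" "snd e = map_prod (snd c) (snd d)"
      "fst e' = fst c' \<times> fst d'" "snd e' = map_prod (snd c') (snd d')"
    by (metis prod_atlasE)
  let ?A = "snd c ` (fst c \<inter> fst c')" and ?B = "snd d ` (fst d \<inter> fst d')"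
  have im: "snd e ` (fst e \<inter> fst e') = ?A \<times> ?B" by (auto simp: e map_prod_def)
  have o: "open (?A \<times> ?B)" by (intro open_Times smooth_atlasD(3)[OF M c(1,3)] smooth_atlasD(3)[OF N c(2,4)])
  then show "open (snd e ` (fst e \<inter> fst e'))" by (simp only: im)
  have "inj_on (snd e) (fst e)"
    using c smooth_atlasD(2)[OF M] smooth_atlasD(2)[OF N] by (simp add: map_prod_inj_on e)
  then have inv: "chart_inv e (snd c p, snd d q) = (p, q)" if "p \<in> fst c" "q \<in> fst d" for p q
    using inv_into_f_f[of "snd e" "fst e" "(p, q)"] that by (simp add: chart_inv_def e)
  let ?f = "\<lambda>x. snd c' (chart_inv c x)" and ?g = "\<lambda>x. snd d' (chart_inv d x)"
  have "smooth_on (?A \<times> ?B) (\<lambda>z. ?f (fst z))"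
    by (rule smooth_on_compose[where f = fst and g = ?f, OF smooth_atlasD(1)[OF M] o _
          smooth_on_bounded_linear[OF o bounded_linear_fst] smooth_atlasD(4)[OF M c(1,3)]]) auto
  moreover have "smooth_on (?A \<times> ?B) (\<lambda>z. ?g (snd z))"
    by (rule smooth_on_compose[where f = snd and g = ?g, OF smooth_atlasD(1)[OF N] o _
          smooth_on_bounded_linear[OF o bounded_linear_snd] smooth_atlasD(4)[OF N c(2,4)]]) auto
  ultimately have "smooth_on (?A \<times> ?B) (\<lambda>z. (?f (fst z), ?g (snd z)))" by (rule smooth_on_Pair[OF o])
  then have "smooth_on (?A \<times> ?B) (snd e' \<circ> chart_inv e)"
    by (rule smooth_on_cong[OF o, rotated])
      (use c in \<open>auto simp: inv e smooth_atlasD(6)[OF M] smooth_atlasD(6)[OF N]\<close>)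
  then show "smooth_on (snd e ` (fst e \<inter> fst e')) (snd e' \<circ> chart_inv e)" by (simp only: im)
qed

lemma smooth_map_fst: 
  assumes "smooth_atlas M" "smooth_atlas N" shows "smooth_map (prod_atlas M N) M fst"
proof (rule smooth_map_chartsI[OF smooth_atlas_prod[OF assms] assms(1)])
  fix p assume "p \<in> pts (prod_atlas M N)"
  then obtain c d where c: "c \<in> M" "d \<in> N" "fst p \<in> fst c" "snd p \<in> fst d" by (auto elim!: ptsE)
  have "open (snd c ` fst c \<times> snd d ` fst d)" by (intro open_Times smooth_atlasD(5)[OF assms(1) c(1)] smooth_atlasD(5)[OF assms(2) c(2)])
  moreover have "map_prod (snd c) (snd d) ` (fst c \<times> fst d) = snd c ` fst c \<times> snd d ` fst d" by force
  ultimately have "smooth_on (map_prod (snd c) (snd d) ` (fst c \<times> fst d)) fst"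
    by (simp add: smooth_on_bounded_linear bounded_linear_fst)
  then show "\<exists>c\<in>prod_atlas M N. \<exists>d\<in>M. \<exists>G. p \<in> fst c \<and>
      (\<forall>q\<in>fst c. fst q \<in> fst d \<and> snd d (fst q) = G (snd c q)) \<and> smooth_on (snd c ` fst c) G"
    using c by (intro bexI[OF _ prod_atlasI[OF c(1,2)]] bexI[of _ c] exI[of _ fst]) (auto simp: mem_Times_iff)
qed

lemma smooth_map_snd: 
  assumes "smooth_atlas M" "smooth_atlas N" shows "smooth_map (prod_atlas M N) N snd"
proof (rule smooth_map_chartsI[OF smooth_atlas_prod[OF assms] assms(2)])
  fix p assume "p \<in> pts (prod_atlas M N)"
  then obtain c d where c: "c \<in> M" "d \<in> N" "fst p \<in> fst c" "snd p \<in> fst d" by (auto elim!: ptsE)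
  have "open (snd c ` fst c \<times> snd d ` fst d)" by (intro open_Times smooth_atlasD(5)[OF assms(1) c(1)] smooth_atlasD(5)[OF assms(2) c(2)])
  moreover have "map_prod (snd c) (snd d) ` (fst c \<times> fst d) = snd c ` fst c \<times> snd d ` fst d" by force
  ultimately have "smooth_on (map_prod (snd c) (snd d) ` (fst c \<times> fst d)) snd"
    by (simp add: smooth_on_bounded_linear bounded_linear_snd)
  then show "\<exists>c\<in>prod_atlas M N. \<exists>d\<in>N. \<exists>G. p \<in> fst c \<and>
      (\<forall>q\<in>fst c. snd q \<in> fst d \<and> snd d (snd q) = G (snd c q)) \<and> smooth_on (snd c ` fst c) G"
    using c by (intro bexI[OF _ prod_atlasI[OF c(1,2)]] bexI[of _ d] exI[of _ snd]) (auto simp: mem_Times_iff)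
qed

lemma smooth_map_Pair:
  assumes L: "smooth_atlas L" and M: "smooth_atlas M" and N: "smooth_atlas N"
    and f: "smooth_map L M f" and g: "smooth_map L N g"
  shows "smooth_map L (prod_atlas M N) (\<lambda>p. (f p, g p))"
proof (rule smooth_map_localI[OF L smooth_atlas_prod[OF M N]])
  fix p assume p: "p \<in> pts L"
  obtain b where b: "b \<in> L" "p \<in> fst b" using ptsE[OF p] .
  obtain c where c: "c \<in> M" "f p \<in> fst c" using ptsE[OF smooth_mapD(1)[OF f p]] .
  obtain d where d: "d \<in> N" "g p \<in> fst d" using ptsE[OF smooth_mapD(1)[OF g p]] .
  let ?A = "snd b ` {p \<in> fst b. f p \<in> fst c}" and ?B = "snd b ` {p \<in> fst b. g p \<in> fst d}"
  have o: "open (?A \<inter> ?B)" by (intro open_Int smooth_mapD(2)[OF f b(1) c(1)] smooth_mapD(2)[OF g b(1) d(1)])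
  have "smooth_on (?A \<inter> ?B) (\<lambda>x. snd c (f (chart_inv b x)))" "smooth_on (?A \<inter> ?B) (\<lambda>x. snd d (g (chart_inv b x)))"
    using smooth_mapD(3)[OF f b(1) c(1)] smooth_mapD(3)[OF g b(1) d(1)] by (auto elim: smooth_on_subset)
  then have "smooth_on (?A \<inter> ?B) (\<lambda>x. map_prod (snd c) (snd d) (f (chart_inv b x), g (chart_inv b x)))"
    unfolding map_prod_simp by (rule smooth_on_Pair[OF o])
  moreover have "?A \<inter> ?B = snd b ` ({p \<in> fst b. f p \<in> fst c} \<inter> {p \<in> fst b. g p \<in> fst d})"
    by (rule inj_on_image_Int[symmetric, OF smooth_atlasD(2)[OF L b(1)]]) auto
  ultimately show "\<exists>ca\<in>L. \<exists>d\<in>prod_atlas M N. \<exists>U. open U \<and> p \<in> fst ca \<and> snd ca p \<in> U \<and> U \<subseteq> snd ca ` fst ca \<and>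
      (\<forall>x\<in>U. (f (chart_inv ca x), g (chart_inv ca x)) \<in> fst d) \<and>
      smooth_on U (\<lambda>x. snd d (f (chart_inv ca x), g (chart_inv ca x)))"
    using b c d o by (intro bexI[of _ b] bexI[OF _ prod_atlasI[OF c(1) d(1)]] exI[of _ "?A \<inter> ?B"])
      (auto simp: smooth_atlasD(6)[OF L b(1)])
qed

lemma smooth_map_Pair_comp:
  assumes "smooth_atlas L" "smooth_atlas M" "smooth_atlas N" "smooth_atlas Q"
    and "smooth_map (prod_atlas M N) Q (\<lambda>(x, y). F x y)" "smooth_map L M f" "smooth_map L N g"
  shows "smooth_map L Q (\<lambda>p. F (f p) (g p))"
  using smooth_map_comp[OF assms(1) smooth_atlas_prod[OF assms(2,3)] assms(4) smooth_map_Pair[OF assms(1-3,6,7)] assms(5)]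
  by simp

section \<open>Tangent vectors as velocities of curves\<close>

text \<open>The tangent vector at \<^term>\<open>p\<close> with coordinate vector \<^term>\<open>v\<close> in the chart \<^term>\<open>c\<close>.\<close>

definition tvec :: "('a, 'e::real_inner) atlas \<Rightarrow> ('a, 'e) chart \<Rightarrow> 'a \<Rightarrow> 'e \<Rightarrow> ('a, 'e) chart \<Rightarrow> 'e" where
  "tvec M c p v = (\<lambda>d. if d \<in> M \<and> p \<in> fst d
     then frechet_derivative (\<lambda>x. snd d (chart_inv c x)) (at (snd c p)) v else 0)"

lemma tangent_spaceI:
  assumes "\<And>c. \<not> (c \<in> M \<and> p \<in> fst c) \<Longrightarrow> \<xi> c = 0"
    and "\<And>c d. c \<in> M \<Longrightarrow> d \<in> M \<Longrightarrow> p \<in> fst c \<Longrightarrow> p \<in> fst d \<Longrightarrow>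
      \<xi> d = frechet_derivative (\<lambda>x. snd d (chart_inv c x)) (at (snd c p)) (\<xi> c)"
  shows "\<xi> \<in> tangent_space M p"
  unfolding tangent_space_def o_def
proof (intro CollectI conjI allI ballI impI)
  fix c assume "\<not> (c \<in> M \<and> p \<in> fst c)" then show "\<xi> c = 0" by (rule assms(1))
next
  fix c d assume "c \<in> M" "d \<in> M" "p \<in> fst c \<and> p \<in> fst d"
  then show "\<xi> d = frechet_derivative (\<lambda>x. snd d (chart_inv c x)) (at (snd c p)) (\<xi> c)"
    by (elim conjE) (rule assms(2))
qed

lemma tangent_spaceD:
  assumes "\<xi> \<in> tangent_space M p"
  shows "\<not> (c \<in> M \<and> p \<in> fst c) \<Longrightarrow> \<xi> c = 0"
    "c \<in> M \<Longrightarrow> d \<in> M \<Longrightarrow> p \<in> fst c \<Longrightarrow> p \<in> fst d \<Longrightarrow>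
      \<xi> d = frechet_derivative (\<lambda>x. snd d (chart_inv c x)) (at (snd c p)) (\<xi> c)"
proof -
  show "\<xi> c = 0" if "\<not> (c \<in> M \<and> p \<in> fst c)"
  proof -
    have "\<forall>c. \<not> (c \<in> M \<and> p \<in> fst c) \<longrightarrow> \<xi> c = 0"
      using assms unfolding tangent_space_def by (elim CollectE conjE)
    then show ?thesis using that by blast
  qed
  show "\<xi> d = frechet_derivative (\<lambda>x. snd d (chart_inv c x)) (at (snd c p)) (\<xi> c)"
    if c: "c \<in> M" "d \<in> M" "p \<in> fst c" "p \<in> fst d"
  proof -
    have "\<forall>c\<in>M. \<forall>d\<in>M. p \<in> fst c \<and> p \<in> fst d \<longrightarrow>
        \<xi> d = frechet_derivative (\<lambda>x. snd d (chart_inv c x)) (at (snd c p)) (\<xi> c)"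
      using assms unfolding tangent_space_def o_def by (elim CollectE conjE)
    then show ?thesis using c by blast
  qed
qed

lemma tangent_space_tvec:
  assumes "\<xi> \<in> tangent_space M p" "c \<in> M" "p \<in> fst c"
  shows "\<xi> = tvec M c p (\<xi> c)"
proof
  fix d show "\<xi> d = tvec M c p (\<xi> c) d"
  proof (cases "d \<in> M \<and> p \<in> fst d")
    case True
    then show ?thesis using tangent_spaceD(2)[OF assms(1,2) _ assms(3), of d] by (simp add: tvec_def)
  next
    case False
    have "tvec M c p (\<xi> c) d = 0" unfolding tvec_def using False by (rule if_not_P)
    then show ?thesis using tangent_spaceD(1)[OF assms(1) False] by simp
  qed
qed

lemma tangent_space_eqI:
  assumes "\<xi> \<in> tangent_space M p" "\<zeta> \<in> tangent_space M p" "c \<in> M" "p \<in> fst c" "\<xi> c = \<zeta> c"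
  shows "\<xi> = \<zeta>"
  using tangent_space_tvec[OF assms(1,3,4)] tangent_space_tvec[OF assms(2,3,4)] assms(5) by simp

lemma has_vector_derivative_cong_ev:
  assumes "(f has_vector_derivative w) (at x)" "\<forall>\<^sub>F t in nhds x. f t = g t"
  shows "(g has_vector_derivative w) (at x)"
  using assms has_derivative_transform_eventually[of f _ x UNIV g]
  unfolding has_vector_derivative_def eventually_nhds_conv_at by simp

text \<open>The chain rule for a curve and a map with coordinate expression \<^term>\<open>G\<close>. The set \<^term>\<open>S\<close>
  accommodates maps that are smooth along a subset only, such as the composition of arrows, which is
  defined on composable pairs.\<close>

lemma curve_through_coordinates:
  fixes G :: "'e::real_inner \<Rightarrow> 'f::real_inner"
  assumes V: "open V" "snd c (\<gamma> 0) \<in> V" "smooth_on V G"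
    and G: "\<And>q. q \<in> S \<Longrightarrow> q \<in> fst c \<Longrightarrow> snd c q \<in> V \<Longrightarrow> f q \<in> fst d \<and> snd d (f q) = G (snd c q)"
    and \<gamma>: "\<forall>\<^sub>F t in nhds (0::real). \<gamma> t \<in> S" "\<forall>\<^sub>F t in nhds (0::real). \<gamma> t \<in> fst c"
      "((\<lambda>t. snd c (\<gamma> t)) has_vector_derivative w) (at 0)"
  shows "\<forall>\<^sub>F t in nhds 0. f (\<gamma> t) \<in> fst d"
    "((\<lambda>t. snd d (f (\<gamma> t))) has_vector_derivative frechet_derivative G (at (snd c (\<gamma> 0))) w) (at 0)"
proof -
  have "continuous (at 0) (\<lambda>t. snd c (\<gamma> t))" using \<gamma>(3) has_vector_derivative_continuous by blast
  then have "((\<lambda>t. snd c (\<gamma> t)) \<longlongrightarrow> snd c (\<gamma> 0)) (nhds 0)"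
    using tendsto_at_iff_tendsto_nhds[of "\<lambda>t. snd c (\<gamma> t)" 0] by (simp add: continuous_at)
  then have "\<forall>\<^sub>F t in nhds 0. snd c (\<gamma> t) \<in> V" using V topological_tendstoD by blast
  then have ev: "\<forall>\<^sub>F t in nhds 0. f (\<gamma> t) \<in> fst d \<and> snd d (f (\<gamma> t)) = G (snd c (\<gamma> t))"
    using \<gamma>(1,2) by eventually_elim (use G in blast)
  then show "\<forall>\<^sub>F t in nhds 0. f (\<gamma> t) \<in> fst d" by eventually_elim simp
  let ?D = "frechet_derivative G (at (snd c (\<gamma> 0)))"
  have D: "(G has_derivative ?D) (at (snd c (\<gamma> 0)))" using smooth_on_has_derivative[OF V(3,2)] .
  have "((\<lambda>t. G (snd c (\<gamma> t))) has_derivative (\<lambda>t. ?D (t *\<^sub>R w))) (at 0)"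
    using has_derivative_compose[OF \<gamma>(3)[unfolded has_vector_derivative_def] D] .
  then have "((\<lambda>t. G (snd c (\<gamma> t))) has_vector_derivative ?D w) (at 0)"
    unfolding has_vector_derivative_def by (simp add: linear_scale[OF has_derivative_linear[OF D]])
  moreover have "\<forall>\<^sub>F t in nhds 0. G (snd c (\<gamma> t)) = snd d (f (\<gamma> t))" using ev by eventually_elim simp
  ultimately show "((\<lambda>t. snd d (f (\<gamma> t))) has_vector_derivative ?D w) (at 0)"
    by (rule has_vector_derivative_cong_ev)
qed

lemma curve_chart_change:
  assumes M: "smooth_atlas M" and c: "c \<in> M" "\<gamma> 0 \<in> fst c" and d: "d \<in> M" "\<gamma> 0 \<in> fst d"
    and \<gamma>: "\<forall>\<^sub>F t in nhds (0::real). \<gamma> t \<in> fst c" "((\<lambda>t. snd c (\<gamma> t)) has_vector_derivative w) (at 0)"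
  shows "\<forall>\<^sub>F t in nhds 0. \<gamma> t \<in> fst d"
    "((\<lambda>t. snd d (\<gamma> t)) has_vector_derivative tvec M c (\<gamma> 0) w d) (at 0)"
proof -
  let ?V = "snd c ` (fst c \<inter> fst d)"
  have V: "open ?V" "snd c (\<gamma> 0) \<in> ?V" "smooth_on ?V (\<lambda>x. snd d (chart_inv c x))"
    using smooth_atlasD(3,4)[OF M c(1) d(1)] c d by auto
  have G: "q \<in> fst d \<and> snd d q = snd d (chart_inv c (snd c q))"
    if "q \<in> UNIV" "q \<in> fst c" "snd c q \<in> ?V" for q
    using that smooth_atlasD(2)[OF M c(1)] smooth_atlasD(6)[OF M c(1)] by (auto dest: inj_onD)
  show "\<forall>\<^sub>F t in nhds 0. \<gamma> t \<in> fst d"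
    "((\<lambda>t. snd d (\<gamma> t)) has_vector_derivative tvec M c (\<gamma> 0) w d) (at 0)"
    using curve_through_coordinates[where \<gamma> = \<gamma> and f = "\<lambda>q. q" and d = d and S = UNIV, OF V G _ \<gamma>] d
    by (simp_all add: tvec_def)
qed

lemma tvec_curve:
  assumes M: "smooth_atlas M" and c: "c \<in> M" "\<gamma> 0 \<in> fst c"
    and \<gamma>: "\<forall>\<^sub>F t in nhds (0::real). \<gamma> t \<in> fst c" "((\<lambda>t. snd c (\<gamma> t)) has_vector_derivative w) (at 0)"
  shows "tvec M c (\<gamma> 0) w \<in> tangent_space M (\<gamma> 0)" "tvec M c (\<gamma> 0) w c = w"
    "has_velocity M \<gamma> (\<gamma> 0, tvec M c (\<gamma> 0) w)"
proof -
  show w: "tvec M c (\<gamma> 0) w c = w"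
    by (rule vector_derivative_unique_at[OF curve_chart_change(2)[OF M c c \<gamma>] \<gamma>(2)])
  have ev: "\<forall>\<^sub>F t in nhds 0. \<gamma> t \<in> fst d" "((\<lambda>t. snd d (\<gamma> t)) has_vector_derivative tvec M c (\<gamma> 0) w d) (at 0)"
    if "d \<in> M" "\<gamma> 0 \<in> fst d" for d
    using curve_chart_change[OF M c that \<gamma>] by auto
  show *: "tvec M c (\<gamma> 0) w \<in> tangent_space M (\<gamma> 0)"
  proof (rule tangent_spaceI)
    show "tvec M c (\<gamma> 0) w d = 0" if "\<not> (d \<in> M \<and> \<gamma> 0 \<in> fst d)" for d
      using that unfolding tvec_def by (rule if_not_P)
    fix d e assume d: "d \<in> M" "e \<in> M" "\<gamma> 0 \<in> fst d" "\<gamma> 0 \<in> fst e"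
    have "tvec M c (\<gamma> 0) w e = tvec M d (\<gamma> 0) (tvec M c (\<gamma> 0) w d) e"
      by (rule vector_derivative_unique_at[OF ev(2)[OF d(2,4)]
            curve_chart_change(2)[OF M d(1,3,2,4) ev[OF d(1,3)]]])
    then show "tvec M c (\<gamma> 0) w e =
        frechet_derivative (\<lambda>x. snd e (chart_inv d x)) (at (snd d (\<gamma> 0))) (tvec M c (\<gamma> 0) w d)"
      unfolding tvec_def[of M d] using d by simp
  qed
  show "has_velocity M \<gamma> (\<gamma> 0, tvec M c (\<gamma> 0) w)"
    unfolding has_velocity_def
  proof (intro conjI ballI impI)
    show "(\<gamma> 0, tvec M c (\<gamma> 0) w) \<in> pts (tangent_bundle M)"
      using * c unfolding pts_def tangent_bundle_def by auto
  qed (use ev in auto)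
qed

lemma line_curve:
  assumes M: "smooth_atlas M" and c: "c \<in> M" "p \<in> fst c"
  obtains \<gamma> where "\<gamma> 0 = p" "\<forall>\<^sub>F t in nhds (0::real). \<gamma> t \<in> fst c"
    "((\<lambda>t. snd c (\<gamma> t)) has_vector_derivative w) (at 0)"
proof -
  let ?\<gamma> = "\<lambda>t::real. chart_inv c (snd c p + t *\<^sub>R w)"
  have "((\<lambda>t. snd c p + t *\<^sub>R w) \<longlongrightarrow> snd c p) (nhds 0)"
    by (auto intro!: tendsto_eq_intros filterlim_ident)
  moreover have "snd c p \<in> snd c ` fst c" using c by simp
  ultimately have "\<forall>\<^sub>F t in nhds 0. snd c p + t *\<^sub>R w \<in> snd c ` fst c"
    using smooth_atlasD(5)[OF M c(1)] topological_tendstoD by blast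
  then have ev: "\<forall>\<^sub>F t in nhds 0. ?\<gamma> t \<in> fst c \<and> snd c p + t *\<^sub>R w = snd c (?\<gamma> t)"
    by eventually_elim (auto simp: smooth_atlasD(6)[OF M c(1)])
  have "((\<lambda>t. snd c p + t *\<^sub>R w) has_vector_derivative w) (at 0)"
    by (auto intro!: derivative_eq_intros)
  moreover have "\<forall>\<^sub>F t in nhds 0. snd c p + t *\<^sub>R w = snd c (?\<gamma> t)" using ev by eventually_elim simp
  ultimately have "((\<lambda>t. snd c (?\<gamma> t)) has_vector_derivative w) (at 0)"
    by (rule has_vector_derivative_cong_ev)
  moreover have "\<forall>\<^sub>F t in nhds 0. ?\<gamma> t \<in> fst c" using ev by eventually_elim simp
  moreover have "?\<gamma> 0 = p" using smooth_atlasD(6)[OF M c] by simp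
  ultimately show ?thesis by (intro that[of ?\<gamma>])
qed

lemma tvec:
  assumes "smooth_atlas M" "c \<in> M" "p \<in> fst c"
  shows "tvec M c p w \<in> tangent_space M p" "tvec M c p w c = w"
proof -
  obtain \<gamma> where "\<gamma> 0 = p" "\<forall>\<^sub>F t in nhds (0::real). \<gamma> t \<in> fst c"
    "((\<lambda>t. snd c (\<gamma> t)) has_vector_derivative w) (at 0)" using line_curve[OF assms] .
  then show "tvec M c p w \<in> tangent_space M p" "tvec M c p w c = w"
    using tvec_curve(1,2)[OF assms(1,2), of \<gamma> w] assms(3) by simp_all
qed

lemma pts_tangent_bundle: "(p, \<xi>) \<in> pts (tangent_bundle M) \<longleftrightarrow> p \<in> pts M \<and> \<xi> \<in> tangent_space M p"
  unfolding pts_def tangent_bundle_def by auto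

lemma mem_tangent_bundle: "v \<in> pts (tangent_bundle M) \<longleftrightarrow> fst v \<in> pts M \<and> snd v \<in> tangent_space M (fst v)"
  using pts_tangent_bundle[of "fst v" "snd v" M] by simp

lemma tangent_space_subspace:
  assumes M: "smooth_atlas M" and p: "p \<in> pts M"
  shows "subspace (tangent_space M p)"
proof -
  obtain c where c: "c \<in> M" "p \<in> fst c" using p by (rule ptsE)
  have l: "linear (frechet_derivative (\<lambda>x. snd d (chart_inv c x)) (at (snd c p)))"
    if "d \<in> M" "p \<in> fst d" for d
    using smooth_on_differentiable[OF smooth_atlasD(4)[OF M c(1) that(1)], of "snd c p"] that c
    by (intro linear_frechet_derivative) auto
  have tv: "tvec M c p v d = (if d \<in> M \<and> p \<in> fst d
      then frechet_derivative (\<lambda>x. snd d (chart_inv c x)) (at (snd c p)) v else 0)" for v d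
    by (simp only: tvec_def)
  have "(tvec M c p v + tvec M c p w) d = tvec M c p (v + w) d \<and> (a *\<^sub>R tvec M c p v) d = tvec M c p (a *\<^sub>R v) d \<and>
    0 = tvec M c p 0 d" for v w a d
  proof (cases "d \<in> M \<and> p \<in> fst d")
    case True
    then have "linear (frechet_derivative (\<lambda>x. snd d (chart_inv c x)) (at (snd c p)))" by (intro l) simp_all
    then show ?thesis
      unfolding tv plus_fun_apply scaleR_fun_def if_P[OF True] by (simp add: linear_add linear_scale linear_0)
  next
    case False
    show ?thesis unfolding tv plus_fun_apply scaleR_fun_def if_not_P[OF False] by simp
  qed
  then have "tvec M c p v + tvec M c p w = tvec M c p (v + w)" "a *\<^sub>R tvec M c p v = tvec M c p (a *\<^sub>R v)"
    "0 = tvec M c p 0" for v w a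
    by (simp_all only: fun_eq_iff zero_fun_apply simp_thms)
  moreover have "tangent_space M p = range (tvec M c p)"
    using tangent_space_tvec[OF _ c] tvec(1)[OF M c] by blast
  ultimately show ?thesis unfolding subspace_def by (auto simp only: ball_simps rangeI)
qed

subsection \<open>Velocities\<close>

lemma velocity_pts: "has_velocity M \<gamma> v \<Longrightarrow> v \<in> pts (tangent_bundle M)"
  unfolding has_velocity_def by simp

lemma velocity_pts_split: "has_velocity M \<gamma> (p, \<xi>) \<Longrightarrow> p \<in> pts M \<and> \<xi> \<in> tangent_space M p \<and> \<gamma> 0 = p"
  unfolding has_velocity_def pts_tangent_bundle by simp

lemma velocity_base: "has_velocity M \<gamma> v \<Longrightarrow> \<gamma> 0 = fst v"
  unfolding has_velocity_def by simp

lemma velocity_eventually: 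
  assumes "has_velocity M \<gamma> v" shows "\<forall>\<^sub>F t in nhds 0. \<gamma> t \<in> pts M"
proof -
  have "fst v \<in> pts M" using velocity_pts[OF assms] by (simp add: mem_tangent_bundle)
  then obtain c where "c \<in> M" "fst v \<in> fst c" by (rule ptsE)
  moreover from this have "\<forall>\<^sub>F t in nhds 0. \<gamma> t \<in> fst c" using assms unfolding has_velocity_def by blast
  ultimately show ?thesis by (auto elim: eventually_mono intro: ptsI)
qed

lemma velocity_unique: 
  assumes "has_velocity M \<gamma> v" "has_velocity M \<gamma> w" shows "v = w"
proof (rule prod_eqI)
  show f: "fst v = fst w" using assms unfolding has_velocity_def by simp
  have v: "snd v \<in> tangent_space M (fst v)" and w: "snd w \<in> tangent_space M (fst v)"
    using assms f by (simp_all add: has_velocity_def mem_tangent_bundle)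
  show "snd v = snd w"
  proof
    fix d show "snd v d = snd w d"
    proof (cases "d \<in> M \<and> fst v \<in> fst d")
      case True
      then have "((\<lambda>t. snd d (\<gamma> t)) has_vector_derivative snd v d) (at 0)"
        "((\<lambda>t. snd d (\<gamma> t)) has_vector_derivative snd w d) (at 0)"
        using assms f unfolding has_velocity_def by simp_all
      then show ?thesis by (rule vector_derivative_unique_at)
    qed (simp add: tangent_spaceD(1)[OF v] tangent_spaceD(1)[OF w])
  qed
qed

lemma velocity_cong:
  assumes "has_velocity M \<gamma> v" "\<forall>\<^sub>F t in nhds 0. \<gamma> t = \<mu> t"
  shows "has_velocity M \<mu> v"
proof -
  have "\<forall>\<^sub>F t in nhds 0. \<mu> t \<in> fst c" "((\<lambda>t. snd c (\<mu> t)) has_vector_derivative snd v c) (at 0)"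
    if c: "c \<in> M" "fst v \<in> fst c" for c
  proof -
    have ev: "\<forall>\<^sub>F t in nhds 0. \<gamma> t \<in> fst c" "((\<lambda>t. snd c (\<gamma> t)) has_vector_derivative snd v c) (at 0)"
      using assms(1) c unfolding has_velocity_def by auto
    show "\<forall>\<^sub>F t in nhds 0. \<mu> t \<in> fst c" using ev(1) assms(2) by eventually_elim simp
    have "\<forall>\<^sub>F t in nhds 0. snd c (\<gamma> t) = snd c (\<mu> t)" using assms(2) by eventually_elim simp
    then show "((\<lambda>t. snd c (\<mu> t)) has_vector_derivative snd v c) (at 0)"
      by (rule has_vector_derivative_cong_ev[OF ev(2)])
  qed
  then show ?thesis using assms eventually_nhds_x_imp_x[OF assms(2)] unfolding has_velocity_def by auto
qed

text \<open>Realized by straight lines in a chart. Hence equations between tangent vectors may be tested on curves.\<close>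

lemma velocity_exists:
  assumes M: "smooth_atlas M" and v: "v \<in> pts (tangent_bundle M)"
  obtains \<gamma> where "has_velocity M \<gamma> v"
proof -
  have v': "fst v \<in> pts M" "snd v \<in> tangent_space M (fst v)"
    using v by (simp_all add: mem_tangent_bundle)
  obtain c where c: "c \<in> M" "fst v \<in> fst c" using v'(1) by (rule ptsE)
  obtain \<gamma> where \<gamma>: "\<gamma> 0 = fst v" "\<forall>\<^sub>F t in nhds (0::real). \<gamma> t \<in> fst c"
    "((\<lambda>t. snd c (\<gamma> t)) has_vector_derivative snd v c) (at 0)" using line_curve[OF M c] .
  have "has_velocity M \<gamma> (\<gamma> 0, tvec M c (\<gamma> 0) (snd v c))"
    by (rule tvec_curve(3)[OF M c(1) _ \<gamma>(2,3)]) (simp add: \<gamma>(1) c)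
  then show ?thesis using that \<gamma>(1) tangent_space_tvec[OF v'(2) c] by simp
qed

text \<open>Both smooth maps and maps that are smooth on a subset transform velocities by the derivative of
  any coordinate expression.\<close>

lemma velocity_along:
  assumes M: "smooth_atlas M" and N: "smooth_atlas N" and \<gamma>: "has_velocity M \<gamma> (p, \<xi>)"
    and c: "c \<in> M" "p \<in> fst c" and d: "d \<in> N" "f p \<in> fst d"
    and V: "open V" "snd c p \<in> V" "smooth_on V G"
    and G: "\<And>q. q \<in> S \<Longrightarrow> q \<in> fst c \<Longrightarrow> snd c q \<in> V \<Longrightarrow> f q \<in> fst d \<and> snd d (f q) = G (snd c q)"
    and S: "\<forall>\<^sub>F t in nhds 0. \<gamma> t \<in> S"
  shows "has_velocity N (\<lambda>t. f (\<gamma> t)) (f p, tvec N d (f p) (frechet_derivative G (at (snd c p)) (\<xi> c)))"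
proof -
  have "\<gamma> 0 = p" "\<forall>\<^sub>F t in nhds 0. \<gamma> t \<in> fst c" "((\<lambda>t. snd c (\<gamma> t)) has_vector_derivative \<xi> c) (at 0)"
    using \<gamma> c unfolding has_velocity_def by auto
  then show ?thesis
    using curve_through_coordinates[where f = f and d = d and \<gamma> = \<gamma>, OF V(1) _ V(3) G S]
      tvec_curve(3)[OF N d(1), of "\<lambda>t. f (\<gamma> t)"] V(2) d(2) by simp
qed

text \<open>The image velocity is computed by a local extension, and one extension serves all curves in the subset
  with velocity \<^term>\<open>v\<close>. So it depends on \<^term>\<open>v\<close> alone, which is what the definite description in
  \<^const>\<open>tangent_Cmp\<close> requires.\<close>

lemma velocity_smooth_map_on:
  assumes M: "smooth_atlas M" and N: "smooth_atlas N" and f: "smooth_map_on M S N f"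
    and v: "fst v \<in> S"
  obtains w where "\<And>\<gamma>. has_velocity M \<gamma> v \<Longrightarrow> \<forall>\<^sub>F t in nhds 0. \<gamma> t \<in> S \<Longrightarrow> has_velocity N (\<lambda>t. f (\<gamma> t)) w"
proof -
  have p: "fst v \<in> pts M" "f (fst v) \<in> pts N" using f v unfolding smooth_map_on_def by auto
  obtain c where c: "c \<in> M" "fst v \<in> fst c" using p(1) by (rule ptsE)
  obtain d where d: "d \<in> N" "f (fst v) \<in> fst d" using p(2) by (rule ptsE)
  obtain V G where V: "open V" "snd c (fst v) \<in> V" "smooth_on V G"
    "\<And>q. q\<in>S \<Longrightarrow> q \<in> fst c \<Longrightarrow> snd c q \<in> V \<Longrightarrow> f q \<in> fst d \<and> snd d (f q) = G (snd c q)"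
    using smooth_map_on_extension[OF M f c v d] by blast
  show ?thesis
    by (rule that[of "(f (fst v), tvec N d (f (fst v)) (frechet_derivative G (at (snd c (fst v))) (snd v c)))"])
      (rule velocity_along[OF M N _ c d V], auto)
qed

lemma velocity_smooth_map:
  assumes M: "smooth_atlas M" and N: "smooth_atlas N" and f: "smooth_map M N f"
    and \<gamma>: "has_velocity M \<gamma> (p, \<xi>)" and c: "c \<in> M" "p \<in> fst c" and d: "d \<in> N" "f p \<in> fst d"
  shows "has_velocity N (\<lambda>t. f (\<gamma> t))
    (f p, tvec N d (f p) (frechet_derivative (\<lambda>x. snd d (f (chart_inv c x))) (at (snd c p)) (\<xi> c)))"
proof (rule velocity_along[where f = f and S = UNIV and V = "snd c ` {p \<in> fst c. f p \<in> fst d}"])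
  show "smooth_atlas M" "smooth_atlas N" "has_velocity M \<gamma> (p, \<xi>)" "c \<in> M" "p \<in> fst c" "d \<in> N" "f p \<in> fst d"
    by (fact+)
  show "open (snd c ` {p \<in> fst c. f p \<in> fst d})"
    "smooth_on (snd c ` {p \<in> fst c. f p \<in> fst d}) (\<lambda>x. snd d (f (chart_inv c x)))"
    using smooth_mapD(2,3)[OF f c(1) d(1)] .
  show "snd c p \<in> snd c ` {p \<in> fst c. f p \<in> fst d}" using c d by auto
  show "\<forall>\<^sub>F t in nhds 0. \<gamma> t \<in> UNIV" by simp
  fix q assume "q \<in> fst c" "snd c q \<in> snd c ` {p \<in> fst c. f p \<in> fst d}"
  then show "f q \<in> fst d \<and> snd d (f q) = snd d (f (chart_inv c (snd c q)))"
    using smooth_atlasD(2)[OF M c(1)] smooth_atlasD(6)[OF M c(1)] by (auto dest: inj_onD)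
qed

text \<open>The defining property of the differential, from which all its functorial properties follow by
  uniqueness of velocities.\<close>

lemma velocity_Tmap:
  assumes M: "smooth_atlas M" and N: "smooth_atlas N" and f: "smooth_map M N f" and \<gamma>: "has_velocity M \<gamma> v"
  shows "has_velocity N (\<lambda>t. f (\<gamma> t)) (Tmap M N f v)"
proof -
  obtain p \<xi> where v: "v = (p, \<xi>)" by (cases v)
  have p: "p \<in> pts M" using velocity_pts_split[of M \<gamma> p \<xi>] \<gamma> v by simp
  define c where "c = (SOME c. c \<in> M \<and> p \<in> fst c)"
  have "\<exists>c. c \<in> M \<and> p \<in> fst c" using p unfolding pts_def by blast
  then have "c \<in> M \<and> p \<in> fst c" unfolding c_def by (rule someI_ex)
  then have c: "c \<in> M" "p \<in> fst c" by simp_all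
  obtain d0 where d0: "d0 \<in> N" "f p \<in> fst d0" using smooth_mapD(1)[OF f p] by (rule ptsE)
  let ?D = "\<lambda>d. frechet_derivative (\<lambda>x. snd d (f (chart_inv c x))) (at (snd c p)) (\<xi> c)"
  let ?w = "\<lambda>d. (f p, tvec N d (f p) (?D d))"
  have w: "has_velocity N (\<lambda>t. f (\<gamma> t)) (?w d)" if "d \<in> N" "f p \<in> fst d" for d
    using velocity_smooth_map[OF M N f _ c that] \<gamma> v by simp
  have "?w d = ?w d0" if "d \<in> N" "f p \<in> fst d" for d
    using velocity_unique[OF w[OF that] w[OF d0]] .
  then have "tvec N d0 (f p) (?D d0) d = ?D d" if "d \<in> N" "f p \<in> fst d" for d
    using tvec(2)[OF N that, of "?D d"] that by simp
  then have "Tmap M N f v = ?w d0"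
    unfolding v Tmap_def o_def c_def[symmetric] Let_def
    by (auto simp: fun_eq_iff c_def[symmetric] tvec_def[of N d0])
  then show ?thesis using w[OF d0] by simp
qed

lemma fst_Tmap [simp]: "fst (Tmap M N f v) = f (fst v)"
  by (simp add: Tmap_def split_beta)

lemma Tmap_pts:
  assumes "smooth_atlas M" "smooth_atlas N" "smooth_map M N f" "v \<in> pts (tangent_bundle M)"
  shows "Tmap M N f v \<in> pts (tangent_bundle N)"
  using velocity_exists[OF assms(1,4)] velocity_Tmap[OF assms(1-3)] velocity_pts by metis

lemma Tmap_coord:
  assumes M: "smooth_atlas M" and N: "smooth_atlas N" and f: "smooth_map M N f"
    and \<xi>: "\<xi> \<in> tangent_space M p" and c: "c \<in> M" "p \<in> fst c" and d: "d \<in> N" "f p \<in> fst d"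
  shows "snd (Tmap M N f (p, \<xi>)) d = frechet_derivative (\<lambda>x. snd d (f (chart_inv c x))) (at (snd c p)) (\<xi> c)"
proof -
  have "(p, \<xi>) \<in> pts (tangent_bundle M)" using \<xi> c by (auto simp: pts_tangent_bundle intro: ptsI)
  then obtain \<gamma> where \<gamma>: "has_velocity M \<gamma> (p, \<xi>)" using velocity_exists[OF M] by blast
  show ?thesis
    using velocity_unique[OF velocity_Tmap[OF M N f \<gamma>] velocity_smooth_map[OF M N f \<gamma> c d]] tvec(2)[OF N d] by simp
qed

lemma Tmap_eqI:
  assumes M: "smooth_atlas M" and N: "smooth_atlas N" and f: "smooth_map M N f"
    and "v \<in> pts (tangent_bundle M)"
    and "\<And>\<gamma>. has_velocity M \<gamma> v \<Longrightarrow> has_velocity N (\<lambda>t. f (\<gamma> t)) w"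
  shows "Tmap M N f v = w"
  using velocity_exists[OF M assms(4)] velocity_unique[OF velocity_Tmap[OF M N f]] assms(5) by metis

lemma Tmap_comp:
  assumes "smooth_atlas M" "smooth_atlas N" "smooth_atlas L" "smooth_map M N f" "smooth_map N L g"
    and "v \<in> pts (tangent_bundle M)"
  shows "Tmap M L (\<lambda>p. g (f p)) v = Tmap N L g (Tmap M N f v)"
  using assms by (intro Tmap_eqI smooth_map_comp[of M N L f g] velocity_Tmap) auto

lemma Tmap_ident: "smooth_atlas M \<Longrightarrow> v \<in> pts (tangent_bundle M) \<Longrightarrow> Tmap M M (\<lambda>p. p) v = v"
  by (intro Tmap_eqI smooth_map_ident) auto

lemma Tmap_cong:
  assumes M: "smooth_atlas M" and N: "smooth_atlas N" and f: "smooth_map M N f"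
    and v: "v \<in> pts (tangent_bundle M)" and e: "\<And>p. p \<in> pts M \<Longrightarrow> f p = g p"
  shows "Tmap M N g v = Tmap M N f v"
proof (rule Tmap_eqI[OF M N smooth_map_cong[OF f M e] v])
  fix \<gamma> assume \<gamma>: "has_velocity M \<gamma> v"
  have "\<forall>\<^sub>F t in nhds 0. f (\<gamma> t) = g (\<gamma> t)" using velocity_eventually[OF \<gamma>] by eventually_elim (rule e)
  then show "has_velocity N (\<lambda>t. g (\<gamma> t)) (Tmap M N f v)"
    by (rule velocity_cong[OF velocity_Tmap[OF M N f \<gamma>]])
qed

lemma Tmap_add_scale:
  assumes M: "smooth_atlas M" and N: "smooth_atlas N" and f: "smooth_map M N f"
    and p: "p \<in> pts M" "\<xi> \<in> tangent_space M p" "\<zeta> \<in> tangent_space M p"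
  shows "snd (Tmap M N f (p, \<xi> + \<zeta>)) = snd (Tmap M N f (p, \<xi>)) + snd (Tmap M N f (p, \<zeta>))"
    "snd (Tmap M N f (p, a *\<^sub>R \<xi>)) = a *\<^sub>R snd (Tmap M N f (p, \<xi>))"
proof -
  obtain c where c: "c \<in> M" "p \<in> fst c" using p(1) by (rule ptsE)
  have S: "\<xi> + \<zeta> \<in> tangent_space M p" "a *\<^sub>R \<xi> \<in> tangent_space M p"
    using tangent_space_subspace[OF M p(1)] p by (auto intro: subspace_add subspace_scale)
  have l: "linear (frechet_derivative (\<lambda>x. snd d (f (chart_inv c x))) (at (snd c p)))"
    if "d \<in> N" "f p \<in> fst d" for d
    using smooth_on_differentiable[OF smooth_mapD(3)[OF f c(1) that(1)], of "snd c p"] c that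
    by (intro linear_frechet_derivative) auto
  have off: "snd (Tmap M N f (p, \<eta>)) d = 0" if "\<not> (d \<in> N \<and> f p \<in> fst d)" for d \<eta>
    using that by (auto simp: Tmap_def)
  have "snd (Tmap M N f (p, \<xi> + \<zeta>)) d = snd (Tmap M N f (p, \<xi>)) d + snd (Tmap M N f (p, \<zeta>)) d" for d
  proof (cases "d \<in> N \<and> f p \<in> fst d")
    case True
    then show ?thesis using Tmap_coord[OF M N f _ c] S p linear_add[OF l] by simp
  qed (simp add: off)
  then show "snd (Tmap M N f (p, \<xi> + \<zeta>)) = snd (Tmap M N f (p, \<xi>)) + snd (Tmap M N f (p, \<zeta>))"
    by (simp add: fun_eq_iff)
  have "snd (Tmap M N f (p, a *\<^sub>R \<xi>)) d = a *\<^sub>R snd (Tmap M N f (p, \<xi>)) d" for d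
  proof (cases "d \<in> N \<and> f p \<in> fst d")
    case True
    then show ?thesis using Tmap_coord[OF M N f _ c] S p linear_scale[OF l] by (simp add: scaleR_fun_def)
  qed (simp add: off)
  then show "snd (Tmap M N f (p, a *\<^sub>R \<xi>)) = a *\<^sub>R snd (Tmap M N f (p, \<xi>))"
    by (simp add: fun_eq_iff scaleR_fun_def)
qed

subsection \<open>The tangent bundle as an atlas\<close>

definition tchart :: "('a, 'e::real_inner) atlas \<Rightarrow> ('a, 'e) chart \<Rightarrow> (('a, 'e) tangent, 'e \<times> 'e) chart" where
  "tchart M c = ({(p, \<xi>). p \<in> fst c \<and> \<xi> \<in> tangent_space M p}, \<lambda>(p, \<xi>). (snd c p, \<xi> c))"

lemma tangent_bundle_tchart: "tangent_bundle M = tchart M ` M"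
  unfolding tangent_bundle_def tchart_def by simp

lemma mem_tchart: "(p, \<xi>) \<in> fst (tchart M c) \<longleftrightarrow> p \<in> fst c \<and> \<xi> \<in> tangent_space M p"
  by (simp add: tchart_def)

lemma snd_tchart: "snd (tchart M c) (p, \<xi>) = (snd c p, \<xi> c)"
  by (simp add: tchart_def)

lemma tchart_image:
  assumes "smooth_atlas M" "c \<in> M" "A \<subseteq> fst c"
  shows "snd (tchart M c) ` {(p, \<xi>). p \<in> A \<and> \<xi> \<in> tangent_space M p} = snd c ` A \<times> UNIV"
proof (rule equalityI; rule subsetI)
  fix z assume "z \<in> snd c ` A \<times> (UNIV :: 'b set)"
  then obtain p where p: "p \<in> A" "z = (snd c p, snd z)" by (metis imageE mem_Times_iff prod.collapse)
  then have "z = snd (tchart M c) (p, tvec M c p (snd z))" "tvec M c p (snd z) \<in> tangent_space M p"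
    using tvec[OF assms(1,2)] assms(3) by (auto simp: snd_tchart)
  then show "z \<in> snd (tchart M c) ` {(p, \<xi>). p \<in> A \<and> \<xi> \<in> tangent_space M p}" using p(1) by blast
qed (auto simp: snd_tchart)

lemma inj_tchart:
  assumes "smooth_atlas M" "c \<in> M"
  shows "inj_on (snd (tchart M c)) (fst (tchart M c))"
proof (rule inj_onI)
  fix v w assume v: "v \<in> fst (tchart M c)" "w \<in> fst (tchart M c)" "snd (tchart M c) v = snd (tchart M c) w"
  obtain p \<xi> q \<zeta> where [simp]: "v = (p, \<xi>)" "w = (q, \<zeta>)" by (cases v, cases w) auto
  have "p = q" using v smooth_atlasD(2)[OF assms] by (auto simp: mem_tchart snd_tchart dest: inj_onD)
  then show "v = w" using v tangent_space_eqI[of \<xi> M p \<zeta> c] assms by (auto simp: mem_tchart snd_tchart)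
qed

lemma chart_inv_tchart:
  assumes "smooth_atlas M" "c \<in> M" "p \<in> fst c"
  shows "chart_inv (tchart M c) (snd c p, v) = (p, tvec M c p v)"
proof -
  have "(p, tvec M c p v) \<in> fst (tchart M c)" "snd (tchart M c) (p, tvec M c p v) = (snd c p, v)"
    using tvec[OF assms] assms(3) by (auto simp: mem_tchart snd_tchart)
  then show ?thesis unfolding chart_inv_def using inj_tchart[OF assms(1,2)] by (metis inv_into_f_f)
qed

lemma smooth_atlas_tangent_bundle:
  fixes M :: "('a, 'e::real_inner) atlas"
  assumes M: "smooth_atlas M" shows "smooth_atlas (tangent_bundle M)"
  unfolding smooth_atlas_def tangent_bundle_tchart
proof (intro conjI ballI; (elim imageE)?)
  show "fin_dim TYPE('e \<times> 'e)" by (rule fin_dim_prod[OF smooth_atlasD(1)[OF M] smooth_atlasD(1)[OF M]])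
  show "inj_on (snd e) (fst e)" if "e = tchart M c" "c \<in> M" for e c using inj_tchart[OF M] that by simp
  fix e e' c d assume e: "e = tchart M c" "e' = tchart M d" and c: "c \<in> M" "d \<in> M"
  let ?A = "snd c ` (fst c \<inter> fst d)" and ?f = "\<lambda>x. snd d (chart_inv c x)"
  have int: "fst e \<inter> fst e' = {(p, \<xi>). p \<in> fst c \<inter> fst d \<and> \<xi> \<in> tangent_space M p}"
    by (auto simp: e mem_tchart)
  have im: "snd e ` (fst e \<inter> fst e') = ?A \<times> UNIV"
    unfolding int unfolding e(1) by (rule tchart_image[OF M c(1)]) simp
  have oA: "open ?A" using smooth_atlasD(3)[OF M c] .
  then have o: "open (?A \<times> (UNIV::'e set))" by (simp add: open_Times)
  then show "open (snd e ` (fst e \<inter> fst e'))" by (simp add: im)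
  have s: "smooth_on ?A ?f" using smooth_atlasD(4)[OF M c] .
  have "smooth_on (?A \<times> (UNIV::'e set)) (\<lambda>z. ?f (fst z))"
    by (rule smooth_on_compose[where f = fst and g = ?f, OF smooth_atlasD(1)[OF M] o _
          smooth_on_bounded_linear[OF o bounded_linear_fst] s]) auto
  then have "smooth_on (?A \<times> UNIV) (\<lambda>z. (?f (fst z), (\<lambda>(x, v). frechet_derivative ?f (at x) v) z))"
    by (rule smooth_on_Pair[OF o _ smooth_on_total_derivative[OF smooth_atlasD(1)[OF M] oA s]])
  then have "smooth_on (?A \<times> UNIV) (snd e' \<circ> chart_inv e)"
  proof (rule smooth_on_cong[OF o, rotated])
    fix z assume "z \<in> ?A \<times> (UNIV::'e set)"
    then obtain p v where p: "p \<in> fst c" "p \<in> fst d" "z = (snd c p, v)" by (cases z) auto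
    have "chart_inv e z = (p, tvec M c p v)" using chart_inv_tchart[OF M c(1) p(1)] p(3) e by simp
    then show "(?f (fst z), (\<lambda>(x, v). frechet_derivative ?f (at x) v) z) = (snd e' \<circ> chart_inv e) z"
      using p c smooth_atlasD(6)[OF M c(1) p(1)] by (simp add: e snd_tchart tvec_def)
  qed
  then show "smooth_on (snd e ` (fst e \<inter> fst e')) (snd e' \<circ> chart_inv e)" by (simp add: im)
qed

text \<open>In charts the differential is \<open>(x, v) \<mapsto> (g(x), Dg(x) v)\<close>, smooth by the lemma on total derivatives.\<close>

lemma smooth_map_Tmap:
  fixes M :: "('a, 'e::real_inner) atlas" and N :: "('b, 'f::real_inner) atlas"
  assumes M: "smooth_atlas M" and N: "smooth_atlas N" and f: "smooth_map M N f"
  shows "smooth_map (tangent_bundle M) (tangent_bundle N) (Tmap M N f)"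
proof (rule smooth_map_localI[OF smooth_atlas_tangent_bundle[OF M] smooth_atlas_tangent_bundle[OF N]])
  fix v assume v: "v \<in> pts (tangent_bundle M)"
  obtain p \<xi> where v': "v = (p, \<xi>)" by (cases v)
  have p: "p \<in> pts M" "\<xi> \<in> tangent_space M p" using v v' by (simp_all add: mem_tangent_bundle)
  obtain c where c: "c \<in> M" "p \<in> fst c" using p(1) by (rule ptsE)
  obtain d where d: "d \<in> N" "f p \<in> fst d" using smooth_mapD(1)[OF f p(1)] by (rule ptsE)
  let ?A = "snd c ` {p \<in> fst c. f p \<in> fst d}" and ?f = "\<lambda>x. snd d (f (chart_inv c x))"
  have oA: "open ?A" and s: "smooth_on ?A ?f" using smooth_mapD(2,3)[OF f c(1) d(1)] by auto
  have o: "open (?A \<times> (UNIV::'e set))" by (simp add: open_Times oA)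
  have "smooth_on (?A \<times> (UNIV::'e set)) (\<lambda>z. ?f (fst z))"
    by (rule smooth_on_compose[where f = fst and g = ?f, OF smooth_atlasD(1)[OF M] o _
          smooth_on_bounded_linear[OF o bounded_linear_fst] s]) auto
  then have "smooth_on (?A \<times> UNIV) (\<lambda>z. (?f (fst z), (\<lambda>(x, v). frechet_derivative ?f (at x) v) z))"
    by (rule smooth_on_Pair[OF o _ smooth_on_total_derivative[OF smooth_atlasD(1)[OF M] oA s]])
  moreover have at: "Tmap M N f (chart_inv (tchart M c) z) \<in> fst (tchart N d) \<and>
      snd (tchart N d) (Tmap M N f (chart_inv (tchart M c) z)) =
        (?f (fst z), (\<lambda>(x, v). frechet_derivative ?f (at x) v) z)" if z: "z \<in> ?A \<times> UNIV" for z
  proof -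
    obtain q v where q: "q \<in> fst c" "f q \<in> fst d" "z = (snd c q, v)" using z by (cases z) auto
    have i: "chart_inv (tchart M c) z = (q, tvec M c q v)"
      using chart_inv_tchart[OF M c(1) q(1)] q(3) by simp
    have t: "tvec M c q v \<in> tangent_space M q" using tvec(1)[OF M c(1) q(1)] .
    define \<zeta> where "\<zeta> = snd (Tmap M N f (q, tvec M c q v))"
    have T: "Tmap M N f (q, tvec M c q v) = (f q, \<zeta>)" by (simp add: \<zeta>_def prod_eq_iff)
    have "(q, tvec M c q v) \<in> pts (tangent_bundle M)" using ptsI[OF c(1) q(1)] t by (simp add: pts_tangent_bundle)
    then have "Tmap M N f (q, tvec M c q v) \<in> pts (tangent_bundle N)" by (rule Tmap_pts[OF M N f])
    then have "\<zeta> \<in> tangent_space N (f q)" unfolding T pts_tangent_bundle by simp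
    moreover have "\<zeta> d = frechet_derivative ?f (at (snd c q)) v"
      using Tmap_coord[OF M N f t c(1) q(1) d(1) q(2)] tvec(2)[OF M c(1) q(1)] by (simp add: \<zeta>_def)
    ultimately show ?thesis
      using q smooth_atlasD(6)[OF M c(1) q(1)] unfolding i T by (simp add: mem_tchart snd_tchart)
  qed
  ultimately have "smooth_on (?A \<times> UNIV) (\<lambda>z. snd (tchart N d) (Tmap M N f (chart_inv (tchart M c) z)))"
    by (elim smooth_on_cong[OF o, rotated]) simp
  moreover have "v \<in> fst (tchart M c)" "snd (tchart M c) v \<in> ?A \<times> UNIV"
    using c d p v' by (auto simp: mem_tchart snd_tchart)
  moreover have "?A \<times> UNIV \<subseteq> snd (tchart M c) ` fst (tchart M c)"
    using tchart_image[OF M c(1) subset_refl] by (auto simp: tchart_def)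
  ultimately show "\<exists>e\<in>tangent_bundle M. \<exists>e'\<in>tangent_bundle N. \<exists>U. open U \<and> v \<in> fst e \<and> snd e v \<in> U \<and>
      U \<subseteq> snd e ` fst e \<and> (\<forall>x\<in>U. Tmap M N f (chart_inv e x) \<in> fst e') \<and>
      smooth_on U (\<lambda>x. snd e' (Tmap M N f (chart_inv e x)))"
    unfolding tangent_bundle_tchart using c d o at
    by (intro bexI[OF _ imageI[OF c(1)]] bexI[OF _ imageI[OF d(1)]] exI[of _ "?A \<times> UNIV"]) blast
qed

subsection \<open>Tangent spaces as manifolds\<close>

text \<open>Coordinates in a single chart of the manifold are global linear coordinates of a tangent space. For the unit
  of a Lie group this is the atlas of the Lie algebra.\<close>

definition fibre_atlas :: "('a, 'e::real_inner) atlas \<Rightarrow> 'a \<Rightarrow> (('a, 'e) chart \<Rightarrow> 'e, 'e) atlas" where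
  "fibre_atlas M p = {(tangent_space M p, \<lambda>A. A c) | c. c \<in> M \<and> p \<in> fst c}"

lemma lie_alg_atlas_fibre: "lie_alg_atlas G = fibre_atlas (charts G) \<one>\<^bsub>G\<^esub>"
  unfolding lie_alg_atlas_def fibre_atlas_def lie_alg_def by simp

lemma fibre_atlasE:
  assumes "e \<in> fibre_atlas M p"
  obtains c where "c \<in> M" "p \<in> fst c" "e = (tangent_space M p, \<lambda>A. A c)"
  using assms unfolding fibre_atlas_def by blast

lemma fibre_atlasI: "c \<in> M \<Longrightarrow> p \<in> fst c \<Longrightarrow> (tangent_space M p, \<lambda>A. A c) \<in> fibre_atlas M p"
  unfolding fibre_atlas_def by blast

lemma pts_fibre_atlas: "p \<in> pts M \<Longrightarrow> pts (fibre_atlas M p) = tangent_space M p"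
proof (rule equalityI; rule subsetI)
  fix A assume "A \<in> pts (fibre_atlas M p)"
  then obtain e where "e \<in> fibre_atlas M p" "A \<in> fst e" by (rule ptsE)
  then show "A \<in> tangent_space M p" by (elim fibre_atlasE) simp
next
  fix A assume p: "p \<in> pts M" and A: "A \<in> tangent_space M p"
  obtain c where c: "c \<in> M" "p \<in> fst c" using p by (rule ptsE)
  show "A \<in> pts (fibre_atlas M p)" by (rule ptsI[OF fibre_atlasI[OF c]]) (simp add: A)
qed

lemma tvec_linear:
  assumes M: "smooth_atlas M" and c: "c \<in> M" "p \<in> fst c"
  shows "tvec M c p v + tvec M c p w = tvec M c p (v + w)" "a *\<^sub>R tvec M c p v = tvec M c p (a *\<^sub>R v)"
proof -
  have S: "subspace (tangent_space M p)" using tangent_space_subspace[OF M ptsI[OF c]] .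
  show "tvec M c p v + tvec M c p w = tvec M c p (v + w)"
    by (rule tangent_space_eqI[OF subspace_add[OF S] _ c])
      (simp_all add: tvec[OF M c])
  show "a *\<^sub>R tvec M c p v = tvec M c p (a *\<^sub>R v)"
    by (rule tangent_space_eqI[OF subspace_scale[OF S] _ c])
      (simp_all add: tvec[OF M c] scaleR_fun_def)
qed

lemma fibre_chart:
  assumes M: "smooth_atlas M" and c: "c \<in> M" "p \<in> fst c"
  shows "inj_on (\<lambda>A. A c) (tangent_space M p)" "(\<lambda>A. A c) ` tangent_space M p = UNIV"
    "chart_inv (tangent_space M p, \<lambda>A. A c) v = tvec M c p v"
proof -
  show i: "inj_on (\<lambda>A. A c) (tangent_space M p)"
    by (rule inj_onI) (rule tangent_space_eqI[OF _ _ c])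
  show "(\<lambda>A. A c) ` tangent_space M p = UNIV"
    by (metis UNIV_eq_I image_eqI tvec[OF M c])
  show "chart_inv (tangent_space M p, \<lambda>A. A c) v = tvec M c p v"
    using inv_into_f_f[OF i tvec(1)[OF M c, of v]] by (simp add: chart_inv_def tvec(2)[OF M c])
qed

lemma smooth_atlas_fibre:
  fixes M :: "('a, 'e::real_inner) atlas"
  assumes M: "smooth_atlas M"
  shows "smooth_atlas (fibre_atlas M p)"
  unfolding smooth_atlas_def
proof (intro conjI ballI; (elim fibre_atlasE)?)
  show "fin_dim TYPE('e)" by (rule smooth_atlasD(1)[OF M])
  show "inj_on (snd e) (fst e)" if "c \<in> M" "p \<in> fst c" "e = (tangent_space M p, \<lambda>A. A c)" for e c
    using fibre_chart(1)[OF M that(1,2)] that(3) by simp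
  fix e e' :: "(('a, 'e) chart \<Rightarrow> 'e, 'e) chart" and c d
  assume c: "c \<in> M" "p \<in> fst c" "e = (tangent_space M p, \<lambda>A. A c)"
    and d: "d \<in> M" "p \<in> fst d" "e' = (tangent_space M p, \<lambda>A. A d)"
  have U: "snd e ` (fst e \<inter> fst e') = UNIV" using fibre_chart(2)[OF M c(1,2)] by (simp add: c(3) d(3))
  then show "open (snd e ` (fst e \<inter> fst e'))" by simp
  have "linear (\<lambda>v. tvec M c p v d)"
    by (rule linearI) (simp_all flip: tvec_linear[OF M c(1,2)] add: scaleR_fun_def)
  then have "bounded_linear (\<lambda>v. tvec M c p v d)" by (rule fin_dim_linear_bounded[OF smooth_atlasD(1)[OF M]])
  then have "smooth_on UNIV (\<lambda>v. tvec M c p v d)" by (rule smooth_on_bounded_linear[OF open_UNIV])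
  moreover have "snd e' \<circ> chart_inv e = (\<lambda>v. tvec M c p v d)"
    by (rule ext) (simp add: fibre_chart(3)[OF M c(1,2)] c(3) d(3))
  ultimately show "smooth_on (snd e ` (fst e \<inter> fst e')) (snd e' \<circ> chart_inv e)" using U by simp
qed

lemma smooth_map_fibreI:
  assumes L: "smooth_atlas L" and M: "smooth_atlas M" and c: "c \<in> M" "p \<in> fst c"
    and f: "\<And>q. q \<in> pts L \<Longrightarrow> f q \<in> tangent_space M p"
    and s: "\<And>b. b \<in> L \<Longrightarrow> smooth_on (snd b ` fst b) (\<lambda>x. f (chart_inv b x) c)"
  shows "smooth_map L (fibre_atlas M p) f"
proof (rule smooth_map_localI[OF L smooth_atlas_fibre[OF M]])
  fix q assume "q \<in> pts L"
  then obtain b where b: "b \<in> L" "q \<in> fst b" by (rule ptsE)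
  have "f (chart_inv b x) \<in> tangent_space M p" if "x \<in> snd b ` fst b" for x
    using that f ptsI[OF b(1)] smooth_atlasD(6)[OF L b(1)] by auto
  then show "\<exists>b\<in>L. \<exists>d\<in>fibre_atlas M p. \<exists>U. open U \<and> q \<in> fst b \<and> snd b q \<in> U \<and> U \<subseteq> snd b ` fst b \<and>
      (\<forall>x\<in>U. f (chart_inv b x) \<in> fst d) \<and> smooth_on U (\<lambda>x. snd d (f (chart_inv b x)))"
    using b s[OF b(1)] smooth_atlasD(5)[OF L b(1)]
    by (intro bexI[OF _ b(1)] bexI[OF _ fibre_atlasI[OF c]] exI[of _ "snd b ` fst b"]) simp
qed

lemma smooth_map_fibreD:
  assumes f: "smooth_map L (fibre_atlas M p) f" and c: "c \<in> M" "p \<in> fst c" and b: "b \<in> L"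
  shows "q \<in> pts L \<Longrightarrow> f q \<in> tangent_space M p"
    "smooth_on (snd b ` fst b) (\<lambda>x. f (chart_inv b x) c)"
proof -
  have m: "f q \<in> tangent_space M p" if "q \<in> pts L" for q
    using smooth_mapD(1)[OF f that] pts_fibre_atlas[OF ptsI[OF c]] by simp
  then show "q \<in> pts L \<Longrightarrow> f q \<in> tangent_space M p" .
  have "{q \<in> fst b. f q \<in> tangent_space M p} = fst b" using m ptsI[OF b] by auto
  then show "smooth_on (snd b ` fst b) (\<lambda>x. f (chart_inv b x) c)"
    using smooth_mapD(3)[OF f b fibre_atlasI[OF c]] by simp
qed

lemma smooth_map_fibre_add:
  assumes L: "smooth_atlas L" and M: "smooth_atlas M" and p: "p \<in> pts M"
    and f: "smooth_map L (fibre_atlas M p) f" and g: "smooth_map L (fibre_atlas M p) g"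
  shows "smooth_map L (fibre_atlas M p) (\<lambda>q. f q + g q)"
proof -
  obtain c where c: "c \<in> M" "p \<in> fst c" using p by (rule ptsE)
  have m: "f q \<in> tangent_space M p" "g q \<in> tangent_space M p" if "q \<in> pts L" for q
    using smooth_mapD(1)[OF f that] smooth_mapD(1)[OF g that] pts_fibre_atlas[OF p] by auto
  show ?thesis
  proof (rule smooth_map_fibreI[OF L M c])
    show "f q + g q \<in> tangent_space M p" if "q \<in> pts L" for q
      using subspace_add[OF tangent_space_subspace[OF M p] m[OF that]] .
    show "smooth_on (snd b ` fst b) (\<lambda>x. (f (chart_inv b x) + g (chart_inv b x)) c)" if b: "b \<in> L" for b
      unfolding plus_fun_apply
      by (rule smooth_on_add[OF smooth_atlasD(5)[OF L b] smooth_map_fibreD(2)[OF f c b] smooth_map_fibreD(2)[OF g c b]])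
  qed
qed

lemma smooth_map_fibre_linear:
  assumes M: "smooth_atlas M" and N: "smooth_atlas N" and p: "p \<in> pts M" and q: "q \<in> pts N"
    and A: "\<And>\<xi>. \<xi> \<in> tangent_space M p \<Longrightarrow> A \<xi> \<in> tangent_space N q"
    and add: "\<And>\<xi> \<zeta>. \<xi> \<in> tangent_space M p \<Longrightarrow> \<zeta> \<in> tangent_space M p \<Longrightarrow> A (\<xi> + \<zeta>) = A \<xi> + A \<zeta>"
    and scale: "\<And>a \<xi>. \<xi> \<in> tangent_space M p \<Longrightarrow> A (a *\<^sub>R \<xi>) = a *\<^sub>R A \<xi>"
  shows "smooth_map (fibre_atlas M p) (fibre_atlas N q) A"
proof -
  obtain d where d: "d \<in> N" "q \<in> fst d" using q by (rule ptsE)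
  show ?thesis
  proof (rule smooth_map_fibreI[OF smooth_atlas_fibre[OF M] N d])
    show "A \<xi> \<in> tangent_space N q" if "\<xi> \<in> pts (fibre_atlas M p)" for \<xi>
      using that A pts_fibre_atlas[OF p] by simp
    fix b assume "b \<in> fibre_atlas M p"
    then obtain c where c: "c \<in> M" "p \<in> fst c" "b = (tangent_space M p, \<lambda>A. A c)" by (rule fibre_atlasE)
    have "linear (\<lambda>v. A (tvec M c p v) d)"
    proof (rule linearI)
      show "A (tvec M c p (v + w)) d = A (tvec M c p v) d + A (tvec M c p w) d" for v w
        by (simp add: add tvec[OF M c(1,2)] flip: tvec_linear(1)[OF M c(1,2)])
      have "A (tvec M c p (r *\<^sub>R v)) = r *\<^sub>R A (tvec M c p v)" for r v
        by (simp add: scale tvec[OF M c(1,2)] flip: tvec_linear(2)[OF M c(1,2)])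
      then show "A (tvec M c p (r *\<^sub>R v)) d = r *\<^sub>R A (tvec M c p v) d" for r v
        by (simp add: scaleR_fun_def)
    qed
    then have "smooth_on UNIV (\<lambda>v. A (tvec M c p v) d)"
      by (intro smooth_on_bounded_linear fin_dim_linear_bounded smooth_atlasD(1)[OF M] open_UNIV)
    then show "smooth_on (snd b ` fst b) (\<lambda>x. A (chart_inv b x) d)"
      using fibre_chart(2,3)[OF M c(1,2)] by (simp add: c(3))
  qed
qed

lemma smooth_map_fibre_diff:
  fixes f :: "'a \<Rightarrow> ('b, 'e::real_inner) chart \<Rightarrow> 'e"
  assumes L: "smooth_atlas L" and M: "smooth_atlas M" and p: "p \<in> pts M"
    and f: "smooth_map L (fibre_atlas M p) f" and g: "smooth_map L (fibre_atlas M p) g"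
  shows "smooth_map L (fibre_atlas M p) (\<lambda>q. f q - g q)"
proof -
  note S = tangent_space_subspace[OF M p]
  have "smooth_map (fibre_atlas M p) (fibre_atlas M p) uminus"
    by (rule smooth_map_fibre_linear[OF M M p p]) (auto simp: subspace_neg[OF S] scaleR_fun_def fun_eq_iff)
  then have "smooth_map L (fibre_atlas M p) (\<lambda>q. - g q)"
    using smooth_map_comp[OF L smooth_atlas_fibre[OF M] smooth_atlas_fibre[OF M] g] by simp
  then show ?thesis using smooth_map_fibre_add[OF L M p f] by fastforce
qed

subsection \<open>Velocities in a product\<close>

text \<open>The tangent vector of the product with components \<^term>\<open>u\<close> and \<^term>\<open>v\<close>. As a sum of differentials of
  slices it is defined without the choice of a chart.\<close>

definition tpair :: "('a, 'e::real_inner) atlas \<Rightarrow> ('b, 'f::real_inner) atlas \<Rightarrow> ('a, 'e) tangent \<Rightarrow>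
    ('b, 'f) tangent \<Rightarrow> ('a \<times> 'b, 'e \<times> 'f) chart \<Rightarrow> 'e \<times> 'f" where
  "tpair M N u v = snd (Tmap M (prod_atlas M N) (\<lambda>x. (x, fst v)) u) +
     snd (Tmap N (prod_atlas M N) (\<lambda>y. (fst u, y)) v)"

definition pchart :: "('a, 'e) chart \<Rightarrow> ('b, 'f) chart \<Rightarrow> ('a \<times> 'b, 'e \<times> 'f) chart" where
  "pchart c d = (fst c \<times> fst d, map_prod (snd c) (snd d))"

lemma pchart: "c \<in> M \<Longrightarrow> d \<in> N \<Longrightarrow> pchart c d \<in> prod_atlas M N" "p \<in> fst c \<Longrightarrow> q \<in> fst d \<Longrightarrow> (p, q) \<in> fst (pchart c d)"
  "snd (pchart c d) (p, q) = (snd c p, snd d q)"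
  by (simp_all add: pchart_def prod_atlasI)

lemma smooth_map_slice:
  assumes "smooth_atlas M" "smooth_atlas N"
  shows "q \<in> pts N \<Longrightarrow> smooth_map M (prod_atlas M N) (\<lambda>x. (x, q))"
    "p \<in> pts M \<Longrightarrow> smooth_map N (prod_atlas M N) (\<lambda>y. (p, y))"
  using assms by (auto intro: smooth_map_Pair smooth_map_ident smooth_map_const)

lemma velocity_pair_chart:
  assumes M: "smooth_atlas M" and N: "smooth_atlas N"
    and c: "c \<in> M" "\<gamma> 0 \<in> fst c" "\<forall>\<^sub>F t in nhds (0::real). \<gamma> t \<in> fst c" "((\<lambda>t. snd c (\<gamma> t)) has_vector_derivative a) (at 0)"
    and d: "d \<in> N" "\<mu> 0 \<in> fst d" "\<forall>\<^sub>F t in nhds (0::real). \<mu> t \<in> fst d" "((\<lambda>t. snd d (\<mu> t)) has_vector_derivative b) (at 0)"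
  shows "has_velocity (prod_atlas M N) (\<lambda>t. (\<gamma> t, \<mu> t)) ((\<gamma> 0, \<mu> 0), tvec (prod_atlas M N) (pchart c d) (\<gamma> 0, \<mu> 0) (a, b))"
proof (rule tvec_curve(3)[OF smooth_atlas_prod[OF M N] pchart(1)[OF c(1) d(1)]])
  show "(\<gamma> 0, \<mu> 0) \<in> fst (pchart c d)" by (rule pchart(2)[OF c(2) d(2)])
  show "\<forall>\<^sub>F t in nhds 0. (\<gamma> t, \<mu> t) \<in> fst (pchart c d)"
    using c(3) d(3) by eventually_elim (rule pchart(2))
  show "((\<lambda>t. snd (pchart c d) (\<gamma> t, \<mu> t)) has_vector_derivative (a, b)) (at 0)"
    unfolding pchart(3) using has_vector_derivative_Pair[OF c(4) d(4)] .
qed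

lemma velocityD:
  assumes "has_velocity M \<gamma> v" "c \<in> M" "fst v \<in> fst c"
  shows "\<gamma> 0 \<in> fst c" "\<forall>\<^sub>F t in nhds 0. \<gamma> t \<in> fst c" "((\<lambda>t. snd c (\<gamma> t)) has_vector_derivative snd v c) (at 0)"
  using assms unfolding has_velocity_def by auto

lemma velocity_chart:
  assumes "v \<in> pts (tangent_bundle M)"
  obtains c where "c \<in> M" "fst v \<in> fst c"
  using assms unfolding mem_tangent_bundle by (blast elim: ptsE)

lemma Tmap_slice:
  assumes M: "smooth_atlas M" and N: "smooth_atlas N"
    and c: "c \<in> M" and d: "d \<in> N"
  shows "u \<in> pts (tangent_bundle M) \<Longrightarrow> fst u \<in> fst c \<Longrightarrow> q \<in> fst d \<Longrightarrow> Tmap M (prod_atlas M N) (\<lambda>x. (x, q)) u =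
      ((fst u, q), tvec (prod_atlas M N) (pchart c d) (fst u, q) (snd u c, 0))"
    "v \<in> pts (tangent_bundle N) \<Longrightarrow> fst v \<in> fst d \<Longrightarrow> p \<in> fst c \<Longrightarrow> Tmap N (prod_atlas M N) (\<lambda>y. (p, y)) v =
      ((p, fst v), tvec (prod_atlas M N) (pchart c d) (p, fst v) (0, snd v d))"
proof -
  note P = smooth_atlas_prod[OF M N]
  show "Tmap M (prod_atlas M N) (\<lambda>x. (x, q)) u =
      ((fst u, q), tvec (prod_atlas M N) (pchart c d) (fst u, q) (snd u c, 0))"
    if u: "u \<in> pts (tangent_bundle M)" "fst u \<in> fst c" "q \<in> fst d"
  proof (rule Tmap_eqI[OF M P smooth_map_slice(1)[OF M N ptsI[OF d u(3)]] u(1)])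
    fix \<gamma> assume \<gamma>: "has_velocity M \<gamma> u"
    show "has_velocity (prod_atlas M N) (\<lambda>t. (\<gamma> t, q))
        ((fst u, q), tvec (prod_atlas M N) (pchart c d) (fst u, q) (snd u c, 0))"
      using velocity_pair_chart[OF M N c velocityD[OF \<gamma> c u(2)] d, of "\<lambda>t. q" 0] u(3) velocity_base[OF \<gamma>] by simp
  qed
  show "Tmap N (prod_atlas M N) (\<lambda>y. (p, y)) v =
      ((p, fst v), tvec (prod_atlas M N) (pchart c d) (p, fst v) (0, snd v d))"
    if v: "v \<in> pts (tangent_bundle N)" "fst v \<in> fst d" "p \<in> fst c"
  proof (rule Tmap_eqI[OF N P smooth_map_slice(2)[OF M N ptsI[OF c v(3)]] v(1)])
    fix \<gamma> assume \<gamma>: "has_velocity N \<gamma> v"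
    show "has_velocity (prod_atlas M N) (\<lambda>t. (p, \<gamma> t))
        ((p, fst v), tvec (prod_atlas M N) (pchart c d) (p, fst v) (0, snd v d))"
      using velocity_pair_chart[OF M N c _ _ _ d velocityD[OF \<gamma> d v(2)], of "\<lambda>t. p" 0] v(3) velocity_base[OF \<gamma>] by simp
  qed
qed

lemma velocity_Pair:
  assumes M: "smooth_atlas M" and N: "smooth_atlas N"
    and \<gamma>: "has_velocity M \<gamma> u" and \<mu>: "has_velocity N \<mu> v"
  shows "has_velocity (prod_atlas M N) (\<lambda>t. (\<gamma> t, \<mu> t)) ((fst u, fst v), tpair M N u v)"
proof -
  note u = velocity_pts[OF \<gamma>] and v = velocity_pts[OF \<mu>]
  obtain c where c: "c \<in> M" "fst u \<in> fst c" using u by (rule velocity_chart)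
  obtain d where d: "d \<in> N" "fst v \<in> fst d" using v by (rule velocity_chart)
  have "tpair M N u v = tvec (prod_atlas M N) (pchart c d) (fst u, fst v) (snd u c, snd v d)"
    using tvec_linear(1)[OF smooth_atlas_prod[OF M N] pchart(1)[OF c(1) d(1)] pchart(2)[OF c(2) d(2)],
        of "(snd u c, 0)" "(0, snd v d)"]
    by (simp add: tpair_def Tmap_slice(1)[OF M N c(1) d(1) u c(2) d(2)] Tmap_slice(2)[OF M N c(1) d(1) v d(2) c(2)])
  then show ?thesis
    using velocity_pair_chart[OF M N c(1) velocityD[OF \<gamma> c] d(1) velocityD[OF \<mu> d]]
      velocity_base[OF \<gamma>] velocity_base[OF \<mu>] by simp
qed

text \<open>The velocity of the pair is a sum of two vectors tangent to slices, and the differential of \<^term>\<open>F\<close> is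
  linear.\<close>

lemma velocity_product_rule:
  assumes M: "smooth_atlas M" and N: "smooth_atlas N" and L: "smooth_atlas L"
    and F: "smooth_map (prod_atlas M N) L F"
    and \<gamma>: "has_velocity M \<gamma> u" and \<mu>: "has_velocity N \<mu> v"
  shows "has_velocity L (\<lambda>t. F (\<gamma> t, \<mu> t)) (F (fst u, fst v),
    snd (Tmap M L (\<lambda>x. F (x, fst v)) u) + snd (Tmap N L (\<lambda>y. F (fst u, y)) v))"
proof -
  note u = velocity_pts[OF \<gamma>] and v = velocity_pts[OF \<mu>] and P = smooth_atlas_prod[OF M N]
  let ?a = "Tmap M (prod_atlas M N) (\<lambda>x. (x, fst v)) u" and ?b = "Tmap N (prod_atlas M N) (\<lambda>y. (fst u, y)) v"
  have p: "fst u \<in> pts M" "fst v \<in> pts N" using u v by (simp_all add: mem_tangent_bundle)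
  have "?a \<in> pts (tangent_bundle (prod_atlas M N))" "?b \<in> pts (tangent_bundle (prod_atlas M N))"
    using Tmap_pts[OF M P smooth_map_slice(1)[OF M N p(2)] u] Tmap_pts[OF N P smooth_map_slice(2)[OF M N p(1)] v] .
  then have ab: "snd ?a \<in> tangent_space (prod_atlas M N) (fst u, fst v)"
    "snd ?b \<in> tangent_space (prod_atlas M N) (fst u, fst v)" by (simp_all add: mem_tangent_bundle)
  have "((fst u, fst v), snd ?a) = ?a" "((fst u, fst v), snd ?b) = ?b" by (simp_all add: prod_eq_iff)
  then have "Tmap (prod_atlas M N) L F ((fst u, fst v), snd ?a) = Tmap M L (\<lambda>x. F (x, fst v)) u"
    "Tmap (prod_atlas M N) L F ((fst u, fst v), snd ?b) = Tmap N L (\<lambda>y. F (fst u, y)) v"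
    using Tmap_comp[OF M P L smooth_map_slice(1)[OF M N p(2)] F u]
      Tmap_comp[OF N P L smooth_map_slice(2)[OF M N p(1)] F v] by simp_all
  then have "Tmap (prod_atlas M N) L F ((fst u, fst v), tpair M N u v) = (F (fst u, fst v),
      snd (Tmap M L (\<lambda>x. F (x, fst v)) u) + snd (Tmap N L (\<lambda>y. F (fst u, y)) v))"
    unfolding tpair_def using p Tmap_add_scale(1)[OF P L F _ ab] by (simp add: prod_eq_iff)
  then show ?thesis using velocity_Tmap[OF P L F velocity_Pair[OF M N \<gamma> \<mu>]] by simp
qed

text \<open>This is why fundamental vector fields are smooth: they are derivatives of the action in the direction
  of the group, taken at the unit.\<close>

lemma smooth_map_partial_derivative:
  fixes M :: "('a, 'e::real_inner) atlas" and N :: "('b, 'f::real_inner) atlas"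
  assumes M: "smooth_atlas M" and N: "smooth_atlas N" and L: "smooth_atlas L"
    and F: "smooth_map (prod_atlas M N) L F" and q: "q \<in> pts N"
  shows "smooth_map (prod_atlas M (fibre_atlas N q)) (tangent_bundle L) (\<lambda>(p, B). Tmap N L (\<lambda>y. F (p, y)) (q, B))"
proof -
  note P = smooth_atlas_prod[OF M N]
  let ?S = "prod_atlas M (fibre_atlas N q)" and ?i = "\<lambda>(p, B). Tmap N (prod_atlas M N) (\<lambda>y. (p, y)) (q, B)"
  have S: "smooth_atlas ?S" by (rule smooth_atlas_prod[OF M smooth_atlas_fibre[OF N]])
  have "smooth_map ?S (tangent_bundle (prod_atlas M N)) ?i"
  proof (rule smooth_map_chartsI[OF S smooth_atlas_tangent_bundle[OF P]])
    fix z assume "z \<in> pts ?S"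
    then have z: "fst z \<in> pts M" "snd z \<in> tangent_space N q" by (auto simp: pts_fibre_atlas[OF q])
    obtain c where c: "c \<in> M" "fst z \<in> fst c" using z(1) by (rule ptsE)
    obtain d where d: "d \<in> N" "q \<in> fst d" using q by (rule ptsE)
    let ?d = "(tangent_space N q, \<lambda>A. A d)"
    let ?e = "pchart c ?d" and ?G = "\<lambda>(x, w). ((x, snd d q), (0::'e, w))"
    have e: "?e \<in> ?S" by (rule pchart(1)[OF c(1) fibre_atlasI[OF d]])
    have "?i y \<in> fst (tchart (prod_atlas M N) (pchart c d)) \<and>
        snd (tchart (prod_atlas M N) (pchart c d)) (?i y) = ?G (snd ?e y)" if y: "y \<in> fst ?e" for y
    proof -
      obtain p B where y': "y = (p, B)" "p \<in> fst c" "B \<in> tangent_space N q"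
        using y by (auto simp: pchart_def)
      have "(q, B) \<in> pts (tangent_bundle N)" using q y' by (simp add: pts_tangent_bundle)
      then have "?i y = ((p, q), tvec (prod_atlas M N) (pchart c d) (p, q) (0, B d))"
        using Tmap_slice(2)[OF M N c(1) d(1), of "(q, B)" p] d(2) y' by simp
      then show ?thesis
        using tvec[OF P pchart(1)[OF c(1) d(1)] pchart(2)[OF y'(2) d(2)]] y' d(2)
        by (simp add: mem_tchart snd_tchart pchart(2,3))
    qed
    moreover have "smooth_on (snd ?e ` fst ?e) ?G"
    proof -
      have o: "open (snd ?e ` fst ?e)" by (rule smooth_atlasD(5)[OF S e])
      have "bounded_linear (\<lambda>z. ((fst z, 0), (0, snd z)) :: ('e \<times> 'f) \<times> ('e \<times> 'f))"
        by (intro bounded_linear_Pair bounded_linear_fst bounded_linear_snd bounded_linear_zero)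
      from smooth_on_add[OF o smooth_on_bounded_linear[OF o this] smooth_on_const[OF o, of "((0, snd d q), (0, 0))"]]
      show ?thesis by (simp add: case_prod_beta')
    qed
    moreover have "z \<in> fst ?e" using z c by (simp add: pchart_def mem_Times_iff)
    ultimately show "\<exists>e\<in>?S. \<exists>d\<in>tangent_bundle (prod_atlas M N). \<exists>G. z \<in> fst e \<and>
        (\<forall>y\<in>fst e. ?i y \<in> fst d \<and> snd d (?i y) = G (snd e y)) \<and> smooth_on (snd e ` fst e) G"
      unfolding tangent_bundle_tchart using e pchart(1)[OF c(1) d(1)]
      by (intro bexI[OF _ e] bexI[OF _ imageI[OF pchart(1)[OF c(1) d(1)]]] exI[of _ ?G]) blast
  qed
  then have "smooth_map ?S (tangent_bundle L) (\<lambda>z. Tmap (prod_atlas M N) L F (?i z))"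
    by (rule smooth_map_comp[OF S smooth_atlas_tangent_bundle[OF P] smooth_atlas_tangent_bundle[OF L] _
        smooth_map_Tmap[OF P L F]])
  then show ?thesis
  proof (rule smooth_map_cong[OF _ S])
    fix z assume "z \<in> pts ?S"
    then have z: "fst z \<in> pts M" "snd z \<in> tangent_space N q" by (auto simp: pts_fibre_atlas[OF q])
    then show "Tmap (prod_atlas M N) L F (?i z) = (case z of (p, B) \<Rightarrow> Tmap N L (\<lambda>y. F (p, y)) (q, B))"
      using Tmap_comp[OF N P L smooth_map_slice(2)[OF M N z(1)] F, of "(q, snd z)"] q
      by (simp add: split_beta pts_tangent_bundle)
  qed
qed

subsection \<open>Lifting curves through submersions\<close>

text \<open>The coordinate version is the lifting of curves through maps with surjective derivative.\<close>

lemma submersion_lift: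
  assumes M: "smooth_atlas M" and N: "smooth_atlas N" and f: "submersion M N f"
    and u: "u \<in> pts (tangent_bundle M)" and \<beta>: "has_velocity N \<beta> (Tmap M N f u)"
  obtains \<gamma> where "has_velocity M \<gamma> u" "\<forall>\<^sub>F t in nhds 0. f (\<gamma> t) = \<beta> t"
proof -
  have fs: "smooth_map M N f" using f unfolding submersion_def by simp
  obtain p \<xi> where u': "u = (p, \<xi>)" by (cases u)
  have p: "p \<in> pts M" "\<xi> \<in> tangent_space M p" using u u' by (simp_all add: mem_tangent_bundle)
  obtain c where c: "c \<in> M" "p \<in> fst c" using p(1) by (rule ptsE)
  obtain d where d: "d \<in> N" "f p \<in> fst d" using smooth_mapD(1)[OF fs p(1)] by (rule ptsE)
  let ?U = "snd c ` {p \<in> fst c. f p \<in> fst d}" and ?f = "\<lambda>x. snd d (f (chart_inv c x))"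
  let ?D = "frechet_derivative ?f (at (snd c p))"
  have surj: "surj ?D"
  proof (rule surjI)
    fix w
    have "tvec N d (f p) w \<in> (\<lambda>\<xi>. snd (Tmap M N f (p, \<xi>))) ` tangent_space M p"
      using f p(1) tvec(1)[OF N d] unfolding submersion_def by simp
    then have "\<exists>\<xi>'. \<xi>' \<in> tangent_space M p \<and> tvec N d (f p) w = snd (Tmap M N f (p, \<xi>'))" by blast
    then have *: "(SOME \<xi>'. \<xi>' \<in> tangent_space M p \<and> tvec N d (f p) w = snd (Tmap M N f (p, \<xi>'))) \<in> tangent_space M p \<and>
        tvec N d (f p) w = snd (Tmap M N f (p, (SOME \<xi>'. \<xi>' \<in> tangent_space M p \<and> tvec N d (f p) w = snd (Tmap M N f (p, \<xi>')))))"
      by (rule someI_ex)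
    show "?D ((SOME \<xi>'. \<xi>' \<in> tangent_space M p \<and> tvec N d (f p) w = snd (Tmap M N f (p, \<xi>'))) c) = w"
      using Tmap_coord[OF M N fs conjunct1[OF *] c d] conjunct2[OF *] tvec(2)[OF N d] by simp
  qed
  have pU: "snd c p \<in> ?U" using c d by simp
  have "fst (Tmap M N f u) \<in> fst d" using d u' by simp
  note \<beta>d = velocityD[OF \<beta> d(1) this]
  have b0: "snd d (\<beta> 0) = ?f (snd c p)"
    using velocity_base[OF \<beta>] u' smooth_atlasD(6)[OF M c] by simp
  have bv: "((\<lambda>t. snd d (\<beta> t)) has_vector_derivative ?D (\<xi> c)) (at 0)"
    using \<beta>d(3) Tmap_coord[OF M N fs p(2) c d] u' by simp
  have "\<exists>\<gamma>'. \<gamma>' 0 = snd c p \<and> (\<gamma>' has_vector_derivative \<xi> c) (at 0) \<and>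
      (\<forall>\<^sub>F t in nhds 0. \<gamma>' t \<in> ?U \<and> ?f (\<gamma>' t) = snd d (\<beta> t))"
    by (rule lift_curve[OF smooth_atlasD(1)[OF M] smooth_atlasD(1)[OF N] smooth_mapD(2)[OF fs c(1) d(1)]
          pU smooth_mapD(3)[OF fs c(1) d(1)] surj b0 bv])
  then obtain \<gamma>' where \<gamma>': "\<gamma>' 0 = snd c p" "(\<gamma>' has_vector_derivative \<xi> c) (at 0)"
    "\<forall>\<^sub>F t in nhds 0. \<gamma>' t \<in> ?U \<and> ?f (\<gamma>' t) = snd d (\<beta> t)" by (elim exE conjE)
  let ?\<gamma> = "\<lambda>t. chart_inv c (\<gamma>' t)"
  have ev: "\<forall>\<^sub>F t in nhds 0. ?\<gamma> t \<in> fst c \<and> \<gamma>' t = snd c (?\<gamma> t) \<and> f (?\<gamma> t) = \<beta> t"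
    using \<gamma>'(3) \<beta>d(2)
  proof eventually_elim
    case (elim t)
    then obtain x where "x \<in> fst c" "f x \<in> fst d" "\<gamma>' t = snd c x" by blast
    then show ?case
      using elim smooth_atlasD(6)[OF M c(1)] inj_onD[OF smooth_atlasD(2)[OF N d(1)], of "f x" "\<beta> t"] by simp
  qed
  have "?\<gamma> 0 = p" using \<gamma>'(1) smooth_atlasD(6)[OF M c] by simp
  moreover have "\<forall>\<^sub>F t in nhds 0. ?\<gamma> t \<in> fst c" using ev by eventually_elim simp
  moreover have "\<forall>\<^sub>F t in nhds 0. \<gamma>' t = snd c (?\<gamma> t)" using ev by eventually_elim simp
  then have "((\<lambda>t. snd c (?\<gamma> t)) has_vector_derivative \<xi> c) (at 0)"
    by (rule has_vector_derivative_cong_ev[OF \<gamma>'(2)])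
  ultimately have "has_velocity M ?\<gamma> (p, tvec M c p (\<xi> c))"
    using tvec_curve(3)[OF M c(1), of ?\<gamma>] c(2) by simp
  then have "has_velocity M ?\<gamma> u" using tangent_space_tvec[OF p(2) c] u' by simp
  moreover have "\<forall>\<^sub>F t in nhds 0. f (?\<gamma> t) = \<beta> t" using ev by eventually_elim simp
  ultimately show ?thesis by (rule that)
qed

section \<open>Functors, transformations and their compositions\<close>

lemma categoryD:
  assumes "category C"
  shows "x \<in> Mor C \<Longrightarrow> Src C x \<in> Ob C" "x \<in> Mor C \<Longrightarrow> Tgt C x \<in> Ob C"
    "u \<in> Ob C \<Longrightarrow> Idn C u \<in> Mor C" "u \<in> Ob C \<Longrightarrow> Src C (Idn C u) = u" "u \<in> Ob C \<Longrightarrow> Tgt C (Idn C u) = u"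
    "x \<in> Mor C \<Longrightarrow> y \<in> Mor C \<Longrightarrow> Src C y = Tgt C x \<Longrightarrow> Cmp C y x \<in> Mor C"
    "x \<in> Mor C \<Longrightarrow> y \<in> Mor C \<Longrightarrow> Src C y = Tgt C x \<Longrightarrow> Src C (Cmp C y x) = Src C x"
    "x \<in> Mor C \<Longrightarrow> y \<in> Mor C \<Longrightarrow> Src C y = Tgt C x \<Longrightarrow> Tgt C (Cmp C y x) = Tgt C y"
    "x \<in> Mor C \<Longrightarrow> Cmp C x (Idn C (Src C x)) = x" "x \<in> Mor C \<Longrightarrow> Cmp C (Idn C (Tgt C x)) x = x"
    "x \<in> Mor C \<Longrightarrow> y \<in> Mor C \<Longrightarrow> z \<in> Mor C \<Longrightarrow> Src C y = Tgt C x \<Longrightarrow> Src C z = Tgt C y \<Longrightarrow>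
       Cmp C z (Cmp C y x) = Cmp C (Cmp C z y) x"
  using assms unfolding category_def by (simp_all add: Pi_iff)

lemma is_functorD:
  assumes "is_functor C D F"
  shows "u \<in> Ob C \<Longrightarrow> fst F u \<in> Ob D" "x \<in> Mor C \<Longrightarrow> snd F x \<in> Mor D"
    "x \<in> Mor C \<Longrightarrow> Src D (snd F x) = fst F (Src C x)" "x \<in> Mor C \<Longrightarrow> Tgt D (snd F x) = fst F (Tgt C x)"
    "u \<in> Ob C \<Longrightarrow> snd F (Idn C u) = Idn D (fst F u)"
    "x \<in> Mor C \<Longrightarrow> y \<in> Mor C \<Longrightarrow> Src C y = Tgt C x \<Longrightarrow> snd F (Cmp C y x) = Cmp D (snd F y) (snd F x)"
  using assms unfolding is_functor_def by (simp_all add: Pi_iff)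

lemma nat_transD:
  assumes "nat_trans C D F F' \<eta>"
  shows "u \<in> Ob C \<Longrightarrow> \<eta> u \<in> Mor D" "u \<in> Ob C \<Longrightarrow> Src D (\<eta> u) = fst F u" "u \<in> Ob C \<Longrightarrow> Tgt D (\<eta> u) = fst F' u"
    "x \<in> Mor C \<Longrightarrow> Cmp D (\<eta> (Tgt C x)) (snd F x) = Cmp D (snd F' x) (\<eta> (Src C x))"
  using assms unfolding nat_trans_def by simp_all

text \<open>Both compositions act on triples that contain the source and the target functor. On extensional
  triples their laws are plain equations.\<close>

definition ntrans :: "('o, 'a, 'z) cat_scheme \<Rightarrow> ('o2, 'a2, 'z2) cat_scheme \<Rightarrow>
    (('o \<Rightarrow> 'o2) \<times> ('a \<Rightarrow> 'a2), 'o \<Rightarrow> 'a2) trans set" where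
  "ntrans C D = {(F, \<eta>, F'). is_functor C D F \<and> extensional_functor C F \<and>
     is_functor C D F' \<and> extensional_functor C F' \<and> \<eta> \<in> extensional (Ob C) \<and> nat_trans C D F F' \<eta>}"

lemma ntransD:
  assumes "(F, \<eta>, F') \<in> ntrans C D"
  shows "is_functor C D F" "is_functor C D F'" "extensional_functor C F" "extensional_functor C F'"
    "\<eta> \<in> extensional (Ob C)" "nat_trans C D F F' \<eta>"
  using assms unfolding ntrans_def by auto

lemma functor_eqI:
  assumes "extensional_functor C F" "extensional_functor C G"
    and "\<And>u. u \<in> Ob C \<Longrightarrow> fst F u = fst G u" "\<And>x. x \<in> Mor C \<Longrightarrow> snd F x = snd G x"
  shows "F = G"
  using assms unfolding extensional_functor_def by (auto intro!: prod_eqI intro: extensionalityI)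

lemma extensional_comp_functor: "extensional_functor C (comp_functor C K F)"
  unfolding extensional_functor_def comp_functor_def by simp

lemma extensional_id_functor: "extensional_functor C (id_functor C)"
  unfolding extensional_functor_def id_functor_def by simp

lemma comp_functor_apply:
  "u \<in> Ob C \<Longrightarrow> fst (comp_functor C K F) u = fst K (fst F u)"
  "x \<in> Mor C \<Longrightarrow> snd (comp_functor C K F) x = snd K (snd F x)"
  unfolding comp_functor_def by simp_all

lemma id_functor_apply:
  "u \<in> Ob C \<Longrightarrow> fst (id_functor C) u = u" "x \<in> Mor C \<Longrightarrow> snd (id_functor C) x = x"
  unfolding id_functor_def by simp_all

lemma is_functor_comp:
  assumes C: "category C" and F: "is_functor C D F" and K: "is_functor D B K"
  shows "is_functor C B (comp_functor C K F)"
  unfolding is_functor_def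
  by (intro conjI ballI impI funcsetI)
    (simp_all add: comp_functor_apply categoryD[OF C] is_functorD[OF F] is_functorD[OF K])

lemma is_functor_id: "category C \<Longrightarrow> is_functor C C (id_functor C)"
  unfolding is_functor_def
  by (intro conjI ballI impI funcsetI) (simp_all add: id_functor_apply categoryD)

lemma comp_functor_assoc:
  assumes "is_functor C D F"
  shows "comp_functor C (comp_functor D L K) F = comp_functor C L (comp_functor C K F)"
  by (rule functor_eqI[OF extensional_comp_functor extensional_comp_functor])
    (simp_all add: comp_functor_apply is_functorD[OF assms])

lemma comp_functor_id:
  assumes "is_functor C D F" "extensional_functor C F"
  shows "comp_functor C F (id_functor C) = F" "comp_functor C (id_functor D) F = F"
  using assms
  by (auto intro!: functor_eqI[OF extensional_comp_functor] simp: comp_functor_apply id_functor_apply is_functorD)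

lemma hcomp_apply:
  "hcomp C D (K, \<eta>', K') (F, \<eta>, F') = (comp_functor C K F,
     \<lambda>u\<in>Ob C. Cmp D (\<eta>' (fst F' u)) (snd K (\<eta> u)), comp_functor C K' F')"
  unfolding hcomp_def by simp

lemma vcomp_apply: "vcomp C D (F', \<eta>', F'') (F, \<eta>, G) = (F, \<lambda>u\<in>Ob C. Cmp D (\<eta>' u) (\<eta> u), F'')"
  unfolding vcomp_def by simp

lemma nat_trans_hcomp:
  assumes C: "category C" and D: "category D" and B: "category B"
    and K: "is_functor D B K" "is_functor D B K'" "nat_trans D B K K' \<eta>'"
    and F: "is_functor C D F" "is_functor C D F'" "nat_trans C D F F' \<eta>"
  shows "nat_trans C B (comp_functor C K F) (comp_functor C K' F') (\<lambda>u\<in>Ob C. Cmp B (\<eta>' (fst F' u)) (snd K (\<eta> u)))"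
  unfolding nat_trans_def
proof (intro conjI ballI)
  note facts = categoryD[OF C] categoryD(1-8)[OF D] categoryD(1-8)[OF B] is_functorD[OF K(1)] is_functorD[OF K(2)]
    is_functorD(1-5)[OF F(1)] is_functorD(1-5)[OF F(2)] nat_transD(1-3)[OF K(3)] nat_transD(1-3)[OF F(3)] comp_functor_apply
  fix x assume x: "x \<in> Mor C"
  let ?s = "Src C x" and ?t = "Tgt C x"
  have "Cmp B (Cmp B (\<eta>' (fst F' ?t)) (snd K (\<eta> ?t))) (snd K (snd F x)) =
      Cmp B (\<eta>' (fst F' ?t)) (snd K (Cmp D (\<eta> ?t) (snd F x)))"
    using x by (simp add: facts categoryD(11)[OF B, symmetric])
  also have "\<dots> = Cmp B (\<eta>' (fst F' ?t)) (snd K (Cmp D (snd F' x) (\<eta> ?s)))"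
    using x by (simp add: nat_transD(4)[OF F(3)])
  also have "\<dots> = Cmp B (Cmp B (\<eta>' (Tgt D (snd F' x))) (snd K (snd F' x))) (snd K (\<eta> ?s))"
    using x by (simp add: facts categoryD(11)[OF B])
  also have "\<dots> = Cmp B (Cmp B (snd K' (snd F' x)) (\<eta>' (Src D (snd F' x)))) (snd K (\<eta> ?s))"
    using nat_transD(4)[OF K(3), of "snd F' x"] x by (simp add: facts)
  also have "\<dots> = Cmp B (snd K' (snd F' x)) (Cmp B (\<eta>' (fst F' ?s)) (snd K (\<eta> ?s)))"
    using x by (simp add: facts categoryD(11)[OF B])
  finally show "Cmp B ((\<lambda>u\<in>Ob C. Cmp B (\<eta>' (fst F' u)) (snd K (\<eta> u))) ?t) (snd (comp_functor C K F) x) =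
      Cmp B (snd (comp_functor C K' F') x) ((\<lambda>u\<in>Ob C. Cmp B (\<eta>' (fst F' u)) (snd K (\<eta> u))) ?s)"
    using x by (simp add: comp_functor_apply categoryD[OF C])
qed (simp_all add: categoryD[OF C] categoryD(1-8)[OF D] categoryD(1-8)[OF B] is_functorD[OF K(1)] is_functorD[OF K(2)]
    is_functorD(1-5)[OF F(1)] is_functorD(1-5)[OF F(2)] nat_transD(1-3)[OF K(3)] nat_transD(1-3)[OF F(3)] comp_functor_apply)

lemma hcomp_ntrans:
  assumes C: "category C" and D: "category D" and B: "category B"
    and "\<zeta> \<in> ntrans D B" "\<xi> \<in> ntrans C D"
  shows "hcomp C B \<zeta> \<xi> \<in> ntrans C B"
proof -
  obtain K \<eta>' K' F \<eta> F' where [simp]: "\<zeta> = (K, \<eta>', K')" "\<xi> = (F, \<eta>, F')" by (metis prod_cases3)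
  note k = ntransD[OF assms(4)[simplified]] and f = ntransD[OF assms(5)[simplified]]
  show ?thesis
    unfolding ntrans_def using nat_trans_hcomp[OF C D B k(1,2,6) f(1,2,6)]
    by (simp add: hcomp_apply extensional_comp_functor is_functor_comp[OF C f(1) k(1)] is_functor_comp[OF C f(2) k(2)])
qed

lemma vcomp_ntrans:
  assumes C: "category C" and D: "category D"
    and "(F', \<eta>', F'') \<in> ntrans C D" "(F, \<eta>, F') \<in> ntrans C D"
  shows "vcomp C D (F', \<eta>', F'') (F, \<eta>, F') \<in> ntrans C D"
proof -
  note a = ntransD[OF assms(3)] and b = ntransD[OF assms(4)]
  note facts = categoryD(1-8)[OF C] categoryD(1-8)[OF D] is_functorD(1-5)[OF a(1)] is_functorD(1-5)[OF a(2)] is_functorD(1-5)[OF b(1)]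
    nat_transD(1-3)[OF a(6)] nat_transD(1-3)[OF b(6)]
  have "nat_trans C D F F'' (\<lambda>u\<in>Ob C. Cmp D (\<eta>' u) (\<eta> u))"
    unfolding nat_trans_def
  proof (intro conjI ballI)
    fix x assume x: "x \<in> Mor C"
    let ?s = "Src C x" and ?t = "Tgt C x"
    have "Cmp D (Cmp D (\<eta>' ?t) (\<eta> ?t)) (snd F x) = Cmp D (\<eta>' ?t) (Cmp D (snd F' x) (\<eta> ?s))"
      using x by (simp add: facts categoryD(11)[OF D, symmetric] nat_transD(4)[OF b(6)])
    also have "\<dots> = Cmp D (Cmp D (snd F'' x) (\<eta>' ?s)) (\<eta> ?s)"
      using x by (simp add: facts categoryD(11)[OF D] nat_transD(4)[OF a(6)])
    also have "\<dots> = Cmp D (snd F'' x) (Cmp D (\<eta>' ?s) (\<eta> ?s))"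
      using x by (simp add: facts categoryD(11)[OF D])
    finally show "Cmp D ((\<lambda>u\<in>Ob C. Cmp D (\<eta>' u) (\<eta> u)) ?t) (snd F x) =
        Cmp D (snd F'' x) ((\<lambda>u\<in>Ob C. Cmp D (\<eta>' u) (\<eta> u)) ?s)"
      using x by (simp add: facts)
  qed (simp_all add: facts)
  then show ?thesis using a b by (simp add: vcomp_apply ntrans_def)
qed

lemma id_trans_ntrans:
  assumes "category C" "category D" "is_functor C D F" "extensional_functor C F"
  shows "(F, id_trans C D (fst F), F) \<in> ntrans C D"
proof -
  note facts = categoryD[OF assms(1)] categoryD(1-8)[OF assms(2)] is_functorD[OF assms(3)]
  have "nat_trans C D F F (id_trans C D (fst F))"
    unfolding nat_trans_def id_trans_def
  proof (intro conjI ballI)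
    fix x assume x: "x \<in> Mor C"
    have "Cmp D (Idn D (Tgt D (snd F x))) (snd F x) = Cmp D (snd F x) (Idn D (Src D (snd F x)))"
      using categoryD(9,10)[OF assms(2) is_functorD(2)[OF assms(3) x]] by simp
    then show "Cmp D ((\<lambda>u\<in>Ob C. Idn D (fst F u)) (Tgt C x)) (snd F x) = Cmp D (snd F x) ((\<lambda>u\<in>Ob C. Idn D (fst F u)) (Src C x))"
      using x by (simp add: facts)
  qed (simp_all add: facts)
  then show ?thesis using assms by (simp add: ntrans_def id_trans_def)
qed

lemma hcomp_assoc:
  assumes C: "category C" and D: "category D" and A: "category A" and B: "category B"
    and "\<zeta> \<in> ntrans A B" "\<nu> \<in> ntrans D A" "\<xi> \<in> ntrans C D"
  shows "hcomp C B (hcomp D B \<zeta> \<nu>) \<xi> = hcomp C B \<zeta> (hcomp C A \<nu> \<xi>)"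
proof -
  obtain L \<zeta>' L' K \<eta>' K' F \<eta> F' where e: "\<zeta> = (L, \<zeta>', L')" "\<nu> = (K, \<eta>', K')" "\<xi> = (F, \<eta>, F')" by (metis prod_cases3)
  note l = ntransD[OF assms(5)[unfolded e]] and k = ntransD[OF assms(6)[unfolded e]] and f = ntransD[OF assms(7)[unfolded e]]
  note facts = categoryD(1-8)[OF C] categoryD(1-8)[OF D] categoryD(1-8)[OF A] categoryD(1-8)[OF B]
    is_functorD(1-5)[OF l(1)] is_functorD(1-5)[OF l(2)] is_functorD(1-5)[OF k(1)] is_functorD(1-5)[OF k(2)]
    is_functorD(1-5)[OF f(1)] is_functorD(1-5)[OF f(2)] nat_transD(1-3)[OF l(6)] nat_transD(1-3)[OF k(6)] nat_transD(1-3)[OF f(6)]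
    comp_functor_apply
  have "Cmp B (Cmp B (\<zeta>' (fst K' (fst F' u))) (snd L (\<eta>' (fst F' u)))) (snd L (snd K (\<eta> u))) =
      Cmp B (\<zeta>' (fst K' (fst F' u))) (snd L (Cmp A (\<eta>' (fst F' u)) (snd K (\<eta> u))))" if "u \<in> Ob C" for u
    using that by (simp add: facts is_functorD(6)[OF l(1)] categoryD(11)[OF B])
  then show ?thesis
    unfolding e hcomp_apply prod.inject
    by (auto simp: comp_functor_assoc[OF f(1)] comp_functor_assoc[OF f(2)] facts intro!: restrict_ext)
qed

lemma hcomp_id_right:
  assumes C: "category C" and D: "category D" and "\<zeta> \<in> ntrans C D"
  shows "hcomp C D \<zeta> (id_functor C, id_trans C C (\<lambda>p. p), id_functor C) = \<zeta>"
proof -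
  obtain K \<eta> K' where e: "\<zeta> = (K, \<eta>, K')" by (metis prod_cases3)
  note k = ntransD[OF assms(3)[unfolded e]]
  have "(\<lambda>u\<in>Ob C. Cmp D (\<eta> (fst (id_functor C) u)) (snd K (id_trans C C (\<lambda>p. p) u))) = \<eta>"
    using k(5) categoryD(9)[OF D nat_transD(1)[OF k(6)]]
    by (auto intro!: extensionalityI[of _ "Ob C"] simp: id_functor_apply id_trans_def is_functorD[OF k(1)] nat_transD(2)[OF k(6)])
  then show ?thesis
    unfolding e hcomp_apply by (simp add: comp_functor_id[OF k(1,3)] comp_functor_id[OF k(2,4)])
qed

lemma hcomp_id_left:
  assumes C: "category C" and D: "category D" and "\<zeta> \<in> ntrans C D"
  shows "hcomp C D (id_functor D, id_trans D D (\<lambda>p. p), id_functor D) \<zeta> = \<zeta>"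
proof -
  obtain K \<eta> K' where e: "\<zeta> = (K, \<eta>, K')" by (metis prod_cases3)
  note k = ntransD[OF assms(3)[unfolded e]]
  have "(\<lambda>u\<in>Ob C. Cmp D (id_trans D D (\<lambda>p. p) (fst K' u)) (snd (id_functor D) (\<eta> u))) = \<eta>"
    using k(5) categoryD(10)[OF D nat_transD(1)[OF k(6)]]
    by (auto intro!: extensionalityI[of _ "Ob C"]
        simp: id_functor_apply id_trans_def is_functorD[OF k(2)] nat_transD(1,3)[OF k(6)])
  then show ?thesis
    unfolding e hcomp_apply by (simp add: comp_functor_id[OF k(1,3)] comp_functor_id[OF k(2,4)])
qed

lemma hcomp_id_id:
  assumes C: "category C" and B: "category B" and F: "is_functor C D F" and K: "is_functor D B K"
  shows "hcomp C B (K, id_trans D B (fst K), K) (F, id_trans C D (fst F), F) =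
    (comp_functor C K F, id_trans C B (fst (comp_functor C K F)), comp_functor C K F)"
proof -
  have "Cmp B (id_trans D B (fst K) (fst F u)) (snd K (id_trans C D (fst F) u)) = Idn B (fst K (fst F u))"
    if u: "u \<in> Ob C" for u
    using categoryD(9)[OF B categoryD(3)[OF B], of "fst K (fst F u)"] u
    by (simp add: id_trans_def is_functorD[OF F] is_functorD[OF K] categoryD(4)[OF B])
  then show ?thesis
    unfolding hcomp_apply by (auto simp: id_trans_def comp_functor_apply intro!: restrict_ext)
qed

lemma hcomp_interchange:
  assumes C: "category C" and D: "category D" and B: "category B"
    and K: "(K1, \<kappa>, K2) \<in> ntrans D B" "(K2, \<kappa>', K3) \<in> ntrans D B"
    and F: "(F1, \<eta>, F2) \<in> ntrans C D" "(F2, \<eta>', F3) \<in> ntrans C D"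
  shows "hcomp C B (vcomp D B (K2, \<kappa>', K3) (K1, \<kappa>, K2)) (vcomp C D (F2, \<eta>', F3) (F1, \<eta>, F2)) =
    vcomp C B (hcomp C B (K2, \<kappa>', K3) (F2, \<eta>', F3)) (hcomp C B (K1, \<kappa>, K2) (F1, \<eta>, F2))"
proof -
  note k = ntransD[OF K(1)] and k' = ntransD[OF K(2)] and f = ntransD[OF F(1)] and f' = ntransD[OF F(2)]
  note facts = categoryD(1-8)[OF C] categoryD(1-8)[OF D] categoryD(1-8)[OF B]
    is_functorD(1-5)[OF k(1)] is_functorD(1-5)[OF k'(1)] is_functorD(1-5)[OF k'(2)]
    is_functorD(1-5)[OF f(1)] is_functorD(1-5)[OF f'(1)] is_functorD(1-5)[OF f'(2)]
    nat_transD(1-3)[OF k(6)] nat_transD(1-3)[OF k'(6)] nat_transD(1-3)[OF f(6)] nat_transD(1-3)[OF f'(6)]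
  have "Cmp B (Cmp B (\<kappa>' (fst F3 u)) (\<kappa> (fst F3 u))) (snd K1 (Cmp D (\<eta>' u) (\<eta> u))) =
      Cmp B (Cmp B (\<kappa>' (fst F3 u)) (snd K2 (\<eta>' u))) (Cmp B (\<kappa> (fst F2 u)) (snd K1 (\<eta> u)))"
    if u: "u \<in> Ob C" for u
  proof -
    have nat: "Cmp B (\<kappa> (fst F3 u)) (snd K1 (\<eta>' u)) = Cmp B (snd K2 (\<eta>' u)) (\<kappa> (fst F2 u))"
      using nat_transD(4)[OF k(6), of "\<eta>' u"] u by (simp add: facts)
    have "Cmp B (Cmp B (\<kappa>' (fst F3 u)) (\<kappa> (fst F3 u))) (snd K1 (Cmp D (\<eta>' u) (\<eta> u))) =
        Cmp B (\<kappa>' (fst F3 u)) (Cmp B (Cmp B (\<kappa> (fst F3 u)) (snd K1 (\<eta>' u))) (snd K1 (\<eta> u)))"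
      using u by (simp add: facts is_functorD(6)[OF k(1)] categoryD(11)[OF B])
    also have "\<dots> = Cmp B (\<kappa>' (fst F3 u)) (Cmp B (Cmp B (snd K2 (\<eta>' u)) (\<kappa> (fst F2 u))) (snd K1 (\<eta> u)))"
      by (simp only: nat)
    also have "\<dots> = Cmp B (Cmp B (\<kappa>' (fst F3 u)) (snd K2 (\<eta>' u))) (Cmp B (\<kappa> (fst F2 u)) (snd K1 (\<eta> u)))"
      using u by (simp add: facts categoryD(11)[OF B])
    finally show ?thesis .
  qed
  then show ?thesis
    unfolding hcomp_apply vcomp_apply prod.inject
    by (auto simp: facts intro!: restrict_ext)
qed

text \<open>The laws by which natural transformations are the arrows of a category.\<close>

lemma vcomp_assoc:
  assumes D: "category D" and "(F1, \<eta>1, F2) \<in> ntrans C D" "(F2, \<eta>2, F3) \<in> ntrans C D" "(F3, \<eta>3, F4) \<in> ntrans C D"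
  shows "vcomp C D (F3, \<eta>3, F4) (vcomp C D (F2, \<eta>2, F3) (F1, \<eta>1, F2)) =
    vcomp C D (vcomp C D (F3, \<eta>3, F4) (F2, \<eta>2, F3)) (F1, \<eta>1, F2)"
proof -
  note a = ntransD(6)[OF assms(2)] and b = ntransD(6)[OF assms(3)] and c = ntransD(6)[OF assms(4)]
  show ?thesis
    unfolding vcomp_apply
    by (auto simp: nat_transD(1-3)[OF a] nat_transD(1-3)[OF b] nat_transD(1-3)[OF c] categoryD(11)[OF D] intro!: restrict_ext)
qed

lemma vcomp_id:
  assumes D: "category D" and "(F, \<eta>, F') \<in> ntrans C D"
  shows "vcomp C D (F, \<eta>, F') (F, id_trans C D (fst F), F) = (F, \<eta>, F')"
    "vcomp C D (F', id_trans C D (fst F'), F') (F, \<eta>, F') = (F, \<eta>, F')"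
proof -
  note a = ntransD(5,6)[OF assms(2)]
  have "Cmp D (\<eta> u) (Idn D (fst F u)) = \<eta> u" "Cmp D (Idn D (fst F' u)) (\<eta> u) = \<eta> u" if "u \<in> Ob C" for u
    using categoryD(9,10)[OF D nat_transD(1)[OF a(2) that]] nat_transD(2,3)[OF a(2) that] by simp_all
  then show "vcomp C D (F, \<eta>, F') (F, id_trans C D (fst F), F) = (F, \<eta>, F')"
    "vcomp C D (F', id_trans C D (fst F'), F') (F, \<eta>, F') = (F, \<eta>, F')"
    unfolding vcomp_apply id_trans_def using a(1)
    by (auto intro!: extensionalityI[of _ "Ob C"])
qed

section \<open>The tangent groupoid\<close>

lemma lie_groupoidD:
  assumes "lie_groupoid E"
  shows "category E" "smooth_atlas (ob_charts E)" "smooth_atlas (mor_charts E)"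
    "pts (ob_charts E) = Ob E" "pts (mor_charts E) = Mor E"
    "submersion (mor_charts E) (ob_charts E) (Src E)" "submersion (mor_charts E) (ob_charts E) (Tgt E)"
    "smooth_map (mor_charts E) (ob_charts E) (Src E)" "smooth_map (mor_charts E) (ob_charts E) (Tgt E)"
    "smooth_map (ob_charts E) (mor_charts E) (Idn E)" "smooth_map (mor_charts E) (mor_charts E) (arrow_inv E)"
    "smooth_map_on (prod_atlas (mor_charts E) (mor_charts E))
       {(y, x). y \<in> Mor E \<and> x \<in> Mor E \<and> Src E y = Tgt E x} (mor_charts E) (\<lambda>(y, x). Cmp E y x)"
    "x \<in> Mor E \<Longrightarrow> \<exists>y. inverse_arrows E x y"
  using assms unfolding lie_groupoid_def submersion_def by (auto intro: manifold_smooth_atlas)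

lemma tangent_gpd_simps [simp]:
  "Ob (tangent_gpd E) = pts (tangent_bundle (ob_charts E))"
  "Mor (tangent_gpd E) = pts (tangent_bundle (mor_charts E))"
  "Src (tangent_gpd E) = Tmap (mor_charts E) (ob_charts E) (Src E)"
  "Tgt (tangent_gpd E) = Tmap (mor_charts E) (ob_charts E) (Tgt E)"
  "Idn (tangent_gpd E) = Tmap (ob_charts E) (mor_charts E) (Idn E)"
  "Cmp (tangent_gpd E) = tangent_Cmp E"
  "ob_charts (tangent_gpd E) = tangent_bundle (ob_charts E)"
  "mor_charts (tangent_gpd E) = tangent_bundle (mor_charts E)"
  unfolding tangent_gpd_def by simp_all

text \<open>The composition of tangent arrows is computed by any composable curves; existence of such curves
  is a separate matter.\<close>

lemma velocity_Cmp:
  assumes E: "lie_groupoid E" and \<gamma>: "has_velocity (mor_charts E) \<gamma> u" and \<mu>: "has_velocity (mor_charts E) \<mu> v"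
    and c: "\<forall>\<^sub>F t in nhds 0. Src E (\<gamma> t) = Tgt E (\<mu> t)"
  shows "has_velocity (mor_charts E) (\<lambda>t. Cmp E (\<gamma> t) (\<mu> t)) (tangent_Cmp E u v)"
proof -
  note e = lie_groupoidD[OF E]
  let ?M = "mor_charts E" and ?S = "{(y, x). y \<in> Mor E \<and> x \<in> Mor E \<and> Src E y = Tgt E x}"
  have S: "\<forall>\<^sub>F t in nhds 0. (\<gamma> t, \<mu> t) \<in> ?S"
    if "has_velocity ?M \<gamma> u" "has_velocity ?M \<mu> v" "\<forall>\<^sub>F t in nhds 0. Src E (\<gamma> t) = Tgt E (\<mu> t)" for \<gamma> \<mu>
    using velocity_eventually[OF that(1)] velocity_eventually[OF that(2)] that(3)
    by eventually_elim (simp add: e(5))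
  have "(fst u, fst v) \<in> ?S"
    using eventually_nhds_x_imp_x[OF S[OF assms(2-4)]] velocity_base[OF \<gamma>] velocity_base[OF \<mu>] by simp
  then obtain w where w: "\<And>\<gamma>. has_velocity (prod_atlas ?M ?M) \<gamma> ((fst u, fst v), tpair ?M ?M u v) \<Longrightarrow>
      \<forall>\<^sub>F t in nhds 0. \<gamma> t \<in> ?S \<Longrightarrow> has_velocity ?M (\<lambda>t. (\<lambda>(y, x). Cmp E y x) (\<gamma> t)) w"
    using velocity_smooth_map_on[OF smooth_atlas_prod[OF e(3) e(3)] e(3) e(12), of "((fst u, fst v), tpair ?M ?M u v)"]
    by auto
  have w': "has_velocity ?M (\<lambda>t. Cmp E (\<gamma> t) (\<mu> t)) w"
    if "has_velocity ?M \<gamma> u" "has_velocity ?M \<mu> v" "\<forall>\<^sub>F t in nhds 0. Src E (\<gamma> t) = Tgt E (\<mu> t)" for \<gamma> \<mu>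
    using w[OF velocity_Pair[OF e(3) e(3) that(1,2)] S[OF that]] by simp
  have "tangent_Cmp E u v = w"
    unfolding tangent_Cmp_def
  proof (rule the_equality)
    show "\<exists>\<gamma> \<mu>. has_velocity ?M \<gamma> u \<and> has_velocity ?M \<mu> v \<and> (\<forall>\<^sub>F t in nhds 0. Src E (\<gamma> t) = Tgt E (\<mu> t)) \<and>
        has_velocity ?M (\<lambda>t. Cmp E (\<gamma> t) (\<mu> t)) w"
      using assms w' by blast
    fix w2 assume "\<exists>\<gamma> \<mu>. has_velocity ?M \<gamma> u \<and> has_velocity ?M \<mu> v \<and> (\<forall>\<^sub>F t in nhds 0. Src E (\<gamma> t) = Tgt E (\<mu> t)) \<and>
        has_velocity ?M (\<lambda>t. Cmp E (\<gamma> t) (\<mu> t)) w2"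
    then show "w2 = w" using w' velocity_unique by blast
  qed
  then show ?thesis using w'[OF assms(2-4)] by simp
qed

text \<open>Composable tangent arrows need not come from composable curves a priori. As the source map is a submersion,
  the first arrow has a representative over the curve of targets of the second.\<close>

lemma composable_curve:
  assumes E: "lie_groupoid E" and u: "u \<in> Mor (tangent_gpd E)"
    and uv: "Src (tangent_gpd E) u = Tgt (tangent_gpd E) v" and \<mu>: "has_velocity (mor_charts E) \<mu> v"
  obtains \<gamma> where "has_velocity (mor_charts E) \<gamma> u" "\<forall>\<^sub>F t in nhds 0. Src E (\<gamma> t) = Tgt E (\<mu> t)"
proof -
  note e = lie_groupoidD[OF E]
  have "has_velocity (ob_charts E) (\<lambda>t. Tgt E (\<mu> t)) (Tmap (mor_charts E) (ob_charts E) (Src E) u)"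
    using velocity_Tmap[OF e(3,2,9) \<mu>] uv by simp
  then show ?thesis using submersion_lift[OF e(3,2,6), of u "\<lambda>t. Tgt E (\<mu> t)"] u that by auto
qed

text \<open>Each axiom is an equation of \<open>E\<close> along curves of composable arrows, which passes to velocities by
  uniqueness.\<close>

lemma category_tangent_gpd:
  assumes E: "lie_groupoid E"
  shows "category (tangent_gpd E)"
proof -
  note e = lie_groupoidD[OF E] and cat = categoryD[OF lie_groupoidD(1)[OF E]]
  let ?T = "tangent_gpd E" and ?O = "ob_charts E" and ?M = "mor_charts E"
  have st: "Src ?T v \<in> Ob ?T" "Tgt ?T v \<in> Ob ?T" if "v \<in> Mor ?T" for v
    using that Tmap_pts[OF e(3,2,8)] Tmap_pts[OF e(3,2,9)] by simp_all
  have idn: "Idn ?T v \<in> Mor ?T" "Src ?T (Idn ?T v) = v" "Tgt ?T (Idn ?T v) = v" if v: "v \<in> Ob ?T" for v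
  proof -
    have v': "v \<in> pts (tangent_bundle ?O)" using v by simp
    show "Idn ?T v \<in> Mor ?T" using Tmap_pts[OF e(2,3,10)] v by simp
    obtain \<gamma> where \<gamma>: "has_velocity ?O \<gamma> v" using velocity_exists[OF e(2) v'] .
    have "\<forall>\<^sub>F t in nhds 0. Src E (Idn E (\<gamma> t)) = \<gamma> t" "\<forall>\<^sub>F t in nhds 0. Tgt E (Idn E (\<gamma> t)) = \<gamma> t"
      by (rule eventually_mono[OF velocity_eventually[OF \<gamma>]], simp add: e(4) cat)+
    then show "Src ?T (Idn ?T v) = v" "Tgt ?T (Idn ?T v) = v"
      using velocity_unique[OF velocity_cong[OF velocity_Tmap[OF e(3,2,8) velocity_Tmap[OF e(2,3,10) \<gamma>]]] \<gamma>]
        velocity_unique[OF velocity_cong[OF velocity_Tmap[OF e(3,2,9) velocity_Tmap[OF e(2,3,10) \<gamma>]]] \<gamma>]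
      by simp_all
  qed
  have cmp: "Cmp ?T y x \<in> Mor ?T" "Src ?T (Cmp ?T y x) = Src ?T x" "Tgt ?T (Cmp ?T y x) = Tgt ?T y"
    if x: "x \<in> Mor ?T" "y \<in> Mor ?T" "Src ?T y = Tgt ?T x" for x y
  proof -
    obtain \<mu> where \<mu>: "has_velocity ?M \<mu> x" by (rule velocity_exists[OF e(3) x(1)[unfolded tangent_gpd_simps]])
    obtain \<gamma> where \<gamma>: "has_velocity ?M \<gamma> y" "\<forall>\<^sub>F t in nhds 0. Src E (\<gamma> t) = Tgt E (\<mu> t)"
      using composable_curve[OF E x(2,3) \<mu>] .
    note c = velocity_Cmp[OF E \<gamma>(1) \<mu> \<gamma>(2)]
    show "Cmp ?T y x \<in> Mor ?T" using velocity_pts[OF c] by simp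
    have "\<forall>\<^sub>F t in nhds 0. Src E (Cmp E (\<gamma> t) (\<mu> t)) = Src E (\<mu> t)" "\<forall>\<^sub>F t in nhds 0. Tgt E (Cmp E (\<gamma> t) (\<mu> t)) = Tgt E (\<gamma> t)"
      by (rule eventually_mono[OF eventually_conj[OF velocity_eventually[OF \<gamma>(1)] eventually_conj[OF velocity_eventually[OF \<mu>] \<gamma>(2)]]], simp add: e(5) cat)+
    then show "Src ?T (Cmp ?T y x) = Src ?T x" "Tgt ?T (Cmp ?T y x) = Tgt ?T y"
      using velocity_unique[OF velocity_cong[OF velocity_Tmap[OF e(3,2,8) c]] velocity_Tmap[OF e(3,2,8) \<mu>]]
        velocity_unique[OF velocity_cong[OF velocity_Tmap[OF e(3,2,9) c]] velocity_Tmap[OF e(3,2,9) \<gamma>(1)]]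
      by simp_all
  qed
  have unit: "Cmp ?T x (Idn ?T (Src ?T x)) = x" "Cmp ?T (Idn ?T (Tgt ?T x)) x = x" if x: "x \<in> Mor ?T" for x
  proof -
    obtain \<mu> where \<mu>: "has_velocity ?M \<mu> x" by (rule velocity_exists[OF e(3) x(1)[unfolded tangent_gpd_simps]])
    note s = velocity_Tmap[OF e(2,3,10) velocity_Tmap[OF e(3,2,8) \<mu>]]
    note t = velocity_Tmap[OF e(2,3,10) velocity_Tmap[OF e(3,2,9) \<mu>]]
    have "\<forall>\<^sub>F t in nhds 0. Src E (\<mu> t) = Tgt E (Idn E (Src E (\<mu> t)))"
      "\<forall>\<^sub>F t in nhds 0. Src E (Idn E (Tgt E (\<mu> t))) = Tgt E (\<mu> t)"
      "\<forall>\<^sub>F t in nhds 0. Cmp E (\<mu> t) (Idn E (Src E (\<mu> t))) = \<mu> t"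
      "\<forall>\<^sub>F t in nhds 0. Cmp E (Idn E (Tgt E (\<mu> t))) (\<mu> t) = \<mu> t"
      by (rule eventually_mono[OF velocity_eventually[OF \<mu>]], simp add: e(5) cat)+
    then show "Cmp ?T x (Idn ?T (Src ?T x)) = x" "Cmp ?T (Idn ?T (Tgt ?T x)) x = x"
      using velocity_unique[OF velocity_cong[OF velocity_Cmp[OF E \<mu> s]] \<mu>]
        velocity_unique[OF velocity_cong[OF velocity_Cmp[OF E t \<mu>]] \<mu>] by simp_all
  qed
  have assoc: "Cmp ?T z (Cmp ?T y x) = Cmp ?T (Cmp ?T z y) x"
    if x: "x \<in> Mor ?T" "y \<in> Mor ?T" "z \<in> Mor ?T" "Src ?T y = Tgt ?T x" "Src ?T z = Tgt ?T y" for x y z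
  proof -
    obtain \<mu> where \<mu>: "has_velocity ?M \<mu> x" by (rule velocity_exists[OF e(3) x(1)[unfolded tangent_gpd_simps]])
    obtain \<gamma> where \<gamma>: "has_velocity ?M \<gamma> y" "\<forall>\<^sub>F t in nhds 0. Src E (\<gamma> t) = Tgt E (\<mu> t)"
      using composable_curve[OF E x(2,4) \<mu>] .
    obtain \<beta> where \<beta>: "has_velocity ?M \<beta> z" "\<forall>\<^sub>F t in nhds 0. Src E (\<beta> t) = Tgt E (\<gamma> t)"
      using composable_curve[OF E x(3,5) \<gamma>(1)] .
    have "\<forall>\<^sub>F t in nhds 0. Src E (\<beta> t) = Tgt E (Cmp E (\<gamma> t) (\<mu> t))"
      "\<forall>\<^sub>F t in nhds 0. Src E (Cmp E (\<beta> t) (\<gamma> t)) = Tgt E (\<mu> t)"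
      "\<forall>\<^sub>F t in nhds 0. Cmp E (\<beta> t) (Cmp E (\<gamma> t) (\<mu> t)) = Cmp E (Cmp E (\<beta> t) (\<gamma> t)) (\<mu> t)"
      by (rule eventually_mono[OF eventually_conj[OF velocity_eventually[OF \<mu>] eventually_conj[OF velocity_eventually[OF \<gamma>(1)] eventually_conj[OF velocity_eventually[OF \<beta>(1)] eventually_conj[OF \<gamma>(2) \<beta>(2)]]]]], simp add: e(5) cat)+
    then show ?thesis
      using velocity_unique[OF velocity_cong[OF velocity_Cmp[OF E \<beta>(1) velocity_Cmp[OF E \<gamma>(1) \<mu> \<gamma>(2)]]]
          velocity_Cmp[OF E velocity_Cmp[OF E \<beta>(1) \<gamma>(1) \<beta>(2)] \<mu>]] by simp
  qed
  show ?thesis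
    unfolding category_def
    by (intro conjI funcsetI ballI impI; (elim conjE)?; (rule st idn cmp unit assoc; assumption))
qed

subsection \<open>Differentials of smooth functors and transformations\<close>

lemma lie_functorD:
  assumes "lie_functor E D F"
  shows "is_functor E D F" "smooth_map (ob_charts E) (ob_charts D) (fst F)" "smooth_map (mor_charts E) (mor_charts D) (snd F)"
  using assms unfolding lie_functor_def by auto

lemma push_functor_apply:
  "v \<in> Ob (tangent_gpd E) \<Longrightarrow> fst (push_functor E F) v = Tmap (ob_charts E) (ob_charts E) (fst F) v"
  "x \<in> Mor (tangent_gpd E) \<Longrightarrow> snd (push_functor E F) x = Tmap (mor_charts E) (mor_charts E) (snd F) x"
  unfolding push_functor_def by simp_all

lemma velocity_push_functor:
  assumes E: "lie_groupoid E" and F: "lie_functor E E F"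
  shows "has_velocity (ob_charts E) \<gamma> v \<Longrightarrow> has_velocity (ob_charts E) (\<lambda>t. fst F (\<gamma> t)) (fst (push_functor E F) v)"
    "has_velocity (mor_charts E) \<mu> x \<Longrightarrow> has_velocity (mor_charts E) (\<lambda>t. snd F (\<mu> t)) (snd (push_functor E F) x)"
proof -
  note e = lie_groupoidD[OF E] and f = lie_functorD[OF F]
  show "has_velocity (ob_charts E) (\<lambda>t. fst F (\<gamma> t)) (fst (push_functor E F) v)" if "has_velocity (ob_charts E) \<gamma> v"
    using velocity_Tmap[OF e(2,2) f(2) that] velocity_pts[OF that] by (simp add: push_functor_apply)
  show "has_velocity (mor_charts E) (\<lambda>t. snd F (\<mu> t)) (snd (push_functor E F) x)" if "has_velocity (mor_charts E) \<mu> x"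
    using velocity_Tmap[OF e(3,3) f(3) that] velocity_pts[OF that] by (simp add: push_functor_apply)
qed

lemma extensional_push_functor: "extensional_functor (tangent_gpd E) (push_functor E F)"
  unfolding extensional_functor_def push_functor_def by simp

lemma is_functor_push:
  assumes E: "lie_groupoid E" and F: "lie_functor E E F"
  shows "is_functor (tangent_gpd E) (tangent_gpd E) (push_functor E F)"
proof -
  note e = lie_groupoidD[OF E] and f = lie_functorD[OF F] and fn = is_functorD[OF lie_functorD(1)[OF F]]
  note cat = categoryD[OF e(1)]
  let ?T = "tangent_gpd E" and ?O = "ob_charts E" and ?M = "mor_charts E" and ?P = "push_functor E F"
  have ob: "fst ?P v \<in> Ob ?T" "snd ?P (Idn ?T v) = Idn ?T (fst ?P v)" if v: "v \<in> Ob ?T" for v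
  proof -
    obtain \<gamma> where \<gamma>: "has_velocity ?O \<gamma> v" by (rule velocity_exists[OF e(2) v[unfolded tangent_gpd_simps]])
    note vF = velocity_push_functor(1)[OF E F \<gamma>]
    show "fst ?P v \<in> Ob ?T" using velocity_pts[OF vF] by simp
    have "\<forall>\<^sub>F t in nhds 0. snd F (Idn E (\<gamma> t)) = Idn E (fst F (\<gamma> t))"
      using velocity_eventually[OF \<gamma>] by eventually_elim (simp add: e(4) fn)
    then show "snd ?P (Idn ?T v) = Idn ?T (fst ?P v)"
      using velocity_unique[OF velocity_cong[OF velocity_push_functor(2)[OF E F velocity_Tmap[OF e(2,3,10) \<gamma>]]]
          velocity_Tmap[OF e(2,3,10) vF]] by simp
  qed
  have mor: "snd ?P x \<in> Mor ?T" "Src ?T (snd ?P x) = fst ?P (Src ?T x)" "Tgt ?T (snd ?P x) = fst ?P (Tgt ?T x)"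
    if x: "x \<in> Mor ?T" for x
  proof -
    obtain \<mu> where \<mu>: "has_velocity ?M \<mu> x" by (rule velocity_exists[OF e(3) x[unfolded tangent_gpd_simps]])
    note vF = velocity_push_functor(2)[OF E F \<mu>]
    show "snd ?P x \<in> Mor ?T" using velocity_pts[OF vF] by simp
    have "\<forall>\<^sub>F t in nhds 0. Src E (snd F (\<mu> t)) = fst F (Src E (\<mu> t))" "\<forall>\<^sub>F t in nhds 0. Tgt E (snd F (\<mu> t)) = fst F (Tgt E (\<mu> t))"
      by (rule eventually_mono[OF velocity_eventually[OF \<mu>]], simp add: e(5) fn)+
    then show "Src ?T (snd ?P x) = fst ?P (Src ?T x)" "Tgt ?T (snd ?P x) = fst ?P (Tgt ?T x)"
      using velocity_unique[OF velocity_cong[OF velocity_Tmap[OF e(3,2,8) vF]] velocity_push_functor(1)[OF E F velocity_Tmap[OF e(3,2,8) \<mu>]]]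
        velocity_unique[OF velocity_cong[OF velocity_Tmap[OF e(3,2,9) vF]] velocity_push_functor(1)[OF E F velocity_Tmap[OF e(3,2,9) \<mu>]]]
      by simp_all
  qed
  have cmp: "snd ?P (Cmp ?T y x) = Cmp ?T (snd ?P y) (snd ?P x)"
    if x: "x \<in> Mor ?T" "y \<in> Mor ?T" "Src ?T y = Tgt ?T x" for x y
  proof -
    obtain \<mu> where \<mu>: "has_velocity ?M \<mu> x" by (rule velocity_exists[OF e(3) x(1)[unfolded tangent_gpd_simps]])
    obtain \<gamma> where \<gamma>: "has_velocity ?M \<gamma> y" "\<forall>\<^sub>F t in nhds 0. Src E (\<gamma> t) = Tgt E (\<mu> t)"
      using composable_curve[OF E x(2,3) \<mu>] .
    have "\<forall>\<^sub>F t in nhds 0. Src E (snd F (\<gamma> t)) = Tgt E (snd F (\<mu> t))"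
      "\<forall>\<^sub>F t in nhds 0. snd F (Cmp E (\<gamma> t) (\<mu> t)) = Cmp E (snd F (\<gamma> t)) (snd F (\<mu> t))"
      by (rule eventually_mono[OF eventually_conj[OF velocity_eventually[OF \<gamma>(1)] eventually_conj[OF velocity_eventually[OF \<mu>] \<gamma>(2)]]], simp add: e(5) fn)+
    then show ?thesis
      using velocity_unique[OF velocity_cong[OF velocity_push_functor(2)[OF E F velocity_Cmp[OF E \<gamma>(1) \<mu> \<gamma>(2)]]]
          velocity_Cmp[OF E velocity_push_functor(2)[OF E F \<gamma>(1)] velocity_push_functor(2)[OF E F \<mu>]]] by simp
  qed
  show ?thesis
    unfolding is_functor_def
    by (intro conjI funcsetI ballI impI; (rule ob mor cmp; assumption))
qed

lemma push_comp_functor: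
  assumes E: "lie_groupoid E" and F: "lie_functor E E F" and K: "lie_functor E E K" and KF: "lie_functor E E (comp_functor E K F)"
  shows "push_functor E (comp_functor E K F) = comp_functor (tangent_gpd E) (push_functor E K) (push_functor E F)"
proof (rule functor_eqI[OF extensional_push_functor extensional_comp_functor])
  note e = lie_groupoidD[OF E]
  fix v assume v: "v \<in> Ob (tangent_gpd E)"
  obtain \<gamma> where \<gamma>: "has_velocity (ob_charts E) \<gamma> v" by (rule velocity_exists[OF e(2) v[unfolded tangent_gpd_simps]])
  have "\<forall>\<^sub>F t in nhds 0. fst (comp_functor E K F) (\<gamma> t) = fst K (fst F (\<gamma> t))"
    using velocity_eventually[OF \<gamma>] by eventually_elim (simp add: e(4) comp_functor_apply)
  from velocity_unique[OF velocity_cong[OF velocity_push_functor(1)[OF E KF \<gamma>] this]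
      velocity_push_functor(1)[OF E K velocity_push_functor(1)[OF E F \<gamma>]]]
  show "fst (push_functor E (comp_functor E K F)) v = fst (comp_functor (tangent_gpd E) (push_functor E K) (push_functor E F)) v"
    using v by (simp only: comp_functor_apply)
next
  note e = lie_groupoidD[OF E]
  fix x assume x: "x \<in> Mor (tangent_gpd E)"
  obtain \<gamma> where \<gamma>: "has_velocity (mor_charts E) \<gamma> x" by (rule velocity_exists[OF e(3) x[unfolded tangent_gpd_simps]])
  have "\<forall>\<^sub>F t in nhds 0. snd (comp_functor E K F) (\<gamma> t) = snd K (snd F (\<gamma> t))"
    using velocity_eventually[OF \<gamma>] by eventually_elim (simp add: e(5) comp_functor_apply)
  from velocity_unique[OF velocity_cong[OF velocity_push_functor(2)[OF E KF \<gamma>] this]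
      velocity_push_functor(2)[OF E K velocity_push_functor(2)[OF E F \<gamma>]]]
  show "snd (push_functor E (comp_functor E K F)) x = snd (comp_functor (tangent_gpd E) (push_functor E K) (push_functor E F)) x"
    using x by (simp only: comp_functor_apply)
qed

lemma push_id_functor:
  assumes E: "lie_groupoid E"
  shows "push_functor E (id_functor E) = id_functor (tangent_gpd E)"
proof (rule functor_eqI[OF extensional_push_functor extensional_id_functor])
  note e = lie_groupoidD[OF E]
  fix v assume v: "v \<in> Ob (tangent_gpd E)"
  have "Tmap (ob_charts E) (ob_charts E) (fst (id_functor E)) v = Tmap (ob_charts E) (ob_charts E) (\<lambda>p. p) v"
    using v by (intro Tmap_cong smooth_map_ident e(2)) (simp_all add: id_functor_apply e(4))
  then show "fst (push_functor E (id_functor E)) v = fst (id_functor (tangent_gpd E)) v"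
    using v Tmap_ident[OF e(2)] by (simp add: push_functor_apply id_functor_apply)
next
  note e = lie_groupoidD[OF E]
  fix v assume v: "v \<in> Mor (tangent_gpd E)"
  have "Tmap (mor_charts E) (mor_charts E) (snd (id_functor E)) v = Tmap (mor_charts E) (mor_charts E) (\<lambda>p. p) v"
    using v by (intro Tmap_cong smooth_map_ident e(3)) (simp_all add: id_functor_apply e(5))
  then show "snd (push_functor E (id_functor E)) v = snd (id_functor (tangent_gpd E)) v"
    using v Tmap_ident[OF e(3)] by (simp add: push_functor_apply id_functor_apply)
qed

definition lie_ntrans :: "('o, 'a, 'm::real_inner, 'n::real_inner) lie_gpd \<Rightarrow>
    (('o \<Rightarrow> 'o) \<times> ('a \<Rightarrow> 'a), 'o \<Rightarrow> 'a) trans set" where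
  "lie_ntrans E = {(F, \<psi>, F'). (F, \<psi>, F') \<in> ntrans E E \<and> lie_functor E E F \<and> lie_functor E E F' \<and>
     smooth_map (ob_charts E) (mor_charts E) \<psi>}"

lemma lie_ntransD:
  assumes "(F, \<psi>, F') \<in> lie_ntrans E"
  shows "(F, \<psi>, F') \<in> ntrans E E" "lie_functor E E F" "lie_functor E E F'" "smooth_map (ob_charts E) (mor_charts E) \<psi>"
    "nat_trans E E F F' \<psi>"
proof -
  show *: "(F, \<psi>, F') \<in> ntrans E E" "lie_functor E E F" "lie_functor E E F'" "smooth_map (ob_charts E) (mor_charts E) \<psi>"
    using assms unfolding lie_ntrans_def by auto
  show "nat_trans E E F F' \<psi>" by (rule ntransD(6)[OF *(1)])
qed

lemma push_trans_apply:
  "push_trans E (F, \<psi>, F') = (push_functor E F, \<lambda>v\<in>Ob (tangent_gpd E). Tmap (ob_charts E) (mor_charts E) \<psi> v, push_functor E F')"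
  unfolding push_trans_def by simp

lemma push_trans_ntrans:
  assumes E: "lie_groupoid E" and \<Psi>: "\<Psi> \<in> lie_ntrans E"
  shows "push_trans E \<Psi> \<in> ntrans (tangent_gpd E) (tangent_gpd E)"
proof -
  obtain F \<psi> F' where eq: "\<Psi> = (F, \<psi>, F')" by (metis prod_cases3)
  note p = lie_ntransD[OF \<Psi>[unfolded eq]]
  note e = lie_groupoidD[OF E] and n = nat_transD[OF p(5)] and f = is_functorD[OF lie_functorD(1)[OF p(2)]]
    and f' = is_functorD[OF lie_functorD(1)[OF p(3)]]
  note cat = categoryD[OF e(1)]
  let ?T = "tangent_gpd E" and ?O = "ob_charts E" and ?M = "mor_charts E" and ?\<psi> = "Tmap (ob_charts E) (mor_charts E) \<psi>"
  have ob: "?\<psi> v \<in> Mor ?T" "Src ?T (?\<psi> v) = fst (push_functor E F) v" "Tgt ?T (?\<psi> v) = fst (push_functor E F') v"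
    if v: "v \<in> Ob ?T" for v
  proof -
    obtain \<gamma> where \<gamma>: "has_velocity ?O \<gamma> v" by (rule velocity_exists[OF e(2) v[unfolded tangent_gpd_simps]])
    note v\<psi> = velocity_Tmap[OF e(2,3) p(4) \<gamma>]
    show "?\<psi> v \<in> Mor ?T" using velocity_pts[OF v\<psi>] by simp
    have "\<forall>\<^sub>F t in nhds 0. Src E (\<psi> (\<gamma> t)) = fst F (\<gamma> t)" "\<forall>\<^sub>F t in nhds 0. Tgt E (\<psi> (\<gamma> t)) = fst F' (\<gamma> t)"
      by (rule eventually_mono[OF velocity_eventually[OF \<gamma>]], simp add: e(4) n)+
    then show "Src ?T (?\<psi> v) = fst (push_functor E F) v" "Tgt ?T (?\<psi> v) = fst (push_functor E F') v"
      using velocity_unique[OF velocity_cong[OF velocity_Tmap[OF e(3,2,8) v\<psi>]] velocity_push_functor(1)[OF E p(2) \<gamma>]]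
        velocity_unique[OF velocity_cong[OF velocity_Tmap[OF e(3,2,9) v\<psi>]] velocity_push_functor(1)[OF E p(3) \<gamma>]]
      by simp_all
  qed
  have nat: "Cmp ?T (?\<psi> (Tgt ?T x)) (snd (push_functor E F) x) = Cmp ?T (snd (push_functor E F') x) (?\<psi> (Src ?T x))"
    if x: "x \<in> Mor ?T" for x
  proof -
    obtain \<mu> where \<mu>: "has_velocity ?M \<mu> x" by (rule velocity_exists[OF e(3) x[unfolded tangent_gpd_simps]])
    note s = velocity_Tmap[OF e(2,3) p(4) velocity_Tmap[OF e(3,2,8) \<mu>]]
      and t = velocity_Tmap[OF e(2,3) p(4) velocity_Tmap[OF e(3,2,9) \<mu>]]
    have "\<forall>\<^sub>F t in nhds 0. Src E (\<psi> (Tgt E (\<mu> t))) = Tgt E (snd F (\<mu> t))"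
      "\<forall>\<^sub>F t in nhds 0. Src E (snd F' (\<mu> t)) = Tgt E (\<psi> (Src E (\<mu> t)))"
      "\<forall>\<^sub>F t in nhds 0. Cmp E (\<psi> (Tgt E (\<mu> t))) (snd F (\<mu> t)) = Cmp E (snd F' (\<mu> t)) (\<psi> (Src E (\<mu> t)))"
      by (rule eventually_mono[OF velocity_eventually[OF \<mu>]], simp add: e(5) n f f' cat)+
    then show ?thesis
      using velocity_unique[OF velocity_cong[OF velocity_Cmp[OF E t velocity_push_functor(2)[OF E p(2) \<mu>]]]
          velocity_Cmp[OF E velocity_push_functor(2)[OF E p(3) \<mu>] s]] by simp
  qed
  have "nat_trans ?T ?T (push_functor E F) (push_functor E F') (\<lambda>v\<in>Ob ?T. ?\<psi> v)"
    unfolding nat_trans_def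
    using ob nat categoryD(1,2)[OF category_tangent_gpd[OF E]] by (simp del: tangent_gpd_simps)
  then show ?thesis
    unfolding eq push_trans_apply
    by (simp add: ntrans_def is_functor_push[OF E] p extensional_push_functor)
qed

text \<open>Together with the analogous facts on vertical composition and on identities: taking differentials is a
  strict 2-functor. The composite transformation is evaluated along a curve, and its velocity is found
  from the tangent composition of the velocities of the factors.\<close>

lemma push_trans_hcomp:
  assumes E: "lie_groupoid E" and \<Phi>: "\<Phi> \<in> lie_ntrans E" and \<Psi>: "\<Psi> \<in> lie_ntrans E" and \<Phi>\<Psi>: "hcomp E E \<Phi> \<Psi> \<in> lie_ntrans E"
  shows "push_trans E (hcomp E E \<Phi> \<Psi>) =
    hcomp (tangent_gpd E) (tangent_gpd E) (push_trans E \<Phi>) (push_trans E \<Psi>)"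
proof -
  obtain F \<psi> F' K \<phi> K' where eq: "\<Psi> = (F, \<psi>, F')" "\<Phi> = (K, \<phi>, K')" by (metis prod_cases3)
  note p = lie_ntransD[OF \<Psi>[unfolded eq]] and k = lie_ntransD[OF \<Phi>[unfolded eq]]
    and pk = lie_ntransD[OF \<Phi>\<Psi>[unfolded eq hcomp_apply]]
  note e = lie_groupoidD[OF E] and n = nat_transD[OF p(5)] nat_transD[OF k(5)]
    and f = is_functorD(1-4)[OF lie_functorD(1)[OF p(2)]] is_functorD(1-4)[OF lie_functorD(1)[OF p(3)]]
      is_functorD(1-4)[OF lie_functorD(1)[OF k(2)]] is_functorD(1-4)[OF lie_functorD(1)[OF k(3)]]
  let ?T = "tangent_gpd E" and ?O = "ob_charts E" and ?M = "mor_charts E"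
  have "Tmap ?O ?M (\<lambda>u\<in>Ob E. Cmp E (\<phi> (fst F' u)) (snd K (\<psi> u))) v =
      Cmp ?T (Tmap ?O ?M \<phi> (fst (push_functor E F') v)) (snd (push_functor E K) (Tmap ?O ?M \<psi> v))" if v: "v \<in> Ob ?T" for v
  proof -
    obtain \<gamma> where \<gamma>: "has_velocity ?O \<gamma> v" by (rule velocity_exists[OF e(2) v[unfolded tangent_gpd_simps]])
    have "\<forall>\<^sub>F t in nhds 0. Src E (\<phi> (fst F' (\<gamma> t))) = Tgt E (snd K (\<psi> (\<gamma> t)))"
      "\<forall>\<^sub>F t in nhds 0. (\<lambda>u\<in>Ob E. Cmp E (\<phi> (fst F' u)) (snd K (\<psi> u))) (\<gamma> t) = Cmp E (\<phi> (fst F' (\<gamma> t))) (snd K (\<psi> (\<gamma> t)))"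
      by (rule eventually_mono[OF velocity_eventually[OF \<gamma>]], simp add: e(4) n f)+
    then show ?thesis
      using velocity_unique[OF velocity_cong[OF velocity_Tmap[OF e(2,3) pk(4) \<gamma>]]
          velocity_Cmp[OF E velocity_Tmap[OF e(2,3) k(4) velocity_push_functor(1)[OF E p(3) \<gamma>]]
            velocity_push_functor(2)[OF E k(2) velocity_Tmap[OF e(2,3) p(4) \<gamma>]]]] by simp
  qed
  moreover have "fst (push_functor E F') v \<in> Ob ?T" if "v \<in> Ob ?T" for v
    using is_functorD(1)[OF is_functor_push[OF E p(3)] that] .
  ultimately show ?thesis
    unfolding eq hcomp_apply push_trans_apply prod.inject
    using push_comp_functor[OF E p(2) k(2) pk(2)] push_comp_functor[OF E p(3) k(3) pk(3)]
    by (auto intro!: restrict_ext simp del: tangent_gpd_simps)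
qed

lemma push_trans_vcomp:
  assumes E: "lie_groupoid E" and \<Phi>: "(F', \<phi>, F'') \<in> lie_ntrans E" and \<Psi>: "(F, \<psi>, F') \<in> lie_ntrans E"
    and \<Phi>\<Psi>: "vcomp E E (F', \<phi>, F'') (F, \<psi>, F') \<in> lie_ntrans E"
  shows "push_trans E (vcomp E E (F', \<phi>, F'') (F, \<psi>, F')) =
    vcomp (tangent_gpd E) (tangent_gpd E) (push_trans E (F', \<phi>, F'')) (push_trans E (F, \<psi>, F'))"
proof -
  note p = lie_ntransD[OF \<Psi>] and k = lie_ntransD[OF \<Phi>] and pk = lie_ntransD[OF \<Phi>\<Psi>[unfolded vcomp_apply]]
  note e = lie_groupoidD[OF E] and n = nat_transD[OF p(5)] nat_transD[OF k(5)]
  let ?T = "tangent_gpd E" and ?O = "ob_charts E" and ?M = "mor_charts E"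
  have "Tmap ?O ?M (\<lambda>u\<in>Ob E. Cmp E (\<phi> u) (\<psi> u)) v = Cmp ?T (Tmap ?O ?M \<phi> v) (Tmap ?O ?M \<psi> v)" if v: "v \<in> Ob ?T" for v
  proof -
    obtain \<gamma> where \<gamma>: "has_velocity ?O \<gamma> v" by (rule velocity_exists[OF e(2) v[unfolded tangent_gpd_simps]])
    have "\<forall>\<^sub>F t in nhds 0. Src E (\<phi> (\<gamma> t)) = Tgt E (\<psi> (\<gamma> t))"
      "\<forall>\<^sub>F t in nhds 0. (\<lambda>u\<in>Ob E. Cmp E (\<phi> u) (\<psi> u)) (\<gamma> t) = Cmp E (\<phi> (\<gamma> t)) (\<psi> (\<gamma> t))"
      by (rule eventually_mono[OF velocity_eventually[OF \<gamma>]], simp add: e(4) n)+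
    then show ?thesis
      using velocity_unique[OF velocity_cong[OF velocity_Tmap[OF e(2,3) pk(4) \<gamma>]]
          velocity_Cmp[OF E velocity_Tmap[OF e(2,3) k(4) \<gamma>] velocity_Tmap[OF e(2,3) p(4) \<gamma>]]] by simp
  qed
  then show ?thesis
    unfolding vcomp_apply push_trans_apply prod.inject by (auto intro!: restrict_ext simp del: tangent_gpd_simps)
qed

lemma push_trans_id:
  assumes E: "lie_groupoid E" and F: "lie_functor E E F"
  shows "push_trans E (F, id_trans E E (fst F), F) =
    (push_functor E F, id_trans (tangent_gpd E) (tangent_gpd E) (fst (push_functor E F)), push_functor E F)"
proof -
  note e = lie_groupoidD[OF E] and f = lie_functorD[OF F]
  let ?T = "tangent_gpd E" and ?O = "ob_charts E" and ?M = "mor_charts E"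
  have "Tmap ?O ?M (id_trans E E (fst F)) v = Idn ?T (fst (push_functor E F) v)" if v: "v \<in> Ob ?T" for v
  proof -
    have "Tmap ?O ?M (id_trans E E (fst F)) v = Tmap ?O ?M (\<lambda>p. Idn E (fst F p)) v"
      using v by (intro Tmap_cong smooth_map_comp[OF e(2,2,3) f(2) e(10)] e(2,3)) (simp_all add: id_trans_def e(4))
    also have "\<dots> = Idn ?T (fst (push_functor E F) v)"
      using v Tmap_comp[OF e(2,2,3) f(2) e(10)] by (simp add: push_functor_apply)
    finally show ?thesis .
  qed
  then show ?thesis unfolding push_trans_apply id_trans_def[of ?T] by (auto intro!: restrict_ext simp del: tangent_gpd_simps)
qed

section \<open>Lie algebras of Lie groups\<close>

lemma velocity_const:
  assumes M: "smooth_atlas M" and p: "p \<in> pts M"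
  shows "has_velocity M (\<lambda>t. p) (p, 0)"
proof -
  obtain c where c: "c \<in> M" "p \<in> fst c" using p by (rule ptsE)
  have "tvec M c p 0 = 0" using tvec_linear(2)[OF M c, of 0 0] by simp
  then show ?thesis using tvec_curve(3)[OF M c(1), of "\<lambda>t. p" 0] c(2) by simp
qed

lemma lie_groupD:
  assumes "lie_group G"
  shows "group G" "smooth_atlas (charts G)" "pts (charts G) = carrier G"
    "smooth_map (prod_atlas (charts G) (charts G)) (charts G) (\<lambda>(x, y). x \<otimes>\<^bsub>G\<^esub> y)"
    "smooth_map (charts G) (charts G) (\<lambda>x. inv\<^bsub>G\<^esub> x)" "\<one>\<^bsub>G\<^esub> \<in> pts (charts G)"
  using assms unfolding lie_group_def
  by (auto intro: manifold_smooth_atlas group.is_monoid monoid.one_closed)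

lemma lie_alg_tangent: "lie_group G \<Longrightarrow> A \<in> lie_alg G \<longleftrightarrow> (\<one>\<^bsub>G\<^esub>, A) \<in> pts (tangent_bundle (charts G))"
  using lie_groupD(6) by (auto simp: lie_alg_def pts_tangent_bundle)

lemma lie_alg_curve:
  assumes "lie_group G" "A \<in> lie_alg G"
  obtains \<gamma> where "has_velocity (charts G) \<gamma> (\<one>\<^bsub>G\<^esub>, A)"
  using velocity_exists[OF lie_groupD(2)[OF assms(1)]] assms lie_alg_tangent by blast

lemma lie_alg_subspace: "lie_group G \<Longrightarrow> subspace (lie_alg G)"
  unfolding lie_alg_def by (intro tangent_space_subspace lie_groupD)

lemma velocity_lie_alg: "lie_group G \<Longrightarrow> has_velocity (charts G) \<gamma> (\<one>\<^bsub>G\<^esub>, A) \<Longrightarrow> A \<in> lie_alg G"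
  using velocity_pts lie_alg_tangent by blast

lemma velocity_Lmap:
  assumes G: "lie_group G" and G': "lie_group G'" and f: "smooth_map (charts G) (charts G') f" "f \<one>\<^bsub>G\<^esub> = \<one>\<^bsub>G'\<^esub>"
    and \<gamma>: "has_velocity (charts G) \<gamma> (\<one>\<^bsub>G\<^esub>, A)"
  shows "has_velocity (charts G') (\<lambda>t. f (\<gamma> t)) (\<one>\<^bsub>G'\<^esub>, Lmap G G' f A)"
proof -
  have "Tmap (charts G) (charts G') f (\<one>\<^bsub>G\<^esub>, A) = (\<one>\<^bsub>G'\<^esub>, Lmap G G' f A)"
    by (simp add: Lmap_def prod_eq_iff f(2))
  then show ?thesis using velocity_Tmap[OF lie_groupD(2)[OF G] lie_groupD(2)[OF G'] f(1) \<gamma>] by simp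
qed

lemma Lmap_mem:
  assumes "lie_group G" "lie_group G'" "smooth_map (charts G) (charts G') f" "f \<one>\<^bsub>G\<^esub> = \<one>\<^bsub>G'\<^esub>" "A \<in> lie_alg G"
  shows "Lmap G G' f A \<in> lie_alg G'"
  using lie_alg_curve[OF assms(1,5)] velocity_Lmap[OF assms(1-4)] velocity_lie_alg[OF assms(2)] by metis

lemma Lmap_linear:
  assumes "lie_group G" "lie_group G'" "smooth_map (charts G) (charts G') f"
    and A: "A \<in> lie_alg G" "B \<in> lie_alg G"
  shows "Lmap G G' f (A + B) = Lmap G G' f A + Lmap G G' f B" "Lmap G G' f (a *\<^sub>R A) = a *\<^sub>R Lmap G G' f A"
    "Lmap G G' f (A - B) = Lmap G G' f A - Lmap G G' f B" "Lmap G G' f (- A) = - Lmap G G' f A" "Lmap G G' f 0 = 0"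
proof -
  note T = Tmap_add_scale[OF lie_groupD(2)[OF assms(1)] lie_groupD(2)[OF assms(2)] assms(3) lie_groupD(6)[OF assms(1)]]
  have add: "Lmap G G' f (A + B) = Lmap G G' f A + Lmap G G' f B" if "A \<in> lie_alg G" "B \<in> lie_alg G" for A B
    unfolding Lmap_def by (rule T(1)) (use that in \<open>simp_all add: lie_alg_def\<close>)
  have scale: "Lmap G G' f (a *\<^sub>R A) = a *\<^sub>R Lmap G G' f A" if "A \<in> lie_alg G" for a A
    unfolding Lmap_def by (rule T(2)) (use that in \<open>simp_all add: lie_alg_def\<close>)
  show "Lmap G G' f (A + B) = Lmap G G' f A + Lmap G G' f B" "Lmap G G' f (a *\<^sub>R A) = a *\<^sub>R Lmap G G' f A"
    by (rule add[OF A], rule scale[OF A(1)])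
  show "Lmap G G' f 0 = 0" using scale[OF A(1), of 0] by simp
  show neg: "Lmap G G' f (- A) = - Lmap G G' f A" using scale[OF A(1), of "-1"] by simp
  have "Lmap G G' f (A - B + B) = Lmap G G' f (A - B) + Lmap G G' f B"
    by (rule add[OF subspace_diff[OF lie_alg_subspace[OF assms(1)] A] A(2)])
  then show "Lmap G G' f (A - B) = Lmap G G' f A - Lmap G G' f B" by simp
qed

lemma Lmap_smooth:
  assumes "lie_group G" "lie_group G'" "smooth_map (charts G) (charts G') f" "f \<one>\<^bsub>G\<^esub> = \<one>\<^bsub>G'\<^esub>"
  shows "smooth_map (lie_alg_atlas G) (lie_alg_atlas G') (Lmap G G' f)"
  unfolding lie_alg_atlas_fibre
  by (rule smooth_map_fibre_linear)
    (use assms Lmap_mem[OF assms] Lmap_linear(1,2)[OF assms(1-3)] in \<open>auto simp: lie_alg_def intro: lie_groupD\<close>)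

lemma velocity_mult:
  assumes G: "lie_group G" and \<gamma>: "has_velocity (charts G) \<gamma> (\<one>\<^bsub>G\<^esub>, A)" "has_velocity (charts G) \<mu> (\<one>\<^bsub>G\<^esub>, B)"
  shows "has_velocity (charts G) (\<lambda>t. \<gamma> t \<otimes>\<^bsub>G\<^esub> \<mu> t) (\<one>\<^bsub>G\<^esub>, A + B)"
proof -
  note g = lie_groupD[OF G]
  interpret group G by (rule g(1))
  have "Tmap (charts G) (charts G) (\<lambda>x. x \<otimes>\<^bsub>G\<^esub> \<one>\<^bsub>G\<^esub>) (\<one>\<^bsub>G\<^esub>, A) = Tmap (charts G) (charts G) (\<lambda>x. x) (\<one>\<^bsub>G\<^esub>, A)"
    "Tmap (charts G) (charts G) (\<lambda>x. \<one>\<^bsub>G\<^esub> \<otimes>\<^bsub>G\<^esub> x) (\<one>\<^bsub>G\<^esub>, B) = Tmap (charts G) (charts G) (\<lambda>x. x) (\<one>\<^bsub>G\<^esub>, B)"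
    using velocity_pts[OF \<gamma>(1)] velocity_pts[OF \<gamma>(2)]
    by (auto intro!: Tmap_cong smooth_map_ident g(2) simp: g(3))
  then show ?thesis
    using velocity_product_rule[OF g(2,2,2,4) \<gamma>] Tmap_ident[OF g(2) velocity_pts[OF \<gamma>(1)]] Tmap_ident[OF g(2) velocity_pts[OF \<gamma>(2)]]
    by simp
qed

lemma velocity_inv:
  assumes G: "lie_group G" and \<gamma>: "has_velocity (charts G) \<gamma> (\<one>\<^bsub>G\<^esub>, A)"
  shows "has_velocity (charts G) (\<lambda>t. inv\<^bsub>G\<^esub> (\<gamma> t)) (\<one>\<^bsub>G\<^esub>, - A)"
proof -
  note g = lie_groupD[OF G]
  interpret group G by (rule g(1))
  have i: "has_velocity (charts G) (\<lambda>t. inv\<^bsub>G\<^esub> (\<gamma> t)) (\<one>\<^bsub>G\<^esub>, Lmap G G (\<lambda>x. inv\<^bsub>G\<^esub> x) A)"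
    by (rule velocity_Lmap[OF G G g(5) _ \<gamma>]) simp
  have "\<forall>\<^sub>F t in nhds 0. \<gamma> t \<otimes>\<^bsub>G\<^esub> inv\<^bsub>G\<^esub> (\<gamma> t) = \<one>\<^bsub>G\<^esub>"
    using velocity_eventually[OF \<gamma>] by eventually_elim (simp add: g(3))
  then have "has_velocity (charts G) (\<lambda>t. \<one>\<^bsub>G\<^esub>) (\<one>\<^bsub>G\<^esub>, A + Lmap G G (\<lambda>x. inv\<^bsub>G\<^esub> x) A)"
    by (rule velocity_cong[OF velocity_mult[OF G \<gamma> i]])
  then have "A + Lmap G G (\<lambda>x. inv\<^bsub>G\<^esub> x) A = 0"
    using velocity_unique[OF _ velocity_const[OF g(2,6)]] by auto
  then have "Lmap G G (\<lambda>x. inv\<^bsub>G\<^esub> x) A = - A" by (simp add: eq_neg_iff_add_eq_0 add.commute)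
  then show ?thesis using i by simp
qed

lemma smooth_map_translate:
  assumes G: "lie_group G" and "g \<in> carrier G" "g' \<in> carrier G"
  shows "smooth_map (charts G) (charts G) (\<lambda>x. g \<otimes>\<^bsub>G\<^esub> x \<otimes>\<^bsub>G\<^esub> g')"
proof -
  note s = lie_groupD[OF G]
  note c = smooth_map_const[OF s(2,2)] and i = smooth_map_ident[OF s(2)]
  have "smooth_map (charts G) (charts G) (\<lambda>x. g \<otimes>\<^bsub>G\<^esub> x)"
    by (rule smooth_map_Pair_comp[OF s(2,2,2,2,4) c i]) (simp add: s(3) assms)
  then show ?thesis
    by (rule smooth_map_Pair_comp[OF s(2,2,2,2,4) _ c]) (simp add: s(3) assms)
qed

lemma velocity_Ad:
  assumes G: "lie_group G" and g: "g \<in> carrier G" and \<gamma>: "has_velocity (charts G) \<gamma> (\<one>\<^bsub>G\<^esub>, A)"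
  shows "has_velocity (charts G) (\<lambda>t. g \<otimes>\<^bsub>G\<^esub> \<gamma> t \<otimes>\<^bsub>G\<^esub> inv\<^bsub>G\<^esub> g) (\<one>\<^bsub>G\<^esub>, Ad G g A)"
proof -
  interpret group G by (rule lie_groupD(1)[OF G])
  show ?thesis unfolding Ad_def
    by (rule velocity_Lmap[OF G G smooth_map_translate[OF G] _ \<gamma>]) (use g in auto)
qed

lemma Ad_facts:
  assumes G: "lie_group G" and g: "g \<in> carrier G" and A: "A \<in> lie_alg G" "B \<in> lie_alg G"
  shows "Ad G g A \<in> lie_alg G" "Ad G g (A + B) = Ad G g A + Ad G g B" "Ad G g (a *\<^sub>R A) = a *\<^sub>R Ad G g A"
proof -
  interpret group G by (rule lie_groupD(1)[OF G])
  have s: "smooth_map (charts G) (charts G) (\<lambda>x. g \<otimes>\<^bsub>G\<^esub> x \<otimes>\<^bsub>G\<^esub> inv\<^bsub>G\<^esub> g)"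
    using smooth_map_translate[OF G g] g by simp
  show "Ad G g A \<in> lie_alg G" "Ad G g (A + B) = Ad G g A + Ad G g B" "Ad G g (a *\<^sub>R A) = a *\<^sub>R Ad G g A"
    unfolding Ad_def using Lmap_mem[OF G G s _ A(1)] Lmap_linear[OF G G s A] g by simp_all
qed

section \<open>Crossed modules\<close>

locale lie_xmod =
  fixes K :: "('g, 'm::real_inner, 'h, 'n::real_inner) xmod"
  assumes xmod: "lie_crossed_module K" and semi: "lie_group (semidirect K)"
begin

abbreviation "G \<equiv> GG K"
abbreviation "H \<equiv> HH K"
abbreviation "S \<equiv> semidirect K"
abbreviation "L \<equiv> lie_2alg K"

lemma G: "lie_group G" and H: "lie_group H"
  using xmod unfolding lie_crossed_module_def by - (elim conjE, assumption)+

sublocale G: group G by (rule lie_groupD(1)[OF G])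
sublocale H: group H by (rule lie_groupD(1)[OF H])
sublocale S: group S by (rule lie_groupD(1)[OF semi])

lemma semidirect_simps [simp]:
  "carrier S = carrier H \<times> carrier G" "\<one>\<^bsub>S\<^esub> = (\<one>\<^bsub>H\<^esub>, \<one>\<^bsub>G\<^esub>)" "charts S = prod_atlas (charts H) (charts G)"
  "(h2, g2) \<otimes>\<^bsub>S\<^esub> (h1, g1) = (h2 \<otimes>\<^bsub>H\<^esub> alpha K g2 h1, g2 \<otimes>\<^bsub>G\<^esub> g1)"
  by (simp_all add: semidirect_def)

lemma xmod_conjuncts:
  "tau K \<in> hom H G" "smooth_map (charts H) (charts G) (tau K)"
  "smooth_map (prod_atlas (charts G) (charts H)) (charts H) (\<lambda>(g, h). alpha K g h)"
  "\<forall>g\<in>carrier G. alpha K g \<in> hom H H" "\<forall>h\<in>carrier H. alpha K \<one>\<^bsub>G\<^esub> h = h"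
  "\<forall>g\<in>carrier G. \<forall>g'\<in>carrier G. \<forall>h\<in>carrier H. alpha K (g \<otimes>\<^bsub>G\<^esub> g') h = alpha K g (alpha K g' h)"
  "\<forall>g\<in>carrier G. \<forall>h\<in>carrier H. tau K (alpha K g h) = g \<otimes>\<^bsub>G\<^esub> tau K h \<otimes>\<^bsub>G\<^esub> inv\<^bsub>G\<^esub> g"
  "\<forall>h\<in>carrier H. \<forall>h'\<in>carrier H. alpha K (tau K h) h' = h \<otimes>\<^bsub>H\<^esub> h' \<otimes>\<^bsub>H\<^esub> inv\<^bsub>H\<^esub> h"
  using xmod unfolding lie_crossed_module_def by - (elim conjE, assumption)+

lemmas tau_hom = xmod_conjuncts(1) and tau_smooth = xmod_conjuncts(2) and alpha_smooth = xmod_conjuncts(3)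

lemma alpha_hom: "g \<in> carrier G \<Longrightarrow> alpha K g \<in> hom H H"
  by (rule bspec[OF xmod_conjuncts(4)])

lemma tau_closed [simp]: "h \<in> carrier H \<Longrightarrow> tau K h \<in> carrier G"
  by (rule hom_in_carrier[OF tau_hom])

lemma alpha_closed [simp]: "g \<in> carrier G \<Longrightarrow> h \<in> carrier H \<Longrightarrow> alpha K g h \<in> carrier H"
  by (rule hom_in_carrier[OF alpha_hom])

lemma alpha_mult: "g \<in> carrier G \<Longrightarrow> h \<in> carrier H \<Longrightarrow> h' \<in> carrier H \<Longrightarrow>
    alpha K g (h \<otimes>\<^bsub>H\<^esub> h') = alpha K g h \<otimes>\<^bsub>H\<^esub> alpha K g h'"
  by (rule hom_mult[OF alpha_hom])

lemma alpha_comp: "g \<in> carrier G \<Longrightarrow> g' \<in> carrier G \<Longrightarrow> h \<in> carrier H \<Longrightarrow> alpha K (g \<otimes>\<^bsub>G\<^esub> g') h = alpha K g (alpha K g' h)"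
  by (rule xmod_conjuncts(6)[THEN bspec, THEN bspec, THEN bspec])

lemma tau_alpha: "g \<in> carrier G \<Longrightarrow> h \<in> carrier H \<Longrightarrow> tau K (alpha K g h) = g \<otimes>\<^bsub>G\<^esub> tau K h \<otimes>\<^bsub>G\<^esub> inv\<^bsub>G\<^esub> g"
  by (rule xmod_conjuncts(7)[THEN bspec, THEN bspec])

lemma peiffer: "h \<in> carrier H \<Longrightarrow> h' \<in> carrier H \<Longrightarrow> alpha K (tau K h) h' = h \<otimes>\<^bsub>H\<^esub> h' \<otimes>\<^bsub>H\<^esub> inv\<^bsub>H\<^esub> h"
  by (rule xmod_conjuncts(8)[THEN bspec, THEN bspec])

lemma tau_one [simp]: "tau K \<one>\<^bsub>H\<^esub> = \<one>\<^bsub>G\<^esub>"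
  using hom_one[OF tau_hom H.is_group G.is_group] .

lemma tau_inv: "h \<in> carrier H \<Longrightarrow> tau K (inv\<^bsub>H\<^esub> h) = inv\<^bsub>G\<^esub> (tau K h)"
  using group_hom.hom_inv[of H G "tau K" h] tau_hom by (simp add: group_hom_def group_hom_axioms_def H.is_group G.is_group)

lemma alpha_one [simp]: "g \<in> carrier G \<Longrightarrow> alpha K g \<one>\<^bsub>H\<^esub> = \<one>\<^bsub>H\<^esub>"
  using hom_one[OF alpha_hom H.is_group H.is_group] .

lemma alpha_inv: "g \<in> carrier G \<Longrightarrow> h \<in> carrier H \<Longrightarrow> alpha K g (inv\<^bsub>H\<^esub> h) = inv\<^bsub>H\<^esub> (alpha K g h)"
  using group_hom.hom_inv[of H H "alpha K g" h] alpha_hom by (simp add: group_hom_def group_hom_axioms_def H.is_group)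

lemma alpha_smooth1: "g \<in> carrier G \<Longrightarrow> smooth_map (charts H) (charts H) (alpha K g)"
  using smooth_map_Pair_comp[OF lie_groupD(2)[OF H] lie_groupD(2)[OF G] lie_groupD(2)[OF H] lie_groupD(2)[OF H] alpha_smooth
      smooth_map_const[OF lie_groupD(2)[OF H] lie_groupD(2)[OF G]] smooth_map_ident[OF lie_groupD(2)[OF H]]]
  by (simp add: lie_groupD(3)[OF G])

lemma inv_semidirect:
  assumes "h \<in> carrier H" "g \<in> carrier G"
  shows "inv\<^bsub>S\<^esub> (h, g) = (alpha K (inv\<^bsub>G\<^esub> g) (inv\<^bsub>H\<^esub> h), inv\<^bsub>G\<^esub> g)"
  by (rule S.inv_equality) (use assms in \<open>simp_all flip: alpha_mult\<close>)

lemma Idn_2group: "Idn (lie_2group K) g = (\<one>\<^bsub>H\<^esub>, g)"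
  by (simp add: lie_2group_def)

lemma lie_2alg_simps [simp]:
  "Ob L = lie_alg G" "Mor L = lie_alg H \<times> lie_alg G" "Src L = snd" "Tgt L (A, B) = Ltau K A + B" "Idn L B = (0, B)"
  "Cmp L (A2, B2) (A1, B1) = (A2 + A1, B1)" "ob_charts L = lie_alg_atlas G"
  "mor_charts L = prod_atlas (lie_alg_atlas H) (lie_alg_atlas G)"
  by (simp_all add: lie_2alg_def)

lemma Cmp_L: "Cmp L y x = (fst y + fst x, snd x)" and Tgt_L: "Tgt L x = Ltau K (fst x) + snd x"
  by (simp_all add: lie_2alg_def split_beta)

lemmas LH = lie_alg_subspace[OF H] and LG = lie_alg_subspace[OF G]

lemma Ltau_facts:
  assumes "A \<in> lie_alg H" "B \<in> lie_alg H"
  shows "Ltau K A \<in> lie_alg G" "Ltau K (A + B) = Ltau K A + Ltau K B" "Ltau K (a *\<^sub>R A) = a *\<^sub>R Ltau K A"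
    "Ltau K (A - B) = Ltau K A - Ltau K B" "Ltau K (- A) = - Ltau K A"
  unfolding Ltau_def
  using Lmap_mem[OF H G tau_smooth tau_one assms(1)] Lmap_linear[OF H G tau_smooth assms] by simp_all

lemma Ltau_0 [simp]: "Ltau K 0 = 0"
  using Ltau_facts(3)[OF subspace_0[OF LH] subspace_0[OF LH], of 0] by simp

lemma Ltau_smooth: "smooth_map (lie_alg_atlas H) (lie_alg_atlas G) (Ltau K)"
  unfolding Ltau_def by (rule Lmap_smooth[OF H G tau_smooth tau_one])

lemma velocity_Ltau: "has_velocity (charts H) \<gamma> (\<one>\<^bsub>H\<^esub>, A) \<Longrightarrow> has_velocity (charts G) (\<lambda>t. tau K (\<gamma> t)) (\<one>\<^bsub>G\<^esub>, Ltau K A)"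
  unfolding Ltau_def by (rule velocity_Lmap[OF H G tau_smooth tau_one])

lemma Lalpha_facts:
  assumes "g \<in> carrier G" "A \<in> lie_alg H" "B \<in> lie_alg H"
  shows "Lalpha K g A \<in> lie_alg H" "Lalpha K g (A + B) = Lalpha K g A + Lalpha K g B" "Lalpha K g (a *\<^sub>R A) = a *\<^sub>R Lalpha K g A"
    "Lalpha K g (A - B) = Lalpha K g A - Lalpha K g B" "Lalpha K g (- A) = - Lalpha K g A" "Lalpha K g 0 = 0"
  unfolding Lalpha_def
  using Lmap_mem[OF H H alpha_smooth1[OF assms(1)] alpha_one[OF assms(1)] assms(2)]
    Lmap_linear[OF H H alpha_smooth1[OF assms(1)] assms(2,3)] by simp_all

lemma velocity_Lalpha:
  "g \<in> carrier G \<Longrightarrow> has_velocity (charts H) \<gamma> (\<one>\<^bsub>H\<^esub>, A) \<Longrightarrow> has_velocity (charts H) (\<lambda>t. alpha K g (\<gamma> t)) (\<one>\<^bsub>H\<^esub>, Lalpha K g A)"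
  unfolding Lalpha_def by (rule velocity_Lmap[OF H H alpha_smooth1 alpha_one])

lemma category_L: "category L"
  unfolding category_def
  by (auto simp: Cmp_L Tgt_L Ltau_facts subspace_add[OF LG] subspace_add[OF LH] subspace_0[OF LH] add.assoc)

lemma inverse_arrows_L:
  assumes "x \<in> Mor L" shows "inverse_arrows L x (- fst x, Ltau K (fst x) + snd x)"
  using assms unfolding inverse_arrows_def
  by (auto simp: Cmp_L Tgt_L Ltau_facts[where B = 0] subspace_0[OF LH] subspace_neg[OF LH] subspace_add[OF LG])

subsection \<open>The adjoint action on \<open>L(H) \<oplus> L(G)\<close>\<close>

text \<open>The decomposition of the Lie algebra of \<open>H \<rtimes> G\<close> is defined by differentials of group-level maps. This
  lemma and the next one characterize it by pairs of curves, the form in which conjugation can be computed.\<close>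

lemma velocity_join:
  assumes "has_velocity (charts H) \<gamma> (\<one>\<^bsub>H\<^esub>, A)" "has_velocity (charts G) \<mu> (\<one>\<^bsub>G\<^esub>, B)"
  shows "has_velocity (charts S) (\<lambda>t. (\<gamma> t, \<mu> t)) (\<one>\<^bsub>S\<^esub>, join_alg K (A, B))"
  using velocity_Pair[OF lie_groupD(2)[OF H] lie_groupD(2)[OF G] assms]
  by (simp add: join_alg_def tpair_def Lmap_def)

lemma velocity_split:
  assumes "has_velocity (charts S) \<sigma> (\<one>\<^bsub>S\<^esub>, C)"
  shows "has_velocity (charts H) (\<lambda>t. fst (\<sigma> t)) (\<one>\<^bsub>H\<^esub>, fst (split_alg K C))"
    "has_velocity (charts G) (\<lambda>t. snd (\<sigma> t)) (\<one>\<^bsub>G\<^esub>, snd (split_alg K C))"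
  using velocity_Lmap[OF semi H _ _ assms, of fst] velocity_Lmap[OF semi G _ _ assms, of snd]
    smooth_map_fst[OF lie_groupD(2)[OF H] lie_groupD(2)[OF G]] smooth_map_snd[OF lie_groupD(2)[OF H] lie_groupD(2)[OF G]]
  by (simp_all add: split_alg_def)

lemma velocity_Ad1:
  assumes "has_velocity (charts H) \<gamma> (\<one>\<^bsub>H\<^esub>, A)" "has_velocity (charts G) \<mu> (\<one>\<^bsub>G\<^esub>, B)" "a \<in> carrier S"
  shows "has_velocity (charts H) (\<lambda>t. fst (a \<otimes>\<^bsub>S\<^esub> (\<gamma> t, \<mu> t) \<otimes>\<^bsub>S\<^esub> inv\<^bsub>S\<^esub> a)) (\<one>\<^bsub>H\<^esub>, fst (Ad1 K a (A, B)))"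
    "has_velocity (charts G) (\<lambda>t. snd (a \<otimes>\<^bsub>S\<^esub> (\<gamma> t, \<mu> t) \<otimes>\<^bsub>S\<^esub> inv\<^bsub>S\<^esub> a)) (\<one>\<^bsub>G\<^esub>, snd (Ad1 K a (A, B)))"
  unfolding Ad1_def
  by (rule velocity_split[OF velocity_Ad[OF semi assms(3) velocity_join[OF assms(1,2)]]])+

lemma Ad_unit_inv_apply:
  assumes g: "g \<in> carrier G" and A: "A \<in> lie_alg H" and B: "B \<in> lie_alg G"
  shows "Ad_unit_inv K g (A, B) = (Lalpha K (inv\<^bsub>G\<^esub> g) A, Ad G (inv\<^bsub>G\<^esub> g) B)"
proof -
  obtain \<gamma> where \<gamma>: "has_velocity (charts H) \<gamma> (\<one>\<^bsub>H\<^esub>, A)" using lie_alg_curve[OF H A] .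
  obtain \<mu> where \<mu>: "has_velocity (charts G) \<mu> (\<one>\<^bsub>G\<^esub>, B)" using lie_alg_curve[OF G B] .
  have a: "inv\<^bsub>S\<^esub> (\<one>\<^bsub>H\<^esub>, g) \<in> carrier S" by (rule S.inv_closed) (simp add: g)
  have ev: "\<forall>\<^sub>F t in nhds 0. \<gamma> t \<in> carrier H \<and> \<mu> t \<in> carrier G"
    using velocity_eventually[OF \<gamma>] velocity_eventually[OF \<mu>]
    by eventually_elim (simp add: lie_groupD(3)[OF H] lie_groupD(3)[OF G])
  have e: "inv\<^bsub>S\<^esub> (\<one>\<^bsub>H\<^esub>, g) \<otimes>\<^bsub>S\<^esub> (x, y) \<otimes>\<^bsub>S\<^esub> inv\<^bsub>S\<^esub> (inv\<^bsub>S\<^esub> (\<one>\<^bsub>H\<^esub>, g)) =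
      (alpha K (inv\<^bsub>G\<^esub> g) x, inv\<^bsub>G\<^esub> g \<otimes>\<^bsub>G\<^esub> y \<otimes>\<^bsub>G\<^esub> inv\<^bsub>G\<^esub> (inv\<^bsub>G\<^esub> g))"
    if "x \<in> carrier H" "y \<in> carrier G" for x y
    using that g by (simp add: inv_semidirect)
  have "\<forall>\<^sub>F t in nhds 0. fst (inv\<^bsub>S\<^esub> (\<one>\<^bsub>H\<^esub>, g) \<otimes>\<^bsub>S\<^esub> (\<gamma> t, \<mu> t) \<otimes>\<^bsub>S\<^esub> inv\<^bsub>S\<^esub> (inv\<^bsub>S\<^esub> (\<one>\<^bsub>H\<^esub>, g))) = alpha K (inv\<^bsub>G\<^esub> g) (\<gamma> t)"
    "\<forall>\<^sub>F t in nhds 0. snd (inv\<^bsub>S\<^esub> (\<one>\<^bsub>H\<^esub>, g) \<otimes>\<^bsub>S\<^esub> (\<gamma> t, \<mu> t) \<otimes>\<^bsub>S\<^esub> inv\<^bsub>S\<^esub> (inv\<^bsub>S\<^esub> (\<one>\<^bsub>H\<^esub>, g))) =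
       inv\<^bsub>G\<^esub> g \<otimes>\<^bsub>G\<^esub> \<mu> t \<otimes>\<^bsub>G\<^esub> inv\<^bsub>G\<^esub> (inv\<^bsub>G\<^esub> g)"
    by (rule eventually_mono[OF ev], simp only: e fst_conv snd_conv)+
  then show ?thesis
    using velocity_unique[OF velocity_cong[OF velocity_Ad1(1)[OF \<gamma> \<mu> a]] velocity_Lalpha[OF _ \<gamma>]]
      velocity_unique[OF velocity_cong[OF velocity_Ad1(2)[OF \<gamma> \<mu> a]] velocity_Ad[OF G _ \<mu>]] g
    unfolding Ad_unit_inv_def Idn_2group by (simp add: prod_eq_iff)
qed

lemma Ltau_Lalpha:
  assumes g: "g \<in> carrier G" and A: "A \<in> lie_alg H"
  shows "Ltau K (Lalpha K g A) = Ad G g (Ltau K A)"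
proof -
  obtain \<gamma> where \<gamma>: "has_velocity (charts H) \<gamma> (\<one>\<^bsub>H\<^esub>, A)" using lie_alg_curve[OF H A] .
  have "\<forall>\<^sub>F t in nhds 0. tau K (alpha K g (\<gamma> t)) = g \<otimes>\<^bsub>G\<^esub> tau K (\<gamma> t) \<otimes>\<^bsub>G\<^esub> inv\<^bsub>G\<^esub> g"
    using velocity_eventually[OF \<gamma>] by eventually_elim (simp add: lie_groupD(3)[OF H] tau_alpha g)
  then show ?thesis
    using velocity_unique[OF velocity_cong[OF velocity_Ltau[OF velocity_Lalpha[OF g \<gamma>]]] velocity_Ad[OF G g velocity_Ltau[OF \<gamma>]]]
    by simp
qed

text \<open>The Peiffer identity in infinitesimal form; it is what makes the forms \<open>\<lambda>-bar\<close> equivariant on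
  arrows. The pair on the left is the velocity of the curve \<open>(x(t) z(t)\<inverse>, \<tau>(z(t)))\<close>, whose
  conjugate is computed in the group.\<close>

lemma Ad1_bar:
  assumes h: "h \<in> carrier H" and g: "g \<in> carrier G" and A: "A \<in> lie_alg H" "B \<in> lie_alg H"
  shows "Ad1 K (inv\<^bsub>S\<^esub> (h, g)) (A - B, Ltau K B) =
    (Lalpha K (inv\<^bsub>G\<^esub> (tau K h \<otimes>\<^bsub>G\<^esub> g)) A - Lalpha K (inv\<^bsub>G\<^esub> g) B, Ltau K (Lalpha K (inv\<^bsub>G\<^esub> g) B))"
proof -
  obtain x where x: "has_velocity (charts H) x (\<one>\<^bsub>H\<^esub>, A)" using lie_alg_curve[OF H A(1)] .
  obtain z where z: "has_velocity (charts H) z (\<one>\<^bsub>H\<^esub>, B)" using lie_alg_curve[OF H A(2)] .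
  let ?i = "inv\<^bsub>G\<^esub> g" and ?a = "inv\<^bsub>S\<^esub> (h, g)"
  have xz: "has_velocity (charts H) (\<lambda>t. x t \<otimes>\<^bsub>H\<^esub> inv\<^bsub>H\<^esub> (z t)) (\<one>\<^bsub>H\<^esub>, A - B)"
    using velocity_mult[OF H x velocity_inv[OF H z]] by simp
  have a: "?a \<in> carrier S" by (rule S.inv_closed) (simp add: h g)
  have ai: "inv\<^bsub>S\<^esub> ?a = (h, g)" by (rule S.inv_inv) (simp add: h g)
  have key: "?a \<otimes>\<^bsub>S\<^esub> (X \<otimes>\<^bsub>H\<^esub> inv\<^bsub>H\<^esub> Z, tau K Z) \<otimes>\<^bsub>S\<^esub> inv\<^bsub>S\<^esub> ?a =
      (alpha K (inv\<^bsub>G\<^esub> (tau K h \<otimes>\<^bsub>G\<^esub> g)) X \<otimes>\<^bsub>H\<^esub> inv\<^bsub>H\<^esub> (alpha K ?i Z), tau K (alpha K ?i Z))"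
    if X: "X \<in> carrier H" "Z \<in> carrier H" for X Z
  proof -
    have "alpha K (inv\<^bsub>G\<^esub> (tau K h \<otimes>\<^bsub>G\<^esub> g)) X = alpha K ?i (alpha K (tau K (inv\<^bsub>H\<^esub> h)) X)"
      using X h g by (simp add: G.inv_mult_group alpha_comp tau_inv)
    also have "\<dots> = alpha K ?i (inv\<^bsub>H\<^esub> h \<otimes>\<^bsub>H\<^esub> X \<otimes>\<^bsub>H\<^esub> h)" using X h by (simp add: peiffer)
    finally have l: "alpha K (inv\<^bsub>G\<^esub> (tau K h \<otimes>\<^bsub>G\<^esub> g)) X = alpha K ?i (inv\<^bsub>H\<^esub> h \<otimes>\<^bsub>H\<^esub> X \<otimes>\<^bsub>H\<^esub> h)" .
    have "alpha K (?i \<otimes>\<^bsub>G\<^esub> tau K Z) h = alpha K ?i (Z \<otimes>\<^bsub>H\<^esub> h \<otimes>\<^bsub>H\<^esub> inv\<^bsub>H\<^esub> Z)"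
      using X h g by (simp add: alpha_comp peiffer)
    then have "?a \<otimes>\<^bsub>S\<^esub> (X \<otimes>\<^bsub>H\<^esub> inv\<^bsub>H\<^esub> Z, tau K Z) \<otimes>\<^bsub>S\<^esub> inv\<^bsub>S\<^esub> ?a =
        (alpha K ?i (inv\<^bsub>H\<^esub> h) \<otimes>\<^bsub>H\<^esub> alpha K ?i (X \<otimes>\<^bsub>H\<^esub> inv\<^bsub>H\<^esub> Z) \<otimes>\<^bsub>H\<^esub> alpha K ?i (Z \<otimes>\<^bsub>H\<^esub> h \<otimes>\<^bsub>H\<^esub> inv\<^bsub>H\<^esub> Z), ?i \<otimes>\<^bsub>G\<^esub> tau K Z \<otimes>\<^bsub>G\<^esub> g)"
      unfolding ai unfolding inv_semidirect[OF h g] using X h g by simp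
    also have "alpha K ?i (inv\<^bsub>H\<^esub> h) \<otimes>\<^bsub>H\<^esub> alpha K ?i (X \<otimes>\<^bsub>H\<^esub> inv\<^bsub>H\<^esub> Z) \<otimes>\<^bsub>H\<^esub> alpha K ?i (Z \<otimes>\<^bsub>H\<^esub> h \<otimes>\<^bsub>H\<^esub> inv\<^bsub>H\<^esub> Z) =
        alpha K ?i (inv\<^bsub>H\<^esub> h \<otimes>\<^bsub>H\<^esub> (X \<otimes>\<^bsub>H\<^esub> inv\<^bsub>H\<^esub> Z) \<otimes>\<^bsub>H\<^esub> (Z \<otimes>\<^bsub>H\<^esub> h \<otimes>\<^bsub>H\<^esub> inv\<^bsub>H\<^esub> Z))"
      using X h g by (simp add: alpha_mult)
    also have "inv\<^bsub>H\<^esub> h \<otimes>\<^bsub>H\<^esub> (X \<otimes>\<^bsub>H\<^esub> inv\<^bsub>H\<^esub> Z) \<otimes>\<^bsub>H\<^esub> (Z \<otimes>\<^bsub>H\<^esub> h \<otimes>\<^bsub>H\<^esub> inv\<^bsub>H\<^esub> Z) = (inv\<^bsub>H\<^esub> h \<otimes>\<^bsub>H\<^esub> X \<otimes>\<^bsub>H\<^esub> h) \<otimes>\<^bsub>H\<^esub> inv\<^bsub>H\<^esub> Z"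
    proof -
      have "inv\<^bsub>H\<^esub> Z \<otimes>\<^bsub>H\<^esub> (Z \<otimes>\<^bsub>H\<^esub> (h \<otimes>\<^bsub>H\<^esub> inv\<^bsub>H\<^esub> Z)) = h \<otimes>\<^bsub>H\<^esub> inv\<^bsub>H\<^esub> Z"
        using X h H.m_assoc[of "inv\<^bsub>H\<^esub> Z" Z "h \<otimes>\<^bsub>H\<^esub> inv\<^bsub>H\<^esub> Z"] by simp
      then show ?thesis using X h by (simp add: H.m_assoc)
    qed
    also have "alpha K ?i ((inv\<^bsub>H\<^esub> h \<otimes>\<^bsub>H\<^esub> X \<otimes>\<^bsub>H\<^esub> h) \<otimes>\<^bsub>H\<^esub> inv\<^bsub>H\<^esub> Z) =
        alpha K (inv\<^bsub>G\<^esub> (tau K h \<otimes>\<^bsub>G\<^esub> g)) X \<otimes>\<^bsub>H\<^esub> inv\<^bsub>H\<^esub> (alpha K ?i Z)"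
      unfolding l using X h g by (simp add: alpha_mult alpha_inv)
    finally show ?thesis using X h g by (simp add: tau_alpha)
  qed
  have ev: "\<forall>\<^sub>F t in nhds 0. x t \<in> carrier H \<and> z t \<in> carrier H"
    using velocity_eventually[OF x] velocity_eventually[OF z] by eventually_elim (simp add: lie_groupD(3)[OF H])
  have "\<forall>\<^sub>F t in nhds 0. fst (?a \<otimes>\<^bsub>S\<^esub> (x t \<otimes>\<^bsub>H\<^esub> inv\<^bsub>H\<^esub> z t, tau K (z t)) \<otimes>\<^bsub>S\<^esub> inv\<^bsub>S\<^esub> ?a) =
      alpha K (inv\<^bsub>G\<^esub> (tau K h \<otimes>\<^bsub>G\<^esub> g)) (x t) \<otimes>\<^bsub>H\<^esub> inv\<^bsub>H\<^esub> (alpha K ?i (z t))"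
    "\<forall>\<^sub>F t in nhds 0. snd (?a \<otimes>\<^bsub>S\<^esub> (x t \<otimes>\<^bsub>H\<^esub> inv\<^bsub>H\<^esub> z t, tau K (z t)) \<otimes>\<^bsub>S\<^esub> inv\<^bsub>S\<^esub> ?a) = tau K (alpha K ?i (z t))"
    by (rule eventually_mono[OF ev], simp only: key fst_conv snd_conv)+
  note c = this
  have i: "?i \<in> carrier G" "inv\<^bsub>G\<^esub> (tau K h \<otimes>\<^bsub>G\<^esub> g) \<in> carrier G" using h g by simp_all
  show ?thesis
    using velocity_unique[OF velocity_cong[OF velocity_Ad1(1)[OF xz velocity_Ltau[OF z] a] c(1)]
        velocity_mult[OF H velocity_Lalpha[OF i(2) x] velocity_inv[OF H velocity_Lalpha[OF i(1) z]]]]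
      velocity_unique[OF velocity_cong[OF velocity_Ad1(2)[OF xz velocity_Ltau[OF z] a] c(2)]
        velocity_Ltau[OF velocity_Lalpha[OF i(1) z]]]
    by (simp add: prod_eq_iff)
qed

lemma Ad1_add:
  assumes a: "a \<in> carrier S" and C: "C \<in> Mor L" "D \<in> Mor L"
  shows "Ad1 K a (C + D) = Ad1 K a C + Ad1 K a D" "Ad1 K a C \<in> Mor L"
proof -
  obtain A B A' B' where e: "C = (A, B)" "D = (A', B')" by (cases C, cases D) auto
  have m: "A \<in> lie_alg H" "B \<in> lie_alg G" "A' \<in> lie_alg H" "B' \<in> lie_alg G" using C e by auto
  obtain \<gamma> where \<gamma>: "has_velocity (charts H) \<gamma> (\<one>\<^bsub>H\<^esub>, A)" using lie_alg_curve[OF H m(1)] .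
  obtain \<mu> where \<mu>: "has_velocity (charts G) \<mu> (\<one>\<^bsub>G\<^esub>, B)" using lie_alg_curve[OF G m(2)] .
  show "Ad1 K a C \<in> Mor L"
    using velocity_lie_alg[OF H velocity_Ad1(1)[OF \<gamma> \<mu> a]] velocity_lie_alg[OF G velocity_Ad1(2)[OF \<gamma> \<mu> a]]
    by (simp add: e mem_Times_iff)
  have j: "join_alg K C \<in> lie_alg S" if "C \<in> Mor L" for C
  proof -
    have "fst C \<in> lie_alg H" "snd C \<in> lie_alg G" using that by auto
    then obtain \<gamma> \<mu> where "has_velocity (charts H) \<gamma> (\<one>\<^bsub>H\<^esub>, fst C)" "has_velocity (charts G) \<mu> (\<one>\<^bsub>G\<^esub>, snd C)"
      using lie_alg_curve[OF H] lie_alg_curve[OF G] by metis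
    from velocity_lie_alg[OF semi velocity_join[OF this]] show ?thesis by simp
  qed
  note s = smooth_map_slice[OF lie_groupD(2)[OF H] lie_groupD(2)[OF G]]
  have "join_alg K (C + D) = join_alg K C + join_alg K D"
    using Lmap_linear(1)[OF H semi _ m(1,3), of "\<lambda>h. (h, \<one>\<^bsub>G\<^esub>)"] Lmap_linear(1)[OF G semi _ m(2,4), of "\<lambda>g. (\<one>\<^bsub>H\<^esub>, g)"]
      s(1)[of "\<one>\<^bsub>G\<^esub>"] s(2)[of "\<one>\<^bsub>H\<^esub>"] lie_groupD(6)[OF H] lie_groupD(6)[OF G]
    by (simp add: join_alg_def e)
  moreover have "split_alg K (X + Y) = split_alg K X + split_alg K Y" if "X \<in> lie_alg S" "Y \<in> lie_alg S" for X Y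
    using Lmap_linear(1)[OF semi H _ that, of fst] Lmap_linear(1)[OF semi G _ that, of snd]
      smooth_map_fst[OF lie_groupD(2)[OF H] lie_groupD(2)[OF G]] smooth_map_snd[OF lie_groupD(2)[OF H] lie_groupD(2)[OF G]]
    by (simp add: split_alg_def)
  ultimately show "Ad1 K a (C + D) = Ad1 K a C + Ad1 K a D"
    unfolding Ad1_def using Ad_facts(1,2)[OF semi a j[OF C(1)] j[OF C(2)]] Ad_facts(1)[OF semi a j[OF C(2)] j[OF C(2)]] by simp
qed

end

section \<open>Principal 2-bundles\<close>

lemma prod_lie_gpd_simps [simp]:
  "Ob (prod_lie_gpd E D) = Ob E \<times> Ob D" "Mor (prod_lie_gpd E D) = Mor E \<times> Mor D"
  "Src (prod_lie_gpd E D) = map_prod (Src E) (Src D)" "Tgt (prod_lie_gpd E D) = map_prod (Tgt E) (Tgt D)"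
  "Idn (prod_lie_gpd E D) = map_prod (Idn E) (Idn D)"
  "Cmp (prod_lie_gpd E D) = (\<lambda>(y, y') (x, x'). (Cmp E y x, Cmp D y' x'))"
  "ob_charts (prod_lie_gpd E D) = prod_atlas (ob_charts E) (ob_charts D)"
  "mor_charts (prod_lie_gpd E D) = prod_atlas (mor_charts E) (mor_charts D)"
  by (simp_all add: prod_lie_gpd_def prod_cat_def cat.defs lie_gpd.defs)

locale gauge_bundle = lie_xmod K
  for K :: "('g, 'm::real_inner, 'h, 'n::real_inner) xmod" +
  fixes P :: "('g, 'h, 'p, 'q, 'k::real_inner, 'l::real_inner, 'x, 'y, 'i::real_inner, 'j::real_inner) bundle_data"
  assumes principal: "principal_2bundle K P"
begin

abbreviation "E \<equiv> total P"
abbreviation "T \<equiv> tangent_gpd (total P)"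
abbreviation "OE \<equiv> ob_charts (total P)"
abbreviation "ME \<equiv> mor_charts (total P)"
abbreviation "act0 p g \<equiv> fst (act P) (p, g)"
abbreviation "act1 x a \<equiv> snd (act P) (x, a)"

lemma E: "lie_groupoid E"
  using principal unfolding principal_2bundle_def by (elim conjE)

lemma base_gpd: "lie_groupoid (base P)" and proj_functor: "lie_functor E (base P) (proj P)"
  and act_functor: "lie_functor (prod_lie_gpd E (lie_2group K)) E (act P)"
  and action0: "lie_group_right_action G OE (fst (act P))"
  and action1: "lie_group_right_action S ME (snd (act P))"
  using principal unfolding principal_2bundle_def principal_bundle_def by - (elim conjE, assumption)+

lemmas e = lie_groupoidD[OF E]
lemmas eC = categoryD[OF lie_groupoidD(1)[OF E]]
lemmas tC = categoryD[OF category_tangent_gpd[OF E]]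
lemmas GA = lie_groupD(2)[OF G] and HA = lie_groupD(2)[OF H]
lemmas SA = smooth_atlas_prod[OF HA GA]

lemma act_smooth: "smooth_map (prod_atlas OE (charts G)) OE (fst (act P))" "smooth_map (prod_atlas ME (charts S)) ME (snd (act P))"
  using action0 action1 unfolding lie_group_right_action_def by simp_all

lemma act0_closed [simp]: "p \<in> Ob E \<Longrightarrow> g \<in> carrier G \<Longrightarrow> act0 p g \<in> Ob E"
  using smooth_mapD(1)[OF act_smooth(1), of "(p, g)"] by (simp add: e(4) lie_groupD(3)[OF G])

lemma act1_closed [simp]: "x \<in> Mor E \<Longrightarrow> h \<in> carrier H \<Longrightarrow> g \<in> carrier G \<Longrightarrow> act1 x (h, g) \<in> Mor E"
  using smooth_mapD(1)[OF act_smooth(2), of "(x, (h, g))"] by (simp add: e(5) lie_groupD(3)[OF G] lie_groupD(3)[OF H])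

lemma act0_one [simp]: "p \<in> Ob E \<Longrightarrow> act0 p \<one>\<^bsub>G\<^esub> = p"
  and act0_mult: "p \<in> Ob E \<Longrightarrow> g \<in> carrier G \<Longrightarrow> g' \<in> carrier G \<Longrightarrow> act0 (act0 p g) g' = act0 p (g \<otimes>\<^bsub>G\<^esub> g')"
  using action0 unfolding lie_group_right_action_def e(4) by simp_all

lemma act1_Src: "x \<in> Mor E \<Longrightarrow> h \<in> carrier H \<Longrightarrow> g \<in> carrier G \<Longrightarrow> Src E (act1 x (h, g)) = act0 (Src E x) g"
  and act1_Tgt: "x \<in> Mor E \<Longrightarrow> h \<in> carrier H \<Longrightarrow> g \<in> carrier G \<Longrightarrow>
    Tgt E (act1 x (h, g)) = act0 (Tgt E x) (tau K h \<otimes>\<^bsub>G\<^esub> g)"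
  using is_functorD(3,4)[OF lie_functorD(1)[OF act_functor], of "(x, (h, g))"] by (simp_all add: lie_2group_def)

lemma act1_Idn: "p \<in> Ob E \<Longrightarrow> g \<in> carrier G \<Longrightarrow> act1 (Idn E p) (\<one>\<^bsub>H\<^esub>, g) = Idn E (act0 p g)"
  using is_functorD(5)[OF lie_functorD(1)[OF act_functor], of "(p, g)"] by (simp add: lie_2group_def)

lemma act1_Cmp:
  assumes "x \<in> Mor E" "y \<in> Mor E" "Src E y = Tgt E x" "g \<in> carrier G"
  shows "act1 (Cmp E y x) (\<one>\<^bsub>H\<^esub>, g) = Cmp E (act1 y (\<one>\<^bsub>H\<^esub>, g)) (act1 x (\<one>\<^bsub>H\<^esub>, g))"
  using is_functorD(6)[OF lie_functorD(1)[OF act_functor], of "(x, (\<one>\<^bsub>H\<^esub>, g))" "(y, (\<one>\<^bsub>H\<^esub>, g))"] assms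
  by (simp add: lie_2group_def)

lemma act_slice_smooth:
  "g \<in> carrier G \<Longrightarrow> smooth_map OE OE (\<lambda>p. act0 p g)" "p \<in> Ob E \<Longrightarrow> smooth_map (charts G) OE (\<lambda>g. act0 p g)"
  "a \<in> carrier S \<Longrightarrow> smooth_map ME ME (\<lambda>x. act1 x a)" "x \<in> Mor E \<Longrightarrow> smooth_map (charts S) ME (\<lambda>a. act1 x a)"
proof -
  note P0 = smooth_atlas_prod[OF e(2) GA] and P1 = smooth_atlas_prod[OF e(3) SA]
  show "smooth_map OE OE (\<lambda>p. act0 p g)" if "g \<in> carrier G"
    by (rule smooth_map_comp[OF e(2) P0 e(2) smooth_map_slice(1)[OF e(2) GA] act_smooth(1)])
      (simp add: that lie_groupD(3)[OF G])
  show "smooth_map (charts G) OE (\<lambda>g. act0 p g)" if "p \<in> Ob E"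
    by (rule smooth_map_comp[OF GA P0 e(2) smooth_map_slice(2)[OF e(2) GA] act_smooth(1)])
      (simp add: that e(4))
  show "smooth_map ME ME (\<lambda>x. act1 x a)" if "a \<in> carrier S"
    by (rule smooth_map_comp[OF e(3) P1 e(3) smooth_map_slice(1)[OF e(3) SA] act_smooth(2)[unfolded semidirect_simps]])
      (use that in \<open>auto simp: lie_groupD(3)[OF G] lie_groupD(3)[OF H]\<close>)
  show "smooth_map (charts S) ME (\<lambda>a. act1 x a)" if "x \<in> Mor E"
    unfolding semidirect_simps
    by (rule smooth_map_comp[OF SA P1 e(3) smooth_map_slice(2)[OF e(3) SA] act_smooth(2)[unfolded semidirect_simps]])
      (simp add: that e(5))
qed

subsection \<open>The infinitesimal actions\<close>

lemma velocity_tact: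
  "g \<in> carrier G \<Longrightarrow> has_velocity OE \<gamma> v \<Longrightarrow> has_velocity OE (\<lambda>t. act0 (\<gamma> t) g) (tact0 P v g)"
  "a \<in> carrier S \<Longrightarrow> has_velocity ME \<mu> x \<Longrightarrow> has_velocity ME (\<lambda>t. act1 (\<mu> t) a) (tact1 P x a)"
  unfolding tact0_def tact1_def
  by (rule velocity_Tmap[OF e(2,2) act_slice_smooth(1)] velocity_Tmap[OF e(3,3) act_slice_smooth(3)]; assumption)+

lemma tact0_closed: "v \<in> Ob T \<Longrightarrow> g \<in> carrier G \<Longrightarrow> tact0 P v g \<in> Ob T"
  and tact1_closed: "x \<in> Mor T \<Longrightarrow> a \<in> carrier S \<Longrightarrow> tact1 P x a \<in> Mor T"
  unfolding tact0_def tact1_def tangent_gpd_simps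
  by (rule Tmap_pts[OF e(2,2) act_slice_smooth(1)], assumption+, rule Tmap_pts[OF e(3,3) act_slice_smooth(3)])

lemma obtain_curve0: assumes "v \<in> Ob T" obtains \<gamma> where "has_velocity OE \<gamma> v" "\<forall>\<^sub>F t in nhds 0. \<gamma> t \<in> Ob E"
proof -
  obtain \<gamma> where \<gamma>: "has_velocity OE \<gamma> v" by (rule velocity_exists[OF e(2) assms[unfolded tangent_gpd_simps]])
  show ?thesis using that[OF \<gamma>] velocity_eventually[OF \<gamma>] e(4) by simp
qed

lemma obtain_curve1: assumes "x \<in> Mor T" obtains \<gamma> where "has_velocity ME \<gamma> x" "\<forall>\<^sub>F t in nhds 0. \<gamma> t \<in> Mor E"
proof -
  obtain \<gamma> where \<gamma>: "has_velocity ME \<gamma> x" by (rule velocity_exists[OF e(3) assms[unfolded tangent_gpd_simps]])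
  show ?thesis using that[OF \<gamma>] velocity_eventually[OF \<gamma>] e(5) by simp
qed

lemma Src_tact1: "x \<in> Mor T \<Longrightarrow> h \<in> carrier H \<Longrightarrow> g \<in> carrier G \<Longrightarrow> Src T (tact1 P x (h, g)) = tact0 P (Src T x) g"
  and Tgt_tact1: "x \<in> Mor T \<Longrightarrow> h \<in> carrier H \<Longrightarrow> g \<in> carrier G \<Longrightarrow>
    Tgt T (tact1 P x (h, g)) = tact0 P (Tgt T x) (tau K h \<otimes>\<^bsub>G\<^esub> g)"
proof -
  assume x: "x \<in> Mor T" and h: "h \<in> carrier H" and g: "g \<in> carrier G"
  obtain \<mu> where \<mu>: "has_velocity ME \<mu> x" and ev: "\<forall>\<^sub>F t in nhds 0. \<mu> t \<in> Mor E" using obtain_curve1[OF x] .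
  have a: "(h, g) \<in> carrier S" using h g by simp
  have hg: "tau K h \<otimes>\<^bsub>G\<^esub> g \<in> carrier G" using h g by simp
  have s: "\<forall>\<^sub>F t in nhds 0. Src E (act1 (\<mu> t) (h, g)) = act0 (Src E (\<mu> t)) g"
    by (rule eventually_mono[OF ev]) (simp add: act1_Src h g)
  have t: "\<forall>\<^sub>F t in nhds 0. Tgt E (act1 (\<mu> t) (h, g)) = act0 (Tgt E (\<mu> t)) (tau K h \<otimes>\<^bsub>G\<^esub> g)"
    by (rule eventually_mono[OF ev]) (simp add: act1_Tgt h g)
  show "Src T (tact1 P x (h, g)) = tact0 P (Src T x) g"
    using velocity_unique[OF velocity_cong[OF velocity_Tmap[OF e(3,2,8) velocity_tact(2)[OF a \<mu>]] s]
        velocity_tact(1)[OF g velocity_Tmap[OF e(3,2,8) \<mu>]]] by simp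
  show "Tgt T (tact1 P x (h, g)) = tact0 P (Tgt T x) (tau K h \<otimes>\<^bsub>G\<^esub> g)"
    using velocity_unique[OF velocity_cong[OF velocity_Tmap[OF e(3,2,9) velocity_tact(2)[OF a \<mu>]] t]
        velocity_tact(1)[OF hg velocity_Tmap[OF e(3,2,9) \<mu>]]] by simp
qed

subsection \<open>Fundamental vector fields\<close>

abbreviation "delta0 p B \<equiv> fst (fundamental K P) (p, B)"
abbreviation "delta1 x C \<equiv> snd (fundamental K P) (x, C)"

lemma velocity_delta0:
  assumes "p \<in> Ob E" "has_velocity (charts G) b (\<one>\<^bsub>G\<^esub>, B)"
  shows "has_velocity OE (\<lambda>t. act0 p (b t)) (delta0 p B)"
  using velocity_Tmap[OF GA e(2) act_slice_smooth(2)[OF assms(1)] assms(2)] by (simp add: fundamental_def)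

lemma velocity_delta1:
  assumes "x \<in> Mor E" "has_velocity (charts H) a (\<one>\<^bsub>H\<^esub>, A)" "has_velocity (charts G) b (\<one>\<^bsub>G\<^esub>, B)"
  shows "has_velocity ME (\<lambda>t. act1 x (a t, b t)) (delta1 x (A, B))"
  using velocity_Tmap[OF lie_groupD(2)[OF semi] e(3) act_slice_smooth(4)[OF assms(1)] velocity_join[OF assms(2,3)]]
  by (simp add: fundamental_def)

lemma eventually_carrier:
  "has_velocity (charts G) b (\<one>\<^bsub>G\<^esub>, B) \<Longrightarrow> \<forall>\<^sub>F t in nhds 0. b t \<in> carrier G"
  "has_velocity (charts H) a (\<one>\<^bsub>H\<^esub>, A) \<Longrightarrow> \<forall>\<^sub>F t in nhds 0. a t \<in> carrier H"
  by (drule velocity_eventually, simp add: lie_groupD(3)[OF G])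
    (drule velocity_eventually, simp add: lie_groupD(3)[OF H])

lemma delta0_closed:
  assumes p: "p \<in> Ob E" and B: "B \<in> lie_alg G" shows "delta0 p B \<in> Ob T"
proof -
  obtain b where "has_velocity (charts G) b (\<one>\<^bsub>G\<^esub>, B)" using lie_alg_curve[OF G B] .
  from velocity_pts[OF velocity_delta0[OF p this]] show ?thesis by simp
qed

lemma delta1_closed:
  assumes x: "x \<in> Mor E" and A: "A \<in> lie_alg H" and B: "B \<in> lie_alg G" shows "delta1 x (A, B) \<in> Mor T"
proof -
  obtain a where a: "has_velocity (charts H) a (\<one>\<^bsub>H\<^esub>, A)" using lie_alg_curve[OF H A] .
  obtain b where b: "has_velocity (charts G) b (\<one>\<^bsub>G\<^esub>, B)" using lie_alg_curve[OF G B] .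
  from velocity_pts[OF velocity_delta1[OF x a b]] show ?thesis by simp
qed

lemma fst_delta0: "p \<in> Ob E \<Longrightarrow> fst (delta0 p B) = p"
  by (simp add: fundamental_def)

lemma delta0_linear:
  assumes "p \<in> Ob E" "B \<in> lie_alg G" "B' \<in> lie_alg G"
  shows "delta0 p (B + B') = (p, snd (delta0 p B) + snd (delta0 p B'))"
    "delta0 p (c *\<^sub>R B) = (p, c *\<^sub>R snd (delta0 p B))"
  using Tmap_add_scale[OF GA e(2) act_slice_smooth(2)[OF assms(1)] lie_groupD(6)[OF G]] assms
  by (simp_all add: fundamental_def prod_eq_iff lie_alg_def)

lemma delta0_smooth: "smooth_map (prod_atlas OE (lie_alg_atlas G)) (tangent_bundle OE) (fst (fundamental K P))"
  using smooth_map_partial_derivative[OF e(2) GA e(2) act_smooth(1) lie_groupD(6)[OF G]]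
  by (simp add: fundamental_def lie_alg_atlas_fibre)

text \<open>The derivative at the unit of \<open>p b g = (p g) (g\<inverse> b g)\<close> with respect to \<open>b\<close>.\<close>

lemma tact0_delta0:
  assumes p: "p \<in> Ob E" and B: "B \<in> lie_alg G" and g: "g \<in> carrier G"
  shows "delta0 (act0 p g) (Ad G (inv\<^bsub>G\<^esub> g) B) = tact0 P (delta0 p B) g"
proof -
  obtain b where b: "has_velocity (charts G) b (\<one>\<^bsub>G\<^esub>, B)" using lie_alg_curve[OF G B] .
  have "\<forall>\<^sub>F t in nhds 0. act0 (act0 p g) (inv\<^bsub>G\<^esub> g \<otimes>\<^bsub>G\<^esub> b t \<otimes>\<^bsub>G\<^esub> inv\<^bsub>G\<^esub> (inv\<^bsub>G\<^esub> g)) = act0 (act0 p (b t)) g"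
  proof (rule eventually_mono[OF eventually_carrier(1)[OF b]])
    fix t assume bt: "b t \<in> carrier G"
    have "g \<otimes>\<^bsub>G\<^esub> (inv\<^bsub>G\<^esub> g \<otimes>\<^bsub>G\<^esub> b t \<otimes>\<^bsub>G\<^esub> g) = b t \<otimes>\<^bsub>G\<^esub> g"
      using bt g by (simp add: G.m_assoc[symmetric])
    then show "act0 (act0 p g) (inv\<^bsub>G\<^esub> g \<otimes>\<^bsub>G\<^esub> b t \<otimes>\<^bsub>G\<^esub> inv\<^bsub>G\<^esub> (inv\<^bsub>G\<^esub> g)) = act0 (act0 p (b t)) g"
      using p g bt by (simp add: act0_mult)
  qed
  from velocity_unique[OF velocity_cong[OF velocity_delta0[OF act0_closed[OF p g] velocity_Ad[OF G G.inv_closed[OF g] b]] this]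
      velocity_tact(1)[OF g velocity_delta0[OF p b]]]
  show ?thesis .
qed

lemma Src_delta1: "x \<in> Mor E \<Longrightarrow> A \<in> lie_alg H \<Longrightarrow> B \<in> lie_alg G \<Longrightarrow> Src T (delta1 x (A, B)) = delta0 (Src E x) B"
  and Tgt_delta1: "x \<in> Mor E \<Longrightarrow> A \<in> lie_alg H \<Longrightarrow> B \<in> lie_alg G \<Longrightarrow> Tgt T (delta1 x (A, B)) = delta0 (Tgt E x) (Ltau K A + B)"
proof -
  assume x: "x \<in> Mor E" and A: "A \<in> lie_alg H" and B: "B \<in> lie_alg G"
  obtain a where a: "has_velocity (charts H) a (\<one>\<^bsub>H\<^esub>, A)" using lie_alg_curve[OF H A] .
  obtain b where b: "has_velocity (charts G) b (\<one>\<^bsub>G\<^esub>, B)" using lie_alg_curve[OF G B] .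
  note ev = eventually_conj[OF eventually_carrier(2)[OF a] eventually_carrier(1)[OF b]]
  have s: "\<forall>\<^sub>F t in nhds 0. Src E (act1 x (a t, b t)) = act0 (Src E x) (b t)"
    by (rule eventually_mono[OF ev]) (simp add: act1_Src x)
  have t: "\<forall>\<^sub>F t in nhds 0. Tgt E (act1 x (a t, b t)) = act0 (Tgt E x) (tau K (a t) \<otimes>\<^bsub>G\<^esub> b t)"
    by (rule eventually_mono[OF ev]) (simp add: act1_Tgt x)
  show "Src T (delta1 x (A, B)) = delta0 (Src E x) B"
    using velocity_unique[OF velocity_cong[OF velocity_Tmap[OF e(3,2,8) velocity_delta1[OF x a b]] s]
        velocity_delta0[OF eC(1)[OF x] b]] by simp
  show "Tgt T (delta1 x (A, B)) = delta0 (Tgt E x) (Ltau K A + B)"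
    using velocity_unique[OF velocity_cong[OF velocity_Tmap[OF e(3,2,9) velocity_delta1[OF x a b]] t]
        velocity_delta0[OF eC(2)[OF x] velocity_mult[OF G velocity_Ltau[OF a] b]]] by simp
qed

section \<open>The gauge 2-group\<close>

lemma gauge_obD:
  assumes "F \<in> gauge_ob K P"
  shows "lie_functor E E F" "extensional_functor E F"
    "p \<in> Ob E \<Longrightarrow> g \<in> carrier G \<Longrightarrow> fst F (act0 p g) = act0 (fst F p) g"
    "x \<in> Mor E \<Longrightarrow> a \<in> carrier S \<Longrightarrow> snd F (act1 x a) = act1 (snd F x) a"
    "p \<in> Ob E \<Longrightarrow> fst (proj P) (fst F p) = fst (proj P) p" "x \<in> Mor E \<Longrightarrow> snd (proj P) (snd F x) = snd (proj P) x"
    "lie_automorphism E F"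
  using assms unfolding gauge_ob_def lie_automorphism_def by (simp_all del: semidirect_simps)

lemma gauge_obI:
  assumes "lie_functor E E F" "extensional_functor E F"
    "\<And>p g. p \<in> Ob E \<Longrightarrow> g \<in> carrier G \<Longrightarrow> fst F (act0 p g) = act0 (fst F p) g"
    "\<And>x a. x \<in> Mor E \<Longrightarrow> a \<in> carrier S \<Longrightarrow> snd F (act1 x a) = act1 (snd F x) a"
    "\<And>p. p \<in> Ob E \<Longrightarrow> fst (proj P) (fst F p) = fst (proj P) p" "\<And>x. x \<in> Mor E \<Longrightarrow> snd (proj P) (snd F x) = snd (proj P) x"
    "lie_functor E E F'" "comp_functor E F' F = id_functor E" "comp_functor E F F' = id_functor E"
  shows "F \<in> gauge_ob K P"
  unfolding gauge_ob_def lie_automorphism_def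
  by (intro CollectI conjI exI[of _ F'] ballI; rule assms; assumption)

lemmas gauge_functor = lie_functorD(1)[OF gauge_obD(1)]

lemma lie_functor_comp:
  assumes F: "lie_functor E E F" and K: "lie_functor E E K'"
  shows "lie_functor E E (comp_functor E K' F)"
proof -
  have "smooth_map OE OE (fst (comp_functor E K' F))"
    by (rule smooth_map_cong[OF smooth_map_comp[OF e(2,2,2) lie_functorD(2)[OF F] lie_functorD(2)[OF K]] e(2)])
      (simp add: comp_functor_apply e(4))
  moreover have "smooth_map ME ME (snd (comp_functor E K' F))"
    by (rule smooth_map_cong[OF smooth_map_comp[OF e(3,3,3) lie_functorD(3)[OF F] lie_functorD(3)[OF K]] e(3)])
      (simp add: comp_functor_apply e(5))
  ultimately show ?thesis
    unfolding lie_functor_def using is_functor_comp[OF e(1) lie_functorD(1)[OF F] lie_functorD(1)[OF K]] by simp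
qed

lemma lie_functor_id: "lie_functor E E (id_functor E)"
proof -
  have "smooth_map OE OE (fst (id_functor E))"
    by (rule smooth_map_cong[OF smooth_map_ident[OF e(2)] e(2)]) (simp add: id_functor_apply e(4))
  moreover have "smooth_map ME ME (snd (id_functor E))"
    by (rule smooth_map_cong[OF smooth_map_ident[OF e(3)] e(3)]) (simp add: id_functor_apply e(5))
  ultimately show ?thesis unfolding lie_functor_def using is_functor_id[OF e(1)] by simp
qed

lemma gauge_inv:
  assumes F: "F \<in> gauge_ob K P"
  shows "lie_functor E E (inv_functor E F)" "comp_functor E (inv_functor E F) F = id_functor E"
    "comp_functor E F (inv_functor E F) = id_functor E"
proof -
  obtain F' where F': "lie_functor E E F'" "comp_functor E F' F = id_functor E" "comp_functor E F F' = id_functor E"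
    using gauge_obD(7)[OF F] unfolding lie_automorphism_def by (elim conjE exE)
  note f = is_functorD(1,2)[OF gauge_functor[OF F]] and f' = is_functorD(1,2)[OF lie_functorD(1)[OF F'(1)]]
  have l: "fst F' (fst F u) = u" "fst F (fst F' u) = u" if "u \<in> Ob E" for u
    using arg_cong[OF F'(2), of "\<lambda>F. fst F u"] arg_cong[OF F'(3), of "\<lambda>F. fst F u"] that
    by (simp_all add: comp_functor_apply id_functor_apply)
  have m: "snd F' (snd F x) = x" "snd F (snd F' x) = x" if "x \<in> Mor E" for x
    using arg_cong[OF F'(2), of "\<lambda>F. snd F x"] arg_cong[OF F'(3), of "\<lambda>F. snd F x"] that
    by (simp_all add: comp_functor_apply id_functor_apply)
  have "inj_on (fst F) (Ob E)" "inj_on (snd F) (Mor E)"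
    by (rule inj_on_inverseI[of _ "fst F'"], erule l) (rule inj_on_inverseI[of _ "snd F'"], erule m)
  then have i: "fst (inv_functor E F) u = fst F' u" "snd (inv_functor E F) x = snd F' x" if "u \<in> Ob E" "x \<in> Mor E" for u x
    using that l f' m inv_into_f_eq[of "fst F" "Ob E" "fst F' u" u] inv_into_f_eq[of "snd F" "Mor E" "snd F' x" x]
    by (simp_all add: inv_functor_def)
  have i0: "fst (inv_functor E F) u = fst F' u" if "u \<in> Ob E" for u
    using i(1)[OF that eC(3)[OF that]] .
  have i1: "snd (inv_functor E F) x = snd F' x" if "x \<in> Mor E" for x
    using i(2)[OF eC(1)[OF that] that] .
  have "is_functor E E (inv_functor E F)"
    using lie_functorD(1)[OF F'(1)] unfolding is_functor_def by (simp add: i0 i1 Pi_iff eC(1-8))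
  moreover have "smooth_map OE OE (fst (inv_functor E F))"
    by (rule smooth_map_cong[OF lie_functorD(2)[OF F'(1)] e(2)]) (simp add: i0 e(4))
  moreover have "smooth_map ME ME (snd (inv_functor E F))"
    by (rule smooth_map_cong[OF lie_functorD(3)[OF F'(1)] e(3)]) (simp add: i1 e(5))
  ultimately show "lie_functor E E (inv_functor E F)" unfolding lie_functor_def by simp
  show "comp_functor E (inv_functor E F) F = id_functor E" "comp_functor E F (inv_functor E F) = id_functor E"
    by (rule functor_eqI[OF extensional_comp_functor extensional_id_functor];
        simp add: comp_functor_apply id_functor_apply i0 i1 l m f f')+
qed

lemma gauge_inv_apply:
  assumes F: "F \<in> gauge_ob K P"
  shows "u \<in> Ob E \<Longrightarrow> fst (inv_functor E F) (fst F u) = u" "u \<in> Ob E \<Longrightarrow> fst F (fst (inv_functor E F) u) = u"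
    "x \<in> Mor E \<Longrightarrow> snd (inv_functor E F) (snd F x) = x" "x \<in> Mor E \<Longrightarrow> snd F (snd (inv_functor E F) x) = x"
  using arg_cong[OF gauge_inv(2)[OF F], of "\<lambda>F. fst F u"] arg_cong[OF gauge_inv(3)[OF F], of "\<lambda>F. fst F u"]
    arg_cong[OF gauge_inv(2)[OF F], of "\<lambda>F. snd F x"] arg_cong[OF gauge_inv(3)[OF F], of "\<lambda>F. snd F x"]
  by (simp_all add: comp_functor_apply id_functor_apply)

lemma extensional_inv_functor: "extensional_functor E (inv_functor E F)"
  by (simp add: extensional_functor_def inv_functor_def)

lemma gauge_inv_closed:
  assumes F: "F \<in> gauge_ob K P"
  shows "inv_functor E F \<in> gauge_ob K P"
proof -
  note i = gauge_inv[OF F] and j = gauge_inv_apply[OF F]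
  note c = is_functorD(1,2)[OF lie_functorD(1)[OF i(1)]]
  have eq0: "fst (inv_functor E F) (act0 p g) = act0 (fst (inv_functor E F) p) g" if p: "p \<in> Ob E" "g \<in> carrier G" for p g
    using gauge_obD(3)[OF F c(1)[OF p(1)] p(2)] j(1)[OF act0_closed[OF c(1)[OF p(1)] p(2)]] p by (simp add: j)
  have eq1: "snd (inv_functor E F) (act1 x a) = act1 (snd (inv_functor E F) x) a" if x: "x \<in> Mor E" "a \<in> carrier S" for x a
  proof -
    obtain h g where a: "a = (h, g)" "h \<in> carrier H" "g \<in> carrier G" using x(2) by auto
    show ?thesis
      using gauge_obD(4)[OF F c(2)[OF x(1)] x(2)] j(3)[of "act1 (snd (inv_functor E F) x) a"] x a c by (simp add: j)
  qed
  show ?thesis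
    by (rule gauge_obI[OF i(1) extensional_inv_functor eq0 eq1 _ _ gauge_obD(1)[OF F] i(3) i(2)])
      (use gauge_obD(5)[OF F c(1)] gauge_obD(6)[OF F c(2)] in \<open>simp_all add: j\<close>)
qed

lemma gauge_comp_closed:
  assumes F: "F \<in> gauge_ob K P" and F': "F' \<in> gauge_ob K P"
  shows "comp_functor E F F' \<in> gauge_ob K P"
proof -
  note f = is_functorD(1,2)[OF gauge_functor[OF F]] and f' = is_functorD(1,2)[OF gauge_functor[OF F']]
  note i = gauge_inv[OF F] and i' = gauge_inv[OF F']
  let ?I = "comp_functor E (inv_functor E F') (inv_functor E F)"
  have "comp_functor E ?I (comp_functor E F F') = id_functor E" "comp_functor E (comp_functor E F F') ?I = id_functor E"
    by (rule functor_eqI[OF extensional_comp_functor extensional_id_functor];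
        simp add: comp_functor_apply id_functor_apply gauge_inv_apply[OF F] gauge_inv_apply[OF F'] f f'
          is_functorD(1,2)[OF lie_functorD(1)[OF i(1)]] is_functorD(1,2)[OF lie_functorD(1)[OF i'(1)]])+
  then show ?thesis
    by (intro gauge_obI[OF lie_functor_comp[OF gauge_obD(1)[OF F'] gauge_obD(1)[OF F]] extensional_comp_functor _ _ _ _
          lie_functor_comp[OF i(1) i'(1)]])
      (auto simp: comp_functor_apply f f' gauge_obD(3-6)[OF F] gauge_obD(3-6)[OF F'])
qed

lemma gauge_id_closed: "id_functor E \<in> gauge_ob K P"
proof -
  have c: "comp_functor E (id_functor E) (id_functor E) = id_functor E"
    by (rule comp_functor_id(1)[OF is_functor_id[OF e(1)] extensional_id_functor])
  show ?thesis
    by (rule gauge_obI[OF lie_functor_id extensional_id_functor _ _ _ _ lie_functor_id c c])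
      (auto simp: id_functor_apply)
qed

lemma gauge_ob_group: "group (ob_grp (gauge K P))" and gauge_ob_carrier: "carrier (ob_grp (gauge K P)) = gauge_ob K P"
proof -
  have "group \<lparr>carrier = gauge_ob K P, monoid.mult = comp_functor E, one = id_functor E\<rparr>"
  proof (rule groupI; simp)
    show "id_functor E \<in> gauge_ob K P" by (rule gauge_id_closed)
    show "comp_functor E F F' \<in> gauge_ob K P" if "F \<in> gauge_ob K P" "F' \<in> gauge_ob K P" for F F'
      using gauge_comp_closed that .
    show "comp_functor E (comp_functor E F F') F'' = comp_functor E F (comp_functor E F' F'')"
      if "F'' \<in> gauge_ob K P" for F F' F''
      by (rule comp_functor_assoc[OF gauge_functor[OF that]])
    show "comp_functor E (id_functor E) F = F" if "F \<in> gauge_ob K P" for F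
      by (rule comp_functor_id(2)[OF gauge_functor[OF that] gauge_obD(2)[OF that]])
    show "\<exists>F'\<in>gauge_ob K P. comp_functor E F' F = id_functor E" if "F \<in> gauge_ob K P" for F
      by (intro bexI[of _ "inv_functor E F"] gauge_inv(2)[OF that] gauge_inv_closed[OF that])
  qed
  then show "group (ob_grp (gauge K P))" by (simp add: gauge_def)
  show "carrier (ob_grp (gauge K P)) = gauge_ob K P" by (simp add: gauge_def)
qed

subsection \<open>Inverses of arrows\<close>

lemma inverse_arrows_unique:
  assumes "inverse_arrows E x y" "inverse_arrows E x z" shows "y = z"
proof -
  have a: "x \<in> Mor E" "y \<in> Mor E" "z \<in> Mor E" "Src E y = Tgt E x" "Tgt E y = Src E x" "Cmp E y x = Idn E (Src E x)"
    "Src E z = Tgt E x" "Tgt E z = Src E x" "Cmp E x z = Idn E (Tgt E x)"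
    using assms unfolding inverse_arrows_def by auto
  have "y = Cmp E y (Cmp E x z)" using a eC(9)[of y] by simp
  also have "\<dots> = Cmp E (Cmp E y x) z" using a eC(11)[of z x y] by simp
  also have "\<dots> = z" using a eC(10)[of z] by simp
  finally show ?thesis .
qed

lemma arrow_inv: assumes "x \<in> Mor E" shows "inverse_arrows E x (arrow_inv E x)"
proof -
  obtain y where y: "inverse_arrows E x y" using e(13)[OF assms] by (elim exE)
  show ?thesis unfolding arrow_inv_def by (rule theI[of "inverse_arrows E x" y, OF y inverse_arrows_unique[OF _ y]])
qed

lemma arrow_invD:
  assumes "x \<in> Mor E"
  shows "arrow_inv E x \<in> Mor E" "Src E (arrow_inv E x) = Tgt E x" "Tgt E (arrow_inv E x) = Src E x"
    "Cmp E (arrow_inv E x) x = Idn E (Src E x)" "Cmp E x (arrow_inv E x) = Idn E (Tgt E x)"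
  using arrow_inv[OF assms] unfolding inverse_arrows_def by auto

lemma arrow_inv_act:
  assumes x: "x \<in> Mor E" and g: "g \<in> carrier G"
  shows "arrow_inv E (act1 x (\<one>\<^bsub>H\<^esub>, g)) = act1 (arrow_inv E x) (\<one>\<^bsub>H\<^esub>, g)"
proof -
  note i = arrow_invD[OF x]
  have "inverse_arrows E (act1 x (\<one>\<^bsub>H\<^esub>, g)) (act1 (arrow_inv E x) (\<one>\<^bsub>H\<^esub>, g))"
    unfolding inverse_arrows_def
    using x g i act1_Cmp[OF x i(1,2) g] act1_Cmp[OF i(1) x _ g]
    by (simp add: act1_Src act1_Tgt act1_Idn eC)
  then show ?thesis using inverse_arrows_unique[OF arrow_inv] x g by auto
qed

lemma smooth_Cmp:
  assumes f: "smooth_map OE ME f" and g: "smooth_map OE ME g" and c: "\<And>u. u \<in> Ob E \<Longrightarrow> Src E (f u) = Tgt E (g u)"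
  shows "smooth_map OE ME (\<lambda>u\<in>Ob E. Cmp E (f u) (g u))"
proof -
  have "smooth_map OE ME (\<lambda>u. (\<lambda>(y, x). Cmp E y x) (f u, g u))"
    by (rule smooth_map_on_comp[OF e(2) smooth_atlas_prod[OF e(3,3)] e(3) smooth_map_Pair[OF e(2,3,3) f g] _ e(12)])
      (use smooth_mapD(1)[OF f] smooth_mapD(1)[OF g] c in \<open>simp add: e(4,5)\<close>)
  then show ?thesis by (rule smooth_map_cong[OF _ e(2)]) (simp add: e(4))
qed

subsection \<open>Morphisms of the gauge 2-group\<close>

lemma nat_iso_E: "nat_iso E E F F' \<psi> \<longleftrightarrow> nat_trans E E F F' \<psi>"
  unfolding nat_iso_def using nat_transD(1)[of E E F F' \<psi>] e(13) by auto

text \<open>In a groupoid every natural transformation is invertible. What remains besides smoothness are the two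
  equations that tie the transformation to the bundle.\<close>

lemma gauge_mor_iff:
  "(F, \<psi>, F') \<in> gauge_mor K P \<longleftrightarrow> F \<in> gauge_ob K P \<and> F' \<in> gauge_ob K P \<and> (F, \<psi>, F') \<in> lie_ntrans E \<and>
     (\<forall>p\<in>Ob E. \<forall>g\<in>carrier G. \<psi> (act0 p g) = act1 (\<psi> p) (\<one>\<^bsub>H\<^esub>, g)) \<and>
     (\<forall>p\<in>Ob E. snd (proj P) (\<psi> p) = Idn (base P) (fst (proj P) p))"
proof -
  have "(F, \<psi>, F') \<in> lie_ntrans E \<longleftrightarrow> \<psi> \<in> extensional (Ob E) \<and> nat_trans E E F F' \<psi> \<and> smooth_map OE ME \<psi>"
    if "F \<in> gauge_ob K P" "F' \<in> gauge_ob K P"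
    using gauge_obD(1,2)[OF that(1)] gauge_obD(1,2)[OF that(2)] gauge_functor[OF that(1)] gauge_functor[OF that(2)]
    by (simp add: lie_ntrans_def ntrans_def)
  then show ?thesis unfolding gauge_mor_def nat_iso_E Idn_2group mem_Collect_eq prod.case by argo
qed

lemma gauge_morD:
  assumes "(F, \<psi>, F') \<in> gauge_mor K P"
  shows "F \<in> gauge_ob K P" "F' \<in> gauge_ob K P" "(F, \<psi>, F') \<in> lie_ntrans E"
    "p \<in> Ob E \<Longrightarrow> g \<in> carrier G \<Longrightarrow> \<psi> (act0 p g) = act1 (\<psi> p) (\<one>\<^bsub>H\<^esub>, g)"
    "p \<in> Ob E \<Longrightarrow> snd (proj P) (\<psi> p) = Idn (base P) (fst (proj P) p)"
    "nat_trans E E F F' \<psi>" "smooth_map OE ME \<psi>" "(F, \<psi>, F') \<in> ntrans E E"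
  using assms lie_ntransD[of F \<psi> F' E] unfolding gauge_mor_iff by auto

lemmas proj = is_functorD[OF lie_functorD(1)[OF proj_functor]]
lemmas baseC = categoryD[OF lie_groupoidD(1)[OF base_gpd]]

lemma gauge_mor_hcomp:
  assumes \<Phi>: "\<Phi> \<in> gauge_mor K P" and \<Psi>: "\<Psi> \<in> gauge_mor K P"
  shows "hcomp E E \<Phi> \<Psi> \<in> gauge_mor K P"
proof -
  obtain F \<psi> F' D \<phi> D' where eq: "\<Psi> = (F, \<psi>, F')" "\<Phi> = (D, \<phi>, D')" by (metis prod_cases3)
  note p = gauge_morD[OF \<Psi>[unfolded eq]] and k = gauge_morD[OF \<Phi>[unfolded eq]]
  note f = is_functorD(1-4)[OF gauge_functor[OF p(1)]] is_functorD(1-4)[OF gauge_functor[OF p(2)]]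
    is_functorD(1-4)[OF gauge_functor[OF k(1)]] is_functorD(1-4)[OF gauge_functor[OF k(2)]] nat_transD(1-3)[OF p(6)] nat_transD(1-3)[OF k(6)]
  let ?\<chi> = "\<lambda>u\<in>Ob E. Cmp E (\<phi> (fst F' u)) (snd D (\<psi> u))"
  have "smooth_map OE ME ?\<chi>"
    by (rule smooth_Cmp[OF smooth_map_comp[OF e(2,2,3) lie_functorD(2)[OF gauge_obD(1)[OF p(2)]] k(7)]
          smooth_map_comp[OF e(2,3,3) p(7) lie_functorD(3)[OF gauge_obD(1)[OF k(1)]]]])
      (simp add: f)
  moreover have "?\<chi> (act0 p g) = act1 (?\<chi> p) (\<one>\<^bsub>H\<^esub>, g)" if "p \<in> Ob E" "g \<in> carrier G" for p g
    using that by (simp add: f p(4) k(4) gauge_obD(3)[OF p(2)] gauge_obD(4)[OF k(1)] act1_Cmp)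
  moreover have "snd (proj P) (?\<chi> p) = Idn (base P) (fst (proj P) p)" if "p \<in> Ob E" for p
    using that baseC(10)[OF baseC(3), of "fst (proj P) p"]
    by (simp add: f p(5) k(5) gauge_obD(5)[OF p(2)] gauge_obD(6)[OF k(1)] proj baseC)
  moreover have "hcomp E E \<Phi> \<Psi> \<in> ntrans E E"
    unfolding eq by (rule hcomp_ntrans[OF e(1,1,1) k(8) p(8)])
  ultimately show ?thesis
    using gauge_comp_closed[OF k(1) p(1)] gauge_comp_closed[OF k(2) p(2)]
    unfolding eq hcomp_apply gauge_mor_iff lie_ntrans_def by (simp add: gauge_obD(1))
qed

lemma gauge_mor_vcomp:
  assumes \<Phi>: "(F', \<phi>, F'') \<in> gauge_mor K P" and \<Psi>: "(F, \<psi>, F') \<in> gauge_mor K P"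
  shows "vcomp E E (F', \<phi>, F'') (F, \<psi>, F') \<in> gauge_mor K P"
proof -
  note p = gauge_morD[OF \<Psi>] and k = gauge_morD[OF \<Phi>]
  note f = is_functorD(1-4)[OF gauge_functor[OF p(2)]] nat_transD(1-3)[OF p(6)] nat_transD(1-3)[OF k(6)]
  let ?\<chi> = "\<lambda>u\<in>Ob E. Cmp E (\<phi> u) (\<psi> u)"
  have "smooth_map OE ME ?\<chi>" by (rule smooth_Cmp[OF k(7) p(7)]) (simp add: f)
  moreover have "?\<chi> (act0 p g) = act1 (?\<chi> p) (\<one>\<^bsub>H\<^esub>, g)" if "p \<in> Ob E" "g \<in> carrier G" for p g
    using that by (simp add: f p(4) k(4) act1_Cmp)
  moreover have "snd (proj P) (?\<chi> p) = Idn (base P) (fst (proj P) p)" if "p \<in> Ob E" for p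
    using that baseC(10)[OF baseC(3), of "fst (proj P) p"] by (simp add: f p(5) k(5) proj baseC)
  moreover note vcomp_ntrans[OF e(1,1) k(8) p(8)]
  ultimately show ?thesis
    using p(1) k(2) unfolding vcomp_apply gauge_mor_iff lie_ntrans_def by (simp add: gauge_obD(1))
qed

lemma gauge_mor_id:
  assumes F: "F \<in> gauge_ob K P"
  shows "(F, id_trans E E (fst F), F) \<in> gauge_mor K P"
proof -
  note f = is_functorD(1-4)[OF gauge_functor[OF F]]
  have "smooth_map OE ME (id_trans E E (fst F))"
    by (rule smooth_map_cong[OF smooth_map_comp[OF e(2,2,3) lie_functorD(2)[OF gauge_obD(1)[OF F]] e(10)] e(2)])
      (simp add: id_trans_def e(4))
  then show ?thesis
    unfolding gauge_mor_iff lie_ntrans_def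
    using id_trans_ntrans[OF e(1,1) gauge_functor[OF F] gauge_obD(2)[OF F]] F gauge_obD(1)[OF F]
    by (auto simp: id_trans_def f gauge_obD(3,5)[OF F] act1_Idn proj)
qed

lemma id_trans_id_functor: "id_trans E E (\<lambda>p. p) = id_trans E E (fst (id_functor E))"
  unfolding id_trans_def by (rule restrict_ext) (simp add: id_functor_apply)

text \<open>The inverse for horizontal composition is obtained from the inverse for vertical composition by
  whiskering with the inverse functors on both sides.\<close>

lemma gauge_mor_vinv:
  assumes \<Psi>: "(F, \<psi>, F') \<in> gauge_mor K P"
  shows "(F', \<lambda>u\<in>Ob E. arrow_inv E (\<psi> u), F) \<in> gauge_mor K P"
proof -
  note p = gauge_morD[OF \<Psi>]
  note n = nat_transD(1-3)[OF p(6)] and f = is_functorD(1-4)[OF gauge_functor[OF p(1)]] is_functorD(1-4)[OF gauge_functor[OF p(2)]]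
  let ?\<chi> = "\<lambda>u\<in>Ob E. arrow_inv E (\<psi> u)"
  have nat: "Cmp E (arrow_inv E (\<psi> (Tgt E x))) (snd F' x) = Cmp E (snd F x) (arrow_inv E (\<psi> (Src E x)))" if x: "x \<in> Mor E" for x
  proof -
    let ?s = "Src E x" and ?t = "Tgt E x"
    note o = eC(1,2)[OF x]
    note iS = arrow_invD[OF n(1)[OF o(1)]] and iT = arrow_invD[OF n(1)[OF o(2)]]
    have "Cmp E (arrow_inv E (\<psi> ?t)) (snd F' x) =
        Cmp E (arrow_inv E (\<psi> ?t)) (Cmp E (snd F' x) (Cmp E (\<psi> ?s) (arrow_inv E (\<psi> ?s))))"
      using eC(9)[OF f(6)[OF x]] x o by (simp add: iS n f)
    also have "\<dots> = Cmp E (arrow_inv E (\<psi> ?t)) (Cmp E (Cmp E (\<psi> ?t) (snd F x)) (arrow_inv E (\<psi> ?s)))"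
      using x o nat_transD(4)[OF p(6) x] eC(11)[OF iS(1) n(1)[OF o(1)] f(6)[OF x]] by (simp add: iS n f)
    also have "\<dots> = Cmp E (Cmp E (Cmp E (arrow_inv E (\<psi> ?t)) (\<psi> ?t)) (snd F x)) (arrow_inv E (\<psi> ?s))"
      using x o by (simp add: iS(1-3) iT(1-3) n f eC(6-8) eC(11))
    also have "\<dots> = Cmp E (snd F x) (arrow_inv E (\<psi> ?s))"
      using x o eC(10)[OF f(2)[OF x]] by (simp add: iT n f)
    finally show ?thesis .
  qed
  have "nat_trans E E F' F ?\<chi>"
    unfolding nat_trans_def using arrow_invD n nat by (simp add: eC)
  moreover have "smooth_map OE ME ?\<chi>"
    by (rule smooth_map_cong[OF smooth_map_comp[OF e(2,3,3) p(7) e(11)] e(2)]) (simp add: e(4))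
  moreover have "?\<chi> (act0 p g) = act1 (?\<chi> p) (\<one>\<^bsub>H\<^esub>, g)" if "p \<in> Ob E" "g \<in> carrier G" for p g
    using that by (simp add: p(4) arrow_inv_act n)
  moreover have "snd (proj P) (?\<chi> p) = Idn (base P) (fst (proj P) p)" if u: "p \<in> Ob E" for p
  proof -
    note i = arrow_invD[OF n(1)[OF u]]
    have "snd (proj P) (arrow_inv E (\<psi> p)) = Cmp (base P) (snd (proj P) (arrow_inv E (\<psi> p))) (snd (proj P) (\<psi> p))"
      using baseC(9)[OF proj(2)[OF i(1)]] u by (simp add: p(5) proj i n f gauge_obD(5)[OF p(2)])
    also have "\<dots> = snd (proj P) (Cmp E (arrow_inv E (\<psi> p)) (\<psi> p))"
      using proj(6)[OF n(1)[OF u] i(1,2)] by simp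
    also have "\<dots> = Idn (base P) (fst (proj P) p)"
      using u by (simp add: i n f proj gauge_obD(5)[OF p(1)])
    finally show ?thesis using u by simp
  qed
  ultimately show ?thesis
    using p(1,2) unfolding gauge_mor_iff lie_ntrans_def ntrans_def by (simp add: gauge_obD(1,2) gauge_functor)
qed

lemma gauge_mor_hinv:
  assumes \<Psi>: "\<Psi> \<in> gauge_mor K P"
  shows "hinv E \<Psi> \<in> gauge_mor K P"
    "hcomp E E (hinv E \<Psi>) \<Psi> = (id_functor E, id_trans E E (\<lambda>p. p), id_functor E)"
proof -
  obtain F \<psi> F' where eq: "\<Psi> = (F, \<psi>, F')" by (metis prod_cases3)
  note p = gauge_morD[OF \<Psi>[unfolded eq]]
  let ?I = "inv_functor E F" and ?I' = "inv_functor E F'"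
  note i = gauge_inv_closed[OF p(1)] and i' = gauge_inv_closed[OF p(2)]
  note n = nat_transD(1-3)[OF p(6)]
  note f = is_functorD(1-4)[OF gauge_functor[OF p(1)]] is_functorD(1-4)[OF gauge_functor[OF p(2)]]
    is_functorD(1-4)[OF gauge_functor[OF i]] is_functorD(1-4)[OF gauge_functor[OF i']]
    gauge_inv_apply[OF p(1)] gauge_inv_apply[OF p(2)]
  let ?w = "hcomp E E (?I, id_trans E E (fst ?I), ?I)
      (hcomp E E (F', \<lambda>u\<in>Ob E. arrow_inv E (\<psi> u), F) (?I', id_trans E E (fst ?I'), ?I'))"
  have w: "?w \<in> gauge_mor K P"
    by (intro gauge_mor_hcomp gauge_mor_id i i' gauge_mor_vinv p(1,2) \<Psi>[unfolded eq])
  have c: "Cmp E (id_trans E E (fst ?I) (fst (comp_functor E F ?I') u))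
      (snd ?I ((\<lambda>u\<in>Ob E. Cmp E ((\<lambda>u\<in>Ob E. arrow_inv E (\<psi> u)) (fst ?I' u)) (snd F' (id_trans E E (fst ?I') u))) u)) =
      snd ?I (arrow_inv E (\<psi> (fst ?I' u)))" if u: "u \<in> Ob E" for u
  proof -
    let ?a = "arrow_inv E (\<psi> (fst ?I' u))"
    have v: "fst ?I' u \<in> Ob E" using u by (simp add: f)
    note a = arrow_invD[OF n(1)[OF v]]
    have "Cmp E ?a (snd F' (Idn E (fst ?I' u))) = ?a"
      using eC(9)[OF a(1)] is_functorD(5)[OF gauge_functor[OF p(2)] v] by (simp add: a n v)
    moreover have "Cmp E (Idn E (fst ?I (fst F (fst ?I' u)))) (snd ?I ?a) = snd ?I ?a"
      using eC(10)[OF is_functorD(2)[OF gauge_functor[OF i] a(1)]] a by (simp add: f n v)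
    ultimately show ?thesis using u v by (simp add: comp_functor_apply id_trans_def f)
  qed
  have "?w = hinv E \<Psi>"
    unfolding hcomp_apply hinv_def eq prod.case prod.inject
    by (intro conjI functor_eqI[OF extensional_comp_functor extensional_inv_functor] restrict_ext c)
      (simp_all add: comp_functor_apply f)
  then show "hinv E \<Psi> \<in> gauge_mor K P" using w by simp
  have "Cmp E (snd ?I (arrow_inv E (\<psi> (fst ?I' (fst F' u))))) (snd ?I (\<psi> u)) = Idn E u" if u: "u \<in> Ob E" for u
    using is_functorD(6)[OF gauge_functor[OF i] n(1)[OF u] arrow_invD(1,2)[OF n(1)[OF u]]] u
      arrow_invD(4)[OF n(1)[OF u]] is_functorD(5)[OF gauge_functor[OF i] f(1)[OF u]]
    by (simp add: f n)
  then show "hcomp E E (hinv E \<Psi>) \<Psi> = (id_functor E, id_trans E E (\<lambda>p. p), id_functor E)"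
    unfolding hinv_def eq prod.case hcomp_apply id_trans_def gauge_inv(2)[OF p(1)] gauge_inv(2)[OF p(2)]
    by (auto intro!: restrict_ext simp: f)
qed

lemma gauge_mor_group: "group (mor_grp (gauge K P))" and gauge_mor_carrier: "carrier (mor_grp (gauge K P)) = gauge_mor K P"
proof -
  have nt: "\<Psi> \<in> ntrans E E" if "\<Psi> \<in> gauge_mor K P" for \<Psi>
    using that gauge_morD(8) by (cases \<Psi>) simp
  have id: "(id_functor E, id_trans E E (\<lambda>p. p), id_functor E) \<in> gauge_mor K P"
    using gauge_mor_id[OF gauge_id_closed] id_trans_id_functor by simp
  have "group \<lparr>carrier = gauge_mor K P, monoid.mult = hcomp E E, one = (id_functor E, id_trans E E (\<lambda>p. p), id_functor E)\<rparr>"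
  proof (rule groupI; simp)
    show "(id_functor E, id_trans E E (\<lambda>p. p), id_functor E) \<in> gauge_mor K P" by (rule id)
    show "hcomp E E \<Phi> \<Psi> \<in> gauge_mor K P" if "\<Phi> \<in> gauge_mor K P" "\<Psi> \<in> gauge_mor K P" for \<Phi> \<Psi>
      using gauge_mor_hcomp that .
    show "hcomp E E (hcomp E E \<Phi> \<Psi>) \<Theta> = hcomp E E \<Phi> (hcomp E E \<Psi> \<Theta>)"
      if "\<Phi> \<in> gauge_mor K P" "\<Psi> \<in> gauge_mor K P" "\<Theta> \<in> gauge_mor K P" for \<Phi> \<Psi> \<Theta>
      by (rule hcomp_assoc[OF e(1,1,1,1) nt nt nt]; rule that)
    show "hcomp E E (id_functor E, id_trans E E (\<lambda>p. p), id_functor E) \<Psi> = \<Psi>" if "\<Psi> \<in> gauge_mor K P" for \<Psi>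
      by (rule hcomp_id_left[OF e(1,1) nt[OF that]])
    show "\<exists>\<Phi>\<in>gauge_mor K P. hcomp E E \<Phi> \<Psi> = (id_functor E, id_trans E E (\<lambda>p. p), id_functor E)" if "\<Psi> \<in> gauge_mor K P" for \<Psi>
      by (intro bexI[of _ "hinv E \<Psi>"] gauge_mor_hinv[OF that])
  qed
  then show "group (mor_grp (gauge K P))" by (simp add: gauge_def)
  show "carrier (mor_grp (gauge K P)) = gauge_mor K P" by (simp add: gauge_def)
qed

lemma gauge_simps:
  "Ob (gauge K P) = gauge_ob K P" "Mor (gauge K P) = gauge_mor K P" "Src (gauge K P) (F, \<psi>, F') = F" "Tgt (gauge K P) (F, \<psi>, F') = F'"
  "Idn (gauge K P) F = (F, id_trans E E (fst F), F)" "Cmp (gauge K P) = vcomp E E"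
  "mult (ob_grp (gauge K P)) = comp_functor E" "\<one>\<^bsub>ob_grp (gauge K P)\<^esub> = id_functor E"
  "mult (mor_grp (gauge K P)) = hcomp E E" "\<one>\<^bsub>mor_grp (gauge K P)\<^esub> = (id_functor E, id_trans E E (\<lambda>p. p), id_functor E)"
  by (simp_all add: gauge_def)

lemma gauge_category: "category (gauge K P)"
  unfolding category_def
proof (intro conjI ballI impI funcsetI)
  fix x assume x: "x \<in> Mor (gauge K P)"
  obtain F \<psi> F' where eq: "x = (F, \<psi>, F')" by (metis prod_cases3)
  note p = gauge_morD[OF x[unfolded eq gauge_simps]]
  show "Src (gauge K P) x \<in> Ob (gauge K P)" "Tgt (gauge K P) x \<in> Ob (gauge K P)" using p by (simp_all add: eq gauge_simps)
  show "Cmp (gauge K P) x (Idn (gauge K P) (Src (gauge K P) x)) = x" "Cmp (gauge K P) (Idn (gauge K P) (Tgt (gauge K P) x)) x = x"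
    using vcomp_id[OF e(1) p(8)] by (simp_all add: eq gauge_simps)
  fix y assume y: "y \<in> Mor (gauge K P)" "Src (gauge K P) y = Tgt (gauge K P) x"
  obtain \<phi> F'' where eq': "y = (F', \<phi>, F'')" using y(2) by (cases y) (simp add: eq gauge_simps)
  note k = gauge_morD[OF y(1)[unfolded eq' gauge_simps]]
  show "Cmp (gauge K P) y x \<in> Mor (gauge K P)"
    using gauge_mor_vcomp x y by (simp add: eq eq' gauge_simps)
  show "Src (gauge K P) (Cmp (gauge K P) y x) = Src (gauge K P) x" "Tgt (gauge K P) (Cmp (gauge K P) y x) = Tgt (gauge K P) y"
    by (simp_all add: eq eq' gauge_simps vcomp_apply)
next
  fix x y z assume x: "x \<in> Mor (gauge K P)" and y: "y \<in> Mor (gauge K P)" and z: "z \<in> Mor (gauge K P)"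
    and c: "Src (gauge K P) y = Tgt (gauge K P) x \<and> Src (gauge K P) z = Tgt (gauge K P) y"
  obtain F \<psi> F' where eq: "x = (F, \<psi>, F')" by (metis prod_cases3)
  obtain \<phi> F'' where eq': "y = (F', \<phi>, F'')" using c by (cases y) (simp add: eq gauge_simps)
  obtain \<theta> F3 where eq'': "z = (F'', \<theta>, F3)" using c by (cases z) (simp add: eq' gauge_simps)
  show "Cmp (gauge K P) z (Cmp (gauge K P) y x) = Cmp (gauge K P) (Cmp (gauge K P) z y) x"
    unfolding eq eq' eq'' gauge_simps
    by (rule vcomp_assoc[OF e(1)]) (use gauge_morD(8) x y z in \<open>simp_all add: eq eq' eq'' gauge_simps\<close>)
qed (simp_all add: gauge_simps gauge_mor_id)

end

section \<open>Fibrewise linear maps\<close>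

lemma fibre_linearI:
  assumes "\<And>p \<xi> \<zeta>. p \<in> pts M \<Longrightarrow> \<xi> \<in> tangent_space M p \<Longrightarrow> \<zeta> \<in> tangent_space M p \<Longrightarrow> f (p, \<xi> + \<zeta>) = f (p, \<xi>) + f (p, \<zeta>)"
    and "\<And>p \<xi> a. p \<in> pts M \<Longrightarrow> \<xi> \<in> tangent_space M p \<Longrightarrow> f (p, a *\<^sub>R \<xi>) = a *\<^sub>R f (p, \<xi>)"
  shows "fibre_linear M f"
  unfolding fibre_linear_def using assms by simp

lemma fibre_linearD:
  assumes "fibre_linear M f" "p \<in> pts M" "\<xi> \<in> tangent_space M p"
  shows "\<zeta> \<in> tangent_space M p \<Longrightarrow> f (p, \<xi> + \<zeta>) = f (p, \<xi>) + f (p, \<zeta>)" "f (p, a *\<^sub>R \<xi>) = a *\<^sub>R f (p, \<xi>)"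
  using assms unfolding fibre_linear_def by simp_all

lemma fibre_linear_cong:
  assumes M: "smooth_atlas M" and f: "fibre_linear M f" and e: "\<And>v. v \<in> pts (tangent_bundle M) \<Longrightarrow> f v = g v"
  shows "fibre_linear M g"
proof (rule fibre_linearI)
  fix p \<xi> assume p: "p \<in> pts M" "\<xi> \<in> tangent_space M p"
  note S = tangent_space_subspace[OF M p(1)]
  have e': "g (p, \<zeta>) = f (p, \<zeta>)" if "\<zeta> \<in> tangent_space M p" for \<zeta>
    using e[of "(p, \<zeta>)"] p(1) that by (simp add: pts_tangent_bundle)
  show "g (p, \<xi> + \<zeta>) = g (p, \<xi>) + g (p, \<zeta>)" if "\<zeta> \<in> tangent_space M p" for \<zeta>
    using fibre_linearD(1)[OF f p that] e' p(2) that subspace_add[OF S p(2) that] by simp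
  show "g (p, a *\<^sub>R \<xi>) = a *\<^sub>R g (p, \<xi>)" for a
    using fibre_linearD(2)[OF f p] e' p(2) subspace_scale[OF S p(2)] by simp
qed

lemma fibre_linear_Tmap:
  assumes M: "smooth_atlas M" and N: "smooth_atlas N" and g: "smooth_map M N g" and f: "fibre_linear N f"
  shows "fibre_linear M (\<lambda>v. f (Tmap M N g v))"
proof (rule fibre_linearI)
  fix p \<xi> assume p: "p \<in> pts M" "\<xi> \<in> tangent_space M p"
  have T: "Tmap M N g (p, \<zeta>) = (g p, snd (Tmap M N g (p, \<zeta>)))" for \<zeta> by (simp add: prod_eq_iff)
  have m: "g p \<in> pts N" "snd (Tmap M N g (p, \<zeta>)) \<in> tangent_space N (g p)" if "\<zeta> \<in> tangent_space M p" for \<zeta>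
    using Tmap_pts[OF M N g, of "(p, \<zeta>)"] p(1) that by (simp_all add: mem_tangent_bundle)
  show "f (Tmap M N g (p, \<xi> + \<zeta>)) = f (Tmap M N g (p, \<xi>)) + f (Tmap M N g (p, \<zeta>))" if "\<zeta> \<in> tangent_space M p" for \<zeta>
    using fibre_linearD(1)[OF f m[OF p(2)] m(2)[OF that]] Tmap_add_scale(1)[OF M N g p that] T by metis
  show "f (Tmap M N g (p, a *\<^sub>R \<xi>)) = a *\<^sub>R f (Tmap M N g (p, \<xi>))" for a
    using fibre_linearD(2)[OF f m[OF p(2)]] Tmap_add_scale(2)[OF M N g p p(2)] T by metis
qed

lemma fibre_linear_add: "fibre_linear M f \<Longrightarrow> fibre_linear M g \<Longrightarrow> fibre_linear M (\<lambda>v. f v + g v)"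
  unfolding fibre_linear_def by (simp add: scaleR_add_right add_ac)

lemma fibre_linear_Pair: "fibre_linear M f \<Longrightarrow> fibre_linear M g \<Longrightarrow> fibre_linear M (\<lambda>v. (f v, g v))"
  unfolding fibre_linear_def by simp

lemma fibre_linear_fst_snd:
  "fibre_linear M f \<Longrightarrow> fibre_linear M (\<lambda>v. fst (f v))" "fibre_linear M f \<Longrightarrow> fibre_linear M (\<lambda>v. snd (f v))"
  unfolding fibre_linear_def by simp_all

lemma fibre_linear_diff: "fibre_linear M f \<Longrightarrow> fibre_linear M g \<Longrightarrow> fibre_linear M (\<lambda>v. f v - g v)"
  unfolding fibre_linear_def by (simp add: scaleR_diff_right)

lemma fibre_linear_map:
  assumes "fibre_linear M f" "\<And>v. v \<in> pts (tangent_bundle M) \<Longrightarrow> f v \<in> V"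
    and "\<And>A B. A \<in> V \<Longrightarrow> B \<in> V \<Longrightarrow> h (A + B) = h A + h B" "\<And>a A. A \<in> V \<Longrightarrow> h (a *\<^sub>R A) = a *\<^sub>R h A"
  shows "fibre_linear M (\<lambda>v. h (f v))"
proof (rule fibre_linearI)
  fix p \<xi> assume p: "p \<in> pts M" "\<xi> \<in> tangent_space M p"
  have m: "f (p, \<zeta>) \<in> V" if "\<zeta> \<in> tangent_space M p" for \<zeta>
    using assms(2)[of "(p, \<zeta>)"] p(1) that by (simp add: pts_tangent_bundle)
  show "h (f (p, \<xi> + \<zeta>)) = h (f (p, \<xi>)) + h (f (p, \<zeta>))" if "\<zeta> \<in> tangent_space M p" for \<zeta>
    using fibre_linearD(1)[OF assms(1) p that] assms(3)[OF m[OF p(2)] m[OF that]] by simp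
  show "h (f (p, a *\<^sub>R \<xi>)) = a *\<^sub>R h (f (p, \<xi>))" for a
    using fibre_linearD(2)[OF assms(1) p] assms(4)[OF m[OF p(2)]] by simp
qed

section \<open>Equivariant forms with values in \<open>L(H) \<oplus> L(G)\<close>\<close>

lemma add_functor_apply:
  "u \<in> Ob C \<Longrightarrow> fst (add_functor C F F') u = fst F u + fst F' u"
  "x \<in> Mor C \<Longrightarrow> snd (add_functor C F F') x = snd F x + snd F' x"
  unfolding add_functor_def add_on_def by simp_all

lemma extensional_add_functor: "extensional_functor C (add_functor C F F')"
  unfolding extensional_functor_def add_functor_def add_on_def by simp

lemma add_trans_apply:
  "add_trans C (F1, \<eta>, F2) (F1', \<eta>', F2') = (add_functor C F1 F1', \<lambda>v\<in>Ob C. \<eta> v + \<eta>' v, add_functor C F2 F2')"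
  unfolding add_trans_def add_on_def by simp

context gauge_bundle
begin

abbreviation "TO \<equiv> tangent_bundle OE"
abbreviation "TM \<equiv> tangent_bundle ME"

lemmas TOA = smooth_atlas_tangent_bundle[OF e(2)] and TMA = smooth_atlas_tangent_bundle[OF e(3)]

lemma LHA: "smooth_atlas (lie_alg_atlas H)" and LGA: "smooth_atlas (lie_alg_atlas G)"
  unfolding lie_alg_atlas_fibre by (rule smooth_atlas_fibre[OF HA], rule smooth_atlas_fibre[OF GA])

lemmas LA = smooth_atlas_prod[OF LHA LGA]

lemma pts_lie_alg: "pts (lie_alg_atlas H) = lie_alg H" "pts (lie_alg_atlas G) = lie_alg G"
  unfolding lie_alg_atlas_fibre lie_alg_def by (rule pts_fibre_atlas[OF lie_groupD(6)[OF H]], rule pts_fibre_atlas[OF lie_groupD(6)[OF G]])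

lemma smooth_LH:
  assumes "smooth_atlas N" "smooth_map N (lie_alg_atlas H) f" "smooth_map N (lie_alg_atlas H) g"
  shows "smooth_map N (lie_alg_atlas H) (\<lambda>v. f v + g v)" "smooth_map N (lie_alg_atlas H) (\<lambda>v. f v - g v)"
  using assms unfolding lie_alg_atlas_fibre
  by (auto intro: smooth_map_fibre_add[OF _ HA lie_groupD(6)[OF H]] smooth_map_fibre_diff[OF _ HA lie_groupD(6)[OF H]])

lemma smooth_LG:
  assumes "smooth_atlas N" "smooth_map N (lie_alg_atlas G) f" "smooth_map N (lie_alg_atlas G) g"
  shows "smooth_map N (lie_alg_atlas G) (\<lambda>v. f v + g v)"
  using assms unfolding lie_alg_atlas_fibre by (rule smooth_map_fibre_add[OF _ GA lie_groupD(6)[OF G]])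

lemma smooth_L_Pair:
  "smooth_atlas N \<Longrightarrow> smooth_map N (lie_alg_atlas H) f \<Longrightarrow> smooth_map N (lie_alg_atlas G) g \<Longrightarrow> smooth_map N (mor_charts L) (\<lambda>v. (f v, g v))"
  unfolding lie_2alg_simps by (rule smooth_map_Pair[OF _ LHA LGA])

lemma smooth_L_proj:
  assumes "smooth_atlas N" "smooth_map N (mor_charts L) f"
  shows "smooth_map N (lie_alg_atlas H) (\<lambda>v. fst (f v))" "smooth_map N (lie_alg_atlas G) (\<lambda>v. snd (f v))"
  using smooth_map_comp[OF assms(1) LA LHA assms(2)[unfolded lie_2alg_simps] smooth_map_fst[OF LHA LGA]]
    smooth_map_comp[OF assms(1) LA LGA assms(2)[unfolded lie_2alg_simps] smooth_map_snd[OF LHA LGA]] .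

lemma smooth_L_add:
  assumes N: "smooth_atlas N" and f: "smooth_map N (mor_charts L) f" and g: "smooth_map N (mor_charts L) g"
  shows "smooth_map N (mor_charts L) (\<lambda>v. f v + g v)"
proof -
  have "smooth_map N (mor_charts L) (\<lambda>v. (fst (f v) + fst (g v), snd (f v) + snd (g v)))"
    by (intro smooth_L_Pair[OF N] smooth_LH(1)[OF N] smooth_LG[OF N] smooth_L_proj[OF N f] smooth_L_proj[OF N g])
  then show ?thesis by (simp add: plus_prod_def)
qed

lemma push_smooth:
  assumes "lie_functor E E F"
  shows "smooth_map TO TO (fst (push_functor E F))" "smooth_map TM TM (snd (push_functor E F))"
proof -
  show "smooth_map TO TO (fst (push_functor E F))"
    by (rule smooth_map_cong[OF smooth_map_Tmap[OF e(2,2) lie_functorD(2)[OF assms]] TOA]) (simp add: push_functor_apply)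
  show "smooth_map TM TM (snd (push_functor E F))"
    by (rule smooth_map_cong[OF smooth_map_Tmap[OF e(3,3) lie_functorD(3)[OF assms]] TMA]) (simp add: push_functor_apply)
qed

text \<open>Gauge transformations commute with the action of each group element, hence so do their differentials.\<close>

lemma push_tact:
  assumes F: "F \<in> gauge_ob K P"
  shows "v \<in> Ob T \<Longrightarrow> g \<in> carrier G \<Longrightarrow> fst (push_functor E F) (tact0 P v g) = tact0 P (fst (push_functor E F) v) g"
    "x \<in> Mor T \<Longrightarrow> a \<in> carrier S \<Longrightarrow> snd (push_functor E F) (tact1 P x a) = tact1 P (snd (push_functor E F) x) a"
proof -
  note f = gauge_obD[OF F]
  show "fst (push_functor E F) (tact0 P v g) = tact0 P (fst (push_functor E F) v) g" if v: "v \<in> Ob T" and g: "g \<in> carrier G"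
  proof -
    obtain \<gamma> where \<gamma>: "has_velocity OE \<gamma> v" and ev: "\<forall>\<^sub>F t in nhds 0. \<gamma> t \<in> Ob E" using obtain_curve0[OF v] .
    have "\<forall>\<^sub>F t in nhds 0. fst F (act0 (\<gamma> t) g) = act0 (fst F (\<gamma> t)) g"
      by (rule eventually_mono[OF ev]) (rule f(3)[OF _ g])
    from velocity_unique[OF velocity_cong[OF velocity_push_functor(1)[OF E f(1) velocity_tact(1)[OF g \<gamma>]] this]
        velocity_tact(1)[OF g velocity_push_functor(1)[OF E f(1) \<gamma>]]] show ?thesis .
  qed
  show "snd (push_functor E F) (tact1 P x a) = tact1 P (snd (push_functor E F) x) a" if x: "x \<in> Mor T" and a: "a \<in> carrier S"
  proof -
    obtain \<gamma> where \<gamma>: "has_velocity ME \<gamma> x" and ev: "\<forall>\<^sub>F t in nhds 0. \<gamma> t \<in> Mor E" using obtain_curve1[OF x] .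
    have "\<forall>\<^sub>F t in nhds 0. snd F (act1 (\<gamma> t) a) = act1 (snd F (\<gamma> t)) a"
      by (rule eventually_mono[OF ev]) (rule f(4)[OF _ a])
    from velocity_unique[OF velocity_cong[OF velocity_push_functor(2)[OF E f(1) velocity_tact(2)[OF a \<gamma>]] this]
        velocity_tact(2)[OF a velocity_push_functor(2)[OF E f(1) \<gamma>]]] show ?thesis .
  qed
qed

lemma push_trans_tact:
  assumes \<Psi>: "(F, \<psi>, F') \<in> gauge_mor K P" and v: "v \<in> Ob T" and g: "g \<in> carrier G"
  shows "Tmap OE ME \<psi> (tact0 P v g) = tact1 P (Tmap OE ME \<psi> v) (\<one>\<^bsub>H\<^esub>, g)"
proof -
  note p = gauge_morD[OF \<Psi>]
  obtain \<gamma> where \<gamma>: "has_velocity OE \<gamma> v" and ev: "\<forall>\<^sub>F t in nhds 0. \<gamma> t \<in> Ob E" using obtain_curve0[OF v] .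
  have a: "(\<one>\<^bsub>H\<^esub>, g) \<in> carrier S" using g by simp
  have "\<forall>\<^sub>F t in nhds 0. \<psi> (act0 (\<gamma> t) g) = act1 (\<psi> (\<gamma> t)) (\<one>\<^bsub>H\<^esub>, g)"
    by (rule eventually_mono[OF ev]) (rule p(4)[OF _ g])
  from velocity_unique[OF velocity_cong[OF velocity_Tmap[OF e(2,3) p(7) velocity_tact(1)[OF g \<gamma>]] this]
      velocity_tact(2)[OF a velocity_Tmap[OF e(2,3) p(7) \<gamma>]]] show ?thesis .
qed

text \<open>Gauge transformations map the curves \<open>p b(t)\<close> that define fundamental vector fields to curves of the same
  kind.\<close>

lemma push_delta:
  assumes F: "F \<in> gauge_ob K P"
  shows "p \<in> Ob E \<Longrightarrow> B \<in> lie_alg G \<Longrightarrow> fst (push_functor E F) (delta0 p B) = delta0 (fst F p) B"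
    "x \<in> Mor E \<Longrightarrow> A \<in> lie_alg H \<Longrightarrow> B \<in> lie_alg G \<Longrightarrow> snd (push_functor E F) (delta1 x (A, B)) = delta1 (snd F x) (A, B)"
proof -
  note f = gauge_obD[OF F] and fn = is_functorD(1,2)[OF gauge_functor[OF F]]
  show "fst (push_functor E F) (delta0 p B) = delta0 (fst F p) B" if p: "p \<in> Ob E" and B: "B \<in> lie_alg G"
  proof -
    obtain b where b: "has_velocity (charts G) b (\<one>\<^bsub>G\<^esub>, B)" using lie_alg_curve[OF G B] .
    have "\<forall>\<^sub>F t in nhds 0. fst F (act0 p (b t)) = act0 (fst F p) (b t)"
      by (rule eventually_mono[OF eventually_carrier(1)[OF b]]) (rule f(3)[OF p])
    from velocity_unique[OF velocity_cong[OF velocity_push_functor(1)[OF E f(1) velocity_delta0[OF p b]] this]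
        velocity_delta0[OF fn(1)[OF p] b]] show ?thesis .
  qed
  show "snd (push_functor E F) (delta1 x (A, B)) = delta1 (snd F x) (A, B)"
    if x: "x \<in> Mor E" and A: "A \<in> lie_alg H" and B: "B \<in> lie_alg G"
  proof -
    obtain a where a: "has_velocity (charts H) a (\<one>\<^bsub>H\<^esub>, A)" using lie_alg_curve[OF H A] .
    obtain b where b: "has_velocity (charts G) b (\<one>\<^bsub>G\<^esub>, B)" using lie_alg_curve[OF G B] .
    have "\<forall>\<^sub>F t in nhds 0. snd F (act1 x (a t, b t)) = act1 (snd F x) (a t, b t)"
      by (rule eventually_mono[OF eventually_conj[OF eventually_carrier(2)[OF a] eventually_carrier(1)[OF b]]])
        (rule f(4)[OF x], simp)
    from velocity_unique[OF velocity_cong[OF velocity_push_functor(2)[OF E f(1) velocity_delta1[OF x a b]] this]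
        velocity_delta1[OF fn(2)[OF x] a b]] show ?thesis .
  qed
qed

text \<open>Semi-strict connection 1-forms and the forms \<open>\<lambda>-bar\<close> have everything in common
  but the condition on the vertical vectors.\<close>

definition eq_form where
  "eq_form \<omega> \<longleftrightarrow> lie_functor T L \<omega> \<and> extensional_functor T \<omega> \<and> fibre_linear OE (fst \<omega>) \<and> fibre_linear ME (snd \<omega>) \<and>
     (\<forall>v\<in>Ob T. \<forall>g\<in>carrier G. fst \<omega> (tact0 P v g) = Ad G (inv\<^bsub>G\<^esub> g) (fst \<omega> v)) \<and>
     (\<forall>x\<in>Mor T. \<forall>a\<in>carrier S. snd \<omega> (tact1 P x a) = Ad1 K (inv\<^bsub>S\<^esub> a) (snd \<omega> x))"

definition eq_trans where
  "eq_trans = {(\<omega>, \<eta>, \<omega>'). eq_form \<omega> \<and> eq_form \<omega>' \<and> (\<omega>, \<eta>, \<omega>') \<in> ntrans T L \<and> smooth_map TO (mor_charts L) \<eta> \<and>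
     (\<forall>v\<in>Ob T. \<forall>g\<in>carrier G. \<eta> (tact0 P v g) = Ad_unit_inv K g (\<eta> v))}"

lemma eq_formD:
  assumes "eq_form \<omega>"
  shows "lie_functor T L \<omega>" "extensional_functor T \<omega>" "fibre_linear OE (fst \<omega>)" "fibre_linear ME (snd \<omega>)"
    "v \<in> Ob T \<Longrightarrow> g \<in> carrier G \<Longrightarrow> fst \<omega> (tact0 P v g) = Ad G (inv\<^bsub>G\<^esub> g) (fst \<omega> v)"
    "x \<in> Mor T \<Longrightarrow> a \<in> carrier S \<Longrightarrow> snd \<omega> (tact1 P x a) = Ad1 K (inv\<^bsub>S\<^esub> a) (snd \<omega> x)"
    "is_functor T L \<omega>" "smooth_map TO (lie_alg_atlas G) (fst \<omega>)" "smooth_map TM (mor_charts L) (snd \<omega>)"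
  using assms unfolding eq_form_def lie_functor_def by (simp_all del: semidirect_simps lie_2alg_simps(8))

lemma eq_form_values:
  assumes "eq_form \<omega>"
  shows "v \<in> Ob T \<Longrightarrow> fst \<omega> v \<in> lie_alg G" "x \<in> Mor T \<Longrightarrow> fst (snd \<omega> x) \<in> lie_alg H" "x \<in> Mor T \<Longrightarrow> snd (snd \<omega> x) = fst \<omega> (Src T x)"
    "x \<in> Mor T \<Longrightarrow> Ltau K (fst (snd \<omega> x)) + fst \<omega> (Src T x) = fst \<omega> (Tgt T x)"
proof -
  note f = is_functorD(1-4)[OF eq_formD(7)[OF assms]]
  show "v \<in> Ob T \<Longrightarrow> fst \<omega> v \<in> lie_alg G" using f(1) by simp
  show "x \<in> Mor T \<Longrightarrow> fst (snd \<omega> x) \<in> lie_alg H" using f(2) by (auto simp: mem_Times_iff)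
  show *: "snd (snd \<omega> x) = fst \<omega> (Src T x)" if "x \<in> Mor T" for x using f(3)[OF that] by simp
  show "x \<in> Mor T \<Longrightarrow> Ltau K (fst (snd \<omega> x)) + fst \<omega> (Src T x) = fst \<omega> (Tgt T x)"
    using f(4)[of x] by (simp add: Tgt_L * del: tangent_gpd_simps)
qed

lemma eq_transD:
  assumes "(\<omega>, \<eta>, \<omega>') \<in> eq_trans"
  shows "eq_form \<omega>" "eq_form \<omega>'" "(\<omega>, \<eta>, \<omega>') \<in> ntrans T L" "smooth_map TO (mor_charts L) \<eta>"
    "v \<in> Ob T \<Longrightarrow> g \<in> carrier G \<Longrightarrow> \<eta> (tact0 P v g) = Ad_unit_inv K g (\<eta> v)" "nat_trans T L \<omega> \<omega>' \<eta>"
proof -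
  show *: "eq_form \<omega>" "eq_form \<omega>'" "(\<omega>, \<eta>, \<omega>') \<in> ntrans T L" "smooth_map TO (mor_charts L) \<eta>"
    "v \<in> Ob T \<Longrightarrow> g \<in> carrier G \<Longrightarrow> \<eta> (tact0 P v g) = Ad_unit_inv K g (\<eta> v)"
    using assms unfolding eq_trans_def by (simp_all del: lie_2alg_simps)
  show "nat_trans T L \<omega> \<omega>' \<eta>" by (rule ntransD(6)[OF *(3)])
qed

lemma eq_trans_values:
  assumes "(\<omega>, \<eta>, \<omega>') \<in> eq_trans" "v \<in> Ob T"
  shows "\<eta> v \<in> Mor L" "fst (\<eta> v) \<in> lie_alg H" "snd (\<eta> v) = fst \<omega> v" "Ltau K (fst (\<eta> v)) + fst \<omega> v = fst \<omega>' v"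
proof -
  note n = nat_transD(1-3)[OF eq_transD(6)[OF assms(1)] assms(2)]
  show "\<eta> v \<in> Mor L" "fst (\<eta> v) \<in> lie_alg H" "snd (\<eta> v) = fst \<omega> v" "Ltau K (fst (\<eta> v)) + fst \<omega> v = fst \<omega>' v"
    using n by (auto simp: mem_Times_iff Tgt_L)
qed

lemma Ad_unit_inv_add:
  assumes "g \<in> carrier G" "x \<in> Mor L" "y \<in> Mor L"
  shows "Ad_unit_inv K g (x + y) = Ad_unit_inv K g x + Ad_unit_inv K g y"
    "Src L y = Tgt L x \<Longrightarrow> Ad_unit_inv K g (Cmp L y x) = Cmp L (Ad_unit_inv K g y) (Ad_unit_inv K g x)"
proof -
  obtain A B A' B' where eq: "x = (A, B)" "y = (A', B')" by (cases x, cases y) auto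
  then have m: "A \<in> lie_alg H" "B \<in> lie_alg G" "A' \<in> lie_alg H" "B' \<in> lie_alg G" using assms by auto
  have i: "inv\<^bsub>G\<^esub> g \<in> carrier G" using assms(1) by simp
  note s = subspace_add[OF LH m(1,3)] subspace_add[OF LH m(3,1)] subspace_add[OF LG m(2,4)]
  show "Ad_unit_inv K g (x + y) = Ad_unit_inv K g x + Ad_unit_inv K g y"
    "Ad_unit_inv K g (Cmp L y x) = Cmp L (Ad_unit_inv K g y) (Ad_unit_inv K g x)"
    using m s assms(1) Lalpha_facts(2)[OF i m(1,3)] Lalpha_facts(2)[OF i m(3,1)] Ad_facts(2)[OF G i m(2,4)]
    by (simp_all add: eq Ad_unit_inv_apply)
qed

lemma Ad1_unit_inv: "Ad1 K (inv\<^bsub>S\<^esub> (\<one>\<^bsub>H\<^esub>, g)) = Ad_unit_inv K g"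
  unfolding Ad_unit_inv_def Idn_2group ..

subsection \<open>Sums\<close>

text \<open>A sum of functors is a functor because source, target and composition of \<open>L(H) \<oplus> L(G)\<close> are
  linear.\<close>

lemma eq_form_add:
  assumes w: "eq_form \<omega>" and w': "eq_form \<omega>'"
  shows "eq_form (add_functor T \<omega> \<omega>')"
proof -
  note a = eq_formD[OF w] and b = eq_formD[OF w'] and av = eq_form_values[OF w] and bv = eq_form_values[OF w']
  note fa = is_functorD[OF a(7)] and fb = is_functorD[OF b(7)]
  have "is_functor T L (add_functor T \<omega> \<omega>')"
    unfolding is_functor_def
  proof (intro conjI ballI impI funcsetI)
    fix x y assume x: "x \<in> Mor T" "y \<in> Mor T" "Src T y = Tgt T x"
    show "snd (add_functor T \<omega> \<omega>') (Cmp T y x) = Cmp L (snd (add_functor T \<omega> \<omega>') y) (snd (add_functor T \<omega> \<omega>') x)"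
      using tC(6)[OF x] fa(6)[OF x] fb(6)[OF x] x by (simp add: add_functor_apply Cmp_L prod_eq_iff del: tangent_gpd_simps)
  next
    fix x assume x: "x \<in> Mor T"
    note o = tC(1,2)[OF x]
    show "snd (add_functor T \<omega> \<omega>') x \<in> Mor L"
      using subspace_add[OF LH av(2)[OF x] bv(2)[OF x]] subspace_add[OF LG av(1)[OF o(1)] bv(1)[OF o(1)]] x
      by (simp add: add_functor_apply mem_Times_iff av(3) bv(3) del: tangent_gpd_simps)
    show "Src L (snd (add_functor T \<omega> \<omega>') x) = fst (add_functor T \<omega> \<omega>') (Src T x)"
      using x o by (simp add: add_functor_apply av(3) bv(3) del: tangent_gpd_simps)
    show "Tgt L (snd (add_functor T \<omega> \<omega>') x) = fst (add_functor T \<omega> \<omega>') (Tgt T x)"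
      using x o av(4)[OF x, symmetric] bv(4)[OF x, symmetric] Ltau_facts(2)[OF av(2)[OF x] bv(2)[OF x]]
      by (simp add: add_functor_apply Tgt_L av(3) bv(3) del: tangent_gpd_simps)
  next
    fix u assume u: "u \<in> Ob T"
    show "fst (add_functor T \<omega> \<omega>') u \<in> Ob L"
      using subspace_add[OF LG av(1)[OF u] bv(1)[OF u]] u by (simp add: add_functor_apply del: tangent_gpd_simps)
    show "snd (add_functor T \<omega> \<omega>') (Idn T u) = Idn L (fst (add_functor T \<omega> \<omega>') u)"
      using u fa(5)[OF u] fb(5)[OF u] tC(3)[OF u] by (simp add: add_functor_apply del: tangent_gpd_simps)
  qed
  moreover have "smooth_map TO (lie_alg_atlas G) (fst (add_functor T \<omega> \<omega>'))"
    by (rule smooth_map_cong[OF smooth_LG[OF TOA a(8) b(8)] TOA]) (simp add: add_functor_apply)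
  moreover have "smooth_map TM (mor_charts L) (snd (add_functor T \<omega> \<omega>'))"
    by (rule smooth_map_cong[OF smooth_L_add[OF TMA a(9) b(9)] TMA]) (simp add: add_functor_apply)
  moreover have "fibre_linear OE (fst (add_functor T \<omega> \<omega>'))"
    by (rule fibre_linear_cong[OF e(2) fibre_linear_add[OF a(3) b(3)]]) (simp add: add_functor_apply)
  moreover have "fibre_linear ME (snd (add_functor T \<omega> \<omega>'))"
    by (rule fibre_linear_cong[OF e(3) fibre_linear_add[OF a(4) b(4)]]) (simp add: add_functor_apply)
  moreover have "fst (add_functor T \<omega> \<omega>') (tact0 P v g) = Ad G (inv\<^bsub>G\<^esub> g) (fst (add_functor T \<omega> \<omega>') v)"
    if v: "v \<in> Ob T" "g \<in> carrier G" for v g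
    using v tact0_closed[OF v] a(5)[OF v] b(5)[OF v] Ad_facts(2)[OF G G.inv_closed[OF v(2)] av(1)[OF v(1)] bv(1)[OF v(1)]]
    by (simp add: add_functor_apply del: tangent_gpd_simps)
  moreover have "snd (add_functor T \<omega> \<omega>') (tact1 P x a') = Ad1 K (inv\<^bsub>S\<^esub> a') (snd (add_functor T \<omega> \<omega>') x)"
    if x: "x \<in> Mor T" "a' \<in> carrier S" for x a'
    using x tact1_closed[OF x] a(6)[OF x] b(6)[OF x] Ad1_add(1)[OF S.inv_closed[OF x(2)] fa(2)[OF x(1)] fb(2)[OF x(1)]]
    by (simp add: add_functor_apply del: tangent_gpd_simps semidirect_simps lie_2alg_simps)
  ultimately show ?thesis
    unfolding eq_form_def lie_functor_def by (simp add: extensional_add_functor del: semidirect_simps)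
qed

lemma eq_trans_add:
  assumes "\<zeta> \<in> eq_trans" "\<zeta>' \<in> eq_trans"
  shows "add_trans T \<zeta> \<zeta>' \<in> eq_trans"
proof -
  obtain \<omega>1 \<eta> \<omega>2 \<omega>1' \<eta>' \<omega>2' where eq: "\<zeta> = (\<omega>1, \<eta>, \<omega>2)" "\<zeta>' = (\<omega>1', \<eta>', \<omega>2')" by (metis prod_cases3)
  note a = eq_transD[OF assms(1)[unfolded eq]] and b = eq_transD[OF assms(2)[unfolded eq]]
  note av = eq_trans_values[OF assms(1)[unfolded eq]] and bv = eq_trans_values[OF assms(2)[unfolded eq]]
  let ?\<eta> = "\<lambda>v\<in>Ob T. \<eta> v + \<eta>' v"
  have "nat_trans T L (add_functor T \<omega>1 \<omega>1') (add_functor T \<omega>2 \<omega>2') ?\<eta>"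
    unfolding nat_trans_def
  proof (intro conjI ballI)
    fix v assume v: "v \<in> Ob T"
    show "?\<eta> v \<in> Mor L"
      using v subspace_add[OF LH av(2)[OF v] bv(2)[OF v]] subspace_add[OF LG, of "snd (\<eta> v)" "snd (\<eta>' v)"] av(1)[OF v] bv(1)[OF v]
      by (auto simp: mem_Times_iff simp del: tangent_gpd_simps)
    show "Src L (?\<eta> v) = fst (add_functor T \<omega>1 \<omega>1') v"
      using v by (simp add: add_functor_apply av(3) bv(3) del: tangent_gpd_simps)
    show "Tgt L (?\<eta> v) = fst (add_functor T \<omega>2 \<omega>2') v"
      using v av(4)[OF v, symmetric] bv(4)[OF v, symmetric] Ltau_facts(2)[OF av(2)[OF v] bv(2)[OF v]]
      by (simp add: add_functor_apply Tgt_L av(3) bv(3) del: tangent_gpd_simps)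
  next
    fix x assume x: "x \<in> Mor T"
    show "Cmp L (?\<eta> (Tgt T x)) (snd (add_functor T \<omega>1 \<omega>1') x) = Cmp L (snd (add_functor T \<omega>2 \<omega>2') x) (?\<eta> (Src T x))"
    proof -
      have q: "y + y' + (z + z') = w + w' + (u + u')" if "y + z = w + u" "y' + z' = w' + u'"
        for y y' z z' w w' u u' :: "('h, 'n) chart \<Rightarrow> 'n"
      proof -
        have "y + y' + (z + z') = (y + z) + (y' + z')" by (simp add: add_ac)
        also have "\<dots> = w + w' + (u + u')" unfolding that by (simp add: add_ac)
        finally show ?thesis .
      qed
      have n: "fst (\<eta> (Tgt T x)) + fst (snd \<omega>1 x) = fst (snd \<omega>2 x) + fst (\<eta> (Src T x))" "snd (snd \<omega>1 x) = snd (\<eta> (Src T x))"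
        "fst (\<eta>' (Tgt T x)) + fst (snd \<omega>1' x) = fst (snd \<omega>2' x) + fst (\<eta>' (Src T x))" "snd (snd \<omega>1' x) = snd (\<eta>' (Src T x))"
        using nat_transD(4)[OF a(6) x] nat_transD(4)[OF b(6) x] by (simp_all add: Cmp_L del: tangent_gpd_simps)
      show ?thesis
        using x tC(1,2)[OF x] q[OF n(1,3)] n(2,4) by (simp add: add_functor_apply Cmp_L del: tangent_gpd_simps)
    qed
  qed
  moreover have "smooth_map TO (mor_charts L) ?\<eta>"
    by (rule smooth_map_cong[OF smooth_L_add[OF TOA a(4) b(4)] TOA]) simp
  moreover have "?\<eta> (tact0 P v g) = Ad_unit_inv K g (?\<eta> v)" if v: "v \<in> Ob T" "g \<in> carrier G" for v g
    using v tact0_closed[OF v] a(5)[OF v] b(5)[OF v] Ad_unit_inv_add(1)[OF v(2) av(1)[OF v(1)] bv(1)[OF v(1)]]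
    by (simp del: tangent_gpd_simps)
  ultimately show ?thesis
    unfolding eq add_trans_apply eq_trans_def ntrans_def
    using eq_form_add[OF a(1) b(1)] eq_form_add[OF a(2) b(2)]
    by (simp add: extensional_add_functor eq_formD(7) del: tangent_gpd_simps)
qed

subsection \<open>Transport along gauge transformations\<close>

lemma eq_form_comp_push:
  assumes w: "eq_form \<omega>" and F: "F \<in> gauge_ob K P"
  shows "eq_form (comp_functor T \<omega> (push_functor E F))"
proof -
  note a = eq_formD[OF w] and f = gauge_obD(1)[OF F] and T = category_tangent_gpd[OF E]
  note pf = is_functor_push[OF E f]
  note p = is_functorD(1,2)[OF pf]
  let ?w = "comp_functor T \<omega> (push_functor E F)"
  have "smooth_map TO (lie_alg_atlas G) (fst ?w)"
    by (rule smooth_map_cong[OF smooth_map_comp[OF TOA TOA LGA push_smooth(1)[OF f] a(8)] TOA]) (simp add: comp_functor_apply)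
  moreover have "smooth_map TM (mor_charts L) (snd ?w)"
    by (rule smooth_map_cong[OF smooth_map_comp[OF TMA TMA LA push_smooth(2)[OF f] a(9)[unfolded lie_2alg_simps]] TMA, folded lie_2alg_simps])
      (simp add: comp_functor_apply)
  moreover have "fibre_linear OE (fst ?w)"
    by (rule fibre_linear_cong[OF e(2) fibre_linear_Tmap[OF e(2,2) lie_functorD(2)[OF f] a(3)]])
      (simp add: comp_functor_apply push_functor_apply)
  moreover have "fibre_linear ME (snd ?w)"
    by (rule fibre_linear_cong[OF e(3) fibre_linear_Tmap[OF e(3,3) lie_functorD(3)[OF f] a(4)]])
      (simp add: comp_functor_apply push_functor_apply)
  moreover have "fst ?w (tact0 P v g) = Ad G (inv\<^bsub>G\<^esub> g) (fst ?w v)" if v: "v \<in> Ob T" "g \<in> carrier G" for v g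
    using v tact0_closed[OF v] push_tact(1)[OF F v] a(5)[OF p(1)[OF v(1)] v(2)]
    by (simp add: comp_functor_apply del: tangent_gpd_simps)
  moreover have "snd ?w (tact1 P x a') = Ad1 K (inv\<^bsub>S\<^esub> a') (snd ?w x)" if x: "x \<in> Mor T" "a' \<in> carrier S" for x a'
    using x tact1_closed[OF x] push_tact(2)[OF F x] a(6)[OF p(2)[OF x(1)] x(2)]
    by (simp add: comp_functor_apply del: tangent_gpd_simps semidirect_simps lie_2alg_simps)
  ultimately show ?thesis
    unfolding eq_form_def lie_functor_def using is_functor_comp[OF T pf a(7)]
    by (simp add: extensional_comp_functor del: semidirect_simps)
qed

text \<open>Equivariance of the horizontal composite combines equivariance of the outer transformation at the
  translated target with the equivariance of the form on the arrow \<^term>\<open>Tmap OE ME \<psi> v\<close>, where the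
  translating group element is the identity arrow of \<^term>\<open>g\<close>.\<close>

lemma eq_trans_hcomp_push:
  assumes "\<zeta> \<in> eq_trans" and \<Psi>: "\<Psi> \<in> gauge_mor K P"
  shows "hcomp T L \<zeta> (push_trans E \<Psi>) \<in> eq_trans"
proof -
  obtain \<omega> \<eta> \<omega>' F \<psi> F' where eq: "\<zeta> = (\<omega>, \<eta>, \<omega>')" "\<Psi> = (F, \<psi>, F')" by (metis prod_cases3)
  note a = eq_transD[OF assms(1)[unfolded eq]] and av = eq_trans_values[OF assms(1)[unfolded eq]]
    and p = gauge_morD[OF \<Psi>[unfolded eq]] and T = category_tangent_gpd[OF E]
  note pn = push_trans_ntrans[OF E p(3), unfolded push_trans_apply]
  note f' = is_functorD(1,2)[OF is_functor_push[OF E gauge_obD(1)[OF p(2)]]]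
  note n = nat_transD(1-3)[OF ntransD(6)[OF pn]]
  have n1: "Tmap OE ME \<psi> v \<in> Mor T" "Src T (Tmap OE ME \<psi> v) = fst (push_functor E F) v"
    "Tgt T (Tmap OE ME \<psi> v) = fst (push_functor E F') v" if "v \<in> Ob T" for v
    using n[OF that] that by (simp_all del: tangent_gpd_simps)
  let ?\<eta> = "\<lambda>v\<in>Ob T. Cmp L (\<eta> (fst (push_functor E F') v)) (snd \<omega> ((\<lambda>v\<in>Ob T. Tmap OE ME \<psi> v) v))"
  have hn: "hcomp T L \<zeta> (push_trans E \<Psi>) \<in> ntrans T L"
    by (rule hcomp_ntrans[OF T T category_L a(3)[folded eq] push_trans_ntrans[OF E p(3)[folded eq]]])
  moreover have "smooth_map TO (mor_charts L) ?\<eta>"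
  proof -
    note s1 = smooth_map_comp[OF TOA TOA LA push_smooth(1)[OF gauge_obD(1)[OF p(2)]] a(4)[unfolded lie_2alg_simps], folded lie_2alg_simps]
    note s2 = smooth_map_comp[OF TOA TMA LA smooth_map_Tmap[OF e(2,3) p(7)] eq_formD(9)[OF a(1), unfolded lie_2alg_simps], folded lie_2alg_simps]
    show ?thesis
      by (rule smooth_map_cong[OF smooth_L_Pair[OF TOA smooth_LH(1)[OF TOA smooth_L_proj(1)[OF TOA s1] smooth_L_proj(1)[OF TOA s2]]
            smooth_L_proj(2)[OF TOA s2]] TOA]) (simp add: Cmp_L)
  qed
  moreover have "?\<eta> (tact0 P v g) = Ad_unit_inv K g (?\<eta> v)" if v: "v \<in> Ob T" "g \<in> carrier G" for v g
  proof -
    let ?u = "fst (push_functor E F') v" and ?x = "Tmap OE ME \<psi> v"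
    have u: "?u \<in> Ob T" using f'(1)[OF v(1)] .
    have x: "?x \<in> Mor T" "snd \<omega> ?x \<in> Mor L" using n1(1)[OF v(1)] is_functorD(2)[OF eq_formD(7)[OF a(1)] n1(1)[OF v(1)]] .
    have c: "Src L (\<eta> ?u) = Tgt L (snd \<omega> ?x)"
      using nat_transD(2)[OF a(6) u] is_functorD(4)[OF eq_formD(7)[OF a(1)] x(1)] n1(3)[OF v(1)] by simp
    have "snd \<omega> (tact1 P ?x (\<one>\<^bsub>H\<^esub>, g)) = Ad_unit_inv K g (snd \<omega> ?x)"
      using eq_formD(6)[OF a(1) x(1), of "(\<one>\<^bsub>H\<^esub>, g)"] v(2) by (simp add: Ad1_unit_inv)
    then show ?thesis
      using v tact0_closed[OF v] push_tact(1)[OF p(2) v] push_trans_tact[OF \<Psi>[unfolded eq] v] a(5)[OF u v(2)]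
        Ad_unit_inv_add(2)[OF v(2) x(2) av(1)[OF u] c]
      by (simp del: tangent_gpd_simps lie_2alg_simps)
  qed
  ultimately show ?thesis
    using eq_form_comp_push[OF a(1) p(1)] eq_form_comp_push[OF a(2) p(2)]
    unfolding eq push_trans_apply hcomp_apply eq_trans_def by (simp del: tangent_gpd_simps lie_2alg_simps)
qed

subsection \<open>Vertical composition\<close>

lemma eq_trans_vcomp:
  assumes "(\<omega>', \<eta>', \<omega>'') \<in> eq_trans" "(\<omega>, \<eta>, \<omega>') \<in> eq_trans"
  shows "vcomp T L (\<omega>', \<eta>', \<omega>'') (\<omega>, \<eta>, \<omega>') \<in> eq_trans"
proof -
  note a = eq_transD[OF assms(2)] and b = eq_transD[OF assms(1)]
  note av = eq_trans_values[OF assms(2)] and bv = eq_trans_values[OF assms(1)]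
  let ?\<eta> = "\<lambda>v\<in>Ob T. Cmp L (\<eta>' v) (\<eta> v)"
  have "smooth_map TO (mor_charts L) ?\<eta>"
    by (rule smooth_map_cong[OF smooth_L_Pair[OF TOA smooth_LH(1)[OF TOA smooth_L_proj(1)[OF TOA b(4)] smooth_L_proj(1)[OF TOA a(4)]]
          smooth_L_proj(2)[OF TOA a(4)]] TOA]) (simp add: Cmp_L)
  moreover have "?\<eta> (tact0 P v g) = Ad_unit_inv K g (?\<eta> v)" if v: "v \<in> Ob T" "g \<in> carrier G" for v g
  proof -
    have c: "Src L (\<eta>' v) = Tgt L (\<eta> v)" using nat_transD(2)[OF b(6) v(1)] nat_transD(3)[OF a(6) v(1)] by simp
    show ?thesis
      using v tact0_closed[OF v] a(5)[OF v] b(5)[OF v] Ad_unit_inv_add(2)[OF v(2) av(1)[OF v(1)] bv(1)[OF v(1)] c]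
      by (simp del: tangent_gpd_simps lie_2alg_simps)
  qed
  ultimately show ?thesis
    using vcomp_ntrans[OF category_tangent_gpd[OF E] category_L b(3) a(3)] a(1) b(2)
    unfolding vcomp_apply eq_trans_def by (simp del: tangent_gpd_simps lie_2alg_simps)
qed

lemma eq_trans_id:
  assumes w: "eq_form \<omega>"
  shows "(\<omega>, id_trans T L (fst \<omega>), \<omega>) \<in> eq_trans"
proof -
  note a = eq_formD[OF w] and av = eq_form_values[OF w]
  have "smooth_map TO (mor_charts L) (id_trans T L (fst \<omega>))"
    by (rule smooth_map_cong[OF smooth_L_Pair[OF TOA smooth_map_const[OF TOA LHA] a(8)] TOA])
      (simp_all add: id_trans_def pts_lie_alg subspace_0[OF LH])
  moreover have "id_trans T L (fst \<omega>) (tact0 P v g) = Ad_unit_inv K g (id_trans T L (fst \<omega>) v)"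
    if v: "v \<in> Ob T" "g \<in> carrier G" for v g
    using v tact0_closed[OF v] a(5)[OF v] av(1)[OF v(1)] Lalpha_facts(6)[OF G.inv_closed[OF v(2)] subspace_0[OF LH] subspace_0[OF LH]]
    by (simp add: id_trans_def Ad_unit_inv_apply subspace_0[OF LH] del: tangent_gpd_simps)
  ultimately show ?thesis
    using id_trans_ntrans[OF category_tangent_gpd[OF E] category_L a(7) a(2)] w
    unfolding eq_trans_def by (simp del: tangent_gpd_simps lie_2alg_simps)
qed

subsection \<open>The forms \<open>\<lambda>-bar\<close>\<close>

lemma Omega_HD:
  assumes "l \<in> Omega_H K P"
  shows "l \<in> extensional (Ob T)" "smooth_map TO (lie_alg_atlas H) l" "fibre_linear OE l"
    "v \<in> Ob T \<Longrightarrow> g \<in> carrier G \<Longrightarrow> l (tact0 P v g) = Lalpha K (inv\<^bsub>G\<^esub> g) (l v)" "v \<in> Ob T \<Longrightarrow> l v \<in> lie_alg H"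
proof -
  show *: "l \<in> extensional (Ob T)" "smooth_map TO (lie_alg_atlas H) l" "fibre_linear OE l"
    "v \<in> Ob T \<Longrightarrow> g \<in> carrier G \<Longrightarrow> l (tact0 P v g) = Lalpha K (inv\<^bsub>G\<^esub> g) (l v)"
    using assms unfolding Omega_H_def by simp_all
  show "v \<in> Ob T \<Longrightarrow> l v \<in> lie_alg H" using smooth_mapD(1)[OF *(2)] by (simp add: pts_lie_alg)
qed

lemma form_bar_apply:
  "v \<in> Ob T \<Longrightarrow> fst (form_bar K P l) v = Ltau K (l v)"
  "x \<in> Mor T \<Longrightarrow> snd (form_bar K P l) x = (l (Tgt T x) - l (Src T x), Ltau K (l (Src T x)))"
  unfolding form_bar_def by simp_all

text \<open>Functoriality holds because differences of values at target and source telescope. Equivariance on arrows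
  is the infinitesimal Peiffer identity.\<close>

lemma eq_form_bar:
  assumes l: "l \<in> Omega_H K P"
  shows "eq_form (form_bar K P l)"
proof -
  note a = Omega_HD[OF l]
  have "is_functor T L (form_bar K P l)"
    unfolding is_functor_def
  proof (intro conjI ballI impI funcsetI)
    fix x y assume x: "x \<in> Mor T" "y \<in> Mor T" "Src T y = Tgt T x"
    show "snd (form_bar K P l) (Cmp T y x) = Cmp L (snd (form_bar K P l) y) (snd (form_bar K P l) x)"
      using tC(6-8)[OF x] x by (simp add: form_bar_apply del: tangent_gpd_simps)
  next
    fix x assume x: "x \<in> Mor T"
    note o = tC(1,2)[OF x] note ls = a(5)[OF o(1)] a(5)[OF o(2)]
    show "snd (form_bar K P l) x \<in> Mor L"
      using x subspace_diff[OF LH ls(2,1)] Ltau_facts(1)[OF ls(1,1)] by (simp add: form_bar_apply del: tangent_gpd_simps)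
    show "Src L (snd (form_bar K P l) x) = fst (form_bar K P l) (Src T x)" "Tgt L (snd (form_bar K P l) x) = fst (form_bar K P l) (Tgt T x)"
      using x o Ltau_facts(4)[OF ls(2,1)] by (simp_all add: form_bar_apply del: tangent_gpd_simps)
  next
    fix u assume u: "u \<in> Ob T"
    show "fst (form_bar K P l) u \<in> Ob L" using Ltau_facts(1)[OF a(5)[OF u] a(5)[OF u]] u by (simp add: form_bar_apply del: tangent_gpd_simps)
    show "snd (form_bar K P l) (Idn T u) = Idn L (fst (form_bar K P l) u)"
      using u tC(3-5)[OF u] by (simp add: form_bar_apply del: tangent_gpd_simps)
  qed
  moreover have "smooth_map TO (lie_alg_atlas G) (fst (form_bar K P l))"
    by (rule smooth_map_cong[OF smooth_map_comp[OF TOA LHA LGA a(2) Ltau_smooth] TOA]) (simp add: form_bar_apply)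
  moreover have "smooth_map TM (mor_charts L) (snd (form_bar K P l))"
  proof -
    note s = smooth_map_comp[OF TMA TOA LHA smooth_map_Tmap[OF e(3,2,8)] a(2)]
      and t = smooth_map_comp[OF TMA TOA LHA smooth_map_Tmap[OF e(3,2,9)] a(2)]
    show ?thesis
      by (rule smooth_map_cong[OF smooth_L_Pair[OF TMA smooth_LH(2)[OF TMA t s] smooth_map_comp[OF TMA LHA LGA s Ltau_smooth]] TMA])
        (simp add: form_bar_apply)
  qed
  moreover have "fibre_linear OE (fst (form_bar K P l))"
    by (rule fibre_linear_cong[OF e(2) fibre_linear_map[OF a(3), of "lie_alg H" "Ltau K"]])
      (use a(5) Ltau_facts in \<open>simp_all add: form_bar_apply\<close>)
  moreover have "fibre_linear ME (snd (form_bar K P l))"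
  proof -
    note s = fibre_linear_Tmap[OF e(3,2,8) a(3)] and t = fibre_linear_Tmap[OF e(3,2,9) a(3)]
    have "fibre_linear ME (\<lambda>v. Ltau K (l (Tmap ME OE (Src E) v)))"
      by (rule fibre_linear_map[OF s, of "lie_alg H" "Ltau K"]) (use a(5) tC(1) Ltau_facts in simp_all)
    then show ?thesis
      by (rule fibre_linear_cong[OF e(3) fibre_linear_Pair[OF fibre_linear_diff[OF t s]]]) (simp add: form_bar_apply)
  qed
  moreover have "fst (form_bar K P l) (tact0 P v g) = Ad G (inv\<^bsub>G\<^esub> g) (fst (form_bar K P l) v)" if v: "v \<in> Ob T" "g \<in> carrier G" for v g
    using v tact0_closed[OF v] a(4)[OF v] Ltau_Lalpha[OF G.inv_closed[OF v(2)] a(5)[OF v(1)]]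
    by (simp add: form_bar_apply del: tangent_gpd_simps)
  moreover have "snd (form_bar K P l) (tact1 P x a') = Ad1 K (inv\<^bsub>S\<^esub> a') (snd (form_bar K P l) x)" if x: "x \<in> Mor T" "a' \<in> carrier S" for x a'
  proof -
    obtain h g where h: "a' = (h, g)" "h \<in> carrier H" "g \<in> carrier G" using x(2) by auto
    have hg: "tau K h \<otimes>\<^bsub>G\<^esub> g \<in> carrier G" using h by simp
    note o = tC(1,2)[OF x(1)]
    show ?thesis
      using x(1) tact1_closed[OF x] Src_tact1[OF x(1) h(2,3)] Tgt_tact1[OF x(1) h(2,3)] a(4)[OF o(1) h(3)] a(4)[OF o(2) hg]
        Ad1_bar[OF h(2,3) a(5)[OF o(2)] a(5)[OF o(1)]]
      by (simp add: form_bar_apply h(1) del: tangent_gpd_simps semidirect_simps)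
  qed
  moreover have "extensional_functor T (form_bar K P l)" unfolding extensional_functor_def form_bar_def by simp
  ultimately show ?thesis unfolding eq_form_def lie_functor_def by (simp del: semidirect_simps)
qed

end

section \<open>Semidirect products and sums of transformations\<close>

text \<open>Instantiated twice, for the objects and for the morphisms of the extended gauge 2-group.\<close>

lemma semidirect_product_group:
  fixes Q :: "'g monoid"
  assumes Q: "group Q"
    and pl: "\<And>x y. x \<in> A \<Longrightarrow> y \<in> A \<Longrightarrow> pl x y \<in> A"
    and assoc: "\<And>x y z. x \<in> A \<Longrightarrow> y \<in> A \<Longrightarrow> z \<in> A \<Longrightarrow> pl (pl x y) z = pl x (pl y z)"
    and zero: "z0 \<in> A" "\<And>x. x \<in> A \<Longrightarrow> pl z0 x = x" and neg: "\<And>x. x \<in> A \<Longrightarrow> \<exists>y\<in>A. pl y x = z0"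
    and act: "\<And>g x. g \<in> carrier Q \<Longrightarrow> x \<in> A \<Longrightarrow> a g x \<in> A"
      "\<And>g x y. g \<in> carrier Q \<Longrightarrow> x \<in> A \<Longrightarrow> y \<in> A \<Longrightarrow> a g (pl x y) = pl (a g x) (a g y)"
      "\<And>g g' x. g \<in> carrier Q \<Longrightarrow> g' \<in> carrier Q \<Longrightarrow> x \<in> A \<Longrightarrow> a (g \<otimes>\<^bsub>Q\<^esub> g') x = a g (a g' x)"
      "\<And>x. x \<in> A \<Longrightarrow> a \<one>\<^bsub>Q\<^esub> x = x"
  shows "group \<lparr>carrier = carrier Q \<times> A, monoid.mult = (\<lambda>(g, x) (g', x'). (g \<otimes>\<^bsub>Q\<^esub> g', pl x (a g x'))), one = (\<one>\<^bsub>Q\<^esub>, z0)\<rparr>"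
    (is "group ?R")
proof -
  interpret group Q by (rule Q)
  show ?thesis
  proof (rule groupI)
    fix u v w assume "u \<in> carrier ?R" "v \<in> carrier ?R" "w \<in> carrier ?R"
    then obtain g x g' x' g'' x'' where "u = (g, x)" "v = (g', x')" "w = (g'', x'')"
      "g \<in> carrier Q" "g' \<in> carrier Q" "g'' \<in> carrier Q" "x \<in> A" "x' \<in> A" "x'' \<in> A" by (cases u, cases v, cases w) auto
    then show "u \<otimes>\<^bsub>?R\<^esub> v \<otimes>\<^bsub>?R\<^esub> w = u \<otimes>\<^bsub>?R\<^esub> (v \<otimes>\<^bsub>?R\<^esub> w)"
      by (simp add: m_assoc assoc act pl)
  next
    fix u assume "u \<in> carrier ?R"
    then obtain g x where u: "u = (g, x)" "g \<in> carrier Q" "x \<in> A" by (cases u) auto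
    obtain y where "y \<in> A" "pl y (a (inv\<^bsub>Q\<^esub> g) x) = z0" using neg[OF act(1)[OF inv_closed[OF u(2)] u(3)]] by (elim bexE)
    then show "\<exists>v\<in>carrier ?R. v \<otimes>\<^bsub>?R\<^esub> u = \<one>\<^bsub>?R\<^esub>"
      using u by (intro bexI[of _ "(inv\<^bsub>Q\<^esub> g, y)"]) simp_all
  qed (auto simp: pl act zero)
qed

lemma category_prod_cat:
  assumes C: "category C" and D: "category D"
  shows "category (prod_cat C D)"
  unfolding category_def prod_cat_def
  by (auto simp: categoryD[OF C] categoryD[OF D])

lemma prod_cat_simps [simp]:
  "Ob (prod_cat C D) = Ob C \<times> Ob D" "Mor (prod_cat C D) = Mor C \<times> Mor D"
  "Src (prod_cat C D) = map_prod (Src C) (Src D)" "Tgt (prod_cat C D) = map_prod (Tgt C) (Tgt D)"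
  "Idn (prod_cat C D) = map_prod (Idn C) (Idn D)"
  "Cmp (prod_cat C D) (y, y') (x, x') = (Cmp C y x, Cmp D y' x')"
  by (simp_all add: prod_cat_def)

lemma add_trans_commute:
  fixes \<zeta> \<zeta>' :: "(('o \<Rightarrow> 'b::ab_semigroup_add) \<times> ('a \<Rightarrow> 'c::ab_semigroup_add), 'o \<Rightarrow> 'c) trans"
  shows "add_trans C \<zeta> \<zeta>' = add_trans C \<zeta>' \<zeta>" 
    "add_trans C (add_trans C \<zeta> \<zeta>') \<zeta>'' = add_trans C \<zeta> (add_trans C \<zeta>' \<zeta>'')"
  unfolding add_trans_def add_functor_def add_on_def
  by (cases \<zeta>, cases \<zeta>', simp add: add.commute fun_eq_iff restrict_def)
    (cases \<zeta>, cases \<zeta>', cases \<zeta>'', simp add: add.assoc fun_eq_iff restrict_def)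

lemma add_functor_commute:
  fixes F F' F'' :: "('o \<Rightarrow> 'b::ab_semigroup_add) \<times> ('a \<Rightarrow> 'c::ab_semigroup_add)"
  shows "add_functor C F F' = add_functor C F' F"
    "add_functor C (add_functor C F F') F'' = add_functor C F (add_functor C F' F'')"
  unfolding add_functor_def add_on_def by (simp_all add: add_ac fun_eq_iff restrict_def)

lemma add_on_laws:
  fixes f g h :: "'s \<Rightarrow> 'v::ab_group_add"
  shows "add_on A (add_on A f g) h = add_on A f (add_on A g h)"
    "f \<in> extensional A \<Longrightarrow> add_on A (\<lambda>v\<in>A. 0) f = f" "add_on A (\<lambda>v\<in>A. - f v) f = (\<lambda>v\<in>A. 0)"
  unfolding add_on_def by (auto simp: add.assoc fun_eq_iff restrict_def extensional_def)

lemma add_trans_proj: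
  "fst (add_trans C \<zeta> \<zeta>') = add_functor C (fst \<zeta>) (fst \<zeta>')"
  "fst (snd (add_trans C \<zeta> \<zeta>')) = add_on (Ob C) (fst (snd \<zeta>)) (fst (snd \<zeta>'))"
  "snd (snd (add_trans C \<zeta> \<zeta>')) = add_functor C (snd (snd \<zeta>)) (snd (snd \<zeta>'))"
  by (cases \<zeta>, cases \<zeta>', simp add: add_trans_def)+

lemma add_on_zero_right:
  fixes f :: "'s \<Rightarrow> 'v::monoid_add"
  shows "f \<in> extensional A \<Longrightarrow> add_on A f (\<lambda>v\<in>A. 0) = f"
  unfolding add_on_def by (auto simp: fun_eq_iff restrict_def extensional_def)

lemma add_functor_assoc_swap:
  fixes F1 F2 F3 :: "('o \<Rightarrow> 'b::ab_semigroup_add) \<times> ('a \<Rightarrow> 'c::ab_semigroup_add)"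
  shows "add_functor C F1 (add_functor C F2 F3) = add_functor C (add_functor C F1 F3) F2"
  by (simp only: add_functor_commute(1)[of C F2 F3] add_functor_commute(2))

lemma add_trans_assoc_swap:
  fixes \<zeta>1 \<zeta>2 \<zeta>3 :: "(('o \<Rightarrow> 'b::ab_semigroup_add) \<times> ('a \<Rightarrow> 'c::ab_semigroup_add), 'o \<Rightarrow> 'c) trans"
  shows "add_trans C \<zeta>1 (add_trans C \<zeta>2 \<zeta>3) = add_trans C (add_trans C \<zeta>1 \<zeta>3) \<zeta>2"
  by (simp only: add_trans_commute(1)[of C \<zeta>2 \<zeta>3] add_trans_commute(2))

lemma add_shift:
  fixes a :: "'v::ab_group_add"
  assumes "a + w = b + s"
  shows "a + - y + (w + (y - z)) = b + (s + - z)"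
proof -
  have "a + - y + (w + (y - z)) = (a + w) + - z" by (simp add: algebra_simps)
  then show ?thesis by (simp only: assms add.assoc)
qed

context gauge_bundle
begin

section \<open>Transport of forms and transformations\<close>

abbreviation "pinv F \<equiv> push_functor E (inv_functor E F)"

lemmas tcat = category_tangent_gpd[OF E]

lemma gauge_inverse_unique:
  assumes "F \<in> gauge_ob K P" "F' \<in> gauge_ob K P" "comp_functor E F' F = id_functor E"
  shows "inv_functor E F = F'"
  using group.inv_equality[OF gauge_ob_group, of F' F] group.inv_equality[OF gauge_ob_group, of "inv_functor E F" F]
    assms gauge_inv_closed[OF assms(1)] gauge_inv(2)[OF assms(1)] by (simp add: gauge_ob_carrier gauge_simps)

lemma gauge_mor_inverse_unique:
  assumes "\<Psi> \<in> gauge_mor K P" "\<Phi> \<in> gauge_mor K P" "hcomp E E \<Phi> \<Psi> = (id_functor E, id_trans E E (\<lambda>p. p), id_functor E)"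
  shows "hinv E \<Psi> = \<Phi>"
  using group.inv_equality[OF gauge_mor_group, of \<Phi> \<Psi>] group.inv_equality[OF gauge_mor_group, of "hinv E \<Psi>" \<Psi>]
    assms gauge_mor_hinv[OF assms(1)] by (simp add: gauge_mor_carrier gauge_simps)

lemma inv_functor_comp:
  assumes F: "F \<in> gauge_ob K P" and F': "F' \<in> gauge_ob K P"
  shows "inv_functor E (comp_functor E F F') = comp_functor E (inv_functor E F') (inv_functor E F)"
proof (rule gauge_inverse_unique[OF gauge_comp_closed[OF F F'] gauge_comp_closed[OF gauge_inv_closed[OF F'] gauge_inv_closed[OF F]]])
  note f = is_functorD(1,2)[OF gauge_functor[OF F]] is_functorD(1,2)[OF gauge_functor[OF F']]
  show "comp_functor E (comp_functor E (inv_functor E F') (inv_functor E F)) (comp_functor E F F') = id_functor E"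
    by (rule functor_eqI[OF extensional_comp_functor extensional_id_functor])
      (simp_all add: comp_functor_apply id_functor_apply f gauge_inv_apply[OF F] gauge_inv_apply[OF F'])
qed

lemma inv_functor_id: "inv_functor E (id_functor E) = id_functor E"
  by (rule gauge_inverse_unique[OF gauge_id_closed gauge_id_closed comp_functor_id(1)[OF is_functor_id[OF e(1)] extensional_id_functor]])

lemma gauge_mor_ntrans: "\<Psi> \<in> gauge_mor K P \<Longrightarrow> \<Psi> \<in> ntrans E E" "\<Psi> \<in> gauge_mor K P \<Longrightarrow> \<Psi> \<in> lie_ntrans E"
  using gauge_morD(8) gauge_morD(3) by (cases \<Psi>, simp)+

lemma hinv_hcomp:
  assumes \<Psi>: "\<Psi> \<in> gauge_mor K P" and \<Psi>': "\<Psi>' \<in> gauge_mor K P"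
  shows "hinv E (hcomp E E \<Psi> \<Psi>') = hcomp E E (hinv E \<Psi>') (hinv E \<Psi>)"
proof -
  have i: "inv\<^bsub>mor_grp (gauge K P)\<^esub> \<Phi> = hinv E \<Phi>" if "\<Phi> \<in> gauge_mor K P" for \<Phi>
    using group.inv_equality[OF gauge_mor_group, of "hinv E \<Phi>" \<Phi>] gauge_mor_hinv[OF that] that
    by (simp add: gauge_mor_carrier gauge_simps)
  show ?thesis
    using group.inv_mult_group[OF gauge_mor_group, of \<Psi> \<Psi>'] \<Psi> \<Psi>' gauge_mor_hcomp[OF \<Psi> \<Psi>']
    by (simp add: gauge_mor_carrier gauge_simps i)
qed

lemma hinv_id:
  assumes F: "F \<in> gauge_ob K P"
  shows "hinv E (F, id_trans E E (fst F), F) = (inv_functor E F, id_trans E E (fst (inv_functor E F)), inv_functor E F)"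
  by (rule gauge_mor_inverse_unique[OF gauge_mor_id[OF F] gauge_mor_id[OF gauge_inv_closed[OF F]]])
    (simp add: hcomp_id_id[OF e(1,1) gauge_functor[OF F] gauge_functor[OF gauge_inv_closed[OF F]]] gauge_inv(2)[OF F] id_trans_id_functor)

text \<open>By the interchange law the composite on the right is a left inverse for horizontal composition, and such
  inverses are unique in the group of gauge morphisms.\<close>

lemma hinv_vcomp:
  assumes \<Phi>: "(F', \<phi>, F'') \<in> gauge_mor K P" and \<Psi>: "(F, \<psi>, F') \<in> gauge_mor K P"
  shows "hinv E (vcomp E E (F', \<phi>, F'') (F, \<psi>, F')) = vcomp E E (hinv E (F', \<phi>, F'')) (hinv E (F, \<psi>, F'))"
proof (rule gauge_mor_inverse_unique[OF gauge_mor_vcomp[OF \<Phi> \<Psi>]])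
  obtain \<phi>' \<psi>' where h: "hinv E (F', \<phi>, F'') = (inv_functor E F', \<phi>', inv_functor E F'')"
    "hinv E (F, \<psi>, F') = (inv_functor E F, \<psi>', inv_functor E F')" by (simp add: hinv_def)
  note p = gauge_mor_hinv(1)[OF \<Phi>, unfolded h] gauge_mor_hinv(1)[OF \<Psi>, unfolded h]
  show "vcomp E E (hinv E (F', \<phi>, F'')) (hinv E (F, \<psi>, F')) \<in> gauge_mor K P"
    unfolding h by (rule gauge_mor_vcomp[OF p])
  have id: "(id_functor E, id_trans E E (\<lambda>p. p), id_functor E) \<in> ntrans E E"
    unfolding id_trans_id_functor by (rule gauge_mor_ntrans(1)[OF gauge_mor_id[OF gauge_id_closed]])
  have "hcomp E E (vcomp E E (hinv E (F', \<phi>, F'')) (hinv E (F, \<psi>, F'))) (vcomp E E (F', \<phi>, F'') (F, \<psi>, F')) =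
      vcomp E E (hcomp E E (hinv E (F', \<phi>, F'')) (F', \<phi>, F'')) (hcomp E E (hinv E (F, \<psi>, F')) (F, \<psi>, F'))"
    unfolding h by (rule hcomp_interchange[OF e(1,1,1) p(2)[THEN gauge_mor_ntrans(1)] p(1)[THEN gauge_mor_ntrans(1)]
          \<Psi>[THEN gauge_mor_ntrans(1)] \<Phi>[THEN gauge_mor_ntrans(1)]])
  also have "\<dots> = vcomp E E (id_functor E, id_trans E E (\<lambda>p. p), id_functor E) (id_functor E, id_trans E E (\<lambda>p. p), id_functor E)"
    using gauge_mor_hinv(2)[OF \<Phi>] gauge_mor_hinv(2)[OF \<Psi>] by simp
  also have "\<dots> = (id_functor E, id_trans E E (\<lambda>p. p), id_functor E)"
    using vcomp_id(1)[OF e(1) id] id_trans_id_functor by simp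
  finally show "hcomp E E (vcomp E E (hinv E (F', \<phi>, F'')) (hinv E (F, \<psi>, F'))) (vcomp E E (F', \<phi>, F'') (F, \<psi>, F')) =
      (id_functor E, id_trans E E (\<lambda>p. p), id_functor E)" .
qed

lemma pinv_comp:
  assumes F: "F \<in> gauge_ob K P" and F': "F' \<in> gauge_ob K P"
  shows "pinv (comp_functor E F F') = comp_functor T (pinv F') (pinv F)"
proof -
  note f = gauge_inv(1)[OF F] and f' = gauge_inv(1)[OF F']
  show ?thesis unfolding inv_functor_comp[OF F F'] by (rule push_comp_functor[OF E f f' lie_functor_comp[OF f f']])
qed

lemma pinv_id: "pinv (id_functor E) = id_functor T"
  by (simp only: inv_functor_id push_id_functor[OF E])

lemmas pinv_functor = is_functor_push[OF E gauge_inv(1)]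

text \<open>The operation \<open>\<zeta> \<circ>\<^sub>H \<Psi>\<^sub>*\<^sup>-\<^sup>1\<close>. It is an action of the gauge 2-group on equivariant
  transformations, additive in \<open>\<zeta>\<close>; the lemmas below state this separately for the group
  products, for vertical composition and for sums.\<close>

definition transport where "transport \<Psi> \<zeta> = hcomp T L \<zeta> (push_trans E (hinv E \<Psi>))"

lemma transport_trans_eq: "transport_trans K P = transport"
  by (simp add: transport_trans_def transport_def fun_eq_iff)

lemma transport_triple:
  "transport (F, \<psi>, F') (\<omega>, \<eta>, \<omega>') = (comp_functor T \<omega> (pinv F), fst (snd (transport (F, \<psi>, F') (\<omega>, \<eta>, \<omega>'))), comp_functor T \<omega>' (pinv F'))"
  by (simp add: transport_def hinv_def push_trans_apply hcomp_apply)

lemma transport_push_ntrans: "\<Psi> \<in> gauge_mor K P \<Longrightarrow> push_trans E (hinv E \<Psi>) \<in> ntrans T T"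
  by (rule push_trans_ntrans[OF E gauge_mor_ntrans(2)[OF gauge_mor_hinv(1)]])

lemma transport_closed: "\<zeta> \<in> eq_trans \<Longrightarrow> \<Psi> \<in> gauge_mor K P \<Longrightarrow> transport \<Psi> \<zeta> \<in> eq_trans"
  unfolding transport_def by (rule eq_trans_hcomp_push[OF _ gauge_mor_hinv(1)])

lemma eq_trans_ntrans: "\<zeta> \<in> eq_trans \<Longrightarrow> \<zeta> \<in> ntrans T L"
  using eq_transD(3) by (cases \<zeta>) simp

text \<open>Inversion and precomposition both reverse products, so the order is preserved. The rest is associativity
  of horizontal composition.\<close>

lemma transport_mult:
  assumes \<Psi>: "\<Psi> \<in> gauge_mor K P" and \<Psi>': "\<Psi>' \<in> gauge_mor K P" and \<zeta>: "\<zeta> \<in> eq_trans"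
  shows "transport (hcomp E E \<Psi> \<Psi>') \<zeta> = transport \<Psi> (transport \<Psi>' \<zeta>)"
proof -
  note h = gauge_mor_hinv(1)[OF \<Psi>] and h' = gauge_mor_hinv(1)[OF \<Psi>']
  have "push_trans E (hinv E (hcomp E E \<Psi> \<Psi>')) = hcomp T T (push_trans E (hinv E \<Psi>')) (push_trans E (hinv E \<Psi>))"
    unfolding hinv_hcomp[OF \<Psi> \<Psi>']
    by (rule push_trans_hcomp[OF E h'[THEN gauge_mor_ntrans(2)] h[THEN gauge_mor_ntrans(2)] gauge_mor_hcomp[OF h' h, THEN gauge_mor_ntrans(2)]])
  then show ?thesis
    unfolding transport_def
    using hcomp_assoc[OF tcat tcat tcat category_L eq_trans_ntrans[OF \<zeta>] transport_push_ntrans[OF \<Psi>'] transport_push_ntrans[OF \<Psi>]] by simp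
qed

lemma transport_id:
  assumes F: "F \<in> gauge_ob K P" and w: "eq_form \<omega>"
  shows "transport (F, id_trans E E (fst F), F) (\<omega>, id_trans T L (fst \<omega>), \<omega>) =
    (comp_functor T \<omega> (pinv F), id_trans T L (fst (comp_functor T \<omega> (pinv F))), comp_functor T \<omega> (pinv F))"
  unfolding transport_def hinv_id[OF F] push_trans_id[OF E gauge_inv(1)[OF F]]
  by (rule hcomp_id_id[OF tcat category_L pinv_functor[OF F] eq_formD(7)[OF w]])

lemma transport_one:
  assumes \<zeta>: "\<zeta> \<in> eq_trans"
  shows "transport (id_functor E, id_trans E E (\<lambda>p. p), id_functor E) \<zeta> = \<zeta>"
proof -
  have "id_trans T T (fst (id_functor T)) = id_trans T T (\<lambda>v. v)"
    unfolding id_trans_def by (rule restrict_ext) (simp add: id_functor_apply)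
  then show ?thesis
    unfolding transport_def id_trans_id_functor hinv_id[OF gauge_id_closed] push_trans_id[OF E gauge_inv(1)[OF gauge_id_closed]] pinv_id
    using hcomp_id_right[OF tcat category_L eq_trans_ntrans[OF \<zeta>]] by simp
qed

text \<open>The interchange law, after moving the vertical composite through inversion and differentiation.\<close>

lemma transport_vcomp:
  assumes \<Phi>: "(F', \<phi>, F'') \<in> gauge_mor K P" and \<Psi>: "(F, \<psi>, F') \<in> gauge_mor K P"
    and \<zeta>: "(\<omega>', \<eta>', \<omega>'') \<in> eq_trans" "(\<omega>, \<eta>, \<omega>') \<in> eq_trans"
  shows "transport (vcomp E E (F', \<phi>, F'') (F, \<psi>, F')) (vcomp T L (\<omega>', \<eta>', \<omega>'') (\<omega>, \<eta>, \<omega>')) =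
    vcomp T L (transport (F', \<phi>, F'') (\<omega>', \<eta>', \<omega>'')) (transport (F, \<psi>, F') (\<omega>, \<eta>, \<omega>'))"
proof -
  obtain \<phi>' \<psi>' where h: "hinv E (F', \<phi>, F'') = (inv_functor E F', \<phi>', inv_functor E F'')"
    "hinv E (F, \<psi>, F') = (inv_functor E F, \<psi>', inv_functor E F')" by (simp add: hinv_def)
  note p = gauge_mor_hinv(1)[OF \<Phi>, unfolded h] gauge_mor_hinv(1)[OF \<Psi>, unfolded h]
  note n = transport_push_ntrans[OF \<Phi>, unfolded h push_trans_apply] transport_push_ntrans[OF \<Psi>, unfolded h push_trans_apply]
  show ?thesis
    unfolding transport_def hinv_vcomp[OF \<Phi> \<Psi>] h
      push_trans_vcomp[OF E p(1)[THEN gauge_mor_ntrans(2)] p(2)[THEN gauge_mor_ntrans(2)] gauge_mor_vcomp[OF p, THEN gauge_mor_ntrans(2)]]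
      push_trans_apply
    by (rule hcomp_interchange[OF tcat tcat category_L \<zeta>(2)[THEN eq_trans_ntrans] \<zeta>(1)[THEN eq_trans_ntrans] n(2,1)])
qed

lemma comp_add_functor:
  assumes "is_functor T T F"
  shows "comp_functor T (add_functor T \<omega> \<omega>') F = add_functor T (comp_functor T \<omega> F) (comp_functor T \<omega>' F)"
  by (rule functor_eqI[OF extensional_comp_functor extensional_add_functor])
    (simp_all add: comp_functor_apply add_functor_apply is_functorD(1,2)[OF assms] del: tangent_gpd_simps)

text \<open>Composition of arrows of \<open>L(H) \<oplus> L(G)\<close> adds first components, and evaluation of a sum of forms is a sum.\<close>

lemma transport_add:
  assumes \<Psi>: "\<Psi> \<in> gauge_mor K P"
  shows "transport \<Psi> (add_trans T \<zeta> \<zeta>') = add_trans T (transport \<Psi> \<zeta>) (transport \<Psi> \<zeta>')"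
proof -
  obtain F \<psi> F' \<omega>1 \<eta> \<omega>2 \<omega>1' \<eta>' \<omega>2' where eq: "push_trans E (hinv E \<Psi>) = (F, \<psi>, F')" "\<zeta> = (\<omega>1, \<eta>, \<omega>2)" "\<zeta>' = (\<omega>1', \<eta>', \<omega>2')"
    by (metis prod_cases3)
  note n = ntransD[OF transport_push_ntrans[OF \<Psi>, unfolded eq]]
  note f = is_functorD(1)[OF n(2)] nat_transD(1)[OF n(6)]
  have "Cmp L ((\<lambda>v\<in>Ob T. \<eta> v + \<eta>' v) (fst F' u)) (snd (add_functor T \<omega>1 \<omega>1') (\<psi> u)) =
      (\<lambda>u\<in>Ob T. Cmp L (\<eta> (fst F' u)) (snd \<omega>1 (\<psi> u))) u + (\<lambda>u\<in>Ob T. Cmp L (\<eta>' (fst F' u)) (snd \<omega>1' (\<psi> u))) u" if u: "u \<in> Ob T" for u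
    using u f(1)[OF u] f(2)[OF u] by (simp add: Cmp_L add_functor_apply add_ac del: tangent_gpd_simps)
  then show ?thesis
    unfolding transport_def eq hcomp_apply add_trans_apply comp_add_functor[OF n(1)] comp_add_functor[OF n(2)]
    by (simp add: restrict_def fun_eq_iff del: tangent_gpd_simps)
qed

lemma vcomp_add:
  "vcomp T L (add_trans T (\<omega>1, \<eta>1, \<omega>2) (\<omega>1', \<eta>1', \<omega>2')) (add_trans T (\<omega>0, \<eta>0, \<omega>1) (\<omega>0', \<eta>0', \<omega>1')) =
   add_trans T (vcomp T L (\<omega>1, \<eta>1, \<omega>2) (\<omega>0, \<eta>0, \<omega>1)) (vcomp T L (\<omega>1', \<eta>1', \<omega>2') (\<omega>0', \<eta>0', \<omega>1'))"
  unfolding add_trans_apply vcomp_apply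
  by (simp add: restrict_def fun_eq_iff Cmp_L add_ac del: tangent_gpd_simps)

subsection \<open>Equivariant 1-forms on \<open>E\<^sub>0\<close>\<close>

lemma transport_form_apply: "v \<in> Ob T \<Longrightarrow> transport_form P F l v = l (fst (pinv F) v)"
  by (simp add: transport_form_def)

lemma Omega_H_I:
  assumes "l \<in> extensional (Ob T)" "smooth_map TO (lie_alg_atlas H) l" "fibre_linear OE l"
    "\<And>v g. v \<in> Ob T \<Longrightarrow> g \<in> carrier G \<Longrightarrow> l (tact0 P v g) = Lalpha K (inv\<^bsub>G\<^esub> g) (l v)"
  shows "l \<in> Omega_H K P"
  using assms unfolding Omega_H_def by simp

lemma Omega_H_add:
  assumes l: "l \<in> Omega_H K P" and l': "l' \<in> Omega_H K P"
  shows "add_on (Ob T) l l' \<in> Omega_H K P"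
proof (rule Omega_H_I)
  note a = Omega_HD[OF l] and b = Omega_HD[OF l']
  show "add_on (Ob T) l l' \<in> extensional (Ob T)" by (simp add: add_on_def)
  show "smooth_map TO (lie_alg_atlas H) (add_on (Ob T) l l')"
    by (rule smooth_map_cong[OF smooth_LH(1)[OF TOA a(2) b(2)] TOA]) (simp add: add_on_def)
  show "fibre_linear OE (add_on (Ob T) l l')"
    by (rule fibre_linear_cong[OF e(2) fibre_linear_add[OF a(3) b(3)]]) (simp add: add_on_def)
  show "add_on (Ob T) l l' (tact0 P v g) = Lalpha K (inv\<^bsub>G\<^esub> g) (add_on (Ob T) l l' v)" if v: "v \<in> Ob T" "g \<in> carrier G" for v g
    using v tact0_closed[OF v] a(4)[OF v] b(4)[OF v] Lalpha_facts(2)[OF G.inv_closed[OF v(2)] a(5)[OF v(1)] b(5)[OF v(1)]]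
    by (simp add: add_on_def del: tangent_gpd_simps)
qed

lemma Omega_H_zero: "zero_form P \<in> Omega_H K P"
proof (rule Omega_H_I)
  show "zero_form P \<in> extensional (Ob T)" by (simp add: zero_form_def)
  show "smooth_map TO (lie_alg_atlas H) (zero_form P)"
    by (rule smooth_map_cong[OF smooth_map_const[OF TOA LHA] TOA, of 0]) (simp_all add: zero_form_def pts_lie_alg subspace_0[OF LH])
  show "fibre_linear OE (zero_form P)"
    by (rule fibre_linear_cong[OF e(2), of "\<lambda>v. 0"]) (simp_all add: zero_form_def fibre_linear_def)
  show "zero_form P (tact0 P v g) = Lalpha K (inv\<^bsub>G\<^esub> g) (zero_form P v)" if v: "v \<in> Ob T" "g \<in> carrier G" for v g
    using v tact0_closed[OF v] Lalpha_facts(6)[OF G.inv_closed[OF v(2)] subspace_0[OF LH] subspace_0[OF LH]]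
    by (simp add: zero_form_def del: tangent_gpd_simps)
qed

lemma Omega_H_neg:
  assumes l: "l \<in> Omega_H K P"
  shows "(\<lambda>v\<in>Ob T. - l v) \<in> Omega_H K P"
proof (rule Omega_H_I)
  note a = Omega_HD[OF l]
  show "(\<lambda>v\<in>Ob T. - l v) \<in> extensional (Ob T)" by simp
  show "smooth_map TO (lie_alg_atlas H) (\<lambda>v\<in>Ob T. - l v)"
    by (rule smooth_map_cong[OF smooth_LH(2)[OF TOA Omega_HD(2)[OF Omega_H_zero] a(2)] TOA]) (simp add: zero_form_def)
  show "fibre_linear OE (\<lambda>v\<in>Ob T. - l v)"
    by (rule fibre_linear_cong[OF e(2) fibre_linear_diff[OF Omega_HD(3)[OF Omega_H_zero] a(3)]]) (simp add: zero_form_def)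
  show "(\<lambda>v\<in>Ob T. - l v) (tact0 P v g) = Lalpha K (inv\<^bsub>G\<^esub> g) ((\<lambda>v\<in>Ob T. - l v) v)" if v: "v \<in> Ob T" "g \<in> carrier G" for v g
    using v tact0_closed[OF v] a(4)[OF v] Lalpha_facts(5)[OF G.inv_closed[OF v(2)] a(5)[OF v(1)] a(5)[OF v(1)]]
    by (simp del: tangent_gpd_simps)
qed

lemma Omega_H_transport:
  assumes F: "F \<in> gauge_ob K P" and l: "l \<in> Omega_H K P"
  shows "transport_form P F l \<in> Omega_H K P"
proof (rule Omega_H_I)
  note a = Omega_HD[OF l] and i = gauge_inv(1)[OF F]
  note p = is_functorD(1)[OF pinv_functor[OF F]]
  show "transport_form P F l \<in> extensional (Ob T)" by (simp add: transport_form_def)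
  show "smooth_map TO (lie_alg_atlas H) (transport_form P F l)"
    by (rule smooth_map_cong[OF smooth_map_comp[OF TOA TOA LHA push_smooth(1)[OF i] a(2)] TOA]) (simp add: transport_form_def)
  show "fibre_linear OE (transport_form P F l)"
    by (rule fibre_linear_cong[OF e(2) fibre_linear_Tmap[OF e(2,2) lie_functorD(2)[OF i] a(3)]])
      (simp add: transport_form_def push_functor_apply)
  show "transport_form P F l (tact0 P v g) = Lalpha K (inv\<^bsub>G\<^esub> g) (transport_form P F l v)" if v: "v \<in> Ob T" "g \<in> carrier G" for v g
    using v tact0_closed[OF v] push_tact(1)[OF gauge_inv_closed[OF F] v] a(4)[OF p[OF v(1)] v(2)]
    by (simp add: transport_form_apply del: tangent_gpd_simps)
qed

lemma transport_form_add:
  assumes F: "F \<in> gauge_ob K P"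
  shows "transport_form P F (add_on (Ob T) l l') = add_on (Ob T) (transport_form P F l) (transport_form P F l')"
  unfolding add_on_def transport_form_def
  by (rule restrict_ext) (use is_functorD(1)[OF pinv_functor[OF F]] in \<open>simp del: tangent_gpd_simps\<close>)

lemma transport_form_mult:
  assumes F: "F \<in> gauge_ob K P" and F': "F' \<in> gauge_ob K P"
  shows "transport_form P (comp_functor E F F') l = transport_form P F (transport_form P F' l)"
  unfolding transport_form_def pinv_comp[OF F F']
  by (rule restrict_ext) (use is_functorD(1)[OF pinv_functor[OF F]] in \<open>simp add: comp_functor_apply del: tangent_gpd_simps\<close>)

lemma transport_form_one: "l \<in> Omega_H K P \<Longrightarrow> transport_form P (id_functor E) l = l"
  unfolding transport_form_def pinv_id
  by (rule extensionalityI[of _ "Ob T"]) (simp_all add: id_functor_apply Omega_HD(1) del: tangent_gpd_simps)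

lemma form_bar_add:
  assumes l: "l \<in> Omega_H K P" and l': "l' \<in> Omega_H K P"
  shows "form_bar K P (add_on (Ob T) l l') = add_functor T (form_bar K P l) (form_bar K P l')"
proof (rule functor_eqI[OF _ extensional_add_functor])
  note a = Omega_HD(5)[OF l] and b = Omega_HD(5)[OF l']
  show "extensional_functor T (form_bar K P (add_on (Ob T) l l'))" by (simp add: extensional_functor_def form_bar_def)
  show "fst (form_bar K P (add_on (Ob T) l l')) u = fst (add_functor T (form_bar K P l) (form_bar K P l')) u" if u: "u \<in> Ob T" for u
    using u Ltau_facts(2)[OF a[OF u] b[OF u]] by (simp add: form_bar_apply add_functor_apply add_on_def del: tangent_gpd_simps)
  show "snd (form_bar K P (add_on (Ob T) l l')) x = snd (add_functor T (form_bar K P l) (form_bar K P l')) x" if x: "x \<in> Mor T" for x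
    using x tC(1,2)[OF x] Ltau_facts(2)[OF a[OF tC(1)[OF x]] b[OF tC(1)[OF x]]]
    by (simp add: form_bar_apply add_functor_apply add_on_def del: tangent_gpd_simps)
qed

text \<open>Precomposition with the functor \<open>F\<^sub>*\<^sup>-\<^sup>1\<close> commutes with pullback along source and target. This
  compatibility of the two gauge actions is the reason why the semidirect product acts.\<close>

lemma form_bar_transport:
  assumes F: "F \<in> gauge_ob K P"
  shows "form_bar K P (transport_form P F l) = comp_functor T (form_bar K P l) (pinv F)"
proof (rule functor_eqI[OF _ extensional_comp_functor])
  note p = is_functorD(1-4)[OF pinv_functor[OF F]]
  show "extensional_functor T (form_bar K P (transport_form P F l))" by (simp add: extensional_functor_def form_bar_def)
  show "fst (form_bar K P (transport_form P F l)) u = fst (comp_functor T (form_bar K P l) (pinv F)) u" if u: "u \<in> Ob T" for u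
    using u p(1)[OF u] by (simp add: form_bar_apply comp_functor_apply transport_form_apply del: tangent_gpd_simps)
  show "snd (form_bar K P (transport_form P F l)) x = snd (comp_functor T (form_bar K P l) (pinv F)) x" if x: "x \<in> Mor T" for x
    using x tC(1,2)[OF x] p(2-4)[OF x] by (simp add: form_bar_apply comp_functor_apply transport_form_apply del: tangent_gpd_simps)
qed

lemma form_bar_zero: "form_bar K P (zero_form P) = (\<lambda>v\<in>Ob T. 0, \<lambda>x\<in>Mor T. 0)"
proof -
  have z: "zero_form P v = 0" if "v \<in> Ob T" for v
    using that by (simp add: zero_form_def)
  show ?thesis
    unfolding form_bar_def
  proof (rule arg_cong2[where f = Pair])
    show "(\<lambda>v\<in>Ob T. Ltau K (zero_form P v)) = (\<lambda>v\<in>Ob T. 0)"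
      by (rule restrict_ext) (simp only: z Ltau_0)
    show "(\<lambda>x\<in>Mor T. (zero_form P (Tgt T x) - zero_form P (Src T x) :: ('h, 'n) chart \<Rightarrow> 'n, Ltau K (zero_form P (Src T x)))) = (\<lambda>x\<in>Mor T. 0)"
      by (rule restrict_ext) (simp only: z tC(1,2) Ltau_0 diff_self zero_prod_def)
  qed
qed

section \<open>The extended gauge 2-group\<close>

abbreviation "bar \<equiv> bar_trans K P"

lemma bar_apply: "bar (l, \<theta>, l') = (form_bar K P l, \<theta>, form_bar K P l')"
  by (simp add: bar_trans_def)

lemma nat_iso_L: "nat_iso C L F F' \<eta> \<longleftrightarrow> nat_trans C L F F' \<eta>"
  unfolding nat_iso_def using inverse_arrows_L nat_transD(1) by (fast del: equalityI)

lemma Omega_hat_mor_iff: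
  "(l, \<theta>, l') \<in> Omega_hat_mor K P \<longleftrightarrow>
    l \<in> Omega_H K P \<and> l' \<in> Omega_H K P \<and> fibre_linear OE \<theta> \<and> bar (l, \<theta>, l') \<in> eq_trans"
proof (cases "l \<in> Omega_H K P \<and> l' \<in> Omega_H K P")
  case True
  then have w: "eq_form (form_bar K P l)" "eq_form (form_bar K P l')" by (auto intro: eq_form_bar)
  show ?thesis
    unfolding Omega_hat_mor_def eq_trans_def ntrans_def bar_apply tangent_gpd_simps(7)
    using w True eq_formD(2,7)[OF w(1)] eq_formD(2,7)[OF w(2)]
    by (simp add: conj_ac del: tangent_gpd_simps lie_2alg_simps)
next
  case False
  then show ?thesis unfolding Omega_hat_mor_def by fastforce
qed

lemma hat_morD:
  assumes "m \<in> Omega_hat_mor K P"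
  shows "fst m \<in> Omega_H K P" "snd (snd m) \<in> Omega_H K P" "fibre_linear OE (fst (snd m))" "bar m \<in> eq_trans"
    "fst (snd m) \<in> extensional (Ob T)"
proof -
  obtain l \<theta> l' where m: "m = (l, \<theta>, l')" by (metis prod_cases3)
  note a = assms[unfolded m Omega_hat_mor_iff]
  show "fst m \<in> Omega_H K P" "snd (snd m) \<in> Omega_H K P" "fibre_linear OE (fst (snd m))" "bar m \<in> eq_trans"
    using a unfolding m by simp_all
  show "fst (snd m) \<in> extensional (Ob T)"
    using ntransD(5)[OF eq_transD(3)[of "form_bar K P l" \<theta> "form_bar K P l'"]] a unfolding m bar_apply by simp
qed

lemma hat_morI:
  assumes "fst m \<in> Omega_H K P" "snd (snd m) \<in> Omega_H K P" "fibre_linear OE (fst (snd m))" "bar m \<in> eq_trans"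
  shows "m \<in> Omega_hat_mor K P"
  using assms by (cases m) (simp add: Omega_hat_mor_iff)

text \<open>The form \<open>\<lambda>\<close> cannot be recovered from \<open>\<lambda>-bar\<close> (for trivial \<open>\<tau>\<close>, a form with
  equal pullbacks along source and target has zero bar), so the outer components are compared as well.\<close>

lemma hat_eqI: "fst m = fst m' \<Longrightarrow> bar m = bar m' \<Longrightarrow> snd (snd m) = snd (snd m') \<Longrightarrow> m = m'"
  by (cases m, cases m') (simp add: bar_apply)

lemma hat_id:
  assumes l: "l \<in> Omega_H K P"
  shows "(l, id_trans T L (fst (form_bar K P l)), l) \<in> Omega_hat_mor K P"
proof -
  note w = eq_form_bar[OF l]
  have "fibre_linear OE (\<lambda>v. (0 :: ('h, 'n) chart \<Rightarrow> 'n))" by (simp add: fibre_linear_def)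
  from fibre_linear_Pair[OF this eq_formD(3)[OF w]]
  have "fibre_linear OE (id_trans T L (fst (form_bar K P l)))"
    by (rule fibre_linear_cong[OF e(2)]) (simp add: id_trans_def)
  then show ?thesis unfolding Omega_hat_mor_iff bar_apply using l eq_trans_id[OF w] by simp
qed

lemma hat_vcomp:
  assumes m': "(l', \<theta>', l'') \<in> Omega_hat_mor K P" and m: "(l, \<theta>, l') \<in> Omega_hat_mor K P"
  shows "vcomp T L (l', \<theta>', l'') (l, \<theta>, l') \<in> Omega_hat_mor K P"
proof (rule hat_morI)
  note a = hat_morD[OF m] and b = hat_morD[OF m']
  show "fst (vcomp T L (l', \<theta>', l'') (l, \<theta>, l')) \<in> Omega_H K P" "snd (snd (vcomp T L (l', \<theta>', l'') (l, \<theta>, l'))) \<in> Omega_H K P"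
    using a b by (simp_all add: vcomp_apply)
  note lin = fibre_linear_Pair[OF fibre_linear_add[OF fibre_linear_fst_snd(1)[OF b(3)] fibre_linear_fst_snd(1)[OF a(3)]]
      fibre_linear_fst_snd(2)[OF a(3)]]
  show "fibre_linear OE (fst (snd (vcomp T L (l', \<theta>', l'') (l, \<theta>, l'))))"
    by (rule fibre_linear_cong[OF e(2) lin]) (simp add: vcomp_apply Cmp_L)
  show "bar (vcomp T L (l', \<theta>', l'') (l, \<theta>, l')) \<in> eq_trans"
    using eq_trans_vcomp[OF b(4)[unfolded bar_apply] a(4)[unfolded bar_apply]] by (simp add: vcomp_apply bar_apply)
qed

text \<open>The two ingredients of \<^const>\<open>ext_mor_mult\<close>: the sum of morphisms of forms, and the transport of such a
  morphism along a gauge morphism.\<close>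

definition hat_add where
  "hat_add m m' = (add_on (Ob T) (fst m) (fst m'), add_on (Ob T) (fst (snd m)) (fst (snd m')), add_on (Ob T) (snd (snd m)) (snd (snd m')))"

definition hat_transport where
  "hat_transport \<Psi> m = (transport_form P (fst \<Psi>) (fst m), fst (snd (transport \<Psi> (bar m))), transport_form P (snd (snd \<Psi>)) (snd (snd m)))"

lemma bar_hat_add:
  assumes "m \<in> Omega_hat_mor K P" "m' \<in> Omega_hat_mor K P"
  shows "bar (hat_add m m') = add_trans T (bar m) (bar m')"
  using form_bar_add[OF hat_morD(1)[OF assms(1)] hat_morD(1)[OF assms(2)]] form_bar_add[OF hat_morD(2)[OF assms(1)] hat_morD(2)[OF assms(2)]]
  by (cases m, cases m') (simp add: hat_add_def bar_apply add_trans_def del: tangent_gpd_simps)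

lemma bar_hat_transport:
  assumes "\<Psi> \<in> gauge_mor K P"
  shows "bar (hat_transport \<Psi> m) = transport \<Psi> (bar m)"
proof -
  obtain F \<psi> F' l \<theta> l' where eq: "\<Psi> = (F, \<psi>, F')" "m = (l, \<theta>, l')" by (metis prod_cases3)
  note p = gauge_morD[OF assms[unfolded eq]]
  show ?thesis
    unfolding eq hat_transport_def fst_conv snd_conv bar_apply form_bar_transport[OF p(1)] form_bar_transport[OF p(2)]
    by (rule transport_triple[symmetric])
qed

lemma hat_transport_proj: "fst (hat_transport \<Psi> m) = transport_form P (fst \<Psi>) (fst m)" "snd (snd (hat_transport \<Psi> m)) = transport_form P (snd (snd \<Psi>)) (snd (snd m))"
  by (simp_all add: hat_transport_def)

lemma hat_add_proj: "fst (hat_add m m') = add_on (Ob T) (fst m) (fst m')" "snd (snd (hat_add m m')) = add_on (Ob T) (snd (snd m)) (snd (snd m'))"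
  by (simp_all add: hat_add_def)

lemma gauge_mor_ends: "\<Psi> \<in> gauge_mor K P \<Longrightarrow> fst \<Psi> \<in> gauge_ob K P" "\<Psi> \<in> gauge_mor K P \<Longrightarrow> snd (snd \<Psi>) \<in> gauge_ob K P"
  using gauge_morD(1,2) by (cases \<Psi>, simp)+

lemma hat_add_closed:
  assumes m: "m \<in> Omega_hat_mor K P" and m': "m' \<in> Omega_hat_mor K P"
  shows "hat_add m m' \<in> Omega_hat_mor K P"
proof (rule hat_morI)
  note a = hat_morD[OF m] and b = hat_morD[OF m']
  show "fst (hat_add m m') \<in> Omega_H K P" "snd (snd (hat_add m m')) \<in> Omega_H K P"
    unfolding hat_add_proj by (rule Omega_H_add[OF a(1) b(1)], rule Omega_H_add[OF a(2) b(2)])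
  show "fibre_linear OE (fst (snd (hat_add m m')))"
    by (rule fibre_linear_cong[OF e(2) fibre_linear_add[OF a(3) b(3)]]) (simp add: hat_add_def add_on_def)
  show "bar (hat_add m m') \<in> eq_trans"
    unfolding bar_hat_add[OF m m'] by (rule eq_trans_add[OF a(4) b(4)])
qed

lemma hat_transport_closed:
  assumes \<Psi>: "\<Psi> \<in> gauge_mor K P" and m: "m \<in> Omega_hat_mor K P"
  shows "hat_transport \<Psi> m \<in> Omega_hat_mor K P"
proof (rule hat_morI)
  note a = hat_morD[OF m]
  show "fst (hat_transport \<Psi> m) \<in> Omega_H K P" "snd (snd (hat_transport \<Psi> m)) \<in> Omega_H K P"
    unfolding hat_transport_proj
    by (rule Omega_H_transport[OF gauge_mor_ends(1)[OF \<Psi>] a(1)], rule Omega_H_transport[OF gauge_mor_ends(2)[OF \<Psi>] a(2)])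
  show "bar (hat_transport \<Psi> m) \<in> eq_trans"
    unfolding bar_hat_transport[OF \<Psi>] by (rule transport_closed[OF a(4) \<Psi>])
  obtain F \<psi> F' l \<theta> l' where eq: "\<Psi> = (F, \<psi>, F')" "m = (l, \<theta>, l')" by (metis prod_cases3)
  obtain \<nu> where h: "hinv E (F, \<psi>, F') = (inv_functor E F, \<nu>, inv_functor E F')" by (simp add: hinv_def)
  note p = gauge_morD[OF \<Psi>[unfolded eq]] and q = gauge_morD[OF gauge_mor_hinv(1)[OF \<Psi>[unfolded eq], unfolded h]]
  note w = eq_form_bar[OF a(1)[unfolded eq fst_conv]]
  have \<theta>: "fibre_linear OE \<theta>" using a(3) by (simp add: eq)
  note l1 = fibre_linear_Tmap[OF e(2,2) lie_functorD(2)[OF gauge_inv(1)[OF p(2)]] fibre_linear_fst_snd(1)[OF \<theta>]]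
  note l2 = fibre_linear_Tmap[OF e(2,3) q(7) eq_formD(4)[OF w]]
  note lin = fibre_linear_Pair[OF fibre_linear_add[OF l1 fibre_linear_fst_snd(1)[OF l2]] fibre_linear_fst_snd(2)[OF l2]]
  show "fibre_linear OE (fst (snd (hat_transport \<Psi> m)))"
    by (rule fibre_linear_cong[OF e(2) lin])
      (simp add: hat_transport_def eq transport_def h bar_apply push_trans_apply hcomp_apply Cmp_L push_functor_apply)
qed

lemma hat_add_assoc: "hat_add (hat_add m m') m'' = hat_add m (hat_add m' m'')"
  for m :: "(('p, 'k) tangent \<Rightarrow> ('h, 'n) chart \<Rightarrow> 'n) \<times> (('p, 'k) tangent \<Rightarrow> (('h, 'n) chart \<Rightarrow> 'n) \<times> (('g, 'm) chart \<Rightarrow> 'm)) \<times>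
    (('p, 'k) tangent \<Rightarrow> ('h, 'n) chart \<Rightarrow> 'n)"
  unfolding hat_add_def fst_conv snd_conv add_on_laws(1) ..

abbreviation "hat_zero \<equiv> (zero_form P, zero_form P, zero_form P)"

lemma hat_zero_closed: "hat_zero \<in> Omega_hat_mor K P"
proof -
  have "id_trans T L (fst (form_bar K P (zero_form P))) = zero_form P"
    unfolding id_trans_def form_bar_zero unfolding zero_form_def by (rule restrict_ext) (simp add: zero_prod_def del: tangent_gpd_simps)
  then show ?thesis using hat_id[OF Omega_H_zero] by simp
qed

lemma hat_add_zero:
  assumes m: "m \<in> Omega_hat_mor K P"
  shows "hat_add hat_zero m = m"
proof -
  note a = hat_morD[OF m]
  show ?thesis
    unfolding hat_add_def zero_form_def fst_conv snd_conv
      add_on_laws(2)[OF Omega_HD(1)[OF a(1)]] add_on_laws(2)[OF Omega_HD(1)[OF a(2)]] add_on_laws(2)[OF a(5)] by simp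
qed

text \<open>Naturality and equivariance of the negative hold because both conditions are linear in the triple. The second
  component of its values is the bar form of the negative, which is known to be smooth and equivariant.\<close>

lemma hat_add_neg:
  assumes m: "m \<in> Omega_hat_mor K P"
  shows "\<exists>m'\<in>Omega_hat_mor K P. hat_add m' m = hat_zero"
proof -
  obtain l \<theta> l' where eq: "m = (l, \<theta>, l')" by (metis prod_cases3)
  note a = hat_morD[OF m, unfolded eq fst_conv snd_conv bar_apply]
  let ?l = "\<lambda>v\<in>Ob T. - l v" and ?\<theta> = "\<lambda>v\<in>Ob T. - \<theta> v" and ?l' = "\<lambda>v\<in>Ob T. - l' v"
  have z: "hat_add (?l, ?\<theta>, ?l') m = hat_zero"
    unfolding hat_add_def eq fst_conv snd_conv zero_form_def add_on_laws(3) ..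
  note n = Omega_H_neg[OF a(1)] Omega_H_neg[OF a(2)]
  note w = eq_form_bar[OF n(1)] eq_form_bar[OF n(2)]
  note tv = eq_trans_values[OF a(4)]
  note lv = Omega_HD(5)[OF a(1)] Omega_HD(5)[OF a(2)]
  have s: "snd (\<theta> v) = Ltau K (l v)" "Ltau K (fst (\<theta> v)) = Ltau K (l' v) - Ltau K (l v)" if v: "v \<in> Ob T" for v
    using tv(3,4)[OF v] v by (simp_all add: form_bar_apply algebra_simps del: tangent_gpd_simps)
  have nv: "?\<theta> v = (0 - fst (\<theta> v), fst (form_bar K P ?l) v)" if v: "v \<in> Ob T" for v
    using v s(1)[OF v] Ltau_facts(5)[OF lv(1)[OF v] lv(1)[OF v]]
    by (simp add: form_bar_apply prod_eq_iff del: tangent_gpd_simps)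
  have nt: "nat_trans T L (form_bar K P ?l) (form_bar K P ?l') ?\<theta>"
    unfolding nat_trans_def
  proof (intro conjI ballI)
    fix v assume v: "v \<in> Ob T"
    show "?\<theta> v \<in> Mor L"
      unfolding nv[OF v] using subspace_diff[OF LH subspace_0[OF LH] tv(2)[OF v]] eq_form_values(1)[OF w(1) v] by simp
    show "Src L (?\<theta> v) = fst (form_bar K P ?l) v" unfolding nv[OF v] by simp
    show "Tgt L (?\<theta> v) = fst (form_bar K P ?l') v"
      unfolding nv[OF v] Tgt_L using v s(2)[OF v] Ltau_facts(5)[OF lv(1)[OF v] lv(1)[OF v]] Ltau_facts(5)[OF lv(2)[OF v] lv(2)[OF v]]
        Ltau_facts(5)[OF tv(2)[OF v] tv(2)[OF v]]
      by (simp add: form_bar_apply del: tangent_gpd_simps)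
  next
    fix x assume x: "x \<in> Mor T"
    note o = tC(1,2)[OF x]
    note nat = nat_transD(4)[OF eq_transD(6)[OF a(4)] x]
    have "fst (\<theta> (Tgt T x)) + (l (Tgt T x) - l (Src T x)) = l' (Tgt T x) - l' (Src T x) + fst (\<theta> (Src T x))"
      using arg_cong[OF nat, of fst] x by (simp add: Cmp_L form_bar_apply del: tangent_gpd_simps)
    then show "Cmp L (?\<theta> (Tgt T x)) (snd (form_bar K P ?l) x) = Cmp L (snd (form_bar K P ?l') x) (?\<theta> (Src T x))"
      using o x s(1)[OF o(1)] Ltau_facts(5)[OF lv(1)[OF o(1)] lv(1)[OF o(1)]]
      by (simp add: Cmp_L form_bar_apply del: tangent_gpd_simps) (simp add: algebra_simps)
  qed
  have "bar (?l, ?\<theta>, ?l') \<in> eq_trans"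
    unfolding eq_trans_def bar_apply ntrans_def mem_Collect_eq prod.case
  proof (intro conjI ballI)
    have "smooth_map TO (lie_alg_atlas H) (\<lambda>v. 0 - fst (\<theta> v))"
      by (rule smooth_LH(2)[OF TOA smooth_map_const[OF TOA LHA] smooth_L_proj(1)[OF TOA eq_transD(4)[OF a(4)]]])
        (simp add: pts_lie_alg subspace_0[OF LH])
    from smooth_L_Pair[OF TOA this eq_formD(8)[OF w(1)]]
    show "smooth_map TO (mor_charts L) ?\<theta>"
      by (rule smooth_map_cong[OF _ TOA]) (rule nv[symmetric], simp)
    fix v g assume v: "v \<in> Ob T" and g: "g \<in> carrier G"
    have i: "inv\<^bsub>G\<^esub> g \<in> carrier G" using g by simp
    have "fst (\<theta> (tact0 P v g)) = Lalpha K (inv\<^bsub>G\<^esub> g) (fst (\<theta> v))"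
      using eq_transD(5)[OF a(4) v g] Ad_unit_inv_apply[OF g tv(2)[OF v], of "snd (\<theta> v)"] tv(1)[OF v] by (simp add: mem_Times_iff)
    then show "?\<theta> (tact0 P v g) = Ad_unit_inv K g (?\<theta> v)"
      unfolding nv[OF v] nv[OF tact0_closed[OF v g]]
      using Ad_unit_inv_apply[OF g subspace_diff[OF LH subspace_0[OF LH] tv(2)[OF v]] eq_form_values(1)[OF w(1) v]]
        Lalpha_facts(5)[OF i tv(2)[OF v] tv(2)[OF v]] eq_formD(5)[OF w(1) v g] by simp
  qed (use w eq_formD(2,7)[OF w(1)] eq_formD(2,7)[OF w(2)] nt in simp_all)
  moreover have "fibre_linear OE ?\<theta>"
  proof -
    have "fibre_linear OE (\<lambda>v. (0 :: (('h, 'n) chart \<Rightarrow> 'n) \<times> (('g, 'm) chart \<Rightarrow> 'm)))" by (simp add: fibre_linear_def)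
    from fibre_linear_diff[OF this a(3)] show ?thesis by (rule fibre_linear_cong[OF e(2)]) simp
  qed
  ultimately have "(?l, ?\<theta>, ?l') \<in> Omega_hat_mor K P"
    unfolding Omega_hat_mor_iff using n by simp
  with z show ?thesis by (rule bexI)
qed

lemma hat_transport_add:
  assumes \<Psi>: "\<Psi> \<in> gauge_mor K P" and m: "m \<in> Omega_hat_mor K P" and m': "m' \<in> Omega_hat_mor K P"
  shows "hat_transport \<Psi> (hat_add m m') = hat_add (hat_transport \<Psi> m) (hat_transport \<Psi> m')"
proof (rule hat_eqI)
  show "bar (hat_transport \<Psi> (hat_add m m')) = bar (hat_add (hat_transport \<Psi> m) (hat_transport \<Psi> m'))"
    unfolding bar_hat_transport[OF \<Psi>] bar_hat_add[OF m m'] bar_hat_add[OF hat_transport_closed[OF \<Psi> m] hat_transport_closed[OF \<Psi> m']] by (rule transport_add[OF \<Psi>])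
qed (simp_all only: hat_transport_proj hat_add_proj transport_form_add[OF gauge_mor_ends(1)[OF \<Psi>]] transport_form_add[OF gauge_mor_ends(2)[OF \<Psi>]])

lemma hcomp_ends: "fst (hcomp C D \<Psi> \<Psi>') = comp_functor C (fst \<Psi>) (fst \<Psi>')" "snd (snd (hcomp C D \<Psi> \<Psi>')) = comp_functor C (snd (snd \<Psi>)) (snd (snd \<Psi>'))"
  by (cases \<Psi>, cases \<Psi>', simp add: hcomp_apply)+

lemma hat_transport_mult:
  assumes \<Psi>: "\<Psi> \<in> gauge_mor K P" and \<Psi>': "\<Psi>' \<in> gauge_mor K P" and m: "m \<in> Omega_hat_mor K P"
  shows "hat_transport (hcomp E E \<Psi> \<Psi>') m = hat_transport \<Psi> (hat_transport \<Psi>' m)"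
proof (rule hat_eqI)
  show "bar (hat_transport (hcomp E E \<Psi> \<Psi>') m) = bar (hat_transport \<Psi> (hat_transport \<Psi>' m))"
    unfolding bar_hat_transport[OF \<Psi>] bar_hat_transport[OF \<Psi>'] bar_hat_transport[OF gauge_mor_hcomp[OF \<Psi> \<Psi>']] by (rule transport_mult[OF \<Psi> \<Psi>' hat_morD(4)[OF m]])
qed (simp_all only: hat_transport_proj hcomp_ends transport_form_mult[OF gauge_mor_ends(1)[OF \<Psi>] gauge_mor_ends(1)[OF \<Psi>']]
    transport_form_mult[OF gauge_mor_ends(2)[OF \<Psi>] gauge_mor_ends(2)[OF \<Psi>']])

abbreviation "gauge_one \<equiv> (id_functor E, id_trans E E (\<lambda>p. p), id_functor E)"

lemma gauge_one_closed: "gauge_one \<in> gauge_mor K P"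
  using gauge_mor_id[OF gauge_id_closed] by (simp add: id_trans_id_functor)

lemma hat_transport_one:
  assumes m: "m \<in> Omega_hat_mor K P"
  shows "hat_transport gauge_one m = m"
proof (rule hat_eqI)
  show "bar (hat_transport gauge_one m) = bar m" unfolding bar_hat_transport[OF gauge_one_closed] by (rule transport_one[OF hat_morD(4)[OF m]])
qed (simp_all add: hat_transport_proj transport_form_one hat_morD[OF m])

lemma bar_vcomp: "bar (vcomp T L m' m) = vcomp T L (bar m') (bar m)"
  by (cases m, cases m') (simp add: vcomp_apply bar_apply)

lemma vcomp_ends: "fst (vcomp C D m' m) = fst m" "snd (snd (vcomp C D m' m)) = snd (snd m')"
  by (cases m, cases m', simp add: vcomp_apply)+

lemma add_trans_id:
  "add_trans T (\<omega>, id_trans T L (fst \<omega>), \<omega>) (\<omega>', id_trans T L (fst \<omega>'), \<omega>') =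
    (add_functor T \<omega> \<omega>', id_trans T L (fst (add_functor T \<omega> \<omega>')), add_functor T \<omega> \<omega>')"
  unfolding add_trans_apply id_trans_def by (simp add: restrict_def fun_eq_iff add_functor_apply del: tangent_gpd_simps)

lemma Omega_hat_simps:
  "Ob (Omega_hat K P) = Omega_H K P" "Mor (Omega_hat K P) = Omega_hat_mor K P" "Src (Omega_hat K P) m = fst m" "Tgt (Omega_hat K P) m = snd (snd m)"
  "Idn (Omega_hat K P) l = (l, id_trans T L (fst (form_bar K P l)), l)" "Cmp (Omega_hat K P) = vcomp T L"
  by (simp_all add: Omega_hat_def split: prod.split)

lemma Omega_hat_category: "category (Omega_hat K P)"
  unfolding category_def
proof (intro conjI ballI impI funcsetI)
  fix x assume x: "x \<in> Mor (Omega_hat K P)"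
  obtain l \<theta> l' where eq: "x = (l, \<theta>, l')" by (metis prod_cases3)
  note a = hat_morD[OF x[unfolded Omega_hat_simps]]
  show "Src (Omega_hat K P) x \<in> Ob (Omega_hat K P)" "Tgt (Omega_hat K P) x \<in> Ob (Omega_hat K P)" using a by (simp_all add: Omega_hat_simps)
  show "Cmp (Omega_hat K P) x (Idn (Omega_hat K P) (Src (Omega_hat K P) x)) = x" "Cmp (Omega_hat K P) (Idn (Omega_hat K P) (Tgt (Omega_hat K P) x)) x = x"
    using vcomp_id[OF category_L eq_trans_ntrans[OF a(4)[unfolded eq bar_apply]]] by (simp_all add: eq Omega_hat_simps vcomp_apply)
  fix y assume y: "y \<in> Mor (Omega_hat K P)" "Src (Omega_hat K P) y = Tgt (Omega_hat K P) x"
  obtain \<theta>' l'' where eq': "y = (l', \<theta>', l'')" using y(2) by (cases y) (simp add: eq Omega_hat_simps)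
  show "Cmp (Omega_hat K P) y x \<in> Mor (Omega_hat K P)"
    using hat_vcomp x y by (simp add: eq eq' Omega_hat_simps)
  show "Src (Omega_hat K P) (Cmp (Omega_hat K P) y x) = Src (Omega_hat K P) x" "Tgt (Omega_hat K P) (Cmp (Omega_hat K P) y x) = Tgt (Omega_hat K P) y"
    by (simp_all add: Omega_hat_simps vcomp_ends)
next
  fix x y z assume x: "x \<in> Mor (Omega_hat K P)" and y: "y \<in> Mor (Omega_hat K P)" and z: "z \<in> Mor (Omega_hat K P)"
    and c: "Src (Omega_hat K P) y = Tgt (Omega_hat K P) x \<and> Src (Omega_hat K P) z = Tgt (Omega_hat K P) y"
  obtain l1 \<theta>1 l2 where eq: "x = (l1, \<theta>1, l2)" by (metis prod_cases3)
  obtain \<theta>2 l3 where eq': "y = (l2, \<theta>2, l3)" using c by (cases y) (simp add: eq Omega_hat_simps)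
  obtain \<theta>3 l4 where eq'': "z = (l3, \<theta>3, l4)" using c by (cases z) (simp add: eq' Omega_hat_simps)
  note n = hat_morD(4)[OF x[unfolded Omega_hat_simps eq], unfolded bar_apply, THEN eq_trans_ntrans]
    hat_morD(4)[OF y[unfolded Omega_hat_simps eq'], unfolded bar_apply, THEN eq_trans_ntrans]
    hat_morD(4)[OF z[unfolded Omega_hat_simps eq''], unfolded bar_apply, THEN eq_trans_ntrans]
  show "Cmp (Omega_hat K P) z (Cmp (Omega_hat K P) y x) = Cmp (Omega_hat K P) (Cmp (Omega_hat K P) z y) x"
    using vcomp_assoc[OF category_L n] by (simp add: eq eq' eq'' Omega_hat_simps vcomp_apply)
qed (simp_all add: Omega_hat_simps hat_id)

text \<open>After passing to bars this is the interchange law for sums applied to the compatibility of transport with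
  vertical composition.\<close>

lemma hat_interchange:
  assumes \<Psi>: "\<Psi> \<in> gauge_mor K P" "\<Psi>' \<in> gauge_mor K P" "fst \<Psi>' = snd (snd \<Psi>)"
    and m: "m \<in> Omega_hat_mor K P" "m' \<in> Omega_hat_mor K P" "fst m' = snd (snd m)"
    and k: "k \<in> Omega_hat_mor K P" "k' \<in> Omega_hat_mor K P" "fst k' = snd (snd k)"
  shows "hat_add (vcomp T L m' m) (hat_transport (vcomp E E \<Psi>' \<Psi>) (vcomp T L k' k)) =
    vcomp T L (hat_add m' (hat_transport \<Psi>' k')) (hat_add m (hat_transport \<Psi> k))"
proof (rule hat_eqI)
  obtain F \<psi> F' \<psi>' F'' where g: "\<Psi> = (F, \<psi>, F')" "\<Psi>' = (F', \<psi>', F'')" using \<Psi>(3) by (cases \<Psi>, cases \<Psi>') simp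
  obtain l1 \<theta> l2 \<theta>' l3 where mm: "m = (l1, \<theta>, l2)" "m' = (l2, \<theta>', l3)" using m(3) by (cases m, cases m') simp
  obtain k1 \<phi> k2 \<phi>' k3 where kk: "k = (k1, \<phi>, k2)" "k' = (k2, \<phi>', k3)" using k(3) by (cases k, cases k') simp
  note \<Psi>c = gauge_mor_vcomp[OF \<Psi>(2,1)[unfolded g]]
  note kc = hat_vcomp[OF k(2,1)[unfolded kk]] and mc = hat_vcomp[OF m(2,1)[unfolded mm]]
  note b = hat_transport_closed[OF \<Psi>(1)[unfolded g] k(1)[unfolded kk]] hat_transport_closed[OF \<Psi>(2)[unfolded g] k(2)[unfolded kk]]
  note kb = hat_morD(4)[OF k(1)[unfolded kk], unfolded bar_apply] hat_morD(4)[OF k(2)[unfolded kk], unfolded bar_apply]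
  obtain s where s: "transport (F, \<psi>, F') (form_bar K P k1, \<phi>, form_bar K P k2) =
      (comp_functor T (form_bar K P k1) (pinv F), s, comp_functor T (form_bar K P k2) (pinv F'))"
    by (rule that[OF transport_triple])
  obtain s' where s': "transport (F', \<psi>', F'') (form_bar K P k2, \<phi>', form_bar K P k3) =
      (comp_functor T (form_bar K P k2) (pinv F'), s', comp_functor T (form_bar K P k3) (pinv F''))"
    by (rule that[OF transport_triple])
  have "bar (hat_add (vcomp T L m' m) (hat_transport (vcomp E E \<Psi>' \<Psi>) (vcomp T L k' k))) =
      add_trans T (vcomp T L (bar m') (bar m)) (transport (vcomp E E \<Psi>' \<Psi>) (vcomp T L (bar k') (bar k)))"
    unfolding g mm kk bar_hat_add[OF mc hat_transport_closed[OF \<Psi>c kc]] bar_hat_transport[OF \<Psi>c] bar_vcomp ..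
  also have "\<dots> = add_trans T (vcomp T L (bar m') (bar m)) (vcomp T L (transport \<Psi>' (bar k')) (transport \<Psi> (bar k)))"
    unfolding g kk bar_apply by (simp only: transport_vcomp[OF \<Psi>(2,1)[unfolded g] kb(2,1)])
  also have "\<dots> = vcomp T L (add_trans T (bar m') (transport \<Psi>' (bar k'))) (add_trans T (bar m) (transport \<Psi> (bar k)))"
    unfolding g mm kk bar_apply s s'
    by (rule vcomp_add[symmetric])
  also have "\<dots> = bar (vcomp T L (hat_add m' (hat_transport \<Psi>' k')) (hat_add m (hat_transport \<Psi> k)))"
    unfolding bar_vcomp bar_hat_add[OF m(1) hat_transport_closed[OF \<Psi>(1) k(1)]] bar_hat_add[OF m(2) hat_transport_closed[OF \<Psi>(2) k(2)]]
      bar_hat_transport[OF \<Psi>(1)] bar_hat_transport[OF \<Psi>(2)] ..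
  finally show "bar (hat_add (vcomp T L m' m) (hat_transport (vcomp E E \<Psi>' \<Psi>) (vcomp T L k' k))) =
      bar (vcomp T L (hat_add m' (hat_transport \<Psi>' k')) (hat_add m (hat_transport \<Psi> k)))" .
qed (simp_all only: hat_add_proj hat_transport_proj vcomp_ends)

abbreviation "X \<equiv> ext_gauge K P"

lemma ext_simps:
  "Ob X = gauge_ob K P \<times> Omega_H K P" "Mor X = gauge_mor K P \<times> Omega_hat_mor K P"
  "Src X (\<Psi>, m) = (fst \<Psi>, fst m)" "Tgt X (\<Psi>, m) = (snd (snd \<Psi>), snd (snd m))"
  "Idn X (F, l) = ((F, id_trans E E (fst F), F), (l, id_trans T L (fst (form_bar K P l)), l))"
  "Cmp X (\<Psi>', m') (\<Psi>, m) = (vcomp E E \<Psi>' \<Psi>, vcomp T L m' m)"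
  "(F, l) \<otimes>\<^bsub>ob_grp X\<^esub> (F', l') = (comp_functor E F F', add_on (Ob T) l (transport_form P F l'))"
  "(\<Psi>, m) \<otimes>\<^bsub>mor_grp X\<^esub> (\<Psi>', m') = (hcomp E E \<Psi> \<Psi>', hat_add m (hat_transport \<Psi> m'))"
  "\<one>\<^bsub>ob_grp X\<^esub> = (id_functor E, zero_form P)" "\<one>\<^bsub>mor_grp X\<^esub> = (gauge_one, hat_zero)"
  by (simp_all add: ext_gauge_def cat.defs two_grp.defs prod_cat_def gauge_def Omega_hat_def ext_ob_mult_def ext_mor_mult_def
      hat_add_def hat_transport_def transport_trans_eq split: prod.split del: tangent_gpd_simps)

lemma ext_category: "category X"
  using category_prod_cat[OF gauge_category Omega_hat_category]
  unfolding category_def by (simp add: ext_gauge_def cat.defs two_grp.defs)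

lemma ext_ob_group: "group (ob_grp X)" and ext_ob_carrier: "carrier (ob_grp X) = Ob X"
proof -
  have "group \<lparr>carrier = carrier (ob_grp (gauge K P)) \<times> Omega_H K P,
      monoid.mult = (\<lambda>(F, l) (F', l'). (F \<otimes>\<^bsub>ob_grp (gauge K P)\<^esub> F', add_on (Ob T) l (transport_form P F l'))),
      one = (\<one>\<^bsub>ob_grp (gauge K P)\<^esub>, zero_form P)\<rparr>"
  proof (rule semidirect_product_group[OF gauge_ob_group Omega_H_add])
    fix l :: "('p, 'k) tangent \<Rightarrow> ('h, 'n) chart \<Rightarrow> 'n" assume l: "l \<in> Omega_H K P"
    show "add_on (Ob T) (zero_form P) l = l" unfolding zero_form_def by (rule add_on_laws(2)[OF Omega_HD(1)[OF l]])
    show "\<exists>l'\<in>Omega_H K P. add_on (Ob T) l' l = zero_form P"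
      by (rule bexI[OF _ Omega_H_neg[OF l]]) (simp only: zero_form_def add_on_laws(3))
  qed (simp_all add: add_on_laws(1) Omega_H_zero gauge_ob_carrier gauge_simps Omega_H_transport transport_form_add transport_form_mult
      transport_form_one del: tangent_gpd_simps)
  then show "group (ob_grp X)"
    by (simp add: ext_gauge_def cat.defs two_grp.defs prod_cat_def gauge_ob_carrier gauge_simps(1) Omega_hat_simps(1) ext_ob_mult_def del: tangent_gpd_simps)
  show "carrier (ob_grp X) = Ob X" by (simp add: ext_gauge_def cat.defs two_grp.defs)
qed

lemma ext_mor_group: "group (mor_grp X)" and ext_mor_carrier: "carrier (mor_grp X) = Mor X"
proof -
  have g: "group \<lparr>carrier = carrier (mor_grp (gauge K P)) \<times> Omega_hat_mor K P,
      monoid.mult = (\<lambda>(\<Psi>, m) (\<Psi>', m'). (\<Psi> \<otimes>\<^bsub>mor_grp (gauge K P)\<^esub> \<Psi>', hat_add m (hat_transport \<Psi> m'))),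
      one = (\<one>\<^bsub>mor_grp (gauge K P)\<^esub>, hat_zero)\<rparr>"
    by (rule semidirect_product_group[OF gauge_mor_group hat_add_closed])
      (simp_all add: hat_add_assoc hat_zero_closed hat_add_zero hat_add_neg gauge_mor_carrier gauge_simps hat_transport_closed hat_transport_add hat_transport_mult hat_transport_one
        del: tangent_gpd_simps)
  have "ext_mor_mult K P = (\<lambda>(\<Psi>, m) (\<Psi>', m'). (\<Psi> \<otimes>\<^bsub>mor_grp (gauge K P)\<^esub> \<Psi>', hat_add m (hat_transport \<Psi> m')))"
    by (simp add: fun_eq_iff ext_mor_mult_def hat_add_def hat_transport_def transport_trans_eq gauge_simps(3,4) split: prod.split del: tangent_gpd_simps)
  with g show "group (mor_grp X)"
    by (simp add: ext_gauge_def cat.defs two_grp.defs prod_cat_def gauge_mor_carrier gauge_simps(2) Omega_hat_simps(2) del: tangent_gpd_simps)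
  show "carrier (mor_grp X) = Mor X" by (simp add: ext_gauge_def cat.defs two_grp.defs)
qed

theorem ext_strict_2group: "strict_2group X"
  unfolding strict_2group_def
proof (intro conjI ext_category ext_ob_group ext_ob_carrier ext_mor_group ext_mor_carrier)
  note mor = group.is_monoid[OF ext_mor_group, THEN monoid.m_closed, unfolded ext_mor_carrier]
    and ob = group.is_monoid[OF ext_ob_group, THEN monoid.m_closed, unfolded ext_ob_carrier]
  show "is_functor (prod_cat X X) X (\<lambda>(g, g'). g \<otimes>\<^bsub>ob_grp X\<^esub> g', \<lambda>(x, x'). x \<otimes>\<^bsub>mor_grp X\<^esub> x')"
    unfolding is_functor_def prod_cat_simps fst_conv snd_conv
  proof (intro conjI ballI impI funcsetI)
    fix u assume u: "u \<in> Ob X \<times> Ob X"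
    then show "(case u of (g, g') \<Rightarrow> g \<otimes>\<^bsub>ob_grp X\<^esub> g') \<in> Ob X" using ob by (cases u) (simp add: mem_Times_iff)
    obtain F l F' l' where eq: "u = ((F, l), (F', l'))" by (metis surj_pair)
    then have a: "F \<in> gauge_ob K P" "l \<in> Omega_H K P" "F' \<in> gauge_ob K P" "l' \<in> Omega_H K P" using u by (simp_all add: ext_simps)
    let ?i = "\<lambda>l. (l, id_trans T L (fst (form_bar K P l)), l)"
    have "hat_add (?i l) (hat_transport (F, id_trans E E (fst F), F) (?i l')) = ?i (add_on (Ob T) l (transport_form P F l'))"
    proof (rule hat_eqI)
      have "bar (hat_add (?i l) (hat_transport (F, id_trans E E (fst F), F) (?i l'))) = add_trans T (bar (?i l)) (transport (F, id_trans E E (fst F), F) (bar (?i l')))"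
        unfolding bar_hat_add[OF hat_id[OF a(2)] hat_transport_closed[OF gauge_mor_id[OF a(1)] hat_id[OF a(4)]]] bar_hat_transport[OF gauge_mor_id[OF a(1)]] ..
      also have "\<dots> = bar (?i (add_on (Ob T) l (transport_form P F l')))"
        unfolding bar_apply transport_id[OF a(1) eq_form_bar[OF a(4)]] add_trans_id form_bar_add[OF a(2) Omega_H_transport[OF a(1,4)]] form_bar_transport[OF a(1)] ..
      finally show "bar (hat_add (?i l) (hat_transport (F, id_trans E E (fst F), F) (?i l'))) = bar (?i (add_on (Ob T) l (transport_form P F l')))" .
    qed (simp_all add: hat_add_proj hat_transport_proj del: tangent_gpd_simps)
    then show "(case map_prod (Idn X) (Idn X) u of (x, x') \<Rightarrow> x \<otimes>\<^bsub>mor_grp X\<^esub> x') = Idn X (case u of (g, g') \<Rightarrow> g \<otimes>\<^bsub>ob_grp X\<^esub> g')"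
      unfolding eq map_prod_simp prod.case ext_simps
      using hcomp_id_id[OF e(1,1) gauge_functor[OF a(3)] gauge_functor[OF a(1)]] by simp
  next
    fix x assume x: "x \<in> Mor X \<times> Mor X"
    then show "(case x of (x, x') \<Rightarrow> x \<otimes>\<^bsub>mor_grp X\<^esub> x') \<in> Mor X" using mor by (cases x) (simp add: mem_Times_iff)
    obtain \<Psi> m \<Psi>' m' where eq: "x = ((\<Psi>, m), (\<Psi>', m'))" by (metis surj_pair)
    show "Src X (case x of (x, x') \<Rightarrow> x \<otimes>\<^bsub>mor_grp X\<^esub> x') = (case map_prod (Src X) (Src X) x of (g, g') \<Rightarrow> g \<otimes>\<^bsub>ob_grp X\<^esub> g')"
      "Tgt X (case x of (x, x') \<Rightarrow> x \<otimes>\<^bsub>mor_grp X\<^esub> x') = (case map_prod (Tgt X) (Tgt X) x of (g, g') \<Rightarrow> g \<otimes>\<^bsub>ob_grp X\<^esub> g')"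
      unfolding eq map_prod_simp prod.case ext_simps by (simp_all only: hcomp_ends hat_add_proj hat_transport_proj)
  next
    fix x y assume x: "x \<in> Mor X \<times> Mor X" and y: "y \<in> Mor X \<times> Mor X"
      and c: "map_prod (Src X) (Src X) y = map_prod (Tgt X) (Tgt X) x"
    obtain \<Psi> m \<Phi> k where eq: "x = ((\<Psi>, m), (\<Phi>, k))" by (metis surj_pair)
    obtain \<Psi>' m' \<Phi>' k' where eq': "y = ((\<Psi>', m'), (\<Phi>', k'))" by (metis surj_pair)
    have a: "\<Psi> \<in> gauge_mor K P" "\<Phi> \<in> gauge_mor K P" "\<Psi>' \<in> gauge_mor K P" "\<Phi>' \<in> gauge_mor K P"
      "m \<in> Omega_hat_mor K P" "k \<in> Omega_hat_mor K P" "m' \<in> Omega_hat_mor K P" "k' \<in> Omega_hat_mor K P"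
      using x y by (simp_all add: eq eq' ext_simps)
    have c': "fst \<Psi>' = snd (snd \<Psi>)" "fst \<Phi>' = snd (snd \<Phi>)" "fst m' = snd (snd m)" "fst k' = snd (snd k)"
      using c by (simp_all add: eq eq' ext_simps)
    obtain F \<psi> F' \<psi>' F'' where g: "\<Psi> = (F, \<psi>, F')" "\<Psi>' = (F', \<psi>', F'')" using c'(1) by (cases \<Psi>, cases \<Psi>') simp
    obtain J \<phi> J' \<phi>' J'' where h: "\<Phi> = (J, \<phi>, J')" "\<Phi>' = (J', \<phi>', J'')" using c'(2) by (cases \<Phi>, cases \<Phi>') simp
    have "hcomp E E (vcomp E E \<Psi>' \<Psi>) (vcomp E E \<Phi>' \<Phi>) = vcomp E E (hcomp E E \<Psi>' \<Phi>') (hcomp E E \<Psi> \<Phi>)"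
      unfolding g h by (rule hcomp_interchange[OF e(1,1,1)]) (use gauge_mor_ntrans(1) a(1-4) in \<open>simp_all add: g h\<close>)
    then show "(case Cmp (prod_cat X X) y x of (x, x') \<Rightarrow> x \<otimes>\<^bsub>mor_grp X\<^esub> x') =
        Cmp X (case y of (x, x') \<Rightarrow> x \<otimes>\<^bsub>mor_grp X\<^esub> x') (case x of (x, x') \<Rightarrow> x \<otimes>\<^bsub>mor_grp X\<^esub> x')"
      unfolding eq eq' prod_cat_simps prod.case ext_simps
      using hat_interchange[OF a(1,3) c'(1) a(5,7) c'(3) a(6,8) c'(4)] by simp
  qed
qed

section \<open>Semi-strict connections and the action\<close>

lemma Omega_semi_ob_iff: "\<omega> \<in> Omega_semi_ob K P \<longleftrightarrow> eq_form \<omega> \<and> semi_strict K P \<omega>"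
  unfolding Omega_semi_ob_def eq_form_def mem_Collect_eq by (simp only: conj_assoc)

lemma Omega_semi_mor_iff:
  "(\<omega>, \<eta>, \<omega>') \<in> Omega_semi_mor K P \<longleftrightarrow> \<omega> \<in> Omega_semi_ob K P \<and> \<omega>' \<in> Omega_semi_ob K P \<and> (\<omega>, \<eta>, \<omega>') \<in> eq_trans"
proof (cases "eq_form \<omega> \<and> eq_form \<omega>'")
  case True
  then show ?thesis
    using eq_formD(2,7)[of \<omega>] eq_formD(2,7)[of \<omega>']
    unfolding Omega_semi_mor_def eq_trans_def ntrans_def nat_iso_L Omega_semi_ob_iff tangent_gpd_simps(7)
    by (simp add: conj_ac del: tangent_gpd_simps lie_2alg_simps)
next
  case False
  then show ?thesis unfolding Omega_semi_mor_def Omega_semi_ob_iff by fastforce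
qed

definition "act_form = (\<lambda>((F, l), \<omega>). add_functor T (comp_functor T \<omega> (pinv F)) (form_bar K P l))"

definition "act_trans = (\<lambda>((\<Psi>, m), \<zeta>). add_trans T (transport \<Psi> \<zeta>) (bar m))"

lemma act_form_apply: "act_form ((F, l), \<omega>) = add_functor T (comp_functor T \<omega> (pinv F)) (form_bar K P l)"
  by (simp add: act_form_def)

lemma act_trans_apply: "act_trans ((\<Psi>, m), \<zeta>) = add_trans T (transport \<Psi> \<zeta>) (bar m)"
  by (simp add: act_trans_def)

lemma eq_form_act:
  assumes w: "eq_form \<omega>" and F: "F \<in> gauge_ob K P" and l: "l \<in> Omega_H K P"
  shows "eq_form (act_form ((F, l), \<omega>))"
  unfolding act_form_apply by (rule eq_form_add[OF eq_form_comp_push[OF w gauge_inv_closed[OF F]] eq_form_bar[OF l]])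

text \<open>A trivialization of the new form on vertical vectors is the sum of two arrows. One is \<open>\<kappa>\<close> at
  \<open>F\<inverse>(p)\<close>: it trivializes \<open>\<omega> \<circ> F\<^sub>*\<^sup>-\<^sup>1\<close> because gauge transformations preserve
  fundamental vectors. The other is \<open>(-\<lambda>(v), \<tau>(\<lambda>(v)))\<close> for the fundamental vector
  \<open>v\<close>, an arrow from \<open>\<tau>(\<lambda>(v))\<close>, the value of \<open>\<lambda>-bar\<close>, to zero.\<close>

lemma semi_strict_act:
  assumes w: "eq_form \<omega>" and s: "semi_strict K P \<omega>" and F: "F \<in> gauge_ob K P" and l: "l \<in> Omega_H K P"
  shows "semi_strict K P (act_form ((F, l), \<omega>))"
proof -
  let ?X = "prod_lie_gpd E L" and ?I = "inv_functor E F" and ?w = "act_form ((F, l), \<omega>)"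
  obtain \<kappa> where nat: "nat_trans ?X L (comp_functor ?X \<omega> (fundamental K P)) (snd, snd) \<kappa>"
    and sm: "smooth_map (ob_charts ?X) (mor_charts L) \<kappa>"
    and lin: "\<forall>p\<in>Ob E. \<forall>B\<in>lie_alg G. (\<forall>B'\<in>lie_alg G. \<kappa> (p, B + B') = \<kappa> (p, B) + \<kappa> (p, B')) \<and> (\<forall>a. \<kappa> (p, a *\<^sub>R B) = a *\<^sub>R \<kappa> (p, B))"
    and eqv: "\<forall>p\<in>Ob E. \<forall>B\<in>lie_alg G. \<forall>g\<in>carrier G. \<kappa> (act0 p g, Ad G (inv\<^bsub>G\<^esub> g) B) = Ad_unit_inv K g (\<kappa> (p, B))"
    using s unfolding semi_strict_def nat_iso_L by (elim exE conjE)
  note Ic = gauge_inv_closed[OF F]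
  note f = is_functorD(1-4)[OF gauge_functor[OF Ic]]
  note lv = Omega_HD(5)[OF l delta0_closed]
  have \<kappa>: "\<kappa> (p, B) \<in> Mor L" "fst (\<kappa> (p, B)) \<in> lie_alg H" "snd (\<kappa> (p, B)) = fst \<omega> (delta0 p B)"
    "Ltau K (fst (\<kappa> (p, B))) + snd (\<kappa> (p, B)) = B" if p: "p \<in> Ob E" "B \<in> lie_alg G" for p B
    using nat_transD(1-3)[OF nat, of "(p, B)"] p by (simp_all add: comp_functor_apply Tgt_L mem_Times_iff)
  have \<kappa>n: "fst (\<kappa> (Tgt E x, Ltau K A + B)) + fst (snd \<omega> (delta1 x (A, B))) = A + fst (\<kappa> (Src E x, B))"
    if x: "x \<in> Mor E" and A: "A \<in> lie_alg H" and B: "B \<in> lie_alg G" for x A B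
    using arg_cong[OF nat_transD(4)[OF nat, of "(x, (A, B))"], of fst] x A B by (simp add: comp_functor_apply Cmp_L)
  let ?c = "\<lambda>p B. (- l (delta0 p B), Ltau K (l (delta0 p B)))"
  define \<mu> where "\<mu> = (\<lambda>(p, B). \<kappa> (fst ?I p, B) + ?c p B)"
  have \<mu>: "\<mu> (p, B) = \<kappa> (fst ?I p, B) + ?c p B" for p B by (simp add: \<mu>_def)
  have w0: "fst ?w (delta0 p B) = fst \<omega> (delta0 (fst ?I p) B) + Ltau K (l (delta0 p B))" if p: "p \<in> Ob E" "B \<in> lie_alg G" for p B
    using delta0_closed[OF p] push_delta(1)[OF Ic p]
    by (simp add: act_form_apply add_functor_apply comp_functor_apply form_bar_apply del: tangent_gpd_simps)
  have w1: "fst (snd ?w (delta1 x (A, B))) = fst (snd \<omega> (delta1 (snd ?I x) (A, B))) + (l (delta0 (Tgt E x) (Ltau K A + B)) - l (delta0 (Src E x) B))"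
    "snd (snd ?w (delta1 x (A, B))) = fst ?w (delta0 (Src E x) B)"
    if x: "x \<in> Mor E" and A: "A \<in> lie_alg H" and B: "B \<in> lie_alg G" for x A B
    using delta1_closed[OF x A B] push_delta(2)[OF Ic x A B] Src_delta1[OF x A B] Tgt_delta1[OF x A B]
      eq_form_values(3)[OF eq_form_act[OF w F l] delta1_closed[OF x A B]]
    by (simp_all add: act_form_apply add_functor_apply comp_functor_apply form_bar_apply del: tangent_gpd_simps)
  have "nat_trans ?X L (comp_functor ?X ?w (fundamental K P)) (snd, snd) \<mu>"
    unfolding nat_trans_def
  proof (intro conjI ballI)
    fix u assume "u \<in> Ob ?X"
    then obtain p B where u: "u = (p, B)" and p: "p \<in> Ob E" "B \<in> lie_alg G" by (cases u) auto
    note k = \<kappa>[OF f(1)[OF p(1)] p(2)] and v = lv[OF p]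
    note lt = Ltau_facts(1)[OF v v]
    show "\<mu> u \<in> Mor L"
      unfolding u \<mu> using subspace_diff[OF LH k(2) v] subspace_add[OF LG _ lt] k(1)
      by (simp add: mem_Times_iff)
    show "Src L (\<mu> u) = fst (comp_functor ?X ?w (fundamental K P)) u"
      unfolding u \<mu> using p w0[OF p] k(3) by (simp add: comp_functor_apply)
    show "Tgt L (\<mu> u) = fst (snd, snd) u"
    proof -
      have "Ltau K (fst (\<kappa> (fst ?I p, B)) - l (delta0 p B)) + (snd (\<kappa> (fst ?I p, B)) + Ltau K (l (delta0 p B))) =
          Ltau K (fst (\<kappa> (fst ?I p, B))) + snd (\<kappa> (fst ?I p, B))"
        unfolding Ltau_facts(4)[OF k(2) v] by (simp add: algebra_simps)
      then show ?thesis unfolding u \<mu> Tgt_L k(4) by simp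
    qed
  next
    fix u assume "u \<in> Mor ?X"
    then obtain x A B where u: "u = (x, (A, B))" and x: "x \<in> Mor E" and A: "A \<in> lie_alg H" and B: "B \<in> lie_alg G" by (cases u) auto
    note o = eC(1,2)[OF x]
    have "fst (\<mu> (Tgt E x, Ltau K A + B)) + fst (snd ?w (delta1 x (A, B))) = A + fst (\<mu> (Src E x, B))"
      unfolding \<mu> w1(1)[OF x A B] fst_add fst_conv by (rule add_shift[OF \<kappa>n[OF f(2)[OF x] A B, unfolded f(3,4)[OF x]]])
    moreover have "snd (snd ?w (delta1 x (A, B))) = snd (\<mu> (Src E x, B))"
      unfolding w1(2)[OF x A B] w0[OF o(1) B] \<mu> snd_add snd_conv \<kappa>(3)[OF f(1)[OF o(1)] B] ..
    ultimately show "Cmp L (\<mu> (Tgt ?X u)) (snd (comp_functor ?X ?w (fundamental K P)) u) = Cmp L (snd (snd, snd) u) (\<mu> (Src ?X u))"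
      using x A B by (simp add: u Cmp_L comp_functor_apply)
  qed
  moreover have "smooth_map (ob_charts ?X) (mor_charts L) \<mu>"
  proof -
    let ?N = "prod_atlas OE (lie_alg_atlas G)"
    note N = smooth_atlas_prod[OF e(2) LGA]
    have o: "ob_charts ?X = ?N" by simp
    note ld = smooth_map_comp[OF N TOA LHA delta0_smooth Omega_HD(2)[OF l]]
    note lt = smooth_map_comp[OF N LHA LGA ld Ltau_smooth]
    have "smooth_map ?N (lie_alg_atlas H) (\<lambda>u. 0 - l (fst (fundamental K P) u))"
      by (rule smooth_LH(2)[OF N smooth_map_const[OF N LHA] ld]) (simp add: pts_lie_alg subspace_0[OF LH])
    note c = smooth_L_Pair[OF N this lt]
    note I = smooth_map_comp[OF N e(2,2) smooth_map_fst[OF e(2) LGA] lie_functorD(2)[OF gauge_inv(1)[OF F]]]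
    have "smooth_map ?N ?N (\<lambda>u. (fst ?I (fst u), snd u))"
      by (rule smooth_map_Pair[OF N e(2) LGA I smooth_map_snd[OF e(2) LGA]])
    from smooth_map_comp[OF N N LA this sm[unfolded o lie_2alg_simps]]
    have k: "smooth_map ?N (mor_charts L) (\<lambda>u. \<kappa> (fst ?I (fst u), snd u))" by simp
    show ?thesis
      unfolding o by (rule smooth_map_cong[OF smooth_L_add[OF N k c] N]) (simp add: \<mu>_def case_prod_beta)
  qed
  moreover have "\<mu> (p, B + B') = \<mu> (p, B) + \<mu> (p, B')" if p: "p \<in> Ob E" "B \<in> lie_alg G" "B' \<in> lie_alg G" for p B B'
  proof -
    have d: "(p, snd (delta0 p C)) = delta0 p C" for C using fst_delta0[OF p(1), of C] by (simp add: prod_eq_iff)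
    have "l (delta0 p (B + B')) = l (delta0 p B) + l (delta0 p B')"
      using fibre_linearD(1)[OF Omega_HD(3)[OF l], of p "snd (delta0 p B)" "snd (delta0 p B')"]
        delta0_closed[OF p(1,2)] delta0_closed[OF p(1,3)] p(1) fst_delta0[OF p(1)]
      unfolding delta0_linear(1)[OF p] by (simp add: mem_tangent_bundle d)
    then show ?thesis
      using lin f(1)[OF p(1)] p(2,3) Ltau_facts(2)[OF lv[OF p(1,2)] lv[OF p(1,3)]] by (simp add: \<mu>)
  qed
  moreover have "\<mu> (p, a *\<^sub>R B) = a *\<^sub>R \<mu> (p, B)" if p: "p \<in> Ob E" "B \<in> lie_alg G" for p B a
  proof -
    have d: "(p, snd (delta0 p C)) = delta0 p C" for C using fst_delta0[OF p(1), of C] by (simp add: prod_eq_iff)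
    have "l (delta0 p (a *\<^sub>R B)) = a *\<^sub>R l (delta0 p B)"
      using fibre_linearD(2)[OF Omega_HD(3)[OF l], of p "snd (delta0 p B)" a] delta0_closed[OF p] p(1) fst_delta0[OF p(1)]
      unfolding delta0_linear(2)[OF p p(2)] by (simp add: mem_tangent_bundle d)
    then show ?thesis
      using lin f(1)[OF p(1)] p(2) Ltau_facts(3)[OF lv[OF p] lv[OF p]] by (simp add: \<mu> scaleR_add_right)
  qed
  moreover have "\<mu> (act0 p g, Ad G (inv\<^bsub>G\<^esub> g) B) = Ad_unit_inv K g (\<mu> (p, B))"
    if p: "p \<in> Ob E" "B \<in> lie_alg G" and g: "g \<in> carrier G" for p B g
  proof -
    note v = lv[OF p] and k = \<kappa>[OF f(1)[OF p(1)] p(2)]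
    have i: "inv\<^bsub>G\<^esub> g \<in> carrier G" using g by simp
    have c: "?c p B \<in> Mor L" using subspace_neg[OF LH v] Ltau_facts(1)[OF v v] by simp
    show ?thesis
      unfolding \<mu> Ad_unit_inv_add(1)[OF g k(1) c] Ad_unit_inv_apply[OF g subspace_neg[OF LH v] Ltau_facts(1)[OF v v]]
        gauge_obD(3)[OF Ic p(1) g] tact0_delta0[OF p g] Omega_HD(4)[OF l delta0_closed[OF p] g]
      using eqv f(1)[OF p(1)] p(2) g Lalpha_facts(5)[OF i v v] Ltau_Lalpha[OF i v] by simp
  qed
  ultimately show ?thesis
    unfolding semi_strict_def nat_iso_L by (intro exI[of _ \<mu>] conjI ballI allI) simp_all
qed

lemma act_form_closed:
  "\<omega> \<in> Omega_semi_ob K P \<Longrightarrow> F \<in> gauge_ob K P \<Longrightarrow> l \<in> Omega_H K P \<Longrightarrow> act_form ((F, l), \<omega>) \<in> Omega_semi_ob K P"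
  unfolding Omega_semi_ob_iff using eq_form_act semi_strict_act by simp

lemma act_trans_ends:
  "fst (act_trans ((\<Psi>, m), \<zeta>)) = act_form ((fst \<Psi>, fst m), fst \<zeta>)"
  "snd (snd (act_trans ((\<Psi>, m), \<zeta>))) = act_form ((snd (snd \<Psi>), snd (snd m)), snd (snd \<zeta>))"
proof -
  obtain F \<psi> F' l \<theta> l' \<omega> \<eta> \<omega>' where eq: "\<Psi> = (F, \<psi>, F')" "m = (l, \<theta>, l')" "\<zeta> = (\<omega>, \<eta>, \<omega>')" by (metis prod_cases3)
  have "fst (transport \<Psi> \<zeta>) = comp_functor T \<omega> (pinv F)" "snd (snd (transport \<Psi> \<zeta>)) = comp_functor T \<omega>' (pinv F')"
    unfolding eq by (subst transport_triple, simp only: fst_conv snd_conv)+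
  then show "fst (act_trans ((\<Psi>, m), \<zeta>)) = act_form ((fst \<Psi>, fst m), fst \<zeta>)"
    "snd (snd (act_trans ((\<Psi>, m), \<zeta>))) = act_form ((snd (snd \<Psi>), snd (snd m)), snd (snd \<zeta>))"
    unfolding act_trans_apply act_form_apply add_trans_proj by (simp_all add: eq bar_apply)
qed

lemma semi_morD:
  assumes "\<zeta> \<in> Omega_semi_mor K P"
  shows "fst \<zeta> \<in> Omega_semi_ob K P" "snd (snd \<zeta>) \<in> Omega_semi_ob K P" "\<zeta> \<in> eq_trans"
  using assms by (cases \<zeta>, simp add: Omega_semi_mor_iff)+

lemma semi_morI: "fst \<zeta> \<in> Omega_semi_ob K P \<Longrightarrow> snd (snd \<zeta>) \<in> Omega_semi_ob K P \<Longrightarrow> \<zeta> \<in> eq_trans \<Longrightarrow> \<zeta> \<in> Omega_semi_mor K P"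
  by (cases \<zeta>) (simp add: Omega_semi_mor_iff)

lemma act_trans_closed:
  assumes \<zeta>: "\<zeta> \<in> Omega_semi_mor K P" and \<Psi>: "\<Psi> \<in> gauge_mor K P" and m: "m \<in> Omega_hat_mor K P"
  shows "act_trans ((\<Psi>, m), \<zeta>) \<in> Omega_semi_mor K P"
proof (rule semi_morI)
  note a = semi_morD[OF \<zeta>] and b = hat_morD[OF m] and p = gauge_mor_ends[OF \<Psi>]
  show "fst (act_trans ((\<Psi>, m), \<zeta>)) \<in> Omega_semi_ob K P" "snd (snd (act_trans ((\<Psi>, m), \<zeta>))) \<in> Omega_semi_ob K P"
    unfolding act_trans_ends by (rule act_form_closed[OF a(1) p(1) b(1)], rule act_form_closed[OF a(2) p(2) b(2)])
  show "act_trans ((\<Psi>, m), \<zeta>) \<in> eq_trans"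
    unfolding act_trans_apply by (rule eq_trans_add[OF transport_closed[OF a(3) \<Psi>] b(4)])
qed

lemma Omega_semi_simps:
  "Ob (Omega_semi K P) = Omega_semi_ob K P" "Mor (Omega_semi K P) = Omega_semi_mor K P"
  "Src (Omega_semi K P) \<zeta> = fst \<zeta>" "Tgt (Omega_semi K P) \<zeta> = snd (snd \<zeta>)"
  "Idn (Omega_semi K P) \<omega> = (\<omega>, id_trans T L (fst \<omega>), \<omega>)" "Cmp (Omega_semi K P) = vcomp T L"
  by (simp_all add: Omega_semi_def split: prod.split)

lemma Omega_semi_category: "category (Omega_semi K P)"
  unfolding category_def
proof (intro conjI ballI impI funcsetI)
  fix x assume x: "x \<in> Mor (Omega_semi K P)"
  obtain w1 \<eta> w2 where eq: "x = (w1, \<eta>, w2)" by (metis prod_cases3)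
  note a = semi_morD[OF x[unfolded Omega_semi_simps]]
  show "Src (Omega_semi K P) x \<in> Ob (Omega_semi K P)" "Tgt (Omega_semi K P) x \<in> Ob (Omega_semi K P)" using a by (simp_all add: Omega_semi_simps)
  show "Cmp (Omega_semi K P) x (Idn (Omega_semi K P) (Src (Omega_semi K P) x)) = x"
    "Cmp (Omega_semi K P) (Idn (Omega_semi K P) (Tgt (Omega_semi K P) x)) x = x"
    using vcomp_id[OF category_L eq_trans_ntrans[OF a(3)[unfolded eq]]] by (simp_all add: eq Omega_semi_simps)
  fix y assume y: "y \<in> Mor (Omega_semi K P)" "Src (Omega_semi K P) y = Tgt (Omega_semi K P) x"
  obtain \<eta>' w3 where eq': "y = (w2, \<eta>', w3)" using y(2) by (cases y) (simp add: eq Omega_semi_simps)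
  note b = semi_morD[OF y(1)[unfolded Omega_semi_simps]]
  show "Cmp (Omega_semi K P) y x \<in> Mor (Omega_semi K P)"
    unfolding Omega_semi_simps
    by (rule semi_morI) (use a b eq_trans_vcomp[OF b(3)[unfolded eq'] a(3)[unfolded eq]] in \<open>simp_all add: vcomp_ends eq eq'\<close>)
  show "Src (Omega_semi K P) (Cmp (Omega_semi K P) y x) = Src (Omega_semi K P) x" "Tgt (Omega_semi K P) (Cmp (Omega_semi K P) y x) = Tgt (Omega_semi K P) y"
    by (simp_all add: Omega_semi_simps vcomp_ends)
next
  fix x y z assume x: "x \<in> Mor (Omega_semi K P)" and y: "y \<in> Mor (Omega_semi K P)" and z: "z \<in> Mor (Omega_semi K P)"
    and c: "Src (Omega_semi K P) y = Tgt (Omega_semi K P) x \<and> Src (Omega_semi K P) z = Tgt (Omega_semi K P) y"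
  obtain w1 \<eta>1 w2 where eq: "x = (w1, \<eta>1, w2)" by (metis prod_cases3)
  obtain \<eta>2 w3 where eq': "y = (w2, \<eta>2, w3)" using c by (cases y) (simp add: eq Omega_semi_simps)
  obtain \<eta>3 w4 where eq'': "z = (w3, \<eta>3, w4)" using c by (cases z) (simp add: eq' Omega_semi_simps)
  note n = semi_morD(3)[OF x[unfolded Omega_semi_simps eq], THEN eq_trans_ntrans]
    semi_morD(3)[OF y[unfolded Omega_semi_simps eq'], THEN eq_trans_ntrans]
    semi_morD(3)[OF z[unfolded Omega_semi_simps eq''], THEN eq_trans_ntrans]
  show "Cmp (Omega_semi K P) z (Cmp (Omega_semi K P) y x) = Cmp (Omega_semi K P) (Cmp (Omega_semi K P) z y) x"
    using vcomp_assoc[OF category_L n] by (simp add: eq eq' eq'' Omega_semi_simps)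
next
  fix w assume w: "w \<in> Ob (Omega_semi K P)"
  then have "eq_form w" by (simp add: Omega_semi_simps Omega_semi_ob_iff)
  from eq_trans_id[OF this] w show "Idn (Omega_semi K P) w \<in> Mor (Omega_semi K P)"
    by (simp add: Omega_semi_simps Omega_semi_mor_iff)
qed (simp_all add: Omega_semi_simps)

lemma act_vcomp:
  assumes \<Psi>: "\<Psi> \<in> gauge_mor K P" "\<Psi>' \<in> gauge_mor K P" "fst \<Psi>' = snd (snd \<Psi>)"
    and m: "m \<in> Omega_hat_mor K P" "m' \<in> Omega_hat_mor K P" "fst m' = snd (snd m)"
    and \<zeta>: "\<zeta> \<in> eq_trans" "\<zeta>' \<in> eq_trans" "fst \<zeta>' = snd (snd \<zeta>)"
  shows "act_trans ((vcomp E E \<Psi>' \<Psi>, vcomp T L m' m), vcomp T L \<zeta>' \<zeta>) = vcomp T L (act_trans ((\<Psi>', m'), \<zeta>')) (act_trans ((\<Psi>, m), \<zeta>))"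
proof -
  obtain F \<psi> F' \<psi>' F'' where g: "\<Psi> = (F, \<psi>, F')" "\<Psi>' = (F', \<psi>', F'')" using \<Psi>(3) by (cases \<Psi>, cases \<Psi>') simp
  obtain l1 \<theta> l2 \<theta>' l3 where mm: "m = (l1, \<theta>, l2)" "m' = (l2, \<theta>', l3)" using m(3) by (cases m, cases m') simp
  obtain w1 \<eta> w2 \<eta>' w3 where zz: "\<zeta> = (w1, \<eta>, w2)" "\<zeta>' = (w2, \<eta>', w3)" using \<zeta>(3) by (cases \<zeta>, cases \<zeta>') simp
  obtain s where s: "transport (F, \<psi>, F') (w1, \<eta>, w2) = (comp_functor T w1 (pinv F), s, comp_functor T w2 (pinv F'))"
    by (rule that[OF transport_triple])
  obtain s' where s': "transport (F', \<psi>', F'') (w2, \<eta>', w3) = (comp_functor T w2 (pinv F'), s', comp_functor T w3 (pinv F''))"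
    by (rule that[OF transport_triple])
  show ?thesis
    unfolding act_trans_apply bar_vcomp unfolding g mm zz bar_apply transport_vcomp[OF \<Psi>(2,1)[unfolded g] \<zeta>(2,1)[unfolded zz]] s s'
    by (rule vcomp_add[symmetric])
qed

lemma act_form_one:
  assumes w: "eq_form \<omega>"
  shows "act_form ((id_functor E, zero_form P), \<omega>) = \<omega>"
proof -
  have x: "fst \<omega> \<in> extensional (Ob T)" "snd \<omega> \<in> extensional (Mor T)"
    using eq_formD(2)[OF w] unfolding extensional_functor_def by simp_all
  show ?thesis
    unfolding act_form_apply pinv_id comp_functor_id(1)[OF eq_formD(7,2)[OF w]] form_bar_zero add_functor_def fst_conv snd_conv
      add_on_zero_right[OF x(1)] add_on_zero_right[OF x(2)] by simp
qed

lemma act_trans_one: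
  assumes \<zeta>: "\<zeta> \<in> eq_trans"
  shows "act_trans ((gauge_one, hat_zero), \<zeta>) = \<zeta>"
proof -
  obtain \<omega> \<eta> \<omega>' where eq: "\<zeta> = (\<omega>, \<eta>, \<omega>')" by (metis prod_cases3)
  note a = eq_transD[OF \<zeta>[unfolded eq]]
  have x: "fst \<omega> \<in> extensional (Ob T)" "snd \<omega> \<in> extensional (Mor T)" "fst \<omega>' \<in> extensional (Ob T)" "snd \<omega>' \<in> extensional (Mor T)"
    "\<eta> \<in> extensional (Ob T)"
    using ntransD(3-5)[OF a(3)] unfolding extensional_functor_def by simp_all
  show ?thesis
    unfolding act_trans_apply transport_one[OF \<zeta>] unfolding eq bar_apply form_bar_zero add_trans_def add_functor_def prod.case fst_conv snd_conv
    unfolding zero_form_def add_on_zero_right[OF x(1)] add_on_zero_right[OF x(2)] add_on_zero_right[OF x(3)] add_on_zero_right[OF x(4)]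
      add_on_zero_right[OF x(5)] by simp
qed

text \<open>The translation by \<open>\<lambda>'\<close> is moved through the gauge transformation \<open>F\<close>, which replaces
  \<open>\<lambda>'\<close> by its transport.\<close>

lemma act_form_mult:
  assumes F: "F \<in> gauge_ob K P" and F': "F' \<in> gauge_ob K P" and l: "l \<in> Omega_H K P" and l': "l' \<in> Omega_H K P"
  shows "act_form ((comp_functor E F F', add_on (Ob T) l (transport_form P F l')), \<omega>) = act_form ((F, l), act_form ((F', l'), \<omega>))"
  unfolding act_form_apply pinv_comp[OF F F'] comp_functor_assoc[OF pinv_functor[OF F], symmetric]
    comp_add_functor[OF pinv_functor[OF F]] form_bar_add[OF l Omega_H_transport[OF F l']] form_bar_transport[OF F]
  by (rule add_functor_assoc_swap)

lemma act_trans_mult: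
  assumes \<Psi>: "\<Psi> \<in> gauge_mor K P" and \<Psi>': "\<Psi>' \<in> gauge_mor K P" and m: "m \<in> Omega_hat_mor K P" and m': "m' \<in> Omega_hat_mor K P"
    and \<zeta>: "\<zeta> \<in> eq_trans"
  shows "act_trans ((hcomp E E \<Psi> \<Psi>', hat_add m (hat_transport \<Psi> m')), \<zeta>) = act_trans ((\<Psi>, m), act_trans ((\<Psi>', m'), \<zeta>))"
  unfolding act_trans_apply transport_mult[OF \<Psi> \<Psi>' \<zeta>] transport_add[OF \<Psi>] bar_hat_add[OF m hat_transport_closed[OF \<Psi> m']] bar_hat_transport[OF \<Psi>]
  by (rule add_trans_assoc_swap)

theorem ext_gauge_action: "left_2group_action X (Omega_semi K P) (act_form, act_trans)"
  unfolding left_2group_action_def fst_conv snd_conv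
proof (intro conjI ballI ext_strict_2group Omega_semi_category)
  show "is_functor (prod_cat X (Omega_semi K P)) (Omega_semi K P) (act_form, act_trans)"
    unfolding is_functor_def prod_cat_simps fst_conv snd_conv
  proof (intro conjI ballI impI funcsetI)
    let ?D = "Omega_semi K P"
    fix u assume u: "u \<in> Ob X \<times> Ob ?D"
    obtain F l \<omega> where eq: "u = ((F, l), \<omega>)" by (metis surj_pair)
    then have a: "F \<in> gauge_ob K P" "l \<in> Omega_H K P" "\<omega> \<in> Omega_semi_ob K P" using u by (simp_all add: ext_simps Omega_semi_simps)
    show "act_form u \<in> Ob ?D" unfolding eq Omega_semi_simps by (rule act_form_closed[OF a(3,1,2)])
    have w: "eq_form \<omega>" using a(3) by (simp add: Omega_semi_ob_iff)
    show "act_trans (map_prod (Idn X) (Idn ?D) u) = Idn ?D (act_form u)"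
      unfolding eq map_prod_simp ext_simps Omega_semi_simps act_trans_apply transport_id[OF a(1) w] bar_apply add_trans_id act_form_apply ..
  next
    let ?D = "Omega_semi K P"
    fix x assume x: "x \<in> Mor X \<times> Mor ?D"
    obtain \<Psi> m \<zeta> where eq: "x = ((\<Psi>, m), \<zeta>)" by (metis surj_pair)
    then have a: "\<Psi> \<in> gauge_mor K P" "m \<in> Omega_hat_mor K P" "\<zeta> \<in> Omega_semi_mor K P" using x by (simp_all add: ext_simps Omega_semi_simps)
    show "act_trans x \<in> Mor ?D" unfolding eq Omega_semi_simps by (rule act_trans_closed[OF a(3,1,2)])
    show "Src ?D (act_trans x) = act_form (map_prod (Src X) (Src ?D) x)"
      "Tgt ?D (act_trans x) = act_form (map_prod (Tgt X) (Tgt ?D) x)"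
      unfolding eq map_prod_simp ext_simps Omega_semi_simps act_trans_ends by (rule refl)+
  next
    let ?D = "Omega_semi K P"
    fix x y assume x: "x \<in> Mor X \<times> Mor ?D" and y: "y \<in> Mor X \<times> Mor ?D"
      and c: "map_prod (Src X) (Src ?D) y = map_prod (Tgt X) (Tgt ?D) x"
    obtain \<Psi> m \<zeta> where eq: "x = ((\<Psi>, m), \<zeta>)" by (metis surj_pair)
    obtain \<Psi>' m' \<zeta>' where eq': "y = ((\<Psi>', m'), \<zeta>')" by (metis surj_pair)
    have a: "\<Psi> \<in> gauge_mor K P" "\<Psi>' \<in> gauge_mor K P" "m \<in> Omega_hat_mor K P" "m' \<in> Omega_hat_mor K P" "\<zeta> \<in> eq_trans" "\<zeta>' \<in> eq_trans"
      using x y semi_morD(3) by (simp_all add: eq eq' ext_simps Omega_semi_simps)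
    have c': "fst \<Psi>' = snd (snd \<Psi>)" "fst m' = snd (snd m)" "fst \<zeta>' = snd (snd \<zeta>)"
      using c by (simp_all add: eq eq' ext_simps Omega_semi_simps)
    show "act_trans (Cmp (prod_cat X ?D) y x) = Cmp ?D (act_trans y) (act_trans x)"
      unfolding eq eq' prod_cat_simps ext_simps Omega_semi_simps
      by (rule act_vcomp[OF a(1,2) c'(1) a(3,4) c'(2) a(5,6) c'(3)])
  qed
next
  fix \<omega> assume "\<omega> \<in> Ob (Omega_semi K P)"
  then show "act_form (\<one>\<^bsub>ob_grp X\<^esub>, \<omega>) = \<omega>"
    unfolding ext_simps by (intro act_form_one) (simp add: Omega_semi_simps Omega_semi_ob_iff)
next
  fix g g' \<omega> assume "g \<in> Ob X" "g' \<in> Ob X" "\<omega> \<in> Ob (Omega_semi K P)"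
  then show "act_form (g \<otimes>\<^bsub>ob_grp X\<^esub> g', \<omega>) = act_form (g, act_form (g', \<omega>))"
    by (cases g, cases g') (simp only: ext_simps mem_Times_iff fst_conv snd_conv act_form_mult)
next
  fix \<zeta> assume "\<zeta> \<in> Mor (Omega_semi K P)"
  then show "act_trans (\<one>\<^bsub>mor_grp X\<^esub>, \<zeta>) = \<zeta>"
    unfolding ext_simps by (intro act_trans_one semi_morD(3)) (simp add: Omega_semi_simps)
next
  fix x x' \<zeta> assume "x \<in> Mor X" "x' \<in> Mor X" "\<zeta> \<in> Mor (Omega_semi K P)"
  then show "act_trans (x \<otimes>\<^bsub>mor_grp X\<^esub> x', \<zeta>) = act_trans (x, act_trans (x', \<zeta>))"
    by (cases x, cases x') (simp only: ext_simps mem_Times_iff fst_conv snd_conv act_trans_mult semi_morD(3) Omega_semi_simps)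
qed

end

theorem mainTheorem9:
  fixes K :: "('g, 'm::real_inner, 'h, 'n::real_inner) xmod"
    and P :: "('g, 'h, 'p, 'q, 'k::real_inner, 'l::real_inner,
               'x, 'y, 'i::real_inner, 'j::real_inner) bundle_data"
  assumes "lie_crossed_module K"
    and "principal_2bundle K P"
  shows "left_2group_action (ext_gauge K P) (Omega_semi K P)
    (\<lambda>((F, l), \<omega>). add_functor (TE P)
         (comp_functor (TE P) \<omega> (push_functor (total P) (inv_functor (total P) F)))
         (form_bar K P l),
     \<lambda>((\<Psi>, \<theta>), \<zeta>). add_trans (TE P)
         (hcomp (TE P) (lie_2alg K) \<zeta> (push_trans (total P) (hinv (total P) \<Psi>)))
         (bar_trans K P \<theta>))"
proof -
  have "lie_group (semidirect K)"
    using assms(2) unfolding principal_2bundle_def principal_bundle_def by blast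
  with assms interpret gauge_bundle K P
    by unfold_locales
  show ?thesis
    using ext_gauge_action unfolding act_form_def act_trans_def transport_def .
qed

end
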